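(* Let $\Omega=(-1,1)^2\subset\mathbb{R}^2$ and $L[u]=\int_\Omega\left(\tfrac12|Du(x)-x|^2+u(x)\right)dx$. The minimizer of $L[u]$ over all non-negative functions $0\le u\in W^{1,2}(\Omega)$ is convex. Its zero set $\{u=0\}$ is smooth, convex, has positive area, and is compactly contained in $\Omega$.
   Context: $W^{1,2}(\Omega)$ is the usual Sobolev space. No convexity constraint is imposed on the competitors. "The zero set is smooth" means that it has smooth boundary. *)

theory Defs
  imports "HOL-Analysis.Analysis"
begin

primrec higher_differentiable_on ::
    "nat \<Rightarrow> ('a::euclidean_space \<Rightarrow> 'b::real_normed_vector) \<Rightarrow> 'a set \<Rightarrow> bool" where
  "higher_differentiable_on 0 f U \<longleftrightarrow> continuous_on U f"
| "higher_differentiable_on (Suc k) f U \<longleftrightarrow>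
     (\<forall>x\<in>U. f differentiable (at x)) \<and>
     (\<forall>v. higher_differentiable_on k (\<lambda>x. frechet_derivative f (at x) v) U)"

(* Intended for open U, where this is the class of infinitely differentiable functions. *)
definition smooth_on :: "('a::euclidean_space \<Rightarrow> 'b::real_normed_vector) \<Rightarrow> 'a set \<Rightarrow> bool" where
  "smooth_on f U \<longleftrightarrow> (\<forall>k. higher_differentiable_on k f U)"

definition compactly_contained :: "'a::topological_space set \<Rightarrow> 'a set \<Rightarrow> bool" where
  "compactly_contained A B \<longleftrightarrow> compact (closure A) \<and> closure A \<subseteq> B"

definition test_functions :: "'a::euclidean_space set \<Rightarrow> ('a \<Rightarrow> real) set" where
  "test_functions \<Omega> = {\<phi>. smooth_on \<phi> UNIV \<and> compactly_contained {x. \<phi> x \<noteq> 0} \<Omega>}"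

definition locally_integrable_on ::
    "('a::euclidean_space \<Rightarrow> 'b::euclidean_space) \<Rightarrow> 'a set \<Rightarrow> bool" where
  "locally_integrable_on f \<Omega> \<longleftrightarrow> (\<forall>K. compact K \<and> K \<subseteq> \<Omega> \<longrightarrow> set_integrable lebesgue K f)"

definition has_weak_gradient ::
    "('a::euclidean_space \<Rightarrow> real) \<Rightarrow> ('a \<Rightarrow> 'a) \<Rightarrow> 'a set \<Rightarrow> bool" where
  "has_weak_gradient u g \<Omega> \<longleftrightarrow>
     locally_integrable_on u \<Omega> \<and> locally_integrable_on g \<Omega> \<and>
     (\<forall>\<phi>\<in>test_functions \<Omega>. \<forall>i\<in>Basis.
        (LINT x:\<Omega>|lebesgue. u x * frechet_derivative \<phi> (at x) i) =
        - (LINT x:\<Omega>|lebesgue. (g x \<bullet> i) * \<phi> x))"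

(* Du, determined only up to a null set of \<Omega>, and arbitrary outside \<Omega>. *)
definition weak_gradient :: "'a::euclidean_space set \<Rightarrow> ('a \<Rightarrow> real) \<Rightarrow> 'a \<Rightarrow> 'a" where
  "weak_gradient \<Omega> u = (SOME g. has_weak_gradient u g \<Omega>)"

definition L2_on :: "'a::euclidean_space set \<Rightarrow> ('a \<Rightarrow> 'b::euclidean_space) set" where
  "L2_on \<Omega> = {f. f \<in> borel_measurable (lebesgue_on \<Omega>) \<and>
                 integrable (lebesgue_on \<Omega>) (\<lambda>x. (norm (f x))\<^sup>2)}"

(* Elements of W12 are functions (representatives), not classes modulo a.e. equality. *)
definition W12 :: "'a::euclidean_space set \<Rightarrow> ('a \<Rightarrow> real) set" where
  "W12 \<Omega> = {u. u \<in> L2_on \<Omega> \<and> (\<exists>g. has_weak_gradient u g \<Omega> \<and> g \<in> L2_on \<Omega>)}"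

(* For closed S: near each boundary point, S is the closed region on one side of the graph
   of a smooth function over the hyperplane orthogonal to some unit vector e. The point
   x - (x \<bullet> e) *\<^sub>R e is the projection of x to that hyperplane. *)
definition smooth_boundary :: "'a::euclidean_space set \<Rightarrow> bool" where
  "smooth_boundary S \<longleftrightarrow>
     (\<forall>p\<in>frontier S. \<exists>r>0. \<exists>e. \<exists>\<gamma> :: 'a \<Rightarrow> real. norm e = 1 \<and> smooth_on \<gamma> UNIV \<and>
        (\<forall>x\<in>ball p r. x \<in> S \<longleftrightarrow> \<gamma> (x - (x \<bullet> e) *\<^sub>R e) \<le> x \<bullet> e))"

definition open_square :: "(real^2) set" where
  "open_square = {x. \<forall>i. -1 < x $ i \<and> x $ i < 1}"

definition L_functional :: "(real^2 \<Rightarrow> real) \<Rightarrow> real" where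
  "L_functional u =
     (LINT x:open_square|lebesgue. (norm (weak_gradient open_square u x - x))\<^sup>2 / 2 + u x)"

definition nonneg_W12 :: "(real^2 \<Rightarrow> real) set" where
  "nonneg_W12 = {u \<in> W12 open_square. AE x in lebesgue_on open_square. 0 \<le> u x}"

definition is_minimizer :: "(real^2 \<Rightarrow> real) \<Rightarrow> bool" where
  "is_minimizer u \<longleftrightarrow> is_arg_min L_functional (\<lambda>w. w \<in> nonneg_W12) u"

definition zero_set :: "(real^2 \<Rightarrow> real) \<Rightarrow> (real^2) set" where
  "zero_set u = {x \<in> open_square. u x = 0}"

end

theory Submission
  imports Defs "HOL-Complex_Analysis.Complex_Analysis"
begin

text \<open>The minimizer is found explicitly. Up to a factor \<open>3/2\<close> the Euler--Lagrange conditions ask for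
  \<open>\<Delta>u = 2\<close> off the zero set and \<open>u\<^sub>\<nu> = 2/3\<close> on the sides. On the complement of the zero set,
  \<open>u\<^sub>x - i u\<^sub>y - cnj z\<close> is then holomorphic, and one parametrises position and gradient by a complex
  variable \<open>s\<close> in the eighth \<open>0 \<le> Im s \<le> Re s, |s| \<le> 1\<close> of the disc, where \<open>|s| = 1\<close> is the free
  boundary: \<open>cnj z = om s\<close> and \<open>\<nabla>u = z + Ga s\<close> with \<open>Ga' = s\<^sup>2 om'\<close> and \<open>om'\<close> an elliptic integrand with
  branch point \<open>b\<close>, the preimage of the middle of a side. The intermediate value theorem provides
  the modulus \<open>b\<close> that matches the square.

  Convexity comes from defining \<open>u\<close> as the supremum of the affine functions obtained from all \<open>s\<close>
  and all symmetries of the square (the Legendre transform of \<open>Phi\<close>). Since the argument of \<open>om'\<close> is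
  controlled along rays, the maximum is attained exactly at the \<open>s\<close> that parametrises the point, so
  that \<open>u\<close> is the desired solution. The zero set is an intersection of half planes whose supporting
  points form a curve with positive smooth radius of curvature.

  That \<open>u\<close> minimizes, uniquely, follows from
  \<open>L[v] = L[u] + 1/2 \<integral>|Dv - Du|\<^sup>2 + 3 \<integral>v\<close>, the last integral being over the zero set of \<open>u\<close>. This is
  integration by parts against the field \<open>Du - x\<close>, which is tangential on the boundary; for Sobolev
  functions \<open>v\<close> it is proved line by line with test functions that are tensor products. Testing
  with the constant \<open>1\<close> shows that the zero set has area \<open>4/3\<close>.\<close>

section \<open>Smooth functions of one real variable\<close>

text \<open>The parameter s is a square root of the trace-free part of the Hessian: since Ga' = s^2
  om', the gradient has derivative v |-> v + s^2 cnj v, with eigenvalues 1 + |s|^2 and 1 - |s|^2. So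
  |s| \<le> 1 means convexity, and on the free boundary s is the unit normal. By symmetry,
  respectively by the boundary condition, the mixed second derivative vanishes on the coordinate
  axis and on the side, so s^2 is real there; on the diagonal it is imaginary. Hence an eighth of
  the positivity set goes to an eighth of the disc and the corner 1 + i to s = 0, while axis and
  side share one radius. The right angle between them at s = b forces a square root in om'. On the
  arc the gradient is constant, which makes s^2 om' real. Reflecting in all edges suggests om' = -k
  / sqrt ((s^4 - b^4) (1 - b^4 s^4)). The gradients 2/3 at z = 1 and 2/3 + 2/3 i at z = 1 + i
  prescribe Ga = -1/3 and Ga = -1/3 - i/3; so along the side Ga has to change by a third of the
  change of om, and this is the equation for b.\<close>

primrec Cn :: "nat \<Rightarrow> (real \<Rightarrow> real) \<Rightarrow> bool" where
  "Cn 0 f \<longleftrightarrow> continuous_on UNIV f"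
| "Cn (Suc n) f \<longleftrightarrow> (\<exists>f'. (\<forall>x. (f has_real_derivative f' x) (at x)) \<and> Cn n f')"

definition Cinf :: "(real \<Rightarrow> real) \<Rightarrow> bool" where
  "Cinf f \<longleftrightarrow> (\<forall>n. Cn n f)"

lemma Cn_SucI:
  assumes "\<And>x. (f has_real_derivative f' x) (at x)" "Cn n f'"
  shows "Cn (Suc n) f"
  using assms by auto

lemma Cn_Suc_imp: "Cn (Suc n) f \<Longrightarrow> Cn n f"
proof (induction n arbitrary: f)
  case 0
  then show ?case
    by (auto simp: continuous_on_eq_continuous_at intro: DERIV_isCont)
next
  case (Suc n)
  then show ?case by (metis Cn.simps(2))
qed

lemma Cn_const: "Cn n (\<lambda>x. c)"
  by (induction n arbitrary: c) (auto intro!: exI[of _ "\<lambda>x. 0"])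

lemma Cn_ident: "Cn n (\<lambda>x. x)"
  by (cases n) (auto intro!: exI[of _ "\<lambda>x. 1"] Cn_const continuous_on_id)

lemma Cn_add: "Cn n f \<Longrightarrow> Cn n g \<Longrightarrow> Cn n (\<lambda>x. f x + g x)"
proof (induction n arbitrary: f g)
  case 0
  then show ?case by (auto intro: continuous_on_add)
next
  case (Suc n)
  then obtain f' g' where "\<And>x. (f has_real_derivative f' x) (at x)" "Cn n f'"
    "\<And>x. (g has_real_derivative g' x) (at x)" "Cn n g'" by auto
  then show ?case
    by (intro Cn_SucI[where f' = "\<lambda>x. f' x + g' x"] DERIV_add Suc.IH) auto
qed

lemma Cn_mult: "Cn n f \<Longrightarrow> Cn n g \<Longrightarrow> Cn n (\<lambda>x. f x * g x)"
proof (induction n arbitrary: f g)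
  case 0
  then show ?case by (auto intro: continuous_on_mult)
next
  case (Suc n)
  then obtain f' g' where f: "\<And>x. (f has_real_derivative f' x) (at x)" "Cn n f'"
    and g: "\<And>x. (g has_real_derivative g' x) (at x)" "Cn n g'" by auto
  show ?case
    using Suc.prems[THEN Cn_Suc_imp] f g
    by (intro Cn_SucI[where f' = "\<lambda>x. f' x * g x + g' x * f x"] DERIV_mult Cn_add Suc.IH) auto
qed

lemma Cn_compose: "Cn n f \<Longrightarrow> Cn n g \<Longrightarrow> Cn n (\<lambda>x. f (g x))"
proof (induction n arbitrary: f g)
  case 0
  then show ?case
    by (simp add: continuous_on_compose2[of UNIV f UNIV g])
next
  case (Suc n)
  then obtain f' g' where f: "\<And>x. (f has_real_derivative f' x) (at x)" "Cn n f'"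
    and g: "\<And>x. (g has_real_derivative g' x) (at x)" "Cn n g'" by auto
  have "Cn n (\<lambda>x. f' (g x) * g' x)"
    using Suc.IH[OF f(2) Cn_Suc_imp[OF Suc.prems(2)]] g(2) by (rule Cn_mult)
  moreover have "((\<lambda>x. f (g x)) has_real_derivative f' (g x) * g' x) (at x)" for x
    by (rule DERIV_chain2[OF f(1) g(1)])
  ultimately show ?case
    unfolding Cn.simps by (intro exI[where x = "\<lambda>x. f' (g x) * g' x"]) simp
qed

lemma Cinf_const: "Cinf (\<lambda>x. c)"
  and Cinf_ident: "Cinf (\<lambda>x. x)"
  and Cinf_add: "Cinf f \<Longrightarrow> Cinf g \<Longrightarrow> Cinf (\<lambda>x. f x + g x)"
  and Cinf_mult: "Cinf f \<Longrightarrow> Cinf g \<Longrightarrow> Cinf (\<lambda>x. f x * g x)"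
  and Cinf_compose: "Cinf f \<Longrightarrow> Cinf g \<Longrightarrow> Cinf (\<lambda>x. f (g x))"
  by (simp_all add: Cinf_def Cn_const Cn_ident Cn_add Cn_mult Cn_compose)

lemma Cinf_minus: "Cinf f \<Longrightarrow> Cinf (\<lambda>x. - f x)"
  using Cinf_mult[OF Cinf_const[of "-1"], of f] by simp

lemma Cinf_diff: "Cinf f \<Longrightarrow> Cinf g \<Longrightarrow> Cinf (\<lambda>x. f x - g x)"
  using Cinf_add[OF _ Cinf_minus, of f g] by simp

lemma Cinf_continuous: "Cinf f \<Longrightarrow> continuous_on A f"
  unfolding Cinf_def by (metis Cn.simps(1) continuous_on_subset subset_UNIV)

text \<open>Each order has its own existential witness for the derivative; uniqueness of derivatives
  identifies them all, so one function serves for every order.\<close>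

lemma Cinf_DERIV:
  assumes "Cinf f"
  obtains f' where "\<And>x. (f has_real_derivative f' x) (at x)" "Cinf f'"
proof -
  obtain f' where f': "\<And>x. (f has_real_derivative f' x) (at x)"
    using assms unfolding Cinf_def by (metis Cn.simps(2))
  have "Cn n f'" for n
  proof -
    obtain g where "\<And>x. (f has_real_derivative g x) (at x)" "Cn n g"
      using assms unfolding Cinf_def by (metis Cn.simps(2))
    moreover have "f' = g" using f' calculation(1) by (auto intro: DERIV_unique)
    ultimately show ?thesis by simp
  qed
  with f' show ?thesis by (intro that) (auto simp: Cinf_def)
qed

lemma Cinf_antideriv:
  assumes "\<And>x. (f has_real_derivative f' x) (at x)" "Cinf f'"
  shows "Cinf f"
proof -
  have "Cn n f" for n
    using assms by (cases n) (auto simp: Cinf_def continuous_on_eq_continuous_at intro: DERIV_isCont)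
  then show ?thesis by (simp add: Cinf_def)
qed

text \<open>A derivative that is as smooth as the function itself turns \<open>Cn n\<close> into
  \<open>Cn (Suc n)\<close>. This handles functions that solve a first-order equation, such as
  reciprocals, inverse functions and the radius of curvature below, without computing higher
  derivatives.\<close>

lemma Cinf_bootstrap:
  assumes f: "\<And>x. (f has_real_derivative f' x) (at x)"
    and step: "\<And>n. Cn n f \<Longrightarrow> Cn n f'"
  shows "Cinf f"
proof -
  have "Cn n f" for n
  proof (induction n)
    case 0
    then show ?case using f by (auto simp: continuous_on_eq_continuous_at intro: DERIV_isCont)
  next
    case (Suc n)
    then show ?case using f step by auto
  qed
  then show ?thesis by (simp add: Cinf_def)
qed

lemma Cinf_sin: "Cinf sin" and Cinf_cos: "Cinf cos"
proof -
  have "Cn n sin \<and> Cn n cos" for n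
  proof (induction n)
    case 0
    then show ?case by (auto intro: continuous_intros)
  next
    case (Suc n)
    have "Cn n (\<lambda>x. - sin x)" using Cn_mult[OF Cn_const[of n "-1"], of sin] Suc by simp
    with Suc show ?case
      by (auto intro!: Cn_SucI[where f' = cos] Cn_SucI[where f' = "\<lambda>x. - sin x"] derivative_eq_intros)
  qed
  then show "Cinf sin" "Cinf cos" by (auto simp: Cinf_def)
qed

lemma Cinf_inverse:
  assumes f: "Cinf f" and nz: "\<And>x. f x \<noteq> 0"
  shows "Cinf (\<lambda>x. inverse (f x))"
proof -
  obtain f' where f': "\<And>x. (f has_real_derivative f' x) (at x)" "Cinf f'"
    using Cinf_DERIV[OF f] by blast
  show ?thesis
  proof (rule Cinf_bootstrap)
    show "((\<lambda>x. inverse (f x)) has_real_derivative - 1 * (inverse (f x) * (f' x * inverse (f x)))) (at x)" for x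
      using DERIV_inverse'[OF f'(1) nz, of x] by (simp add: algebra_simps)
    show "Cn n (\<lambda>x. - 1 * (inverse (f x) * (f' x * inverse (f x))))" if "Cn n (\<lambda>x. inverse (f x))" for n
      using f'(2) that by (intro Cn_mult Cn_const) (auto simp: Cinf_def)
  qed
qed

lemma Cinf_inverse_function:
  assumes f: "\<And>x. (f has_real_derivative f' x) (at x)" "Cinf f'"
    and pos: "\<And>x. f' x \<noteq> 0" and cont: "continuous_on UNIV g" and inv: "\<And>y. f (g y) = y"
  shows "Cinf g"
proof (rule Cinf_bootstrap)
  show "(g has_real_derivative inverse (f' (g y))) (at y)" for y
    by (rule DERIV_inverse_function[where f = f and a = "y - 1" and b = "y + 1"])
       (use assms in \<open>auto simp: continuous_on_eq_continuous_at\<close>)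
  show "Cn n (\<lambda>y. inverse (f' (g y)))" if "Cn n g" for n
    using Cn_compose[OF _ that] Cinf_inverse[OF f(2) pos] by (auto simp: Cinf_def)
qed

section \<open>Flat functions and compactly supported bumps\<close>

definition smooth_step :: "real \<Rightarrow> real" where
  "smooth_step x = (if x > 0 then exp (- (1 / x)) else 0)"

lemma exp_inverse_power_limit: "((\<lambda>x. inverse x ^ n * exp (- (1 / x))) \<longlongrightarrow> 0) (at_right (0::real))"
proof -
  have "((\<lambda>y::real. y ^ n / exp y) \<longlongrightarrow> 0) at_top"
    by (rule tendsto_power_div_exp_0)
  then have "((\<lambda>x::real. inverse x ^ n / exp (inverse x)) \<longlongrightarrow> 0) (at_right 0)"
    by (rule filterlim_compose) (rule filterlim_inverse_at_top_right)
  then show ?thesis by (simp add: exp_minus field_simps)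
qed

lemma Cinf_smooth_step: "Cinf smooth_step"
proof -
  \<comment> \<open>The functions x^(-k) exp (-1/x), extended by 0, form a family that is closed
    under differentiation up to linear combinations; a statement about k = 0 alone would not carry
    an induction.\<close>
  define F where "F k x = (if x > 0 then inverse x ^ k * exp (- (1 / x)) else 0 :: real)" for k x
  have DF: "(F k has_real_derivative F (k + 2) x - real k * F (k + 1) x) (at x)" for k x
  proof (cases x "0::real" rule: linorder_cases)
    case greater
    have "((\<lambda>x. inverse x ^ k * exp (- (1 / x))) has_real_derivative
       F (k + 2) x - real k * F (k + 1) x) (at x)"
      using greater
      by (auto intro!: derivative_eq_intros simp: F_def field_simps power2_eq_square)
         (cases k; simp add: field_simps)
    then show ?thesis
      by (rule has_field_derivative_transform_within_open[where S = "{0<..}"])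
         (use greater in \<open>auto simp: F_def\<close>)
  next
    case less
    have "((\<lambda>x. 0) has_real_derivative F (k + 2) x - real k * F (k + 1) x) (at x)"
      using less by (auto simp: F_def)
    then show ?thesis
      by (rule has_field_derivative_transform_within_open[where S = "{..<0}"])
         (use less in \<open>auto simp: F_def\<close>)
  next
    case equal
    \<comment> \<open>At the origin the left quotients are 0 and the right ones are the family
      member with index k + 1, which tends to 0.\<close>
    have "((\<lambda>h. (F k (0 + h) - F k 0) / h) \<longlongrightarrow> 0) (at (0::real))"
    proof (rule filterlim_split_at)
      have "eventually (\<lambda>h. (F k (0 + h) - F k 0) / h = 0) (at_left (0::real))"
        by (auto simp: eventually_at_left_field F_def intro: exI[of _ "-1"])
      then show "((\<lambda>h. (F k (0 + h) - F k 0) / h) \<longlongrightarrow> 0) (at_left (0::real))"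
        by (rule tendsto_eventually)
      show "((\<lambda>h. (F k (0 + h) - F k 0) / h) \<longlongrightarrow> 0) (at_right (0::real))"
        by (rule Lim_transform_eventually[OF exp_inverse_power_limit[of "Suc k"]])
           (auto simp: eventually_at_right_field F_def field_simps intro: exI[of _ 1])
    qed
    with equal show ?thesis by (simp add: DERIV_def F_def)
  qed
  have "Cn n (F k)" for n k
  proof (induction n arbitrary: k)
    case 0
    then show ?case using DF by (auto simp: continuous_on_eq_continuous_at intro: DERIV_isCont)
  next
    case (Suc n)
    have "Cn n (\<lambda>x. F (k + 2) x + (- real k) * F (k + 1) x)"
      by (intro Cn_add Cn_mult Cn_const Suc)
    with DF[of k] show ?case by (intro Cn_SucI[of "F k"]) auto
  qed
  moreover have "smooth_step = F 0" by (simp add: F_def smooth_step_def fun_eq_iff)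
  ultimately show ?thesis unfolding Cinf_def by metis
qed

lemma smooth_step_nonneg: "0 \<le> smooth_step x" and smooth_step_le1: "smooth_step x \<le> 1"
  and smooth_step_pos_iff: "0 < smooth_step x \<longleftrightarrow> 0 < x"
  by (auto simp: smooth_step_def)

lemma smooth_step_mono: "x \<le> y \<Longrightarrow> smooth_step x \<le> smooth_step y"
  by (auto simp: smooth_step_def field_simps)

text \<open>The flanks steepen with n, and the bumps tend boundedly to the indicator of the open
  interval. Integrals over boxes are thus limits of integrals against smooth tensor
  products.\<close>

definition bump :: "real \<Rightarrow> real \<Rightarrow> nat \<Rightarrow> real \<Rightarrow> real" where
  "bump a b n x = smooth_step (real n * (x - a)) * smooth_step (real n * (b - x))"

lemma Cinf_bump: "Cinf (bump a b n)"
  unfolding bump_def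
  by (intro Cinf_mult Cinf_compose[OF Cinf_smooth_step] Cinf_diff Cinf_const Cinf_ident)

lemma bump_nonneg: "0 \<le> bump a b n x" and bump_le1: "bump a b n x \<le> 1"
  unfolding bump_def by (auto intro!: mult_nonneg_nonneg mult_le_one smooth_step_nonneg smooth_step_le1)

lemma bump_outside: "x \<notin> {a<..<b} \<Longrightarrow> bump a b n x = 0"
  by (auto simp: bump_def smooth_step_def zero_less_mult_iff)

lemma bump_tendsto: "(\<lambda>n. bump a b n x) \<longlonglongrightarrow> indicat_real {a<..<b} x"
proof (cases "x \<in> {a<..<b}")
  case True
  have *: "(\<lambda>n. smooth_step (real n * c)) \<longlonglongrightarrow> 1" if "c > 0" for c
  proof -
    have "(\<lambda>n. exp (- (1 / (real n * c)))) \<longlonglongrightarrow> exp (- (0 / c))"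
      using tendsto_divide[OF lim_inverse_n tendsto_const[of c]] that
      by (intro tendsto_exp tendsto_minus) (simp add: inverse_eq_divide)
    then have "(\<lambda>n. exp (- (1 / (real n * c)))) \<longlonglongrightarrow> 1" by simp
    then show ?thesis
      by (rule Lim_transform_eventually)
         (use that in \<open>auto simp: smooth_step_def eventually_sequentially intro!: exI[of _ 1]\<close>)
  qed
  from tendsto_mult[OF *[of "x - a"] *[of "b - x"]] True show ?thesis
    by (simp add: bump_def)
qed (simp add: bump_outside)

section \<open>Smoothness in several variables\<close>

lemma higher_differentiable_on_add:
  "higher_differentiable_on n f UNIV \<Longrightarrow> higher_differentiable_on n g UNIV \<Longrightarrow>
   higher_differentiable_on n (\<lambda>x. f x + g x) UNIV"
proof (induction n arbitrary: f g)
  case 0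
  then show ?case by (auto intro: continuous_on_add)
next
  case (Suc n)
  have "frechet_derivative (\<lambda>x. f x + g x) (at x) v =
      frechet_derivative f (at x) v + frechet_derivative g (at x) v" for x v
    using Suc.prems
    by (intro fun_cong[OF frechet_derivative_at[symmetric], of _ _ _ v] has_derivative_add)
       (simp_all add: frechet_derivative_works[symmetric])
  with Suc show ?case by simp
qed

lemma higher_differentiable_on_scale:
  fixes f :: "'a::euclidean_space \<Rightarrow> real"
  shows "higher_differentiable_on n f UNIV \<Longrightarrow> higher_differentiable_on n (\<lambda>x. c * f x) UNIV"
proof (induction n arbitrary: f)
  case 0
  then show ?case by (auto intro: continuous_intros)
next
  case (Suc n)
  have "frechet_derivative (\<lambda>x. c * f x) (at x) v = c * frechet_derivative f (at x) v" for x v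
    using Suc.prems
    by (intro fun_cong[OF frechet_derivative_at[symmetric], of _ _ _ v] has_derivative_mult_right)
       (simp_all add: frechet_derivative_works[symmetric])
  with Suc show ?case by simp
qed

lemma has_derivative_tensor:
  fixes u v x :: "'a::euclidean_space"
  assumes "(f has_real_derivative f') (at (x \<bullet> u))" "(g has_real_derivative g') (at (x \<bullet> v))"
  shows "((\<lambda>x. f (x \<bullet> u) * g (x \<bullet> v)) has_derivative
    (\<lambda>w. (w \<bullet> u) * (f' * g (x \<bullet> v)) + (w \<bullet> v) * (f (x \<bullet> u) * g'))) (at x)"
proof -
  have f: "((\<lambda>x. f (x \<bullet> u)) has_derivative (\<lambda>w. (w \<bullet> u) * f')) (at x)"
    using has_derivative_compose[OF has_derivative_inner_left[OF has_derivative_ident] assms(1)[unfolded has_field_derivative_def]]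
    by (simp add: mult.commute)
  have g: "((\<lambda>x. g (x \<bullet> v)) has_derivative (\<lambda>w. (w \<bullet> v) * g')) (at x)"
    using has_derivative_compose[OF has_derivative_inner_left[OF has_derivative_ident] assms(2)[unfolded has_field_derivative_def]]
    by (simp add: mult.commute)
  show ?thesis
    using has_derivative_mult[OF f g] by (simp add: algebra_simps)
qed

lemma frechet_derivative_tensor:
  fixes u v x :: "'a::euclidean_space"
  assumes "(f has_real_derivative f') (at (x \<bullet> u))" "(g has_real_derivative g') (at (x \<bullet> v))"
  shows "frechet_derivative (\<lambda>x. f (x \<bullet> u) * g (x \<bullet> v)) (at x) =
    (\<lambda>w. (w \<bullet> u) * (f' * g (x \<bullet> v)) + (w \<bullet> v) * (f (x \<bullet> u) * g'))"
  using frechet_derivative_at[OF has_derivative_tensor[OF assms]] by simp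

text \<open>A directional derivative of a tensor product is a combination of two tensor products, so
  an induction over all pairs of factors closes. With 1 as second factor it also covers functions of
  one linear coordinate, such as the graph functions of the free boundary.\<close>

lemma smooth_on_tensor:
  fixes u v :: "'a::euclidean_space"
  assumes "Cinf f" "Cinf g"
  shows "smooth_on (\<lambda>x. f (x \<bullet> u) * g (x \<bullet> v)) UNIV"
proof -
  have "higher_differentiable_on n (\<lambda>x. f (x \<bullet> u) * g (x \<bullet> v)) UNIV" if "Cinf f" "Cinf g" for n f g
    using that
  proof (induction n arbitrary: f g)
    case 0
    have "continuous_on UNIV (\<lambda>x. f (x \<bullet> u))" "continuous_on UNIV (\<lambda>x. g (x \<bullet> v))"
      by (rule continuous_on_compose2[OF Cinf_continuous[of _ UNIV]];
          use 0 in \<open>auto intro: continuous_intros\<close>)+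
    then show ?case by (auto intro: continuous_on_mult)
  next
    case (Suc n)
    obtain f' where f': "\<And>x. (f has_real_derivative f' x) (at x)" "Cinf f'"
      using Cinf_DERIV Suc.prems(1) by blast
    obtain g' where g': "\<And>x. (g has_real_derivative g' x) (at x)" "Cinf g'"
      using Cinf_DERIV Suc.prems(2) by blast
    have "(\<lambda>x. f (x \<bullet> u) * g (x \<bullet> v)) differentiable (at x)" for x
      using has_derivative_tensor[OF f'(1) g'(1)] differentiable_def by blast
    moreover have "higher_differentiable_on n
        (\<lambda>x. frechet_derivative (\<lambda>x. f (x \<bullet> u) * g (x \<bullet> v)) (at x) w) UNIV" for w
      unfolding frechet_derivative_tensor[OF f'(1) g'(1)]
      using higher_differentiable_on_add[OF
          higher_differentiable_on_scale[OF Suc.IH[OF f'(2) Suc.prems(2)]]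
          higher_differentiable_on_scale[OF Suc.IH[OF Suc.prems(1) g'(2)]]] .
    ultimately show ?case unfolding higher_differentiable_on.simps by blast
  qed
  with assms show ?thesis by (simp add: smooth_on_def)
qed

section \<open>The hodograph map\<close>

text \<open>A branch of sqrt (s - b) whose cut runs straight down from b: the factor -i turns the
  closed upper half plane into the closed right half plane, where \<open>csqrt\<close> is
  continuous, and \<open>cis (pi / 4)\<close> undoes the turn.\<close>

definition rt :: "real \<Rightarrow> complex \<Rightarrow> complex" where
  "rt b s = cis (pi / 4) * csqrt (- \<i> * (s - of_real b))"

lemma cis_pi4_squared: "(cis (pi / 4))\<^sup>2 = \<i>"
  by (simp add: Complex.DeMoivre cis_pi_half)

lemma rt_squared: "(rt b s)\<^sup>2 = s - of_real b"
  by (simp add: rt_def power_mult_distrib cis_pi4_squared algebra_simps)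

text \<open>The origin is an end of the cut, but |csqrt z| = sqrt |z| forces the limit 0 there. This
  is what makes om continuous up to the branch point b.\<close>

lemma isCont_csqrt_0: "isCont csqrt 0"
proof -
  have "isCont (\<lambda>z::complex. sqrt (norm z)) 0"
    by (intro continuous_intros)
  then have "((\<lambda>z::complex. sqrt (norm z)) \<longlongrightarrow> sqrt (norm (0::complex))) (at 0)"
    unfolding isCont_def .
  then have "((\<lambda>z. norm (csqrt z)) \<longlongrightarrow> 0) (at 0)"
    by (simp only: norm_csqrt norm_zero real_sqrt_zero)
  then show ?thesis
    unfolding isCont_def csqrt_0 by (rule tendsto_norm_zero_cancel)
qed

lemma rt_continuous: "continuous_on {s. 0 \<le> Im s} (rt b)"
proof -
  have "continuous_on ((\<lambda>s. - \<i> * (s - of_real b)) ` {s. 0 \<le> Im s}) csqrt"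
  proof (rule continuous_at_imp_continuous_on, safe)
    fix s assume s: "0 \<le> Im s"
    show "isCont csqrt (- \<i> * (s - of_real b))"
    proof (cases "- \<i> * (s - of_real b) = 0")
      case True
      then show ?thesis using isCont_csqrt_0 by metis
    next
      case False
      then have "- \<i> * (s - of_real b) \<notin> \<real>\<^sub>\<le>\<^sub>0"
        using s by (auto simp: complex_nonpos_Reals_iff complex_eq_iff)
      then show ?thesis by (rule continuous_at_csqrt)
    qed
  qed
  then have "continuous_on {s. 0 \<le> Im s} (\<lambda>s. csqrt (- \<i> * (s - of_real b)))"
    by (rule continuous_on_compose2) (auto intro!: continuous_intros)
  then show ?thesis
    unfolding rt_def by (intro continuous_intros)
qed

lemma upper_half_not_nonpos:
  assumes "0 \<le> Im s" "s \<noteq> of_real b"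
  shows "- \<i> * (s - of_real b) \<notin> \<real>\<^sub>\<le>\<^sub>0"
  using assms by (auto simp: complex_nonpos_Reals_iff complex_eq_iff)

lemma rt_nonzero: "s \<noteq> of_real b \<Longrightarrow> rt b s \<noteq> 0"
  using rt_squared[of b s] by auto

lemma rt_derivative:
  assumes "0 \<le> Im s" "s \<noteq> of_real b"
  shows "(rt b has_field_derivative 1 / (2 * rt b s)) (at s)"
proof -
  have "((\<lambda>s. - \<i> * (s - of_real b)) has_field_derivative - \<i> * (1 - 0)) (at s)"
    by (intro DERIV_cmult DERIV_diff DERIV_ident DERIV_const)
  from DERIV_cmult[OF has_field_derivative_csqrt'[OF this upper_half_not_nonpos[OF assms]], of "cis (pi / 4)"]
  have "(rt b has_field_derivative
      cis (pi / 4) * ((- \<i> * (1 - 0)) / (2 * csqrt (- \<i> * (s - of_real b))))) (at s)"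
    unfolding rt_def .
  also have "cis (pi / 4) * ((- \<i> * (1 - 0)) / (2 * csqrt (- \<i> * (s - of_real b)))) = 1 / (2 * rt b s)"
  proof -
    have "cis (pi / 4) * cis (pi / 4) = \<i>" using cis_pi4_squared by (simp add: power2_eq_square)
    then show ?thesis using rt_nonzero[OF assms(2)] by (simp add: rt_def field_simps)
  qed
  finally show ?thesis .
qed

text \<open>If \<open>a\<close> is analytic near \<open>b\<close>, then \<open>a / sqrt (s - b)\<close> has a primitive of the form
  \<open>sqrt (s - b)\<close> times an analytic function: substitute the square of the integration variable
  along the ray from \<open>b\<close>.\<close>
lemma half_primitive:
  fixes a :: "complex \<Rightarrow> complex" and b :: complex
  assumes "open D" "convex D" and b: "b \<in> D" and a: "a holomorphic_on D"
  defines "BB \<equiv> \<lambda>s. integral {0..1} (\<lambda>\<rho>::real. 2 * a (b + \<rho>\<^sup>2 *\<^sub>R (s - b)))"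
  obtains BB' where "\<And>s. s \<in> D \<Longrightarrow> (BB has_field_derivative BB' s) (at s)"
    "\<And>s. s \<in> D \<Longrightarrow> (s - b) * BB' s + BB s / 2 = a s"
proof
  define BB' where "BB' s = integral {0..1} (\<lambda>\<rho>::real. 2 * (\<rho>\<^sup>2 *\<^sub>R deriv a (b + \<rho>\<^sup>2 *\<^sub>R (s - b))))" for s
  have inD: "b + \<rho>\<^sup>2 *\<^sub>R (s - b) \<in> D" if "s \<in> D" "\<rho> \<in> {0..1}" for s and \<rho> :: real
  proof -
    have "(1 - \<rho>\<^sup>2) *\<^sub>R b + \<rho>\<^sup>2 *\<^sub>R s \<in> D"
      using that by (intro convexD[OF \<open>convex D\<close>] b) (auto simp: power_le_one)
    then show ?thesis by (simp add: algebra_simps)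
  qed
  have da: "(a has_field_derivative deriv a z) (at z)" if "z \<in> D" for z
    using a \<open>open D\<close> that by (rule holomorphic_derivI)
  have ca: "continuous_on D a" using a by (rule holomorphic_on_imp_continuous_on)
  have cda: "continuous_on D (deriv a)"
    using a \<open>open D\<close> by (intro holomorphic_on_imp_continuous_on holomorphic_deriv)
  show "(BB has_field_derivative BB' s) (at s)" if s: "s \<in> D" for s
  proof -
    have "((\<lambda>s. integral (cbox 0 1) (\<lambda>\<rho>::real. 2 * a (b + \<rho>\<^sup>2 *\<^sub>R (s - b)))) has_field_derivative
        integral (cbox 0 1) (\<lambda>\<rho>::real. 2 * (\<rho>\<^sup>2 *\<^sub>R deriv a (b + \<rho>\<^sup>2 *\<^sub>R (s - b))))) (at s within D)"
    proof (rule leibniz_rule_field_derivative[where fx = "\<lambda>s \<rho>. 2 * (\<rho>\<^sup>2 *\<^sub>R deriv a (b + \<rho>\<^sup>2 *\<^sub>R (s - b)))"])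
      fix x and t :: real assume "x \<in> D" "t \<in> cbox 0 1"
      then have "(a has_field_derivative deriv a (b + t\<^sup>2 *\<^sub>R (x - b))) (at (b + t\<^sup>2 *\<^sub>R (x - b)))"
        by (intro da inD) auto
      then have "((\<lambda>x. 2 * a (b + t\<^sup>2 *\<^sub>R (x - b))) has_field_derivative
          2 * (deriv a (b + t\<^sup>2 *\<^sub>R (x - b)) * t\<^sup>2)) (at x)"
        by (intro DERIV_cmult DERIV_chain2[where f = a])
           (auto intro!: derivative_eq_intros simp: scaleR_conv_of_real)
      then show "((\<lambda>x. 2 * a (b + t\<^sup>2 *\<^sub>R (x - b))) has_field_derivative
          2 * (t\<^sup>2 *\<^sub>R deriv a (b + t\<^sup>2 *\<^sub>R (x - b)))) (at x within D)"
        by (auto simp: scaleR_conv_of_real mult.commute intro: has_field_derivative_at_within)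
    next
      fix x assume "x \<in> D"
      then show "(\<lambda>\<rho>::real. 2 * a (b + \<rho>\<^sup>2 *\<^sub>R (x - b))) integrable_on cbox 0 1"
        by (intro integrable_continuous continuous_intros continuous_on_compose2[OF ca]) (auto intro: inD)
    next
      show "continuous_on (D \<times> cbox 0 1) (\<lambda>(x, t). 2 * (t\<^sup>2 *\<^sub>R deriv a (b + t\<^sup>2 *\<^sub>R (x - b))))"
        unfolding split_beta
        by (intro continuous_intros continuous_on_compose2[OF cda]) (auto intro!: inD)
    qed (use s assms in auto)
    then show ?thesis
      unfolding BB_def BB'_def at_within_open[OF s \<open>open D\<close>] by simp
  qed
  show "(s - b) * BB' s + BB s / 2 = a s" if s: "s \<in> D" for s
  proof -
    have i1: "((\<lambda>\<rho>::real. 2 * (\<rho>\<^sup>2 *\<^sub>R deriv a (b + \<rho>\<^sup>2 *\<^sub>R (s - b)))) has_integral BB' s) {0..1}"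
      unfolding BB'_def
      by (intro integrable_integral integrable_continuous_interval continuous_intros
          continuous_on_compose2[OF cda]) (auto intro!: inD s)
    have i2: "((\<lambda>\<rho>::real. 2 * a (b + \<rho>\<^sup>2 *\<^sub>R (s - b))) has_integral BB s) {0..1}"
      unfolding BB_def
      by (intro integrable_integral integrable_continuous_interval continuous_intros
          continuous_on_compose2[OF ca]) (auto intro!: inD s)
    have "((\<lambda>\<rho>::real. (s - b) * (2 * (\<rho>\<^sup>2 *\<^sub>R deriv a (b + \<rho>\<^sup>2 *\<^sub>R (s - b)))) + 2 * a (b + \<rho>\<^sup>2 *\<^sub>R (s - b)) / 2)
        has_integral (s - b) * BB' s + BB s / 2) {0..1}"
      by (intro has_integral_add has_integral_mult_right has_integral_divide i1 i2)
    \<comment> \<open>The integrand is the derivative in \<rho> of \<rho> times a at b + \<rho>^2 (s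
      - b), whose values at 1 and 0 are a s and 0.\<close>
    moreover have "((\<lambda>\<rho>::real. (s - b) * (2 * (\<rho>\<^sup>2 *\<^sub>R deriv a (b + \<rho>\<^sup>2 *\<^sub>R (s - b)))) + 2 * a (b + \<rho>\<^sup>2 *\<^sub>R (s - b)) / 2)
        has_integral 1 *\<^sub>R a (b + 1\<^sup>2 *\<^sub>R (s - b)) - 0 *\<^sub>R a (b + 0\<^sup>2 *\<^sub>R (s - b))) {0..1}"
    proof (rule fundamental_theorem_of_calculus)
      fix x :: real assume x: "x \<in> {0..1}"
      have "((\<lambda>\<rho>::real. b + \<rho>\<^sup>2 *\<^sub>R (s - b)) has_vector_derivative (2 * x) *\<^sub>R (s - b)) (at x within {0..1})"
        by (auto intro!: derivative_eq_intros simp: has_vector_derivative_def)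
      from field_vector_diff_chain_within[OF this, of a "deriv a (b + x\<^sup>2 *\<^sub>R (s - b))"]
      have "((\<lambda>\<rho>::real. a (b + \<rho>\<^sup>2 *\<^sub>R (s - b))) has_vector_derivative
          (2 * x) *\<^sub>R (s - b) * deriv a (b + x\<^sup>2 *\<^sub>R (s - b))) (at x within {0..1})"
        using da[OF inD[OF s x]] by (auto simp: o_def intro: has_field_derivative_at_within)
      from has_vector_derivative_scaleR[OF DERIV_ident this]
      show "((\<lambda>\<rho>::real. \<rho> *\<^sub>R a (b + \<rho>\<^sup>2 *\<^sub>R (s - b))) has_vector_derivative
          (s - b) * (2 * (x\<^sup>2 *\<^sub>R deriv a (b + x\<^sup>2 *\<^sub>R (s - b)))) + 2 * a (b + x\<^sup>2 *\<^sub>R (s - b)) / 2)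
          (at x within {0..1})"
        by (simp add: scaleR_conv_of_real power2_eq_square algebra_simps)
    qed simp
    ultimately show ?thesis by (auto dest: has_integral_unique)
  qed
qed

section \<open>The elliptic integrand and its domain\<close>

definition sector :: "complex set" where
  "sector = {s. 0 \<le> Im s \<and> Im s \<le> Re s \<and> norm s \<le> 1}"

text \<open>The factor of 1 / sqrt ((s^4 - b^4) (1 - b^4 s^4)) that is regular at b: s^4 - b^4
  splits into (s - b) (s + b) (s^2 + b^2), and the root of s - b is left to \<open>rt\<close>.
  Separate principal roots are taken because each radicand avoids the cut on
  \<open>big_sector\<close>, whereas the product may not.\<close>

definition At :: "real \<Rightarrow> complex \<Rightarrow> complex" where
  "At b s = 1 / (csqrt (s + of_real b) * csqrt (s\<^sup>2 + (of_real b)\<^sup>2) * csqrt (1 - (of_real b) ^ 4 * s ^ 4))"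

text \<open>An open convex neighbourhood of the sector without singularities of \<open>At\<close>:
  the half planes exclude -b, i b and -i b, the ball excludes the zeros of 1 - b^4 s^4. Convexity
  provides the rays from b and the primitives of holomorphic functions.\<close>

definition big_sector :: "real \<Rightarrow> complex set" where
  "big_sector b = ball 0 (1 / b) \<inter> {s. Im s < Re s + b} \<inter> {s. - Im s < Re s + b}"

lemma open_big_sector: "open (big_sector b)"
  unfolding big_sector_def by (intro open_Int open_ball open_Collect_less continuous_intros)

lemma convex_big_sector: "convex (big_sector b)"
proof -
  have "{s. Im s < Re s + b} = {s. inner (Complex (-1) 1) s < b}"
    "{s. - Im s < Re s + b} = {s. inner (Complex (-1) (-1)) s < b}"
    by (auto simp: inner_complex_def)
  then show ?thesis
    unfolding big_sector_def by (simp only:) (intro convex_Int convex_ball convex_halfspace_lt)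
qed

lemma sector_subset_big_sector: "0 < b \<Longrightarrow> b < 1 \<Longrightarrow> sector \<subseteq> big_sector b"
proof
  fix s assume b: "0 < b" "b < 1" and s: "s \<in> sector"
  have "1 < 1 / b" using b by (simp add: field_simps)
  then have "norm s < 1 / b" using s by (auto simp: sector_def)
  with b s show "s \<in> big_sector b" by (auto simp: sector_def big_sector_def)
qed

lemma At_holomorphic:
  assumes b: "0 < b" "b < 1"
  shows "At b holomorphic_on big_sector b"
proof -
  have 1: "s + of_real b \<notin> \<real>\<^sub>\<le>\<^sub>0" if "s \<in> big_sector b" for s
    using that by (auto simp: big_sector_def complex_nonpos_Reals_iff)
  have 2: "s\<^sup>2 + (of_real b)\<^sup>2 \<notin> \<real>\<^sub>\<le>\<^sub>0" if "s \<in> big_sector b" for s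
  proof
    assume "s\<^sup>2 + (of_real b)\<^sup>2 \<in> \<real>\<^sub>\<le>\<^sub>0"
    then have 1: "(Re s)\<^sup>2 - (Im s)\<^sup>2 + b\<^sup>2 \<le> 0" and 2: "2 * Re s * Im s = 0"
      by (auto simp: complex_nonpos_Reals_iff Re_power2 Im_power2)
    \<comment> \<open>A real square leaves the two axes; on the imaginary one, the half planes keep
      |Im s| below b.\<close>
    from 2 have "Re s = 0 \<or> Im s = 0" by simp
    then show False
    proof
      assume "Re s = 0"
      then have "b\<^sup>2 \<le> (Im s)\<^sup>2" using 1 by simp
      then have "\<bar>b\<bar> \<le> \<bar>Im s\<bar>" by (simp add: abs_le_square_iff)
      with \<open>Re s = 0\<close> that b show False by (auto simp: big_sector_def)
    next
      assume "Im s = 0"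
      then have "(Re s)\<^sup>2 + b\<^sup>2 \<le> 0" using 1 by simp
      moreover have "(Re s)\<^sup>2 \<ge> 0" "b\<^sup>2 > 0" using b by auto
      ultimately show False by linarith
    qed
  qed
  have 3: "1 - (of_real b) ^ 4 * s ^ 4 \<notin> \<real>\<^sub>\<le>\<^sub>0" if "s \<in> big_sector b" for s
  proof -
    have "norm (of_real b * s) < 1" using that b by (auto simp: big_sector_def norm_mult field_simps)
    then have "norm ((of_real b * s) ^ 4) < 1"
      unfolding norm_power by (simp add: power_less_one_iff)
    then have "Re ((of_real b) ^ 4 * s ^ 4) < 1"
      using complex_Re_le_cmod[of "(of_real b * s) ^ 4"] by (simp add: power_mult_distrib)
    then show ?thesis by (auto simp: complex_nonpos_Reals_iff)
  qed
  have nz: "csqrt (s + of_real b) \<noteq> 0" "csqrt (s\<^sup>2 + (of_real b)\<^sup>2) \<noteq> 0"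
    "csqrt (1 - (of_real b) ^ 4 * s ^ 4) \<noteq> 0" if "s \<in> big_sector b" for s
    using 1[OF that] 2[OF that] 3[OF that] by auto
  show ?thesis
    unfolding At_def
    using 1 2 3 nz by (intro holomorphic_intros) auto
qed

text \<open>With s = b \<sigma>, this is what is left of the lemniscatic root sqrt (1 - \<sigma>^4)
  once sqrt (1 - \<sigma>) is removed. The substitution \<sigma> = 1 - \<rho>^2 absorbs the latter
  and produces the factors 2 in the integrands below, which are therefore continuous on the closed
  interval.\<close>

definition lem_weight :: "real \<Rightarrow> real" where
  "lem_weight \<sigma> = sqrt ((1 + \<sigma>) * (1 + \<sigma>\<^sup>2))"

lemma lem_weight_pos: "0 \<le> \<sigma> \<Longrightarrow> 0 < lem_weight \<sigma>"
  by (auto simp: lem_weight_def intro!: mult_pos_pos add_pos_nonneg)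

lemma lem_weight_cont: "continuous_on A (\<lambda>x. lem_weight (f x))" if "continuous_on A f"
  unfolding lem_weight_def by (intro continuous_intros that)

lemma unit_sq: "0 \<le> 1 - \<rho>\<^sup>2 \<and> 1 - \<rho>\<^sup>2 \<le> (1::real)" if "\<rho> \<in> {0..1}" for \<rho>
  using that by (auto simp: power_le_one)

text \<open>The integrand is minus the derivative of \<open>\<sigma> sqrt (1 - \<sigma>^4)\<close>, written in the variable
  \<open>\<rho> = sqrt (1 - \<sigma>)\<close>.\<close>
lemma lem_weight_integral:
  "((\<lambda>\<rho>. 2 * (1 - 3 * (1 - \<rho>\<^sup>2) ^ 4) / lem_weight (1 - \<rho>\<^sup>2)) has_integral 0) {0..1}"
proof -
  have "((\<lambda>\<rho>. - (- (2 * (1 - 3 * (1 - \<rho>\<^sup>2) ^ 4) / lem_weight (1 - \<rho>\<^sup>2)))) has_integral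
     - ((1 - 1\<^sup>2) * 1 * lem_weight (1 - 1\<^sup>2) - (1 - 0\<^sup>2) * 0 * lem_weight (1 - 0\<^sup>2))) {0..1}"
  proof (intro has_integral_neg fundamental_theorem_of_calculus)
    fix \<rho> :: real assume \<rho>: "\<rho> \<in> {0..1}"
    define \<sigma> where "\<sigma> = 1 - \<rho>\<^sup>2"
    have \<sigma>: "0 \<le> \<sigma>" using unit_sq[OF \<rho>] by (simp add: \<sigma>_def)
    define Q where "Q = (1 + \<sigma>) * (1 + \<sigma>\<^sup>2)"
    have Q: "Q > 0" using \<sigma> by (auto simp: Q_def intro!: mult_pos_pos add_pos_nonneg)
    have W: "lem_weight \<sigma> = sqrt Q" "sqrt Q > 0" "sqrt Q * sqrt Q = Q"
      using Q by (auto simp: lem_weight_def Q_def)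
    define Q' where "Q' = (- (2 * \<rho>)) * (1 + \<sigma>\<^sup>2) + (1 + \<sigma>) * (2 * \<sigma> * (- (2 * \<rho>)))"
    have s': "((\<lambda>\<rho>. 1 - \<rho>\<^sup>2) has_real_derivative - (2 * \<rho>)) (at \<rho>)"
      by (auto intro!: derivative_eq_intros)
    have dQ: "((\<lambda>\<rho>. (1 + (1 - \<rho>\<^sup>2)) * (1 + (1 - \<rho>\<^sup>2)\<^sup>2)) has_real_derivative Q') (at \<rho>)"
      by (auto intro!: derivative_eq_intros simp: Q'_def \<sigma>_def algebra_simps power2_eq_square)
    have dW: "((\<lambda>\<rho>. lem_weight (1 - \<rho>\<^sup>2)) has_real_derivative Q' / (2 * sqrt Q)) (at \<rho>)"
    proof -
      have "(sqrt has_real_derivative inverse (sqrt Q) / 2) (at ((1 + (1 - \<rho>\<^sup>2)) * (1 + (1 - \<rho>\<^sup>2)\<^sup>2)))"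
        using DERIV_real_sqrt[OF Q] by (simp add: Q_def \<sigma>_def)
      from DERIV_chain2[OF this dQ] show ?thesis
        by (simp add: lem_weight_def field_simps)
    qed
    have "((\<lambda>\<rho>. (1 - \<rho>\<^sup>2) * \<rho> * lem_weight (1 - \<rho>\<^sup>2)) has_real_derivative
      ((1 - \<rho>\<^sup>2) * 1 + (- (2 * \<rho>)) * \<rho>) * lem_weight (1 - \<rho>\<^sup>2)
       + (1 - \<rho>\<^sup>2) * \<rho> * (Q' / (2 * sqrt Q))) (at \<rho>)"
      by (rule derivative_eq_intros s' dW refl)+ (simp add: algebra_simps)
    also have "((1 - \<rho>\<^sup>2) * 1 + (- (2 * \<rho>)) * \<rho>) * lem_weight (1 - \<rho>\<^sup>2)
       + (1 - \<rho>\<^sup>2) * \<rho> * (Q' / (2 * sqrt Q)) =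
       (2 * (\<sigma> - 2 * \<rho>\<^sup>2) * Q + \<sigma> * \<rho> * Q') / (2 * sqrt Q)"
    proof -
      have *: "(x * 1 + (- (2 * \<rho>)) * \<rho>) * q + x * \<rho> * (Q' / (2 * q)) =
          (2 * (x - 2 * \<rho>\<^sup>2) * (q * q) + x * \<rho> * Q') / (2 * q)" if "q > 0" for x q :: real
        using that by (simp add: field_simps power2_eq_square)
      show ?thesis
        using *[OF W(2), of \<sigma>] unfolding W(3) unfolding W(1)[symmetric] unfolding \<sigma>_def .
    qed
    also have "2 * (\<sigma> - 2 * \<rho>\<^sup>2) * Q + \<sigma> * \<rho> * Q' = - (4 * (1 - 3 * \<sigma> ^ 4))"
    proof -
      have r: "\<rho>\<^sup>2 = 1 - \<sigma>" by (simp add: \<sigma>_def)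
      have "\<sigma> * \<rho> * Q' = - 2 * \<sigma> * \<rho>\<^sup>2 * (1 + \<sigma>\<^sup>2 + 2 * \<sigma> * (1 + \<sigma>))"
        by (simp add: Q'_def algebra_simps power2_eq_square)
      then show ?thesis unfolding r Q_def by algebra
    qed
    also have "- (4 * (1 - 3 * \<sigma> ^ 4)) / (2 * sqrt Q) = - (2 * (1 - 3 * (1 - \<rho>\<^sup>2) ^ 4) / lem_weight (1 - \<rho>\<^sup>2))"
      using W by (simp add: \<sigma>_def[symmetric] field_simps)
    finally show "((\<lambda>\<rho>. (1 - \<rho>\<^sup>2) * \<rho> * lem_weight (1 - \<rho>\<^sup>2)) has_vector_derivative
        - (2 * (1 - 3 * (1 - \<rho>\<^sup>2) ^ 4) / lem_weight (1 - \<rho>\<^sup>2))) (at \<rho> within {0..1})"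
      by (auto simp: has_real_derivative_iff_has_vector_derivative[symmetric] intro: has_field_derivative_at_within)
  qed simp
  then show ?thesis by simp
qed

text \<open>Up to a positive factor, the integral of (1 - 3 s^2) |om'| over the segment from 0 to b.
  It vanishes exactly when Ga changes by a third of the change of om along the half side.\<close>

definition modulus_integral :: "real \<Rightarrow> real" where
  "modulus_integral b = integral {0..1} (\<lambda>\<rho>. 2 * (1 - 3 * b\<^sup>2 * (1 - \<rho>\<^sup>2)\<^sup>2) /
     (lem_weight (1 - \<rho>\<^sup>2) * sqrt (1 - b ^ 8 * (1 - \<rho>\<^sup>2) ^ 4)))"

lemma pow_lt1:
  assumes "0 \<le> b" "b < 1" "\<rho> \<in> {0..1}"
  shows "b ^ 8 * (1 - \<rho>\<^sup>2) ^ 4 < (1::real)"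
proof -
  have "b ^ 8 < 1" using assms by (simp add: power_less_one_iff)
  moreover have "b ^ 8 * (1 - \<rho>\<^sup>2) ^ 4 \<le> b ^ 8 * 1"
    using assms unit_sq[OF assms(3)] by (intro mult_left_mono power_le_one) auto
  ultimately show ?thesis by simp
qed

text \<open>At b = 0 the integral is I 0, which is positive. Without the factor sqrt (1 - b^8
  \<sigma>^4) the integral would be I 0 - 3 b^2 I 2, and since I 0 = 3 I 4 < 3 I 2 this is negative
  for some b < 1. The factor only lowers the sign further, as its reciprocal puts more weight where
  the integrand is negative.\<close>

lemma exists_modulus:
  obtains b where "0 < b" "b < 1" "modulus_integral b = 0"
proof -
  define I where "I n = integral {0..1} (\<lambda>\<rho>. 2 * (1 - \<rho>\<^sup>2) ^ n / lem_weight (1 - \<rho>\<^sup>2))" for n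
  have W: "lem_weight (1 - \<rho>\<^sup>2) > 0" if "\<rho> \<in> {0..1}" for \<rho>
    using unit_sq[OF that] by (simp add: lem_weight_pos)
  have cI: "continuous_on {0..1} (\<lambda>\<rho>. 2 * (1 - \<rho>\<^sup>2) ^ n / lem_weight (1 - \<rho>\<^sup>2))" for n
    by (intro continuous_intros lem_weight_cont) (use W in force)
  have hI: "((\<lambda>\<rho>. 2 * (1 - \<rho>\<^sup>2) ^ n / lem_weight (1 - \<rho>\<^sup>2)) has_integral I n) {0..1}" for n
    unfolding I_def by (intro integrable_integral integrable_continuous_interval cI)
  have "((\<lambda>\<rho>. 2 * (1 - \<rho>\<^sup>2) ^ 0 / lem_weight (1 - \<rho>\<^sup>2) - 3 * (2 * (1 - \<rho>\<^sup>2) ^ 4 / lem_weight (1 - \<rho>\<^sup>2)))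
      has_integral I 0 - 3 * I 4) {0..1}"
    by (intro has_integral_diff has_integral_mult_right hI)
  moreover have "2 * (1 - \<rho>\<^sup>2) ^ 0 / lem_weight (1 - \<rho>\<^sup>2) - 3 * (2 * (1 - \<rho>\<^sup>2) ^ 4 / lem_weight (1 - \<rho>\<^sup>2)) =
     2 * (1 - 3 * (1 - \<rho>\<^sup>2) ^ 4) / lem_weight (1 - \<rho>\<^sup>2)" for \<rho>
    by (simp add: diff_divide_distrib right_diff_distrib)
  ultimately have "((\<lambda>\<rho>. 2 * (1 - 3 * (1 - \<rho>\<^sup>2) ^ 4) / lem_weight (1 - \<rho>\<^sup>2)) has_integral I 0 - 3 * I 4) {0..1}"
    by (simp only:)
  then have I04: "I 0 = 3 * I 4"
    using has_integral_unique[OF lem_weight_integral] by fastforce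
  have I42: "I 4 < I 2"
  proof -
    have h: "((\<lambda>\<rho>. 2 * (1 - \<rho>\<^sup>2) ^ 2 / lem_weight (1 - \<rho>\<^sup>2) - 2 * (1 - \<rho>\<^sup>2) ^ 4 / lem_weight (1 - \<rho>\<^sup>2))
      has_integral I 2 - I 4) {0..1}"
      by (intro has_integral_diff hI)
    have nn: "0 \<le> 2 * (1 - \<rho>\<^sup>2) ^ 2 / lem_weight (1 - \<rho>\<^sup>2) - 2 * (1 - \<rho>\<^sup>2) ^ 4 / lem_weight (1 - \<rho>\<^sup>2)"
      if "\<rho> \<in> {0..1}" for \<rho>
    proof -
      have "(1 - \<rho>\<^sup>2) ^ 4 \<le> (1 - \<rho>\<^sup>2)\<^sup>2"
        using unit_sq[OF that] by (intro power_decreasing) auto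
      then show ?thesis
        using W[OF that] by (simp add: divide_right_mono)
    qed
    have "I 2 - I 4 \<noteq> 0"
    proof
      assume "I 2 - I 4 = 0"
      then have "((\<lambda>\<rho>. 2 * (1 - \<rho>\<^sup>2) ^ 2 / lem_weight (1 - \<rho>\<^sup>2) - 2 * (1 - \<rho>\<^sup>2) ^ 4 / lem_weight (1 - \<rho>\<^sup>2))
        has_integral 0) (cbox 0 1)" using h by simp
      from has_integral_0_cbox_imp_0[OF _ _ this, of "1/2"] nn continuous_on_diff[OF cI[of 2] cI[of 4]]
      have "2 * (1 - (1/2)\<^sup>2) ^ 2 / lem_weight (1 - (1/2)\<^sup>2) - 2 * (1 - (1/2)\<^sup>2) ^ 4 / lem_weight (1 - (1/2)\<^sup>2) = (0::real)"
        by (auto simp del: right_minus_eq simp: box_eq_empty)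
      with W[of "1/2"] show False by (simp add: field_simps)
    qed
    moreover have "0 \<le> I 2 - I 4" using h nn by (rule has_integral_nonneg)
    ultimately show ?thesis by simp
  qed
  have I20: "I 2 \<le> I 0"
  proof (rule has_integral_le[OF hI hI])
    fix \<rho> :: real assume "\<rho> \<in> {0..1}"
    then show "2 * (1 - \<rho>\<^sup>2) ^ 2 / lem_weight (1 - \<rho>\<^sup>2) \<le> 2 * (1 - \<rho>\<^sup>2) ^ 0 / lem_weight (1 - \<rho>\<^sup>2)"
      using unit_sq W by (intro divide_right_mono mult_left_mono power_decreasing) (auto intro: less_imp_le)
  qed
  have I0: "0 \<le> I 0"
    by (rule has_integral_nonneg[OF hI]) (use W in \<open>auto intro: less_imp_le\<close>)
  have I2: "0 < I 2" using I0 I04 I42 by linarith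
  \<comment> \<open>The midpoint of 1 and I 0 / (3 I 2) = I 4 / I 2. It is below 1, so that b1 =
    sqrt c is an admissible modulus, and it makes I 0 - 3 c I 2 negative.\<close>
  define c where "c = (1 + I 0 / (3 * I 2)) / 2"
  have c: "I 0 / (3 * I 2) < c" "c < 1" "0 < c"
    using I04 I42 I2 I0 by (auto simp: c_def field_simps)
  define b1 where "b1 = sqrt c"
  have b1: "0 < b1" "b1 < 1" "b1\<^sup>2 = c" using c by (auto simp: b1_def)
  define F where "F b \<rho> = 2 * (1 - 3 * b\<^sup>2 * (1 - \<rho>\<^sup>2)\<^sup>2) /
     (lem_weight (1 - \<rho>\<^sup>2) * sqrt (1 - b ^ 8 * (1 - \<rho>\<^sup>2) ^ 4))" for b \<rho>
  have "continuous_on ({0..b1} \<times> cbox 0 1) (\<lambda>(b, \<rho>). F b \<rho>)"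
    unfolding F_def split_beta
    by (intro continuous_intros lem_weight_cont)
       (use W pow_lt1 b1 in \<open>force simp: order.strict_iff_not\<close>)
  then have contJ: "continuous_on {0..b1} modulus_integral"
    unfolding modulus_integral_def F_def[symmetric] box_real[symmetric]
    by (rule integral_continuous_on_param)
  have iF: "F b integrable_on {0..1}" if "b \<in> {0..b1}" for b
  proof (rule integrable_continuous_interval)
    show "continuous_on {0..1} (F b)"
      unfolding F_def
      by (intro continuous_intros lem_weight_cont)
         (use W pow_lt1[of b] b1 that in \<open>force simp: order.strict_iff_not\<close>)
  qed
  have m0: "modulus_integral 0 = I 0"
    by (simp add: modulus_integral_def I_def)
  then have J0: "0 \<le> modulus_integral 0" using I0 by simp
  have J1: "modulus_integral b1 < 0"
  proof -
    \<comment> \<open>The sign change of 1 - 3 c \<sigma>^2. The factor 1 / sqrt (1 - b1^8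
      \<sigma>^4) increases with \<sigma>, so freezing it at \<sigma>0 enlarges the integrand both
      where it is positive and where it is negative.\<close>
    define \<sigma>0 where "\<sigma>0 = sqrt (1 / (3 * c))"
    define K where "K = sqrt (1 - b1 ^ 8 * \<sigma>0 ^ 4)"
    have s0: "0 \<le> \<sigma>0" "\<sigma>0\<^sup>2 = 1 / (3 * c)" using c by (auto simp: \<sigma>0_def)
    have "1 / 3 \<le> I 0 / (3 * I 2)" using I20 I2 by (simp add: field_simps)
    then have c3: "1 < 3 * c" using c(1) by linarith
    have s01: "\<sigma>0 \<le> 1" using c3 by (auto simp: \<sigma>0_def)
    have b8: "b1 ^ 8 < 1" using b1 by (simp add: power_less_one_iff)
    have "b1 ^ 8 * \<sigma>0 ^ 4 \<le> b1 ^ 8 * 1"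
      using s0 s01 b1 by (intro mult_left_mono power_le_one) auto
    then have K: "0 < K" using b8 by (auto simp: K_def)
    have hA: "((\<lambda>\<rho>. (1 / K) * (2 * (1 - \<rho>\<^sup>2) ^ 0 / lem_weight (1 - \<rho>\<^sup>2) - 3 * c * (2 * (1 - \<rho>\<^sup>2)\<^sup>2 / lem_weight (1 - \<rho>\<^sup>2))))
      has_integral (1 / K) * (I 0 - 3 * c * I 2)) {0..1}"
      by (intro has_integral_diff has_integral_mult_right hI)
    have hB: "(F b1 has_integral modulus_integral b1) {0..1}"
      unfolding modulus_integral_def F_def[symmetric] by (intro integrable_integral iF) (use b1 in auto)
    have hC: "F b1 \<rho> \<le> (1 / K) * (2 * (1 - \<rho>\<^sup>2) ^ 0 / lem_weight (1 - \<rho>\<^sup>2) - 3 * c * (2 * (1 - \<rho>\<^sup>2)\<^sup>2 / lem_weight (1 - \<rho>\<^sup>2)))"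
      if \<rho>: "\<rho> \<in> {0..1}" for \<rho>
    proof -
      define \<sigma> where "\<sigma> = 1 - \<rho>\<^sup>2"
      have \<sigma>: "0 \<le> \<sigma>" "\<sigma> \<le> 1" using unit_sq[OF \<rho>] by (auto simp: \<sigma>_def)
      define Ks where "Ks = sqrt (1 - b1 ^ 8 * \<sigma> ^ 4)"
      have Ks: "0 < Ks" using pow_lt1[OF _ b1(2) \<rho>] b1 by (simp add: Ks_def \<sigma>_def)
      have "(1 - 3 * c * \<sigma>\<^sup>2) * (1 / Ks) \<le> (1 - 3 * c * \<sigma>\<^sup>2) * (1 / K)"
      proof (cases "\<sigma> \<le> \<sigma>0")
        case True
        then have "\<sigma>\<^sup>2 \<le> \<sigma>0\<^sup>2" using \<sigma> by (intro power_mono)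
        then have "0 \<le> 1 - 3 * c * \<sigma>\<^sup>2" using s0 c by (simp add: field_simps)
        moreover have "K \<le> Ks" unfolding K_def Ks_def using True \<sigma> b1 by (auto intro!: mult_left_mono power_mono)
        ultimately show ?thesis using K Ks by (intro mult_left_mono divide_left_mono) auto
      next
        case False
        then have "\<sigma>0\<^sup>2 \<le> \<sigma>\<^sup>2" using s0 by (intro power_mono) auto
        then have "1 - 3 * c * \<sigma>\<^sup>2 \<le> 0" using s0 c by (simp add: field_simps)
        moreover have "Ks \<le> K" unfolding K_def Ks_def using False s0 b1 by (auto intro!: mult_left_mono power_mono)
        ultimately show ?thesis using K Ks by (intro mult_left_mono_neg divide_left_mono) auto
      qed
      then have "(2 / lem_weight \<sigma>) * ((1 - 3 * c * \<sigma>\<^sup>2) * (1 / Ks)) \<le> (2 / lem_weight \<sigma>) * ((1 - 3 * c * \<sigma>\<^sup>2) * (1 / K))"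
        by (rule mult_left_mono) (use W[OF \<rho>] in \<open>simp add: \<sigma>_def\<close>)
      then show ?thesis
        unfolding F_def \<sigma>_def[symmetric] Ks_def[symmetric] b1(3)
        by (simp add: field_simps diff_divide_distrib)
    qed
    have "modulus_integral b1 \<le> (1 / K) * (I 0 - 3 * c * I 2)"
      by (rule has_integral_le[OF hB hA hC])
    also have "\<dots> < 0" using c I2 K by (auto simp: field_simps mult_less_0_iff)
    finally show ?thesis .
  qed
  have "\<exists>b. 0 \<le> b \<and> b \<le> b1 \<and> modulus_integral b = 0"
    by (rule IVT2') (use J0 J1 contJ b1 in auto)
  then obtain b where b: "0 \<le> b" "b \<le> b1" "modulus_integral b = 0" by auto
  have "b \<noteq> 0" using m0 b(3) I04 I42 I2 I20 by auto
  with b b1 show ?thesis by (intro that[of b]) auto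
qed


lemma At_of_real:
  assumes "0 < b" "b < 1" "0 \<le> \<sigma>" "\<sigma> \<le> 1"
  shows "At b (of_real (b * \<sigma>)) =
    of_real (1 / (b * sqrt b * lem_weight \<sigma> * sqrt (1 - b ^ 8 * \<sigma> ^ 4)))"
proof -
  have "b ^ 8 * \<sigma> ^ 4 \<le> 1 * 1"
    using assms by (intro mult_mono power_le_one) auto
  then have 1: "csqrt (1 - (of_real b) ^ 4 * (of_real (b * \<sigma>)) ^ 4) = of_real (sqrt (1 - b ^ 8 * \<sigma> ^ 4))"
    by (subst of_real_sqrt) (auto simp: power_mult_distrib simp flip: power_add mult.assoc)
  have 2: "csqrt (of_real (b * \<sigma>) + of_real b) = of_real (sqrt (b * (1 + \<sigma>)))"
    using assms by (subst of_real_sqrt) (auto simp: algebra_simps)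
  have 3: "csqrt ((of_real (b * \<sigma>))\<^sup>2 + (of_real b)\<^sup>2) = of_real (sqrt (b\<^sup>2 * (1 + \<sigma>\<^sup>2)))"
    using assms by (subst of_real_sqrt) (auto simp: algebra_simps power_mult_distrib)
  have "sqrt (b * (1 + \<sigma>)) * sqrt (b\<^sup>2 * (1 + \<sigma>\<^sup>2)) = b * sqrt b * lem_weight \<sigma>"
    using assms by (simp add: lem_weight_def real_sqrt_mult)
  then show ?thesis
    unfolding At_def 1 2 3 by (simp flip: of_real_mult)
qed

text \<open>om and Ga are constants plus \<open>rt\<close> times a holomorphic function, hence
  continuous at b although their derivatives blow up there. In om Ga' the product of
  \<open>rt\<close> and 1 / \<open>rt\<close> cancels, so G needs only one singular term, the one
  already in Ga, and a primitive P of a holomorphic function.\<close>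

lemma exists_hodograph_map:
  obtains b k :: real and om Ga G :: "complex \<Rightarrow> complex"
  where "0 < b" "b < 1" "0 < k"
    and "continuous_on sector om" "continuous_on sector Ga" "continuous_on sector G"
    and "\<And>s. s \<in> sector \<Longrightarrow> s \<noteq> of_real b \<Longrightarrow>
      (om has_field_derivative - of_real k * At b s / rt b s) (at s)"
    and "\<And>s. s \<in> sector \<Longrightarrow> s \<noteq> of_real b \<Longrightarrow>
      (Ga has_field_derivative s\<^sup>2 * (- of_real k * At b s / rt b s)) (at s)"
    and "\<And>s. s \<in> sector \<Longrightarrow> s \<noteq> of_real b \<Longrightarrow>
      (G has_field_derivative om s * (s\<^sup>2 * (- of_real k * At b s / rt b s))) (at s)"
    and "om (of_real b) = 1" "Ga (of_real b) = - 1 / 3" "om 0 = 1 - \<i>" "Ga 0 = - 1 / 3 - \<i> / 3"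
proof -
  obtain b where b: "0 < b" "b < 1" "modulus_integral b = 0" by (rule exists_modulus)
  let ?D = "big_sector b"
  have sub: "sector \<subseteq> ?D" using sector_subset_big_sector b by blast
  have bD: "of_real b \<in> ?D" using b by (intro subsetD[OF sub]) (auto simp: sector_def)
  have hol1: "At b holomorphic_on ?D" using b by (intro At_holomorphic)
  have hol2: "(\<lambda>s. s\<^sup>2 * At b s) holomorphic_on ?D" by (intro holomorphic_intros hol1)
  define B1 where "B1 s = integral {0..1} (\<lambda>\<rho>::real. 2 * At b (of_real b + \<rho>\<^sup>2 *\<^sub>R (s - of_real b)))" for s
  define B2 where "B2 s = integral {0..1} (\<lambda>\<rho>::real. 2 * ((of_real b + \<rho>\<^sup>2 *\<^sub>R (s - of_real b))\<^sup>2 *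
    At b (of_real b + \<rho>\<^sup>2 *\<^sub>R (s - of_real b))))" for s
  obtain B1' where B1': "\<And>s. s \<in> ?D \<Longrightarrow> (B1 has_field_derivative B1' s) (at s)"
    "\<And>s. s \<in> ?D \<Longrightarrow> (s - of_real b) * B1' s + B1 s / 2 = At b s"
    unfolding B1_def using half_primitive[OF open_big_sector convex_big_sector bD hol1] by blast
  obtain B2' where B2': "\<And>s. s \<in> ?D \<Longrightarrow> (B2 has_field_derivative B2' s) (at s)"
    "\<And>s. s \<in> ?D \<Longrightarrow> (s - of_real b) * B2' s + B2 s / 2 = s\<^sup>2 * At b s"
    unfolding B2_def using half_primitive[OF open_big_sector convex_big_sector bD hol2] by blast
  have rtB: "((\<lambda>s. rt b s * B s) has_field_derivative a / rt b s) (at s)"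
    if "s \<in> sector" "s \<noteq> of_real b" "(B has_field_derivative B') (at s)"
      "(s - of_real b) * B' + B s / 2 = a" for s a B B'
  proof -
    have nz: "rt b s \<noteq> 0" using that(2) by (rule rt_nonzero)
    have "((\<lambda>s. rt b s * B s) has_field_derivative 1 / (2 * rt b s) * B s + B' * rt b s) (at s)"
      using that by (intro DERIV_mult rt_derivative) (auto simp: sector_def)
    moreover have "1 / (2 * rt b s) * B s + B' * rt b s = ((rt b s)\<^sup>2 * B' + B s / 2) / rt b s"
      using nz by (simp add: field_simps power2_eq_square)
    ultimately show ?thesis using that(4) by (simp add: rt_squared)
  qed
  have B1hol: "B1 holomorphic_on ?D"
    unfolding holomorphic_on_open[OF open_big_sector] using B1'(1) by blast
  have "(\<lambda>s. B1 s * (s\<^sup>2 * At b s)) holomorphic_on ?D" by (intro holomorphic_intros hol2 B1hol)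
  then obtain P where P: "\<And>s. s \<in> ?D \<Longrightarrow> (P has_field_derivative B1 s * (s\<^sup>2 * At b s)) (at s within ?D)"
    using holomorphic_convex_primitive'[OF convex_big_sector open_big_sector] by blast
  \<comment> \<open>The real integrand of \<open>B1 0\<close>, the integral along the segment from b
    to 0. Multiplied by s^2 = b^2 (1 - \<rho>^2)^2 it becomes the integrand of
    \<open>B2 0\<close>.\<close>
  define g where "g \<rho> = 2 / (b * sqrt b * lem_weight (1 - \<rho>\<^sup>2) * sqrt (1 - b ^ 8 * (1 - \<rho>\<^sup>2) ^ 4))" for \<rho>
  define X where "X = integral {0..1} g"
  define Y where "Y = integral {0..1} (\<lambda>\<rho>. b\<^sup>2 * (1 - \<rho>\<^sup>2)\<^sup>2 * g \<rho>)"
  have W: "lem_weight (1 - \<rho>\<^sup>2) > 0" if "\<rho> \<in> {0..1}" for \<rho>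
    using unit_sq[OF that] by (simp add: lem_weight_pos)
  have q1: "b ^ 8 * (1 - \<rho>\<^sup>2) ^ 4 < 1" if "\<rho> \<in> {0..1}" for \<rho>
    using pow_lt1[of b \<rho>] b that by auto
  have gpos: "g \<rho> > 0" if "\<rho> \<in> {0..1}" for \<rho>
    using W[OF that] q1[OF that] b by (auto simp: g_def intro!: divide_pos_pos mult_pos_pos)
  have gcont: "continuous_on {0..1} g"
    unfolding g_def
    by (intro continuous_intros lem_weight_cont) (use W q1 b in \<open>force simp: order.strict_iff_not\<close>)
  have hX: "(g has_integral X) {0..1}"
    unfolding X_def by (intro integrable_integral integrable_continuous_interval gcont)
  have hY: "((\<lambda>\<rho>. b\<^sup>2 * (1 - \<rho>\<^sup>2)\<^sup>2 * g \<rho>) has_integral Y) {0..1}"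
    unfolding Y_def by (intro integrable_integral integrable_continuous_interval continuous_intros gcont)
  have X: "X > 0"
  proof -
    have "X \<noteq> 0"
    proof
      assume "X = 0"
      then have "(g has_integral 0) (cbox 0 1)" using hX by simp
      from has_integral_0_cbox_imp_0[OF _ _ this, of 0] gpos gcont show False
        by (fastforce simp: box_eq_empty less_imp_le)
    qed
    moreover have "X \<ge> 0" using gpos by (intro has_integral_nonneg[OF hX]) (auto intro: less_imp_le)
    ultimately show ?thesis by simp
  qed
  \<comment> \<open>This is \<open>modulus_integral b = 0\<close>, multiplied out by b sqrt
    b.\<close>
  have XY: "X = 3 * Y"
  proof -
    have "((\<lambda>\<rho>. b * sqrt b * (g \<rho> - 3 * (b\<^sup>2 * (1 - \<rho>\<^sup>2)\<^sup>2 * g \<rho>))) has_integral b * sqrt b * (X - 3 * Y)) {0..1}"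
      by (intro has_integral_mult_right has_integral_diff hX hY)
    moreover have "b * sqrt b * (g \<rho> - 3 * (b\<^sup>2 * (1 - \<rho>\<^sup>2)\<^sup>2 * g \<rho>)) = 2 * (1 - 3 * b\<^sup>2 * (1 - \<rho>\<^sup>2)\<^sup>2) /
     (lem_weight (1 - \<rho>\<^sup>2) * sqrt (1 - b ^ 8 * (1 - \<rho>\<^sup>2) ^ 4))" for \<rho>
    proof -
      have *: "b * sqrt b * (2 / (b * sqrt b * w * q) - 3 * (y * (2 / (b * sqrt b * w * q)))) = 2 * (1 - 3 * y) / (w * q)"
        for w q y :: real
        using b by (cases "w = 0"; cases "q = 0") (simp_all add: field_simps)
      show ?thesis unfolding g_def * by (simp add: mult.assoc)
    qed
    ultimately have "modulus_integral b = b * sqrt b * (X - 3 * Y)"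
      unfolding modulus_integral_def by (simp add: integral_unique)
    then show ?thesis using b by simp
  qed
  have arg: "of_real b + \<rho>\<^sup>2 *\<^sub>R (0 - of_real b) = complex_of_real (b * (1 - \<rho>\<^sup>2))" for \<rho> :: real
    by (simp add: scaleR_conv_of_real algebra_simps)
  have Atg: "2 * At b (of_real b + \<rho>\<^sup>2 *\<^sub>R (0 - of_real b)) = of_real (g \<rho>)" if "\<rho> \<in> {0..1}" for \<rho>
    using unit_sq[OF that] b unfolding arg by (subst At_of_real) (auto simp: g_def)
  have B10: "B1 0 = of_real X"
  proof -
    have "((\<lambda>\<rho>. complex_of_real (g \<rho>)) has_integral of_real X) {0..1}" using hX by (rule has_integral_of_real)
    then have "((\<lambda>\<rho>::real. 2 * At b (of_real b + \<rho>\<^sup>2 *\<^sub>R (0 - of_real b))) has_integral of_real X) {0..1}"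
      by (rule has_integral_eq[rotated]) (simp only: Atg)
    then show ?thesis unfolding B1_def by (rule integral_unique)
  qed
  have B20: "B2 0 = of_real Y"
  proof -
    have "((\<lambda>\<rho>. complex_of_real (b\<^sup>2 * (1 - \<rho>\<^sup>2)\<^sup>2 * g \<rho>)) has_integral of_real Y) {0..1}"
      using hY by (rule has_integral_of_real)
    moreover have "complex_of_real (b\<^sup>2 * (1 - \<rho>\<^sup>2)\<^sup>2 * g \<rho>) = 2 * ((of_real b + \<rho>\<^sup>2 *\<^sub>R (0 - of_real b))\<^sup>2 *
        At b (of_real b + \<rho>\<^sup>2 *\<^sub>R (0 - of_real b)))" if "\<rho> \<in> {0..1}" for \<rho>
      using Atg[OF that] unfolding arg by (simp add: power_mult_distrib)
    ultimately have "((\<lambda>\<rho>::real. 2 * ((of_real b + \<rho>\<^sup>2 *\<^sub>R (0 - of_real b))\<^sup>2 *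
        At b (of_real b + \<rho>\<^sup>2 *\<^sub>R (0 - of_real b)))) has_integral of_real Y) {0..1}"
      by (rule has_integral_eq[rotated])
    then show ?thesis unfolding B2_def by (rule integral_unique)
  qed
  \<comment> \<open>As \<open>rt b 0\<close> is i sqrt b, this scale gives om 0 = 1 - i; then Ga 0
    is right as well, because X = 3 Y.\<close>
  define k where "k = 1 / (sqrt b * X)"
  have k: "k > 0" using X b by (simp add: k_def)
  have rt0: "rt b 0 = \<i> * of_real (sqrt b)"
  proof -
    have "csqrt (\<i> * of_real b) = of_real (sqrt b) * cis (pi / 4)"
    proof (rule csqrt_unique)
      show "(complex_of_real (sqrt b) * cis (pi / 4))\<^sup>2 = \<i> * of_real b"
        using b unfolding power_mult_distrib cis_pi4_squared by (simp flip: of_real_power)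
      show "0 < Re (complex_of_real (sqrt b) * cis (pi / 4)) \<or>
        Re (complex_of_real (sqrt b) * cis (pi / 4)) = 0 \<and> 0 \<le> Im (complex_of_real (sqrt b) * cis (pi / 4))"
        using b by (simp add: cos_45)
    qed
    moreover have "cis (pi / 4) * cis (pi / 4) = \<i>"
      using cis_pi4_squared by (simp add: power2_eq_square)
    ultimately show ?thesis by (simp add: rt_def)
  qed
  have krX: "of_real k * (\<i> * of_real (sqrt b)) * of_real X = \<i>"
    "of_real k * (\<i> * of_real (sqrt b)) * of_real Y = \<i> / 3"
  proof -
    have 1: "k * sqrt b * X = 1" "k * sqrt b * Y = 1 / 3" using X XY b by (auto simp: k_def)
    have *: "of_real k * (\<i> * of_real (sqrt b)) * of_real x = \<i> * of_real (k * sqrt b * x)" for x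
      by (simp add: mult_ac)
    show "of_real k * (\<i> * of_real (sqrt b)) * of_real X = \<i>"
      "of_real k * (\<i> * of_real (sqrt b)) * of_real Y = \<i> / 3" unfolding * 1 by simp_all
  qed
  have rtb: "rt b (of_real b) = 0" by (simp add: rt_def)
  define om where "om s = 1 - of_real k * (rt b s * B1 s)" for s
  define Ga where "Ga s = - 1 / 3 - of_real k * (rt b s * B2 s)" for s
  define G where "G s = (of_real k)\<^sup>2 * P s - of_real k * (rt b s * B2 s)" for s
  have crt: "continuous_on sector (rt b)"
    by (rule continuous_on_subset[OF rt_continuous]) (auto simp: sector_def)
  have cD: "continuous_on sector f" if "\<And>s. s \<in> ?D \<Longrightarrow> (f has_field_derivative f' s) (at s)" for f f'
    using that sub by (intro continuous_at_imp_continuous_on) (auto intro: DERIV_isCont)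
  have P': "(P has_field_derivative B1 s * (s\<^sup>2 * At b s)) (at s)" if "s \<in> ?D" for s
    using P[OF that] unfolding at_within_open[OF that open_big_sector] .
  show ?thesis
  proof (rule that[of b k om Ga G])
    show "continuous_on sector om" "continuous_on sector Ga" "continuous_on sector G"
      unfolding om_def Ga_def G_def
      by (intro continuous_intros crt cD[OF B1'(1)] cD[OF B2'(1)] cD[OF P']; assumption)+
  next
    fix s assume s: "s \<in> sector" "s \<noteq> of_real b"
    then have sD: "s \<in> ?D" using sub by blast
    note d1 = rtB[OF s B1'(1)[OF sD] B1'(2)[OF sD]] and d2 = rtB[OF s B2'(1)[OF sD] B2'(2)[OF sD]]
    show "(om has_field_derivative - of_real k * At b s / rt b s) (at s)"
      unfolding om_def using DERIV_diff[OF DERIV_const DERIV_cmult[OF d1, of "of_real k"], of 1] by simp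
    show "(Ga has_field_derivative s\<^sup>2 * (- of_real k * At b s / rt b s)) (at s)"
      unfolding Ga_def using DERIV_diff[OF DERIV_const DERIV_cmult[OF d2, of "of_real k"], of "-1/3"]
      by (simp add: mult_ac)
    have "(G has_field_derivative (of_real k)\<^sup>2 * (B1 s * (s\<^sup>2 * At b s)) - of_real k * (s\<^sup>2 * At b s / rt b s)) (at s)"
      unfolding G_def by (intro DERIV_diff DERIV_cmult P' sD d2)
    moreover have "om s * (s\<^sup>2 * (- of_real k * At b s / rt b s)) =
        (of_real k)\<^sup>2 * (B1 s * (s\<^sup>2 * At b s)) - of_real k * (s\<^sup>2 * At b s / rt b s)"
      using rt_nonzero[OF s(2)] by (simp add: om_def field_simps power2_eq_square)
    ultimately show "(G has_field_derivative om s * (s\<^sup>2 * (- of_real k * At b s / rt b s))) (at s)" by simp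
  qed (use b k krX in \<open>simp_all add: om_def Ga_def rtb rt0 B10 B20 mult.assoc\<close>)
qed

lemma has_real_derivative_Re: "(g has_vector_derivative D) F \<Longrightarrow> ((\<lambda>x. Re (g x)) has_vector_derivative Re D) F"
  and has_real_derivative_Im: "(g has_vector_derivative D) F \<Longrightarrow> ((\<lambda>x. Im (g x)) has_vector_derivative Im D) F"
  by (rule bounded_linear.has_vector_derivative[OF bounded_linear_Re]
           bounded_linear.has_vector_derivative[OF bounded_linear_Im]; assumption)+

text \<open>The exceptional point c lets a path run through the branch point, where the functions in
  question are continuous but not differentiable.\<close>

lemma nondecreasing_except:
  fixes f :: "real \<Rightarrow> real"
  assumes "x \<le> y" "continuous_on {x..y} f"
    and D: "\<And>z. x < z \<Longrightarrow> z < y \<Longrightarrow> z \<noteq> c \<Longrightarrow> \<exists>D. (f has_vector_derivative D) (at z) \<and> 0 \<le> D"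
  shows "f x \<le> f y"
proof -
  have mono: "f u \<le> f v" if "x \<le> u" "u \<le> v" "v \<le> y" "c \<le> u \<or> v \<le> c" for u v
  proof (cases "u = v")
    case False
    then have "u < v" using that by simp
    then show ?thesis
    proof (rule DERIV_nonneg_imp_increasing_open[OF less_imp_le])
      fix z assume "u < z" "z < v"
      then show "\<exists>y. (f has_real_derivative y) (at z) \<and> 0 \<le> y"
        using D[of z] that by (auto simp: has_real_derivative_iff_has_vector_derivative)
    qed (use assms(2) that in \<open>auto intro: continuous_on_subset\<close>)
  qed simp
  show ?thesis
  proof (cases "x \<le> c \<and> c \<le> y")
    case True
    then show ?thesis using mono[of x c] mono[of c y] by simp
  next
    case False
    then show ?thesis using mono[of x y] assms(1) by auto
  qed
qed

lemma strictly_increasing_except: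
  fixes f :: "real \<Rightarrow> real"
  assumes "x < y" "continuous_on {x..y} f"
    and D: "\<And>z. x < z \<Longrightarrow> z < y \<Longrightarrow> z \<noteq> c \<Longrightarrow> \<exists>D. (f has_vector_derivative D) (at z) \<and> 0 < D"
  shows "f x < f y"
proof -
  have mono: "f u < f v" if "x \<le> u" "u < v" "v \<le> y" "c \<le> u \<or> v \<le> c" for u v
    using \<open>u < v\<close>
  proof (rule DERIV_pos_imp_increasing_open)
    fix z assume "u < z" "z < v"
    then show "\<exists>y. (f has_real_derivative y) (at z) \<and> 0 < y"
      using D[of z] that by (auto simp: has_real_derivative_iff_has_vector_derivative)
  qed (use assms(2) that in \<open>auto intro: continuous_on_subset\<close>)
  show ?thesis
  proof (cases "x < c \<and> c < y")
    case True
    then show ?thesis using mono[of x c] mono[of c y] by simp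
  next
    case False
    then show ?thesis using mono[of x y] assms(1) by auto
  qed
qed

text \<open>The equation for the square determines 2 \<mu> only modulo 2 pi. Adding up the arguments
  of the separate factors confines it to (-pi/2, 2 pi), and in that interval a nonnegative sine
  leaves just [0, pi].\<close>

lemma root_polar:
  assumes b: "0 < b" "b < 1" and s: "s \<in> sector" "s \<noteq> of_real b"
  obtains R \<mu> where "R > 0" "rt b s / At b s = of_real R * cis \<mu>" "- pi / 2 < 2 * \<mu>" "2 * \<mu> < 2 * pi"
    "of_real (R\<^sup>2) * cis (2 * \<mu>) = (s ^ 4 - (of_real b) ^ 4) * (1 - (of_real b) ^ 4 * s ^ 4)"
proof -
  define z1 where "z1 = - \<i> * (s - of_real b)"
  define z2 where "z2 = s + of_real b"
  define z3 where "z3 = s\<^sup>2 + (of_real b)\<^sup>2"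
  define z4 where "z4 = 1 - (of_real b) ^ 4 * s ^ 4"
  have s': "0 \<le> Im s" "Im s \<le> Re s" "norm s \<le> 1" using s by (auto simp: sector_def)
  have sq: "(Im s)\<^sup>2 \<le> (Re s)\<^sup>2" using s' by (intro power_mono)
  have z1: "z1 \<noteq> 0" "0 \<le> Re z1" using s s' by (auto simp: z1_def)
  have z2: "0 < Re z2" "0 \<le> Im z2" using b s' by (auto simp: z2_def)
  have z3: "0 < Re z3" "0 \<le> Im z3"
    using b s' sq by (auto simp: z3_def Re_power2 Im_power2 simp flip: of_real_power intro!: add_nonneg_pos)
  have "norm ((of_real b) ^ 4 * s ^ 4) < 1"
  proof -
    have "norm ((of_real b) ^ 4 * s ^ 4) = b ^ 4 * norm s ^ 4" using b by (simp add: norm_mult norm_power)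
    also have "\<dots> \<le> b ^ 4 * 1" using s' b by (intro mult_left_mono power_le_one) auto
    also have "\<dots> < 1" using b by (simp add: power_less_one_iff)
    finally show ?thesis .
  qed
  then have z4: "0 < Re z4" using complex_Re_le_cmod[of "(of_real b) ^ 4 * s ^ 4"] by (simp add: z4_def)
  have "0 \<le> Im (s ^ 4)"
  proof -
    have "s ^ 4 = (s\<^sup>2)\<^sup>2" by (simp flip: power_mult)
    then have "Im (s ^ 4) = 2 * Re (s\<^sup>2) * Im (s\<^sup>2)" by (simp only: Im_power2)
    also have "\<dots> \<ge> 0" using sq s' by (simp add: Re_power2 Im_power2)
    finally show ?thesis .
  qed
  then have z4': "Im z4 \<le> 0" using b by (simp add: z4_def flip: of_real_power)
  have nz: "z1 \<noteq> 0" "z2 \<noteq> 0" "z3 \<noteq> 0" "z4 \<noteq> 0" using z1 z2 z3 z4 by auto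
  have a1: "- pi / 2 \<le> Im (Ln z1)" "Im (Ln z1) \<le> pi / 2" using z1 Re_Ln_pos_le[of z1] by auto
  have a2: "0 \<le> Im (Ln z2)" "Im (Ln z2) < pi / 2" using z2 nz Re_Ln_pos_lt[of z2] Im_Ln_pos_le[of z2] by auto
  have a3: "0 \<le> Im (Ln z3)" "Im (Ln z3) < pi / 2" using z3 nz Re_Ln_pos_lt[of z3] Im_Ln_pos_le[of z3] by auto
  have a4: "- pi / 2 < Im (Ln z4)" "Im (Ln z4) \<le> 0"
  proof -
    show "- pi / 2 < Im (Ln z4)" using z4 nz Re_Ln_pos_lt[of z4] by auto
    show "Im (Ln z4) \<le> 0"
      using Im_Ln_pos_lt[of z4] nz z4' Re_Ln_pos_lt[of z4] z4 by auto
  qed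
  \<comment> \<open>The summand i pi/2 stands for the factor \<open>cis (pi / 4)\<close> of
    \<open>rt\<close>, squared; halving it with the rest gives the argument of the root.\<close>
  define L where "L = (\<i> * of_real (pi / 2) + Ln z1 + Ln z2 + Ln z3 + Ln z4) / 2"
  have eL: "rt b s / At b s = exp L"
  proof -
    have "cis (pi / 4) = exp (\<i> * of_real (pi / 2) / 2)" by (simp add: cis_conv_exp)
    then have "rt b s / At b s = exp (\<i> * of_real (pi / 2) / 2) * exp (Ln z1 / 2) * exp (Ln z2 / 2) * exp (Ln z3 / 2) * exp (Ln z4 / 2)"
      unfolding rt_def At_def z1_def[symmetric] z2_def[symmetric] z3_def[symmetric] z4_def[symmetric]
      using nz by (simp add: csqrt_exp_Ln)
    then show ?thesis by (simp add: L_def exp_add[symmetric] add_divide_distrib)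
  qed
  have "of_real ((exp (Re L))\<^sup>2) * cis (2 * Im L) = (exp L)\<^sup>2"
    by (simp add: exp_eq_polar power_mult_distrib Complex.DeMoivre)
  also have "\<dots> = exp (\<i> * of_real (pi / 2)) * exp (Ln z1) * exp (Ln z2) * exp (Ln z3) * exp (Ln z4)"
  proof -
    have "2 * L = \<i> * of_real (pi / 2) + Ln z1 + Ln z2 + Ln z3 + Ln z4" by (simp add: L_def)
    then show ?thesis by (simp only: exp_double[symmetric] exp_add)
  qed
  also have "\<dots> = \<i> * z1 * z2 * z3 * z4"
    using nz by (simp add: exp_Ln del: of_real_divide flip: cis_conv_exp)
  also have "\<i> * z1 * z2 * z3 = s ^ 4 - (of_real b) ^ 4"
    by (simp add: z1_def z2_def z3_def algebra_simps power2_eq_square power4_eq_xxxx)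
  finally have N: "of_real ((exp (Re L))\<^sup>2) * cis (2 * Im L) = (s ^ 4 - (of_real b) ^ 4) * z4" .
  have imL: "2 * Im L = pi / 2 + Im (Ln z1) + Im (Ln z2) + Im (Ln z3) + Im (Ln z4)"
    by (simp add: L_def)
  show ?thesis
  proof (rule that[of "exp (Re L)" "Im L"])
    show "rt b s / At b s = of_real (exp (Re L)) * cis (Im L)" unfolding eL by (rule exp_eq_polar)
    show "- pi / 2 < 2 * Im L" "2 * Im L < 2 * pi" using imL a1 a2 a3 a4 by linarith+
  qed (use N in \<open>auto simp: z4_def\<close>)
qed

definition wder :: "real \<Rightarrow> real \<Rightarrow> complex \<Rightarrow> complex" where
  "wder b k s = - of_real k * At b s / rt b s"

text \<open>The argument of \<open>wder\<close> is controlled by the signs of the imaginary parts of \<open>N\<close> and of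
  \<open>cis (- 4 * \<alpha>) * N\<close>, where \<open>N = (s^4 - b^4) (1 - b^4 s^4)\<close>.\<close>
lemma wder_polar:
  assumes b: "0 < b" "b < 1" "0 < k"
    and \<rho>: "0 \<le> \<rho>" "\<rho> \<le> 1" and \<alpha>: "0 \<le> \<alpha>" "\<alpha> \<le> pi / 4"
    and nb: "of_real \<rho> * cis \<alpha> \<noteq> of_real b"
  obtains K \<mu> where "K > 0" "wder b k (of_real \<rho> * cis \<alpha>) = - of_real K * cis (- \<mu>)"
    "2 * \<alpha> \<le> \<mu>" "\<mu> \<le> pi / 2"
    "\<alpha> = 0 \<Longrightarrow> b < \<rho> \<Longrightarrow> \<mu> = 0" "\<alpha> = 0 \<Longrightarrow> \<rho> < b \<Longrightarrow> \<mu> = pi / 2"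
    "0 < \<rho> \<Longrightarrow> 0 < \<alpha> \<Longrightarrow> \<alpha> < pi / 4 \<Longrightarrow> 0 < \<mu> \<and> \<mu> < pi / 2"
    "\<rho> = 1 \<Longrightarrow> \<mu> = 2 * \<alpha> \<and> K = k / norm (1 - (of_real b) ^ 4 * cis (4 * \<alpha>))"
proof -
  define s where "s = of_real \<rho> * cis \<alpha>"
  have sec: "s \<in> sector"
  proof -
    have "sin \<alpha> \<le> cos \<alpha>"
      using sin_monotone_2pi_le[of \<alpha> "pi/4"] cos_monotone_0_pi_le[of \<alpha> "pi/4"] \<alpha> by (simp add: sin_45 cos_45)
    moreover have "0 \<le> sin \<alpha>" using \<alpha> by (intro sin_ge_zero) auto
    ultimately show ?thesis using \<rho> by (auto simp: sector_def s_def norm_mult intro: mult_left_mono)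
  qed
  obtain R \<mu> where R: "R > 0" "rt b s / At b s = of_real R * cis \<mu>" "- pi / 2 < 2 * \<mu>" "2 * \<mu> < 2 * pi"
    and N: "of_real (R\<^sup>2) * cis (2 * \<mu>) = (s ^ 4 - (of_real b) ^ 4) * (1 - (of_real b) ^ 4 * s ^ 4)"
    using root_polar[OF b(1,2) sec] nb unfolding s_def by blast
  define B where "B = b ^ 4"
  define r where "r = \<rho> ^ 4"
  define c where "c = cos (4 * \<alpha>)"
  define d where "d = sin (4 * \<alpha>)"
  have cd: "c\<^sup>2 + d\<^sup>2 = 1" by (simp add: c_def d_def)
  have B: "0 < B" "B < 1" using b by (auto simp: B_def power_less_one_iff)
  have r: "0 \<le> r" "r \<le> 1" using \<rho> by (auto simp: r_def power_le_one)
  have d0: "0 \<le> d" unfolding d_def using \<alpha> by (intro sin_ge_zero) auto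
  have q: "s ^ 4 = Complex (r * c) (r * d)"
    by (simp add: s_def r_def c_def d_def power_mult_distrib Complex.DeMoivre complex_eq_iff flip: of_real_power)
  have N': "of_real (R\<^sup>2) * cis (2 * \<mu>) = (Complex (r * c) (r * d) - of_real B) * (1 - of_real B * Complex (r * c) (r * d))"
    using N unfolding q B_def by simp
  have ReN: "R\<^sup>2 * cos (2 * \<mu>) = (r * c - B) * (1 - B * (r * c)) + r * d * (B * (r * d))"
    using arg_cong[OF N', of Re] by simp
  have ImN: "R\<^sup>2 * sin (2 * \<mu>) = r * d * (1 + B\<^sup>2 - 2 * B * (r * c))"
  proof -
    have "R\<^sup>2 * sin (2 * \<mu>) = (r * c - B) * (- (B * (r * d))) + r * d * (1 - B * (r * c))"
      using arg_cong[OF N', of Im] by simp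
    also have "\<dots> = r * d * (1 + B\<^sup>2 - 2 * B * (r * c))"
      by (simp add: algebra_simps power2_eq_square)
    finally show ?thesis .
  qed
  \<comment> \<open>The right-hand side vanishes for r = 1, which pins \<mu> to 2 \<alpha> on the
    arc.\<close>
  have ImN4: "R\<^sup>2 * sin (2 * \<mu> - 4 * \<alpha>) = B * d * (1 - r\<^sup>2)"
  proof -
    have "R\<^sup>2 * sin (2 * \<mu> - 4 * \<alpha>) = (R\<^sup>2 * sin (2 * \<mu>)) * c - (R\<^sup>2 * cos (2 * \<mu>)) * d"
      by (simp add: sin_diff c_def d_def algebra_simps)
    also have "\<dots> = B * d * (1 - r\<^sup>2 * (c\<^sup>2 + d\<^sup>2))" unfolding ReN ImN by algebra
    finally show ?thesis by (simp add: cd)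
  qed
  have R2: "R\<^sup>2 > 0" using R by simp
  have c1: "\<bar>c\<bar> \<le> 1" by (simp add: c_def)
  have fpos: "0 < 1 + B\<^sup>2 - 2 * B * (r * c)"
  proof -
    have "r * c \<le> r * 1" using r c1 by (intro mult_left_mono) auto
    then have "r * c \<le> 1" using r by simp
    then have "2 * B * (r * c) \<le> 2 * B" using B by simp
    moreover have "0 < (1 - B)\<^sup>2" using B by simp
    ultimately show ?thesis by (simp add: power2_diff)
  qed
  have sin2: "0 \<le> sin (2 * \<mu>)"
  proof -
    have "0 \<le> R\<^sup>2 * sin (2 * \<mu>)" unfolding ImN using r d0 fpos by simp
    then show ?thesis using R2 by (simp add: zero_le_mult_iff)
  qed
  have mu: "0 \<le> 2 * \<mu>" "2 * \<mu> \<le> pi"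
  proof -
    show "0 \<le> 2 * \<mu>"
    proof (rule ccontr)
      assume "\<not> 0 \<le> 2 * \<mu>"
      then have "sin (- (2 * \<mu>)) > 0" using R(3) by (intro sin_gt_zero) auto
      then show False using sin2 by simp
    qed
    show "2 * \<mu> \<le> pi" using sin_lt_zero[of "2 * \<mu>"] sin2 R(4) by force
  qed
  have sin24: "0 \<le> sin (2 * \<mu> - 4 * \<alpha>)"
  proof -
    have "r\<^sup>2 \<le> 1" using r by (simp add: power_le_one)
    then have "0 \<le> R\<^sup>2 * sin (2 * \<mu> - 4 * \<alpha>)" unfolding ImN4 using B d0 by simp
    then show ?thesis using R2 by (simp add: zero_le_mult_iff)
  qed
  have ge: "4 * \<alpha> \<le> 2 * \<mu>"
  proof (rule ccontr)
    assume lt: "\<not> 4 * \<alpha> \<le> 2 * \<mu>"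
    show False
    proof (cases "4 * \<alpha> - 2 * \<mu> < pi")
      case True
      then have "sin (4 * \<alpha> - 2 * \<mu>) > 0" using lt by (intro sin_gt_zero) auto
      then show False using sin24 sin_minus[of "4 * \<alpha> - 2 * \<mu>"] by simp
    next
      case False
      \<comment> \<open>The one configuration that the sines do not exclude, as 2 \<mu> - 4 \<alpha>
        = -pi also has sine 0. Here N is negative, which contradicts \<mu> = 0.\<close>
      then have m: "\<mu> = 0" "4 * \<alpha> = pi" using \<alpha> mu by auto
      then have "c = -1" "d = 0" by (auto simp: c_def d_def)
      then have "R\<^sup>2 = - ((r + B) * (1 + B * r))" using ReN m by (simp add: algebra_simps)
      moreover have "0 \<le> (r + B) * (1 + B * r)" using r B by (intro mult_nonneg_nonneg) auto
      ultimately show False using R2 by linarith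
    qed
  qed
  have zero: "x = 0 \<or> x = pi" if "0 \<le> x" "x \<le> pi" "sin x = 0" for x :: real
    using that sin_gt_zero[of x] by fastforce
  have a0: "\<mu> = (if b < \<rho> then 0 else pi / 2)" if "\<alpha> = 0"
  proof -
    have cd0: "c = 1" "d = 0" using that by (auto simp: c_def d_def)
    have "R\<^sup>2 * sin (2 * \<mu>) = 0" using ImN cd0 by simp
    then have "2 * \<mu> = 0 \<or> 2 * \<mu> = pi" using R2 mu by (intro zero) auto
    moreover have RN: "R\<^sup>2 * cos (2 * \<mu>) = (r - B) * (1 - B * r)" using ReN cd0 by simp
    moreover have Br: "0 < 1 - B * r"
      using B r mult_left_le[of r B] by linarith
    moreover have "B < r \<longleftrightarrow> b < \<rho>"
      using \<rho> b by (simp add: B_def r_def power_mono_iff linorder_not_le[symmetric])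
    moreover have "\<rho> \<noteq> b" using nb that by auto
    moreover have "r \<noteq> B \<longleftrightarrow> \<rho> \<noteq> b"
      using \<rho> b by (simp add: B_def r_def power_eq_iff_eq_base)
    ultimately show ?thesis
    proof (elim disjE)
      assume "2 * \<mu> = 0"
      then have "0 < (r - B) * (1 - B * r)" using RN R2 by simp
      then have "0 < r - B" using Br by (rule zero_less_mult_pos2)
      then show ?thesis using \<open>2 * \<mu> = 0\<close> \<open>B < r \<longleftrightarrow> b < \<rho>\<close> by simp
    next
      assume "2 * \<mu> = pi"
      then have "0 < (B - r) * (1 - B * r)" using RN R2 by (simp add: algebra_simps)
      then have "0 < B - r" using Br by (rule zero_less_mult_pos2)
      then show ?thesis using \<open>2 * \<mu> = pi\<close> \<open>B < r \<longleftrightarrow> b < \<rho>\<close> by simp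
    qed
  qed
  show ?thesis
  proof (rule that[of "k / R" \<mu>])
    show "k / R > 0" using b R by simp
    have rtnz: "rt b s \<noteq> 0" using nb by (auto simp: s_def intro!: rt_nonzero)
    have Atnz: "At b s \<noteq> 0" using R by auto
    have "wder b k s = - of_real k / (rt b s / At b s)" using rtnz Atnz by (simp add: wder_def field_simps)
    also have "\<dots> = - of_real (k / R) * cis (- \<mu>)"
      unfolding R(2) using R(1) by (simp add: field_simps cis_inverse[symmetric])
    finally show "wder b k (of_real \<rho> * cis \<alpha>) = - of_real (k / R) * cis (- \<mu>)" by (simp add: s_def)
    show "2 * \<alpha> \<le> \<mu>" "\<mu> \<le> pi / 2" using ge mu by auto
    show "\<alpha> = 0 \<Longrightarrow> b < \<rho> \<Longrightarrow> \<mu> = 0" "\<alpha> = 0 \<Longrightarrow> \<rho> < b \<Longrightarrow> \<mu> = pi / 2" using a0 by auto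
    show "0 < \<mu> \<and> \<mu> < pi / 2" if "0 < \<rho>" "0 < \<alpha>" "\<alpha> < pi / 4"
    proof -
      have "0 < d" unfolding d_def using that by (intro sin_gt_zero) auto
      then have "0 < R\<^sup>2 * sin (2 * \<mu>)" unfolding ImN using fpos that by (simp add: r_def)
      then have "sin (2 * \<mu>) \<noteq> 0" by auto
      then have "2 * \<mu> \<noteq> 0" "2 * \<mu> \<noteq> pi" by auto
      then show ?thesis using mu by auto
    qed
    show "\<mu> = 2 * \<alpha> \<and> k / R = k / norm (1 - (of_real b) ^ 4 * cis (4 * \<alpha>))" if "\<rho> = 1"
    proof
      have r1: "r = 1" using that by (simp add: r_def)
      have "sin (2 * \<mu> - 4 * \<alpha>) = 0" using ImN4 r1 R2 by simp
      then have "2 * \<mu> - 4 * \<alpha> = 0 \<or> 2 * \<mu> - 4 * \<alpha> = pi" using ge mu \<alpha> by (intro zero) auto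
      then show "\<mu> = 2 * \<alpha>"
      proof
        assume "2 * \<mu> - 4 * \<alpha> = pi"
        then have "\<alpha> = 0" "\<mu> = pi / 2" using mu \<alpha> by auto
        then show ?thesis using a0 that b by auto
      qed simp
      have e: "1 - (of_real b) ^ 4 * cis (4 * \<alpha>) = 1 - of_real B * Complex c d"
        by (simp add: B_def c_def d_def complex_eq_iff)
      \<comment> \<open>For |s| = 1 the two factors of N are conjugate up to the unimodular factor
        s^4, so each has modulus R.\<close>
      have "norm (Complex c d - of_real B) = norm (1 - of_real B * Complex c d)"
      proof -
        have "(c - B)\<^sup>2 + d\<^sup>2 = (1 - B * c)\<^sup>2 + (B * d)\<^sup>2"
          using cd by algebra
        then show ?thesis by (simp add: cmod_def)
      qed
      moreover have "R\<^sup>2 = norm (Complex c d - of_real B) * norm (1 - of_real B * Complex c d)"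
        using arg_cong[OF N', of norm] r1 R by (simp add: norm_mult norm_power)
      ultimately have "R\<^sup>2 = (norm (1 - of_real B * Complex c d))\<^sup>2" by (simp add: power2_eq_square)
      then have "R = norm (1 - of_real B * Complex c d)" using R by (simp add: power2_eq_iff_nonneg)
      then show "k / R = k / norm (1 - (of_real b) ^ 4 * cis (4 * \<alpha>))" unfolding e by simp
    qed
  qed
qed


section \<open>The hodograph map, the gradient and the Legendre potential\<close>

locale hodograph =
  fixes b k :: real and om Ga G :: "complex \<Rightarrow> complex"
  assumes b: "0 < b" "b < 1" and k: "0 < k"
    and om_cont: "continuous_on sector om" and Ga_cont: "continuous_on sector Ga" and G_cont: "continuous_on sector G"
    and om_deriv: "\<And>s. s \<in> sector \<Longrightarrow> s \<noteq> of_real b \<Longrightarrow> (om has_field_derivative wder b k s) (at s)"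
    and Ga_deriv: "\<And>s. s \<in> sector \<Longrightarrow> s \<noteq> of_real b \<Longrightarrow> (Ga has_field_derivative s\<^sup>2 * wder b k s) (at s)"
    and G_deriv: "\<And>s. s \<in> sector \<Longrightarrow> s \<noteq> of_real b \<Longrightarrow> (G has_field_derivative om s * (s\<^sup>2 * wder b k s)) (at s)"
    and om_b: "om (of_real b) = 1" and Ga_b: "Ga (of_real b) = - 1 / 3"
    and om_0: "om 0 = 1 - \<i>" and Ga_0: "Ga 0 = - 1 / 3 - \<i> / 3"
begin

definition zz :: "complex \<Rightarrow> complex" where "zz s = cnj (om s)"
definition pp :: "complex \<Rightarrow> complex" where "pp s = cnj (om s) + Ga s"
text \<open>The Legendre transform of the solution: its differential is the inner product of
  \<open>zz\<close> with the differential of \<open>pp\<close>. The part cnj om of \<open>pp\<close>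
  contributes |om|^2 / 2 and the part Ga contributes Re G, as G' = om Ga'. The constant is fixed by
  Phi 1 = 0.\<close>

definition Phi :: "complex \<Rightarrow> real" where
  "Phi s = ((norm (om s))\<^sup>2 - (norm (om 1))\<^sup>2) / 2 + Re (G s - G 1)"
text \<open>The affine function of x with slope \<open>pp s\<close> that should touch the solution
  at \<open>zz s\<close>; \<open>UU\<close> is its value at that point.\<close>

definition Psi :: "complex \<Rightarrow> complex \<Rightarrow> real" where "Psi x s = Re (pp s * cnj x) - Phi s"
definition UU :: "complex \<Rightarrow> real" where "UU s = Psi (zz s) s"

abbreviation "w \<equiv> wder b k"

lemma zz_cont: "continuous_on sector zz" and pp_cont: "continuous_on sector pp"
  unfolding zz_def pp_def by (intro continuous_intros om_cont Ga_cont)+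

lemma Phi_cont: "continuous_on sector Phi"
  unfolding Phi_def by (intro continuous_intros om_cont G_cont) auto

lemma Psi_cont: "continuous_on sector (Psi x)" and UU_cont: "continuous_on sector UU"
  unfolding Psi_def UU_def by (intro continuous_intros pp_cont Phi_cont zz_cont)+

lemma polar_in_sector:
  assumes "0 \<le> \<rho>" "\<rho> \<le> 1" "0 \<le> \<alpha>" "\<alpha> \<le> pi / 4"
  shows "of_real \<rho> * cis \<alpha> \<in> sector"
proof -
  have "sin \<alpha> \<le> cos \<alpha>"
    using sin_monotone_2pi_le[of \<alpha> "pi/4"] cos_monotone_0_pi_le[of \<alpha> "pi/4"] assms by (simp add: sin_45 cos_45)
  moreover have "0 \<le> sin \<alpha>" using assms by (intro sin_ge_zero) auto
  ultimately show ?thesis using assms by (auto simp: sector_def norm_mult intro: mult_left_mono)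
qed

lemma sector_polar:
  assumes "s \<in> sector"
  obtains \<rho> \<alpha> where "0 \<le> \<rho>" "\<rho> \<le> 1" "0 \<le> \<alpha>" "\<alpha> \<le> pi / 4" "s = of_real \<rho> * cis \<alpha>" "norm s = \<rho>"
proof (cases "s = 0")
  case True
  then show ?thesis by (intro that[of 0 0]) auto
next
  case False
  have s: "0 \<le> Im s" "Im s \<le> Re s" "norm s \<le> 1" using assms by (auto simp: sector_def)
  have eq: "s = of_real (norm s) * cis (Arg s)" using False by (simp add: cis_Arg sgn_div_norm scaleR_conv_of_real field_simps)
  have a0: "0 \<le> Arg s" "Arg s \<le> pi"
    using s False Im_Ln_pos_le[of s] by (auto simp: Arg_eq_Im_Ln)
  have "sin (Arg s) \<le> cos (Arg s)"
  proof -
    have "norm s * sin (Arg s) \<le> norm s * cos (Arg s)"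
      using arg_cong[OF eq, of Re] arg_cong[OF eq, of Im] s(2) by simp
    then show ?thesis using False by simp
  qed
  have "Arg s \<le> pi / 4"
  proof (rule ccontr)
    assume "\<not> Arg s \<le> pi / 4"
    then have "0 < sin (Arg s - pi / 4)" using a0 by (intro sin_gt_zero) auto
    moreover have "sin (Arg s - pi / 4) = (sin (Arg s) - cos (Arg s)) * (sqrt 2 / 2)"
      by (simp only: sin_diff sin_45 cos_45) (simp add: algebra_simps)
    ultimately have "cos (Arg s) < sin (Arg s)" by (simp add: zero_less_mult_iff)
    with \<open>sin (Arg s) \<le> cos (Arg s)\<close> show False by simp
  qed
  with s a0 eq show ?thesis by (intro that[of "norm s" "Arg s"]) auto
qed

lemma on_axis: "of_real \<rho> * cis \<alpha> = of_real b \<Longrightarrow> 0 \<le> \<rho> \<Longrightarrow> 0 \<le> \<alpha> \<Longrightarrow> \<alpha> \<le> pi / 4 \<Longrightarrow> \<rho> = b \<and> \<alpha> = 0"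
proof -
  assume e: "of_real \<rho> * cis \<alpha> = of_real b" and \<rho>: "0 \<le> \<rho>" and \<alpha>: "0 \<le> \<alpha>" "\<alpha> \<le> pi / 4"
  have "\<rho> = b" using arg_cong[OF e, of norm] \<rho> b by (simp add: norm_mult)
  moreover have "\<rho> * sin \<alpha> = 0" using arg_cong[OF e, of Im] by simp
  then have "sin \<alpha> = 0" using b \<open>\<rho> = b\<close> by simp
  then have "\<alpha> = 0" using sin_gt_zero[of \<alpha>] \<alpha> pi_gt_zero by fastforce
  ultimately show ?thesis by simp
qed

lemmas w_polar = wder_polar[OF b k]

context
  fixes \<gamma> :: "real \<Rightarrow> complex" and x :: real and v :: complex
  assumes \<gamma>: "(\<gamma> has_vector_derivative v) (at x)" and in_sector: "\<gamma> x \<in> sector" "\<gamma> x \<noteq> of_real b"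
begin

lemma path_om: "((\<lambda>x. om (\<gamma> x)) has_vector_derivative v * w (\<gamma> x)) (at x)"
  using field_vector_diff_chain_at[OF \<gamma> om_deriv[OF in_sector]] by (simp add: o_def)

lemma path_Ga: "((\<lambda>x. Ga (\<gamma> x)) has_vector_derivative (\<gamma> x)\<^sup>2 * (v * w (\<gamma> x))) (at x)"
  using field_vector_diff_chain_at[OF \<gamma> Ga_deriv[OF in_sector]] by (simp add: o_def mult_ac)

lemma path_zz: "((\<lambda>x. zz (\<gamma> x)) has_vector_derivative cnj (v * w (\<gamma> x))) (at x)"
  unfolding zz_def by (rule bounded_linear.has_vector_derivative[OF bounded_linear_cnj path_om])

lemma path_pp: "((\<lambda>x. pp (\<gamma> x)) has_vector_derivative
    cnj (v * w (\<gamma> x)) + (\<gamma> x)\<^sup>2 * (v * w (\<gamma> x))) (at x)"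
  unfolding pp_def
  using has_vector_derivative_add[OF path_zz path_Ga] by (simp add: zz_def)

lemma path_Phi: "((\<lambda>x. Phi (\<gamma> x)) has_vector_derivative
    Re (om (\<gamma> x) * (cnj (v * w (\<gamma> x)) + (\<gamma> x)\<^sup>2 * (v * w (\<gamma> x))))) (at x)"
proof -
  have "((\<lambda>x. G (\<gamma> x)) has_vector_derivative v * (om (\<gamma> x) * ((\<gamma> x)\<^sup>2 * w (\<gamma> x)))) (at x)"
    using field_vector_diff_chain_at[OF \<gamma> G_deriv[OF in_sector]] by (simp add: o_def)
  note g = has_real_derivative_Re[OF has_vector_derivative_diff[OF this has_vector_derivative_const]]
  have "((\<lambda>x. (Re (om (\<gamma> x)))\<^sup>2 + (Im (om (\<gamma> x)))\<^sup>2) has_real_derivative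
      2 * Re (om (\<gamma> x)) * Re (v * w (\<gamma> x)) + 2 * Im (om (\<gamma> x)) * Im (v * w (\<gamma> x))) (at x)"
    using DERIV_add[OF DERIV_power[OF has_real_derivative_Re[OF path_om, unfolded
          has_real_derivative_iff_has_vector_derivative[symmetric]], of 2]
        DERIV_power[OF has_real_derivative_Im[OF path_om, unfolded
          has_real_derivative_iff_has_vector_derivative[symmetric]], of 2]]
    by (simp add: mult_ac)
  note h = this[THEN DERIV_diff[OF _ DERIV_const], THEN DERIV_cdivide, of "(norm (om 1))\<^sup>2" 2,
      unfolded has_real_derivative_iff_has_vector_derivative]
  have "((\<lambda>x. Phi (\<gamma> x)) has_vector_derivative
    (2 * Re (om (\<gamma> x)) * Re (v * w (\<gamma> x)) + 2 * Im (om (\<gamma> x)) * Im (v * w (\<gamma> x)) - 0) / 2 +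
    Re (v * (om (\<gamma> x) * ((\<gamma> x)\<^sup>2 * w (\<gamma> x))) - 0)) (at x)"
    unfolding Phi_def by (rule has_vector_derivative_add[OF h[folded cmod_power2] g])
  then show ?thesis by (simp add: algebra_simps add_divide_distrib diff_divide_distrib)
qed

text \<open>Because d Phi is the inner product of \<open>zz\<close> with d pp, only the inner
  product of Y = y - zz with d pp remains. Expressed through om' it is Re (om' (Y + s^2 cnj Y)), and
  for |s| < 1 the bracket vanishes only at Y = 0.\<close>

lemma path_Psi: "((\<lambda>x. Psi y (\<gamma> x)) has_vector_derivative
    Re (v * w (\<gamma> x) * ((y - zz (\<gamma> x)) + (\<gamma> x)\<^sup>2 * cnj (y - zz (\<gamma> x))))) (at x)"
proof -
  have "((\<lambda>x. Psi y (\<gamma> x)) has_vector_derivative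
    Re ((cnj (v * w (\<gamma> x)) + (\<gamma> x)\<^sup>2 * (v * w (\<gamma> x))) * cnj y) -
    Re (om (\<gamma> x) * (cnj (v * w (\<gamma> x)) + (\<gamma> x)\<^sup>2 * (v * w (\<gamma> x))))) (at x)"
    unfolding Psi_def
    by (intro has_vector_derivative_diff path_Phi has_real_derivative_Re has_vector_derivative_mult_left path_pp)
  also have "Re ((cnj (v * w (\<gamma> x)) + (\<gamma> x)\<^sup>2 * (v * w (\<gamma> x))) * cnj y) -
    Re (om (\<gamma> x) * (cnj (v * w (\<gamma> x)) + (\<gamma> x)\<^sup>2 * (v * w (\<gamma> x)))) =
    Re (v * w (\<gamma> x) * ((y - zz (\<gamma> x)) + (\<gamma> x)\<^sup>2 * cnj (y - zz (\<gamma> x))))"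
  proof -
    have *: "Re (cnj A * cnj Y) = Re (A * Y)" for A Y by simp
    have "(cnj A + B * A) * cnj y - cnj z * (cnj A + B * A) = cnj A * cnj (y - z) + B * A * cnj (y - z)" for A B z
      by (simp add: algebra_simps)
    then have "Re ((cnj A + B * A) * cnj y) - Re (cnj z * (cnj A + B * A)) = Re (A * (y - z)) + Re (B * A * cnj (y - z))" for A B z
      by (metis "*" minus_complex.sel(1) plus_complex.sel(1))
    from this[of "v * w (\<gamma> x)" "(\<gamma> x)\<^sup>2" "zz (\<gamma> x)"] show ?thesis
      by (simp add: zz_def algebra_simps)
  qed
  finally show ?thesis .
qed

end

lemma ray_deriv: "((\<lambda>\<rho>. of_real \<rho> * c) has_vector_derivative c) (at x)"
  unfolding has_vector_derivative_def scaleR_conv_of_real[symmetric]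
  by (auto intro!: derivative_eq_intros)

lemma arc_deriv: "((\<lambda>\<alpha>. c * cis \<alpha>) has_vector_derivative c * (\<i> * cis x)) (at x)"
proof -
  have "(cis has_vector_derivative \<i> * cis x) (at x)"
    using has_vector_derivative_complex_iff by (auto simp: has_real_derivative_iff_has_vector_derivative[symmetric] intro!: derivative_eq_intros)
  then show ?thesis by (rule has_vector_derivative_mult_right)
qed

lemma path_cont:
  assumes "continuous_on sector f" "continuous_on {x..y} \<gamma>" "\<And>t. x \<le> t \<Longrightarrow> t \<le> y \<Longrightarrow> \<gamma> t \<in> sector"
  shows "continuous_on {x..y} (\<lambda>t::real. f (\<gamma> t))"
  by (rule continuous_on_compose2[OF assms(1,2)]) (use assms(3) in auto)


lemma polar_ne_b: "of_real \<rho> * cis \<alpha> \<noteq> of_real b"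
  if "\<alpha> \<noteq> 0 \<or> \<rho> \<noteq> b" "0 \<le> \<rho>" "0 \<le> \<alpha>" "\<alpha> \<le> pi / 4" for \<rho> \<alpha>
  using on_axis[of \<rho> \<alpha>] that by blast

lemma ray_cont: "continuous_on A (\<lambda>\<rho>. of_real \<rho> * c :: complex)"
  by (intro continuous_intros)

lemma arc_cont: "continuous_on A (\<lambda>\<alpha>. c * cis \<alpha>)"
  by (intro continuous_intros)

text \<open>Along a ray the derivatives are given by the polar form of \<open>w\<close>, with
  \<open>\<alpha>' = \<mu> - \<alpha>\<close> between \<open>\<alpha>\<close> and \<open>pi / 2 - \<alpha>\<close>.\<close>
lemma ray_polar:
  assumes "0 \<le> \<rho>" "\<rho> \<le> 1" "0 \<le> \<alpha>" "\<alpha> \<le> pi / 4" "\<alpha> \<noteq> 0 \<or> \<rho> \<noteq> b"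
  obtains K \<beta> where "K > 0" "\<alpha> \<le> \<beta>" "\<beta> \<le> pi / 2 - \<alpha>" "b < \<rho> \<Longrightarrow> \<beta> < pi / 2"
    "\<alpha> = 0 \<Longrightarrow> b < \<rho> \<Longrightarrow> \<beta> = 0" "\<alpha> = 0 \<Longrightarrow> \<rho> < b \<Longrightarrow> \<beta> = pi / 2"
    "\<rho> = 1 \<Longrightarrow> \<beta> = \<alpha> \<and> K = k / norm (1 - (of_real b) ^ 4 * cis (4 * \<alpha>))"
    "cis \<alpha> * w (of_real \<rho> * cis \<alpha>) = - of_real K * cis (- \<beta>)"
    "((\<lambda>\<rho>. om (of_real \<rho> * cis \<alpha>)) has_vector_derivative - of_real K * cis (- \<beta>)) (at \<rho>)"
    "((\<lambda>\<rho>. Ga (of_real \<rho> * cis \<alpha>)) has_vector_derivative - of_real (K * \<rho>\<^sup>2) * cis (2 * \<alpha> - \<beta>)) (at \<rho>)"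
    "((\<lambda>\<rho>. pp (of_real \<rho> * cis \<alpha>)) has_vector_derivative
        - of_real K * (cis \<beta> + of_real (\<rho>\<^sup>2) * cis (2 * \<alpha> - \<beta>))) (at \<rho>)"
proof -
  note ne = polar_ne_b[OF assms(5,1,3,4)]
  show ?thesis
  proof (rule w_polar[OF assms(1-4) ne])
  fix K \<mu> assume \<mu>: "K > 0" "w (of_real \<rho> * cis \<alpha>) = - of_real K * cis (- \<mu>)"
    "2 * \<alpha> \<le> \<mu>" "\<mu> \<le> pi / 2"
    "\<alpha> = 0 \<Longrightarrow> b < \<rho> \<Longrightarrow> \<mu> = 0" "\<alpha> = 0 \<Longrightarrow> \<rho> < b \<Longrightarrow> \<mu> = pi / 2"
    "0 < \<rho> \<Longrightarrow> 0 < \<alpha> \<Longrightarrow> \<alpha> < pi / 4 \<Longrightarrow> 0 < \<mu> \<and> \<mu> < pi / 2"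
    "\<rho> = 1 \<Longrightarrow> \<mu> = 2 * \<alpha> \<and> K = k / norm (1 - (of_real b) ^ 4 * cis (4 * \<alpha>))"
  note sec = polar_in_sector[OF assms(1-4)]
  have d: "cis \<alpha> * w (of_real \<rho> * cis \<alpha>) = - of_real K * cis (- (\<mu> - \<alpha>))"
    unfolding \<mu>(2) by (simp add: cis_mult mult.left_commute)
  have sq: "(of_real \<rho> * cis \<alpha>)\<^sup>2 * (- of_real K * cis (- (\<mu> - \<alpha>))) =
      - of_real (K * \<rho>\<^sup>2) * cis (2 * \<alpha> - (\<mu> - \<alpha>))"
  proof -
    have "cis (2 * \<alpha> - (\<mu> - \<alpha>)) = cis (2 * \<alpha>) * cis (- (\<mu> - \<alpha>))" unfolding cis_mult by simp
    then show ?thesis by (simp only: power_mult_distrib Complex.DeMoivre) (simp add: mult_ac)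
  qed
  show thesis
  proof (rule that[of K "\<mu> - \<alpha>"])
    show "b < \<rho> \<Longrightarrow> \<mu> - \<alpha> < pi / 2"
      using \<mu>(4,5) assms(3) by (cases "\<alpha> = 0") auto
    show "((\<lambda>\<rho>. om (of_real \<rho> * cis \<alpha>)) has_vector_derivative - of_real K * cis (- (\<mu> - \<alpha>))) (at \<rho>)"
      using path_om[OF ray_deriv sec ne] unfolding d .
    show "((\<lambda>\<rho>. Ga (of_real \<rho> * cis \<alpha>)) has_vector_derivative
        - of_real (K * \<rho>\<^sup>2) * cis (2 * \<alpha> - (\<mu> - \<alpha>))) (at \<rho>)"
      using path_Ga[OF ray_deriv sec ne] unfolding d sq .
    show "((\<lambda>\<rho>. pp (of_real \<rho> * cis \<alpha>)) has_vector_derivative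
        - of_real K * (cis (\<mu> - \<alpha>) + of_real (\<rho>\<^sup>2) * cis (2 * \<alpha> - (\<mu> - \<alpha>)))) (at \<rho>)"
      using path_pp[OF ray_deriv sec ne] unfolding d sq by (simp add: cis_cnj algebra_simps)
  qed (use \<mu> d in auto)
  qed
qed

text \<open>The tangential velocity of s is i \<rho> times the radial one. Conjugation turns the
  plus sign in the radial derivative of \<open>pp\<close> into a minus sign, so that for \<rho> = 1,
  where \<beta> = \<alpha>, the derivatives of \<open>pp\<close> and \<open>Phi\<close> along the
  arc vanish.\<close>

lemma arc_polar:
  assumes "0 < \<rho>" "\<rho> \<le> 1" "0 \<le> \<alpha>" "\<alpha> \<le> pi / 4" "\<alpha> \<noteq> 0 \<or> \<rho> \<noteq> b"
  obtains K \<beta> where "K > 0" "\<alpha> \<le> \<beta>" "\<beta> \<le> pi / 2 - \<alpha>"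
    "\<rho> = 1 \<Longrightarrow> \<beta> = \<alpha> \<and> K = k / norm (1 - (of_real b) ^ 4 * cis (4 * \<alpha>))"
    "((\<lambda>\<alpha>. zz (of_real \<rho> * cis \<alpha>)) has_vector_derivative of_real (\<rho> * K) * (\<i> * cis \<beta>)) (at \<alpha>)"
    "((\<lambda>\<alpha>. pp (of_real \<rho> * cis \<alpha>)) has_vector_derivative
        of_real (\<rho> * K) * (\<i> * (cis \<beta> - of_real (\<rho>\<^sup>2) * cis (2 * \<alpha> - \<beta>)))) (at \<alpha>)"
    "((\<lambda>\<alpha>. Phi (of_real \<rho> * cis \<alpha>)) has_vector_derivative
        Re (om (of_real \<rho> * cis \<alpha>) * (of_real (\<rho> * K) * (\<i> * (cis \<beta> - of_real (\<rho>\<^sup>2) * cis (2 * \<alpha> - \<beta>)))))) (at \<alpha>)"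
proof -
  note ne = polar_ne_b[OF assms(5) less_imp_le[OF assms(1)] assms(3,4)]
  note sec = polar_in_sector[OF less_imp_le[OF assms(1)] assms(2-4)]
  show ?thesis
  proof (rule ray_polar[OF less_imp_le[OF assms(1)] assms(2-5)])
  fix K \<beta> assume \<beta>: "K > 0" "\<alpha> \<le> \<beta>" "\<beta> \<le> pi / 2 - \<alpha>"
    "\<rho> = 1 \<Longrightarrow> \<beta> = \<alpha> \<and> K = k / norm (1 - (of_real b) ^ 4 * cis (4 * \<alpha>))"
    "cis \<alpha> * w (of_real \<rho> * cis \<alpha>) = - of_real K * cis (- \<beta>)"
  have d: "of_real \<rho> * (\<i> * cis \<alpha>) * w (of_real \<rho> * cis \<alpha>) = - of_real (\<rho> * K) * (\<i> * cis (- \<beta>))"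
    using arg_cong[OF \<beta>(5), of "\<lambda>z. of_real \<rho> * \<i> * z"] by (simp add: mult_ac)
  have e: "cnj (- of_real (\<rho> * K) * (\<i> * cis (- \<beta>))) +
      (of_real \<rho> * cis \<alpha>)\<^sup>2 * (- of_real (\<rho> * K) * (\<i> * cis (- \<beta>))) =
      of_real (\<rho> * K) * (\<i> * (cis \<beta> - of_real (\<rho>\<^sup>2) * cis (2 * \<alpha> - \<beta>)))"
  proof -
    have "cis (2 * \<alpha> - \<beta>) = cis (2 * \<alpha>) * cis (- \<beta>)" unfolding cis_mult by simp
    moreover have "cnj (cis (- \<beta>)) = cis \<beta>" by (simp add: cis_cnj)
    moreover have "(cis \<alpha>)\<^sup>2 = cis (2 * \<alpha>)" by (simp add: Complex.DeMoivre)
    ultimately show ?thesis by (simp add: power_mult_distrib algebra_simps)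
  qed
  show thesis
  proof (rule that[of K \<beta>])
    show "((\<lambda>\<alpha>. zz (of_real \<rho> * cis \<alpha>)) has_vector_derivative of_real (\<rho> * K) * (\<i> * cis \<beta>)) (at \<alpha>)"
      using path_zz[OF arc_deriv sec ne] unfolding d by (simp add: cis_cnj)
    show "((\<lambda>\<alpha>. pp (of_real \<rho> * cis \<alpha>)) has_vector_derivative
        of_real (\<rho> * K) * (\<i> * (cis \<beta> - of_real (\<rho>\<^sup>2) * cis (2 * \<alpha> - \<beta>)))) (at \<alpha>)"
      using path_pp[OF arc_deriv sec ne] unfolding d e .
    show "((\<lambda>\<alpha>. Phi (of_real \<rho> * cis \<alpha>)) has_vector_derivative
        Re (om (of_real \<rho> * cis \<alpha>) * (of_real (\<rho> * K) * (\<i> * (cis \<beta> - of_real (\<rho>\<^sup>2) * cis (2 * \<alpha> - \<beta>)))))) (at \<alpha>)"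
      using path_Phi[OF arc_deriv sec ne] unfolding d e .
  qed (use \<beta> in auto)
  qed
qed

end

lemma constant_except:
  fixes f :: "real \<Rightarrow> real"
  assumes "x \<le> y" "continuous_on {x..y} f"
    and D: "\<And>z. x < z \<Longrightarrow> z < y \<Longrightarrow> z \<noteq> c \<Longrightarrow> (f has_vector_derivative 0) (at z)"
  shows "f x = f y"
proof (rule antisym)
  show "f x \<le> f y"
    by (rule nondecreasing_except[OF assms(1,2), of c]) (use D in fastforce)
  have "- f x \<le> - f y"
  proof (rule nondecreasing_except[OF assms(1) continuous_on_minus[OF assms(2)], of c])
    fix z assume "x < z" "z < y" "z \<noteq> c"
    then show "\<exists>D. ((\<lambda>x. - f x) has_vector_derivative D) (at z) \<and> 0 \<le> D"
      using has_vector_derivative_minus[OF D] by fastforce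
  qed
  then show "f y \<le> f x" by simp
qed

lemma ex_Re: "(g has_vector_derivative D) F \<Longrightarrow> P (Re D) \<Longrightarrow> \<exists>E. ((\<lambda>x. Re (g x)) has_vector_derivative E) F \<and> P E"
  and ex_Im: "(g has_vector_derivative D) F \<Longrightarrow> P (Im D) \<Longrightarrow> \<exists>E. ((\<lambda>x. Im (g x)) has_vector_derivative E) F \<and> P E"
  and ex_minus_Re: "(g has_vector_derivative D) F \<Longrightarrow> P (- Re D) \<Longrightarrow> \<exists>E. ((\<lambda>x. - Re (g x)) has_vector_derivative E) F \<and> P E"
  and ex_minus_Im: "(g has_vector_derivative D) F \<Longrightarrow> P (- Im D) \<Longrightarrow> \<exists>E. ((\<lambda>x. - Im (g x)) has_vector_derivative E) F \<and> P E"
  by (rule exI conjI has_vector_derivative_minus has_real_derivative_Re has_real_derivative_Im; assumption?)+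

context hodograph
begin

lemma rayc:
  assumes "continuous_on sector f" "0 \<le> x" "y \<le> 1" "0 \<le> \<alpha>" "\<alpha> \<le> pi / 4"
  shows "continuous_on {x..y} (\<lambda>r. f (of_real r * cis \<alpha>))"
  by (rule path_cont[OF assms(1) ray_cont]) (use assms in \<open>auto intro!: polar_in_sector\<close>)

lemma arcc:
  assumes "continuous_on sector f" "0 \<le> r" "r \<le> 1" "0 \<le> x" "y \<le> pi / 4"
  shows "continuous_on {x..y} (\<lambda>\<alpha>. f (of_real r * cis \<alpha>))"
  by (rule path_cont[OF assms(1) arc_cont]) (use assms in \<open>auto intro!: polar_in_sector\<close>)

lemma axisc: "continuous_on sector f \<Longrightarrow> 0 \<le> x \<Longrightarrow> y \<le> 1 \<Longrightarrow> continuous_on {x..y} (\<lambda>r. f (of_real r))"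
  using rayc[of f x y 0] by simp

lemma Re_c: "continuous_on A f \<Longrightarrow> continuous_on A (\<lambda>x. Re (f x))"
  and Im_c: "continuous_on A f \<Longrightarrow> continuous_on A (\<lambda>x. Im (f x))"
  by (intro continuous_intros; assumption)+

subsection \<open>The edges of the sector\<close>

text \<open>At \<alpha> = pi/4 the range from \<alpha> to pi/2 - \<alpha> of the angle \<beta> is a
  single point, so the direction of om' is known exactly.\<close>

lemma diagonal_deriv:
  assumes "0 < r" "r < 1"
  obtains K where "K > 0" "w (of_real r * cis (pi / 4)) = of_real K * \<i>"
    "((\<lambda>r. om (of_real r * cis (pi / 4))) has_vector_derivative - of_real K * cis (- (pi / 4))) (at r)"
    "((\<lambda>r. Ga (of_real r * cis (pi / 4))) has_vector_derivative - of_real (K * r\<^sup>2) * cis (pi / 4)) (at r)"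
    "((\<lambda>r. pp (of_real r * cis (pi / 4))) has_vector_derivative - of_real (K * (1 + r\<^sup>2)) * cis (pi / 4)) (at r)"
proof (rule ray_polar[of r "pi / 4"])
  fix K \<beta> assume "K > 0" and "pi / 4 \<le> \<beta>" "\<beta> \<le> pi / 2 - pi / 4"
    and h: "cis (pi / 4) * w (of_real r * cis (pi / 4)) = - of_real K * cis (- \<beta>)"
    "((\<lambda>r. om (of_real r * cis (pi / 4))) has_vector_derivative - of_real K * cis (- \<beta>)) (at r)"
    "((\<lambda>r. Ga (of_real r * cis (pi / 4))) has_vector_derivative - of_real (K * r\<^sup>2) * cis (2 * (pi / 4) - \<beta>)) (at r)"
    "((\<lambda>r. pp (of_real r * cis (pi / 4))) has_vector_derivative
        - of_real K * (cis \<beta> + of_real (r\<^sup>2) * cis (2 * (pi / 4) - \<beta>))) (at r)"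
  then have \<beta>: "\<beta> = pi / 4" "2 * (pi / 4) - \<beta> = pi / 4" by auto
  show thesis
  proof (rule that[of K])
    have "cis (pi / 4) * w (of_real r * cis (pi / 4)) = cis (pi / 4) * (of_real K * \<i>)"
    proof -
      have "- cis (- (pi / 4)) = cis (pi / 4) * \<i>"
        by (simp add: complex_eq_iff cos_45 sin_45)
      then have "- of_real K * cis (- (pi / 4)) = cis (pi / 4) * (of_real K * \<i>)"
        by (metis mult.left_commute mult_minus_left mult_minus_right)
      then show ?thesis using h(1) \<beta> by simp
    qed
    then show "w (of_real r * cis (pi / 4)) = of_real K * \<i>"
      unfolding mult_cancel_left using cis_neq_zero by blast
    show "((\<lambda>r. om (of_real r * cis (pi / 4))) has_vector_derivative - of_real K * cis (- (pi / 4))) (at r)"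
      using h(2) unfolding \<beta>(1) .
    show "((\<lambda>r. Ga (of_real r * cis (pi / 4))) has_vector_derivative - of_real (K * r\<^sup>2) * cis (pi / 4)) (at r)"
      using h(3) unfolding \<beta>(2) .
    show "((\<lambda>r. pp (of_real r * cis (pi / 4))) has_vector_derivative - of_real (K * (1 + r\<^sup>2)) * cis (pi / 4)) (at r)"
      using h(4)[unfolded \<beta>(2)] unfolding \<beta> by (simp add: algebra_simps)
  qed (fact \<open>K > 0\<close>)
qed (use assms in auto)

text \<open>\<open>zz\<close> and \<open>pp\<close> move in the fixed direction of the diagonal,
  starting from values on it at s = 0. The bound on Ga is there for Re zz = Re pp - Re Ga: together
  with positivity of Re pp it makes Re zz positive.\<close>

lemma on_diagonal:
  assumes "0 \<le> r" "r \<le> 1"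
  shows "Re (zz (of_real r * cis (pi / 4))) = Im (zz (of_real r * cis (pi / 4)))"
    and "Re (pp (of_real r * cis (pi / 4))) = Im (pp (of_real r * cis (pi / 4)))"
    and "Re (Ga (of_real r * cis (pi / 4))) \<le> - 1 / 3"
proof -
  note c = assms
  let ?s = "\<lambda>r. complex_of_real r * cis (pi / 4)"
  have "Re (om (?s 0)) + Im (om (?s 0)) = Re (om (?s r)) + Im (om (?s r))"
  proof (rule constant_except[OF assms(1), where f = "\<lambda>r. Re (om (?s r)) + Im (om (?s r))"])
    show "continuous_on {0..r} (\<lambda>r. Re (om (?s r)) + Im (om (?s r)))"
      by (intro continuous_intros rayc om_cont) (use assms in auto)
    fix z assume z: "0 < z" "z < r"
    show "((\<lambda>r. Re (om (?s r)) + Im (om (?s r))) has_vector_derivative 0) (at z)"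
    proof (rule diagonal_deriv[of z])
      fix K assume "((\<lambda>r. om (?s r)) has_vector_derivative - of_real K * cis (- (pi / 4))) (at z)"
      from has_vector_derivative_add[OF has_real_derivative_Re[OF this] has_real_derivative_Im[OF this]]
      show ?thesis by (simp add: cos_45 sin_45)
    qed (use z assms in auto)
  qed
  then show "Re (zz (?s r)) = Im (zz (?s r))" by (simp add: zz_def om_0)
  have "Re (pp (?s 0)) - Im (pp (?s 0)) = Re (pp (?s r)) - Im (pp (?s r))"
  proof (rule constant_except[OF assms(1), where f = "\<lambda>r. Re (pp (?s r)) - Im (pp (?s r))"])
    show "continuous_on {0..r} (\<lambda>r. Re (pp (?s r)) - Im (pp (?s r)))"
      by (intro continuous_intros rayc pp_cont) (use assms in auto)
    fix z assume z: "0 < z" "z < r"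
    show "((\<lambda>r. Re (pp (?s r)) - Im (pp (?s r))) has_vector_derivative 0) (at z)"
    proof (rule diagonal_deriv[of z])
      fix K assume "((\<lambda>r. pp (?s r)) has_vector_derivative - of_real (K * (1 + z\<^sup>2)) * cis (pi / 4)) (at z)"
      from has_vector_derivative_diff[OF has_real_derivative_Re[OF this] has_real_derivative_Im[OF this]]
      show ?thesis by (simp add: cos_45 sin_45)
    qed (use z assms in auto)
  qed
  then show "Re (pp (?s r)) = Im (pp (?s r))" by (simp add: pp_def om_0 Ga_0)
  have "- Re (Ga (?s 0)) \<le> - Re (Ga (?s r))"
  proof (rule nondecreasing_except[OF assms(1), where f = "\<lambda>r. - Re (Ga (?s r))"])
    show "continuous_on {0..r} (\<lambda>r. - Re (Ga (?s r)))"
      by (intro continuous_intros rayc Ga_cont) (use assms in auto)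
    fix z assume z: "0 < z" "z < r"
    show "\<exists>D. ((\<lambda>r. - Re (Ga (?s r))) has_vector_derivative D) (at z) \<and> 0 \<le> D"
    proof (rule diagonal_deriv[of z])
      fix K assume "K > 0" "((\<lambda>r. Ga (?s r)) has_vector_derivative - of_real (K * z\<^sup>2) * cis (pi / 4)) (at z)"
      then show ?thesis
        by (intro ex_minus_Re[where P = "\<lambda>D. 0 \<le> D"]) (auto simp: cos_45)
    qed (use z assms in auto)
  qed
  then show "Re (Ga (?s r)) \<le> - 1 / 3" by (simp add: Ga_0)
qed

lemma axis_deriv_right:
  assumes "b < r" "r < 1"
  obtains K where "K > 0" "w (of_real r) = - of_real K"
    "((\<lambda>r. om (of_real r)) has_vector_derivative - of_real K) (at r)"
    "((\<lambda>r. Ga (of_real r)) has_vector_derivative - of_real (K * r\<^sup>2)) (at r)"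
    "((\<lambda>r. pp (of_real r)) has_vector_derivative - of_real (K * (1 + r\<^sup>2))) (at r)"
proof (rule ray_polar[of r 0])
  fix K \<beta> assume "K > 0" and \<beta>: "0 = (0::real) \<Longrightarrow> b < r \<Longrightarrow> \<beta> = 0"
    and h: "cis 0 * w (of_real r * cis 0) = - of_real K * cis (- \<beta>)"
    "((\<lambda>r. om (of_real r * cis 0)) has_vector_derivative - of_real K * cis (- \<beta>)) (at r)"
    "((\<lambda>r. Ga (of_real r * cis 0)) has_vector_derivative - of_real (K * r\<^sup>2) * cis (2 * 0 - \<beta>)) (at r)"
    "((\<lambda>r. pp (of_real r * cis 0)) has_vector_derivative
        - of_real K * (cis \<beta> + of_real (r\<^sup>2) * cis (2 * 0 - \<beta>))) (at r)"
  show thesis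
    by (rule that[of K]) (use h \<open>K > 0\<close> \<beta> assms in \<open>auto simp: algebra_simps\<close>)
qed (use assms b in auto)

lemma axis_deriv_left:
  assumes "0 < r" "r < b"
  obtains K where "K > 0" "w (of_real r) = of_real K * \<i>"
    "((\<lambda>r. om (of_real r)) has_vector_derivative of_real K * \<i>) (at r)"
    "((\<lambda>r. pp (of_real r)) has_vector_derivative - of_real (K * (1 - r\<^sup>2)) * \<i>) (at r)"
proof (rule ray_polar[of r 0])
  fix K \<beta> assume "K > 0" and \<beta>: "0 = (0::real) \<Longrightarrow> r < b \<Longrightarrow> \<beta> = pi / 2"
    and h: "cis 0 * w (of_real r * cis 0) = - of_real K * cis (- \<beta>)"
    "((\<lambda>r. om (of_real r * cis 0)) has_vector_derivative - of_real K * cis (- \<beta>)) (at r)"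
    "((\<lambda>r. pp (of_real r * cis 0)) has_vector_derivative
        - of_real K * (cis \<beta> + of_real (r\<^sup>2) * cis (2 * 0 - \<beta>))) (at r)"
  have "cis (- (pi / 2)) = - \<i>" by (simp add: complex_eq_iff)
  then show thesis
    by (intro that[of K]) (use h \<open>K > 0\<close> \<beta> assms in \<open>auto simp: algebra_simps\<close>)
qed (use assms b in auto)

text \<open>Between b and 1 the derivatives om' and Ga' are real, so om and Ga keep the imaginary
  part 0 that they have at b: this piece of the radius runs along the symmetry axis of the
  square.\<close>

lemma on_right_axis:
  assumes "b \<le> r" "r \<le> 1"
  shows "Im (zz (of_real r)) = 0" "Im (pp (of_real r)) = 0" "Re (Ga (of_real r)) \<le> - 1 / 3"
proof -
  have "Im (om (of_real b)) = Im (om (of_real r))"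
  proof (rule constant_except[OF assms(1), where f = "\<lambda>r. Im (om (of_real r))"])
    show "continuous_on {b..r} (\<lambda>r. Im (om (of_real r)))"
      by (intro Im_c axisc om_cont) (use assms b in auto)
    fix z assume z: "b < z" "z < r"
    show "((\<lambda>r. Im (om (of_real r))) has_vector_derivative 0) (at z)"
    proof (rule axis_deriv_right[of z])
      fix K assume "((\<lambda>r. om (of_real r)) has_vector_derivative - of_real K) (at z)"
      from has_real_derivative_Im[OF this] show ?thesis by simp
    qed (use z assms in auto)
  qed
  then show "Im (zz (of_real r)) = 0" by (simp add: zz_def om_b)
  have "Im (pp (of_real b)) = Im (pp (of_real r))"
  proof (rule constant_except[OF assms(1), where f = "\<lambda>r. Im (pp (of_real r))"])
    show "continuous_on {b..r} (\<lambda>r. Im (pp (of_real r)))"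
      by (intro Im_c axisc pp_cont) (use assms b in auto)
    fix z assume z: "b < z" "z < r"
    show "((\<lambda>r. Im (pp (of_real r))) has_vector_derivative 0) (at z)"
    proof (rule axis_deriv_right[of z])
      fix K assume "((\<lambda>r. pp (of_real r)) has_vector_derivative - of_real (K * (1 + z\<^sup>2))) (at z)"
      from has_real_derivative_Im[OF this] show ?thesis by simp
    qed (use z assms in auto)
  qed
  then show "Im (pp (of_real r)) = 0" by (simp add: pp_def om_b Ga_b)
  have "- Re (Ga (of_real b)) \<le> - Re (Ga (of_real r))"
  proof (rule nondecreasing_except[OF assms(1), where f = "\<lambda>r. - Re (Ga (of_real r))"])
    show "continuous_on {b..r} (\<lambda>r. - Re (Ga (of_real r)))"
      by (intro continuous_on_minus Re_c axisc Ga_cont) (use assms b in auto)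
    fix z assume z: "b < z" "z < r"
    show "\<exists>D. ((\<lambda>r. - Re (Ga (of_real r))) has_vector_derivative D) (at z) \<and> 0 \<le> D"
    proof (rule axis_deriv_right[of z])
      fix K assume "K > 0" "((\<lambda>r. Ga (of_real r)) has_vector_derivative - of_real (K * z\<^sup>2)) (at z)"
      then show ?thesis
        by (intro ex_minus_Re[where P = "\<lambda>D. 0 \<le> D"]) auto
    qed (use z assms in auto)
  qed
  then show "Re (Ga (of_real r)) \<le> - 1 / 3" by (simp add: Ga_b)
qed

text \<open>Left of b, om' is imaginary, so the image climbs the side from its midpoint to the
  corner. The derivative of \<open>pp\<close> is imaginary too, which keeps the normal derivative at
  its value 2/3 in b.\<close>

lemma on_left_axis:
  assumes "0 \<le> r" "r \<le> b"
  shows "Re (zz (of_real r)) = 1" "Re (pp (of_real r)) = 2 / 3" "r < b \<Longrightarrow> 0 < Im (zz (of_real r))"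
proof -
  have "Re (om (of_real r)) = Re (om (of_real b))"
  proof (rule constant_except[OF assms(2), where f = "\<lambda>r. Re (om (of_real r))"])
    show "continuous_on {r..b} (\<lambda>r. Re (om (of_real r)))"
      by (intro Re_c axisc om_cont) (use assms b in auto)
    fix z assume z: "r < z" "z < b"
    show "((\<lambda>r. Re (om (of_real r))) has_vector_derivative 0) (at z)"
    proof (rule axis_deriv_left[of z])
      fix K assume "((\<lambda>r. om (of_real r)) has_vector_derivative of_real K * \<i>) (at z)"
      from has_real_derivative_Re[OF this] show ?thesis by simp
    qed (use z assms in auto)
  qed
  then show "Re (zz (of_real r)) = 1" by (simp add: zz_def om_b)
  have "Re (pp (of_real r)) = Re (pp (of_real b))"
  proof (rule constant_except[OF assms(2), where f = "\<lambda>r. Re (pp (of_real r))"])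
    show "continuous_on {r..b} (\<lambda>r. Re (pp (of_real r)))"
      by (intro Re_c axisc pp_cont) (use assms b in auto)
    fix z assume z: "r < z" "z < b"
    show "((\<lambda>r. Re (pp (of_real r))) has_vector_derivative 0) (at z)"
    proof (rule axis_deriv_left[of z])
      fix K assume "((\<lambda>r. pp (of_real r)) has_vector_derivative - of_real (K * (1 - z\<^sup>2)) * \<i>) (at z)"
      from has_real_derivative_Re[OF this] show ?thesis by simp
    qed (use z assms in auto)
  qed
  then show "Re (pp (of_real r)) = 2 / 3" by (simp add: pp_def om_b Ga_b)
  assume lt: "r < b"
  have "Im (om (of_real r)) < Im (om (of_real b))"
  proof (rule strictly_increasing_except[OF lt, where f = "\<lambda>r. Im (om (of_real r))"])
    show "continuous_on {r..b} (\<lambda>r. Im (om (of_real r)))"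
      by (intro Im_c axisc om_cont) (use assms b in auto)
    fix z assume z: "r < z" "z < b"
    show "\<exists>D. ((\<lambda>r. Im (om (of_real r))) has_vector_derivative D) (at z) \<and> 0 < D"
    proof (rule axis_deriv_left[of z])
      fix K assume "K > 0" "((\<lambda>r. om (of_real r)) has_vector_derivative of_real K * \<i>) (at z)"
      then show ?thesis
        by (intro ex_Im[where P = "\<lambda>D. 0 < D"]) auto
    qed (use z assms in auto)
  qed
  then show "0 < Im (zz (of_real r))" by (simp add: zz_def om_b)
qed

text \<open>The derivative of \<open>pp\<close> along the arc vanishes, and the constant lies on
  both mirror lines: Im = 0 at s = 1 and Re = Im at s = cis (pi/4). Hence it is 0.\<close>

lemma on_arc:
  assumes "0 \<le> \<alpha>" "\<alpha> \<le> pi / 4"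
  shows "pp (cis \<alpha>) = 0" "Phi (cis \<alpha>) = 0"
proof -
  have d: "((\<lambda>\<alpha>. pp (of_real 1 * cis \<alpha>)) has_vector_derivative 0) (at z)"
    "((\<lambda>\<alpha>. Phi (of_real 1 * cis \<alpha>)) has_vector_derivative 0) (at z)"
    if z: "0 < z" "z < pi / 4" for z
  proof -
    have "((\<lambda>\<alpha>. pp (of_real 1 * cis \<alpha>)) has_vector_derivative 0) (at z) \<and>
      ((\<lambda>\<alpha>. Phi (of_real 1 * cis \<alpha>)) has_vector_derivative 0) (at z)"
    proof (rule arc_polar[of 1 z])
      fix K \<beta> assume \<beta>: "1 = (1::real) \<Longrightarrow> \<beta> = z \<and> K = k / norm (1 - (of_real b) ^ 4 * cis (4 * z))"
        and h: "((\<lambda>\<alpha>. pp (of_real 1 * cis \<alpha>)) has_vector_derivative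
          of_real (1 * K) * (\<i> * (cis \<beta> - of_real (1\<^sup>2) * cis (2 * z - \<beta>)))) (at z)"
        "((\<lambda>\<alpha>. Phi (of_real 1 * cis \<alpha>)) has_vector_derivative
        Re (om (of_real 1 * cis z) * (of_real (1 * K) * (\<i> * (cis \<beta> - of_real (1\<^sup>2) * cis (2 * z - \<beta>)))))) (at z)"
      have "\<beta> = z" "2 * z - \<beta> = z" using \<beta> by auto
      then have 0: "of_real (1 * K) * (\<i> * (cis \<beta> - of_real (1\<^sup>2) * cis (2 * z - \<beta>))) = (0::complex)" by simp
      show ?thesis using h unfolding 0 by simp
    qed (use z in auto)
    then show "((\<lambda>\<alpha>. pp (of_real 1 * cis \<alpha>)) has_vector_derivative 0) (at z)"
      "((\<lambda>\<alpha>. Phi (of_real 1 * cis \<alpha>)) has_vector_derivative 0) (at z)" by auto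
  qed
  have cp: "continuous_on {x..y} (\<lambda>\<alpha>. pp (of_real 1 * cis \<alpha>))" if "0 \<le> x" "y \<le> pi / 4" for x y
    using arcc[OF pp_cont, of 1] that by simp
  have Re_const: "Re (pp (of_real 1 * cis x)) = Re (pp (of_real 1 * cis y))"
    and Im_const: "Im (pp (of_real 1 * cis x)) = Im (pp (of_real 1 * cis y))"
    if "0 \<le> x" "x \<le> y" "y \<le> pi / 4" for x y
    using that(2) Re_c[OF cp[OF that(1,3)]] Im_c[OF cp[OF that(1,3)]]
      d(1)[THEN has_real_derivative_Re] d(1)[THEN has_real_derivative_Im] that
    by (intro constant_except[where f = "\<lambda>\<alpha>. Re (pp (of_real 1 * cis \<alpha>))" and c = 0]
      constant_except[where f = "\<lambda>\<alpha>. Im (pp (of_real 1 * cis \<alpha>))" and c = 0]; simp)+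
  have "Im (pp 1) = 0" using on_right_axis(2)[of 1] b by simp
  moreover have "Re (pp (cis (pi / 4))) = Im (pp (cis (pi / 4)))" using on_diagonal(2)[of 1] by simp
  ultimately show "pp (cis \<alpha>) = 0"
    using Re_const[of 0 \<alpha>] Re_const[of \<alpha> "pi / 4"] Im_const[of 0 \<alpha>] Im_const[of \<alpha> "pi / 4"] assms
    by (simp add: complex_eq_iff)
  have "Phi (of_real 1 * cis 0) = Phi (of_real 1 * cis \<alpha>)"
    by (rule constant_except[OF assms(1), where f = "\<lambda>\<alpha>. Phi (of_real 1 * cis \<alpha>)"])
       (use arcc[OF Phi_cont, of 1 0 \<alpha>] d(2) assms in auto)
  then show "Phi (cis \<alpha>) = 0" by (simp add: Phi_def)
qed

subsection \<open>Signs along rays and arcs\<close>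

text \<open>Before b the derivatives along a ray may vanish, namely on the real radius, where
  \<beta> = pi/2. Beyond b they are strict, and every ray has such a last piece since b < 1.\<close>

lemma ray_increase:
  assumes "0 \<le> r" "r < 1" and c: "continuous_on {r..1} f"
    and d: "\<And>z. r < z \<Longrightarrow> z < 1 \<Longrightarrow> z \<noteq> b \<Longrightarrow>
      \<exists>D::real. (f has_vector_derivative D) (at z) \<and> 0 \<le> D \<and> (b < z \<longrightarrow> 0 < D)"
  shows "f r < f 1"
proof -
  define m where "m = max r b"
  have "f r \<le> f m"
  proof (rule nondecreasing_except[of r m f b])
    show "continuous_on {r..m} f"
      by (rule continuous_on_subset[OF c]) (use assms b in \<open>auto simp: m_def\<close>)
    fix z assume z: "r < z" "z < m" "z \<noteq> b"
    then have "z < 1" using assms b by (auto simp: m_def)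
    then show "\<exists>D. (f has_vector_derivative D) (at z) \<and> 0 \<le> D"
      using d[of z] z by blast
  qed (simp add: m_def)
  also have "f m < f 1"
  proof (rule strictly_increasing_except[of m 1 f b])
    show "continuous_on {m..1} f"
      by (rule continuous_on_subset[OF c]) (auto simp: m_def)
    fix z assume z: "m < z" "z < 1" "z \<noteq> b"
    then have "r < z" "b < z" by (auto simp: m_def)
    then show "\<exists>D. (f has_vector_derivative D) (at z) \<and> 0 < D"
      using d[of z] z by blast
  qed (use assms b in \<open>simp add: m_def\<close>)
  finally show ?thesis .
qed

text \<open>\<open>pp\<close> is 0 at the outer end of the ray, and its radial velocity has
  nonpositive real part, as \<beta> and 2 \<alpha> - \<beta> both stay within a right angle of
  0.\<close>

lemma Re_pp_pos:
  assumes "0 \<le> r" "r < 1" "0 \<le> \<alpha>" "\<alpha> \<le> pi / 4"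
  shows "0 < Re (pp (of_real r * cis \<alpha>))"
proof -
  have "- Re (pp (of_real r * cis \<alpha>)) < - Re (pp (of_real 1 * cis \<alpha>))"
  proof (rule ray_increase[OF assms(1,2), where f = "\<lambda>r. - Re (pp (of_real r * cis \<alpha>))"])
    show "continuous_on {r..1} (\<lambda>r. - Re (pp (of_real r * cis \<alpha>)))"
      by (intro continuous_on_minus Re_c rayc pp_cont) (use assms in auto)
    fix z assume z: "r < z" "z < 1" "z \<noteq> b"
    show "\<exists>D. ((\<lambda>r. - Re (pp (of_real r * cis \<alpha>))) has_vector_derivative D) (at z) \<and> 0 \<le> D \<and> (b < z \<longrightarrow> 0 < D)"
    proof (rule ray_polar[of z \<alpha>])
      fix K \<beta> assume \<beta>: "K > 0" "\<alpha> \<le> \<beta>" "\<beta> \<le> pi / 2 - \<alpha>" "b < z \<Longrightarrow> \<beta> < pi / 2"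
        and h: "((\<lambda>r. pp (of_real r * cis \<alpha>)) has_vector_derivative
          - of_real K * (cis \<beta> + of_real (z\<^sup>2) * cis (2 * \<alpha> - \<beta>))) (at z)"
      have "- Re (- of_real K * (cis \<beta> + of_real (z\<^sup>2) * cis (2 * \<alpha> - \<beta>))) = K * (cos \<beta> + z\<^sup>2 * cos (2 * \<alpha> - \<beta>))" by simp
      moreover have "0 \<le> cos \<beta>" using \<beta> assms by (intro cos_ge_zero) auto
      moreover have "0 \<le> cos (2 * \<alpha> - \<beta>)" using \<beta> assms by (intro cos_ge_zero) auto
      moreover have "b < z \<Longrightarrow> 0 < cos \<beta>" using \<beta> assms by (intro cos_gt_zero_pi) auto
      ultimately show ?thesis using \<beta>(1)
        by (intro ex_minus_Re[OF h, where P = "\<lambda>D. 0 \<le> D \<and> (b < z \<longrightarrow> 0 < D)"])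
           (auto intro!: mult_pos_pos add_pos_nonneg)
    qed (use assms z in auto)
  qed
  then show ?thesis using on_arc[of \<alpha>] assms by simp
qed

lemma Im_pp_nonneg:
  assumes "0 \<le> r" "r \<le> 1" "0 \<le> \<alpha>" "\<alpha> \<le> pi / 4"
  shows "0 \<le> Im (pp (of_real r * cis \<alpha>))"
proof -
  have "- Im (pp (of_real r * cis \<alpha>)) \<le> - Im (pp (of_real 1 * cis \<alpha>))"
  proof (rule nondecreasing_except[OF assms(2), where f = "\<lambda>r. - Im (pp (of_real r * cis \<alpha>))" and c = b])
    show "continuous_on {r..1} (\<lambda>r. - Im (pp (of_real r * cis \<alpha>)))"
      by (intro continuous_on_minus Im_c rayc pp_cont) (use assms in auto)
    fix z assume z: "r < z" "z < 1" "z \<noteq> b"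
    show "\<exists>D. ((\<lambda>r. - Im (pp (of_real r * cis \<alpha>))) has_vector_derivative D) (at z) \<and> 0 \<le> D"
    proof (rule ray_polar[of z \<alpha>])
      fix K \<beta> assume \<beta>: "K > 0" "\<alpha> \<le> \<beta>" "\<beta> \<le> pi / 2 - \<alpha>"
        and h: "((\<lambda>r. pp (of_real r * cis \<alpha>)) has_vector_derivative
          - of_real K * (cis \<beta> + of_real (z\<^sup>2) * cis (2 * \<alpha> - \<beta>))) (at z)"
      have s0: "0 \<le> sin \<beta>" using \<beta> assms by (intro sin_ge_zero) auto
      have "sin \<beta> + sin (2 * \<alpha> - \<beta>) = 2 * sin \<alpha> * cos (\<beta> - \<alpha>)"
        using sin_plus_sin[of \<beta> "2 * \<alpha> - \<beta>"] by (simp add: diff_divide_distrib)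
      moreover have "0 \<le> sin \<alpha>" using assms by (intro sin_ge_zero) auto
      moreover have "0 \<le> cos (\<beta> - \<alpha>)" using \<beta> assms by (intro cos_ge_zero) auto
      ultimately have s1: "0 \<le> sin \<beta> + sin (2 * \<alpha> - \<beta>)" by simp
      have z2: "0 \<le> z\<^sup>2" "z\<^sup>2 \<le> 1" using z assms by (auto simp: power_le_one)
      \<comment> \<open>The derivative is affine in z^2, so it is nonnegative if it is so for z^2 =
        0 and z^2 = 1; in the second case the two sines combine to a product.\<close>
      have "0 \<le> (1 - z\<^sup>2) * sin \<beta> + z\<^sup>2 * (sin \<beta> + sin (2 * \<alpha> - \<beta>))"
        using mult_nonneg_nonneg[OF z2(1) s1] mult_nonneg_nonneg[of "1 - z\<^sup>2", OF _ s0] z2 by auto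
      then have "0 \<le> K * (sin \<beta> + z\<^sup>2 * sin (2 * \<alpha> - \<beta>))"
        using \<beta>(1) by (intro mult_nonneg_nonneg) (auto simp: algebra_simps)
      then show ?thesis
        by (intro ex_minus_Im[OF h, where P = "\<lambda>D. 0 \<le> D"]) simp
    qed (use assms z in auto)
  qed
  then show ?thesis using on_arc[of \<alpha>] assms by simp
qed

text \<open>The comparison runs along circular arcs instead of rays: Im - Re grows with the angle
  and is 0 on the diagonal.\<close>

lemma Im_pp_le_Re_pp:
  assumes "0 \<le> r" "r \<le> 1" "0 \<le> \<alpha>" "\<alpha> \<le> pi / 4"
  shows "Im (pp (of_real r * cis \<alpha>)) \<le> Re (pp (of_real r * cis \<alpha>))"
proof (cases "r = 0")
  case True
  then show ?thesis by (simp add: pp_def om_0 Ga_0)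
next
  case False
  let ?f = "\<lambda>\<alpha>. Im (pp (of_real r * cis \<alpha>)) - Re (pp (of_real r * cis \<alpha>))"
  have "?f \<alpha> \<le> ?f (pi / 4)"
  proof (rule nondecreasing_except[OF assms(4), of ?f 0])
    show "continuous_on {\<alpha>..pi / 4} ?f"
      by (intro continuous_on_diff Im_c Re_c arcc pp_cont) (use assms in auto)
    fix x assume x: "\<alpha> < x" "x < pi / 4"
    show "\<exists>D. (?f has_vector_derivative D) (at x) \<and> 0 \<le> D"
    proof (rule arc_polar[of r x])
      fix K \<beta> assume \<beta>: "K > 0" "x \<le> \<beta>" "\<beta> \<le> pi / 2 - x"
        and h: "((\<lambda>\<alpha>. pp (of_real r * cis \<alpha>)) has_vector_derivative
          of_real (r * K) * (\<i> * (cis \<beta> - of_real (r\<^sup>2) * cis (2 * x - \<beta>)))) (at x)"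
      define S1 where "S1 = sin \<beta> + cos \<beta>"
      define S2 where "S2 = sin (2 * x - \<beta>) + cos (2 * x - \<beta>)"
      have D: "(?f has_vector_derivative r * K * (S1 - r\<^sup>2 * S2)) (at x)"
        using has_vector_derivative_diff[OF has_real_derivative_Im[OF h] has_real_derivative_Re[OF h]]
        by (simp add: S1_def S2_def algebra_simps)
      have "S1 - S2 = 2 * sin (\<beta> - x) * (cos x - sin x)"
        using sin_diff_sin[of \<beta> "2 * x - \<beta>"] cos_diff_cos[of \<beta> "2 * x - \<beta>"] sin_minus[of "\<beta> - x"]
        by (simp add: S1_def S2_def algebra_simps diff_divide_distrib)
      moreover have "0 \<le> sin (\<beta> - x)" using \<beta> x assms by (intro sin_ge_zero) auto
      moreover have "sin x \<le> cos x"
        using sin_monotone_2pi_le[of x "pi/4"] cos_monotone_0_pi_le[of x "pi/4"] x assms by (simp add: sin_45 cos_45)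
      ultimately have 1: "0 \<le> S1 - S2" by simp
      have "0 \<le> sin \<beta>" using \<beta> x assms by (intro sin_ge_zero) auto
      moreover have "0 \<le> cos \<beta>" using \<beta> x assms by (intro cos_ge_zero) auto
      ultimately have 2: "0 \<le> S1" by (simp add: S1_def)
      have z2: "0 \<le> r\<^sup>2" "r\<^sup>2 \<le> 1" using assms by (auto simp: power_le_one)
      have "0 \<le> (1 - r\<^sup>2) * S1 + r\<^sup>2 * (S1 - S2)"
        using 1 2 z2 by (intro add_nonneg_nonneg mult_nonneg_nonneg) auto
      then have "0 \<le> r * K * (S1 - r\<^sup>2 * S2)"
        using \<beta>(1) assms by (intro mult_nonneg_nonneg) (auto simp: algebra_simps)
      with D show ?thesis by blast
    qed (use x assms False in auto)
  qed
  then show ?thesis using on_diagonal(2)[OF assms(1,2)] by simp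
qed

text \<open>The derivative of \<open>UU\<close> is the inner product of the gradient
  \<open>pp\<close> with the velocity of \<open>zz\<close>. Along a ray, \<open>pp\<close> lies in
  the first quadrant and the velocity in the third, so \<open>UU\<close> decreases to its value 0 on
  the arc.\<close>

lemma UU_pos:
  assumes "0 \<le> r" "r < 1" "0 \<le> \<alpha>" "\<alpha> \<le> pi / 4"
  shows "0 < UU (of_real r * cis \<alpha>)"
proof -
  have "- UU (of_real r * cis \<alpha>) < - UU (of_real 1 * cis \<alpha>)"
  proof (rule ray_increase[OF assms(1,2), where f = "\<lambda>r. - UU (of_real r * cis \<alpha>)"])
    show "continuous_on {r..1} (\<lambda>r. - UU (of_real r * cis \<alpha>))"
      by (intro continuous_on_minus rayc UU_cont) (use assms in auto)
    fix z assume z: "r < z" "z < 1" "z \<noteq> b"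
    show "\<exists>D. ((\<lambda>r. - UU (of_real r * cis \<alpha>)) has_vector_derivative D) (at z) \<and> 0 \<le> D \<and> (b < z \<longrightarrow> 0 < D)"
    proof (rule ray_polar[of z \<alpha>])
      let ?s = "of_real z * cis \<alpha>"
      fix K \<beta> assume \<beta>: "K > 0" "\<alpha> \<le> \<beta>" "\<beta> \<le> pi / 2 - \<alpha>" "b < z \<Longrightarrow> \<beta> < pi / 2"
        and e: "cis \<alpha> * w ?s = - of_real K * cis (- \<beta>)"
        and h: "((\<lambda>r. om (of_real r * cis \<alpha>)) has_vector_derivative - of_real K * cis (- \<beta>)) (at z)"
      have sec: "?s \<in> sector" "?s \<noteq> of_real b"
        using z assms polar_ne_b[of \<alpha> z] by (auto intro!: polar_in_sector)
      note p = path_pp[OF ray_deriv sec, unfolded e] and q = path_Phi[OF ray_deriv sec, unfolded e]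
      let ?q = "cnj (- of_real K * cis (- \<beta>)) + ?s\<^sup>2 * (- of_real K * cis (- \<beta>))"
      have "((\<lambda>r. - UU (of_real r * cis \<alpha>)) has_vector_derivative
        - (Re (pp ?s * (- of_real K * cis (- \<beta>)) + ?q * om ?s) - Re (om ?s * ?q))) (at z)"
        unfolding UU_def Psi_def zz_def complex_cnj_cnj
        by (intro has_vector_derivative_minus has_vector_derivative_diff q has_real_derivative_Re has_vector_derivative_mult p h)
      also have "- (Re (pp ?s * (- of_real K * cis (- \<beta>)) + ?q * om ?s) - Re (om ?s * ?q)) =
          K * (Re (pp ?s) * cos \<beta> + Im (pp ?s) * sin \<beta>)"
        by (simp add: algebra_simps)
      finally have D: "((\<lambda>r. - UU (of_real r * cis \<alpha>)) has_vector_derivative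
          K * (Re (pp ?s) * cos \<beta> + Im (pp ?s) * sin \<beta>)) (at z)" .
      have "0 \<le> cos \<beta>" using \<beta> assms by (intro cos_ge_zero) auto
      moreover have "b < z \<Longrightarrow> 0 < cos \<beta>" using \<beta> assms by (intro cos_gt_zero_pi) auto
      moreover have "0 \<le> sin \<beta>" using \<beta> assms by (intro sin_ge_zero) auto
      moreover have "0 < Re (pp ?s)" "0 \<le> Im (pp ?s)"
        using Re_pp_pos[of z \<alpha>] Im_pp_nonneg[of z \<alpha>] z assms by auto
      ultimately show ?thesis using \<beta>(1)
        by (intro exI[of _ "K * (Re (pp ?s) * cos \<beta> + Im (pp ?s) * sin \<beta>)"] conjI D)
           (auto intro!: mult_pos_pos add_pos_nonneg)
    qed (use assms z in auto)
  qed
  then show ?thesis using on_arc[of \<alpha>] assms by (simp add: UU_def Psi_def)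
qed

text \<open>The velocity of \<open>zz\<close> along the ray is a positive multiple of - cis \<beta>,
  and \<beta> differs from \<alpha> by at most a right angle. So \<open>zz\<close> reaches the arc
  from the outer side of the line with normal cis \<alpha>.\<close>

lemma ray_normal:
  assumes "0 \<le> r" "r < 1" "0 \<le> \<alpha>" "\<alpha> \<le> pi / 4"
  shows "0 < Re (cnj (cis \<alpha>) * (zz (of_real r * cis \<alpha>) - zz (cis \<alpha>)))"
proof -
  have "- Re (cis \<alpha> * om (of_real r * cis \<alpha>)) < - Re (cis \<alpha> * om (of_real 1 * cis \<alpha>))"
  proof (rule ray_increase[OF assms(1,2), where f = "\<lambda>r. - Re (cis \<alpha> * om (of_real r * cis \<alpha>))"])
    show "continuous_on {r..1} (\<lambda>r. - Re (cis \<alpha> * om (of_real r * cis \<alpha>)))"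
      by (intro continuous_on_minus Re_c continuous_on_mult continuous_on_const rayc om_cont) (use assms in auto)
    fix z assume z: "r < z" "z < 1" "z \<noteq> b"
    show "\<exists>D. ((\<lambda>r. - Re (cis \<alpha> * om (of_real r * cis \<alpha>))) has_vector_derivative D) (at z) \<and> 0 \<le> D \<and> (b < z \<longrightarrow> 0 < D)"
    proof (rule ray_polar[of z \<alpha>])
      fix K \<beta> assume \<beta>: "K > 0" "\<alpha> \<le> \<beta>" "\<beta> \<le> pi / 2 - \<alpha>" "b < z \<Longrightarrow> \<beta> < pi / 2"
        and h: "((\<lambda>r. om (of_real r * cis \<alpha>)) has_vector_derivative - of_real K * cis (- \<beta>)) (at z)"
      have "- Re (cis \<alpha> * (- of_real K * cis (- \<beta>))) = K * cos (\<beta> - \<alpha>)"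
        by (simp add: cos_diff algebra_simps)
      moreover have "0 \<le> cos (\<beta> - \<alpha>)" using \<beta> assms by (intro cos_ge_zero) auto
      moreover have "b < z \<Longrightarrow> 0 < cos (\<beta> - \<alpha>)" using \<beta> assms by (intro cos_gt_zero_pi) auto
      ultimately show ?thesis using \<beta>(1)
        by (intro ex_minus_Re[OF has_vector_derivative_mult_right[OF h], where P = "\<lambda>D. 0 \<le> D \<and> (b < z \<longrightarrow> 0 < D)"]) auto
    qed (use assms z in auto)
  qed
  then show ?thesis by (simp add: zz_def algebra_simps)
qed


subsection \<open>The interior of the sector\<close>

lemma w_quadrant:
  assumes "s \<in> sector" "s \<noteq> of_real b"
  obtains K \<mu> where "K > 0" "0 \<le> \<mu>" "\<mu> \<le> pi / 2" "w s = - of_real K * cis (- \<mu>)"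
    "0 < Im s \<Longrightarrow> Im s < Re s \<Longrightarrow> 0 < \<mu> \<and> \<mu> < pi / 2"
proof (rule sector_polar[OF assms(1)])
  fix r \<alpha> assume p: "0 \<le> r" "r \<le> 1" "0 \<le> \<alpha>" "\<alpha> \<le> pi / 4" and s: "s = of_real r * cis \<alpha>"
  show thesis
  proof (rule w_polar[OF p])
    show "of_real r * cis \<alpha> \<noteq> of_real b" using assms(2) s by simp
    fix K \<mu> assume \<mu>: "K > 0" "w (of_real r * cis \<alpha>) = - of_real K * cis (- \<mu>)"
      "2 * \<alpha> \<le> \<mu>" "\<mu> \<le> pi / 2" and i: "0 < r \<Longrightarrow> 0 < \<alpha> \<Longrightarrow> \<alpha> < pi / 4 \<Longrightarrow> 0 < \<mu> \<and> \<mu> < pi / 2"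
    have "0 < \<mu> \<and> \<mu> < pi / 2" if "0 < Im s" "Im s < Re s"
    proof (rule i)
      show "0 < r" using that p by (auto simp: s zero_less_mult_iff)
      show "0 < \<alpha>" using that p by (cases "\<alpha> = 0") (auto simp: s)
      show "\<alpha> < pi / 4" using that p by (cases "\<alpha> = pi / 4") (auto simp: s cos_45 sin_45)
    qed
    with \<mu> p show thesis by (intro that[of K \<mu>]) (auto simp: s)
  qed
qed

text \<open>Going up vertically from the real axis, Im zz has derivative K cos \<mu> > 0, and it
  starts at a nonnegative value, on the symmetry axis or on the side of the square.\<close>

lemma Im_zz_pos:
  assumes s: "s \<in> sector" "0 < Im s" "Im s < Re s"
  shows "0 < Im (zz s)"
proof -
  define \<gamma> where "\<gamma> t = of_real (Re s) + of_real t * \<i>" for t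
  have c\<gamma>: "continuous_on A \<gamma>" for A unfolding \<gamma>_def by (intro continuous_intros)
  have sec: "\<gamma> t \<in> sector" if "0 \<le> t" "t \<le> Im s" for t
  proof -
    have "(Re s)\<^sup>2 + t\<^sup>2 \<le> (Re s)\<^sup>2 + (Im s)\<^sup>2" using that by (intro add_left_mono power_mono)
    moreover have "(norm s)\<^sup>2 \<le> 1" using s by (auto simp: sector_def power_le_one)
    ultimately have "norm (\<gamma> t) \<le> 1" by (simp add: \<gamma>_def cmod_def)
    then show ?thesis using that s by (auto simp: sector_def \<gamma>_def)
  qed
  have "- Im (om (\<gamma> 0)) < - Im (om (\<gamma> (Im s)))"
  proof (rule strictly_increasing_except[OF s(2), of "\<lambda>t. - Im (om (\<gamma> t))" 0])
    show "continuous_on {0..Im s} (\<lambda>t. - Im (om (\<gamma> t)))"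
      by (intro continuous_on_minus Im_c path_cont[OF om_cont c\<gamma>]) (blast intro: sec)+
    fix z assume z: "0 < z" "z < Im s"
    have d: "(\<gamma> has_vector_derivative \<i>) (at z)"
      unfolding \<gamma>_def using has_vector_derivative_add[OF has_vector_derivative_const ray_deriv] by simp
    have g: "\<gamma> z \<in> sector" "\<gamma> z \<noteq> of_real b" using sec[of z] z by (auto simp: \<gamma>_def complex_eq_iff)
    show "\<exists>D. ((\<lambda>t. - Im (om (\<gamma> t))) has_vector_derivative D) (at z) \<and> 0 < D"
    proof (rule w_quadrant[OF g])
      fix K \<mu> assume \<mu>: "K > 0" "w (\<gamma> z) = - of_real K * cis (- \<mu>)"
        "0 < Im (\<gamma> z) \<Longrightarrow> Im (\<gamma> z) < Re (\<gamma> z) \<Longrightarrow> 0 < \<mu> \<and> \<mu> < pi / 2"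
      have "0 < \<mu> \<and> \<mu> < pi / 2" using \<mu>(3) z s by (simp add: \<gamma>_def)
      then have "0 < cos \<mu>" by (intro cos_gt_zero_pi) auto
      with \<mu> show ?thesis
        by (intro ex_minus_Im[OF path_om[OF d g], where P = "\<lambda>D. 0 < D"]) simp
    qed
  qed
  moreover have "\<gamma> (Im s) = s" by (simp add: \<gamma>_def complex_eq_iff)
  moreover have "0 \<le> Im (zz (\<gamma> 0))"
  proof -
    have "Re s \<le> 1" using s complex_Re_le_cmod[of s] by (auto simp: sector_def)
    then show ?thesis
      using on_left_axis(3)[of "Re s"] on_right_axis(1)[of "Re s"] s
      by (cases "Re s < b") (auto simp: \<gamma>_def)
  qed
  ultimately show ?thesis by (simp add: zz_def)
qed

text \<open>The same as for Im zz, now along the segment orthogonal to the diagonal: \<sigma> and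
  \<tau> are the coordinates of s along and across it, and the foot of the segment is mapped to the
  diagonal of the square.\<close>

lemma Im_zz_less_Re_zz:
  assumes s: "s \<in> sector" "0 < Im s" "Im s < Re s"
  shows "Im (zz s) < Re (zz s)"
proof -
  define \<sigma> where "\<sigma> = (Re s + Im s) * (sqrt 2 / 2)"
  define \<tau> where "\<tau> = (Re s - Im s) * (sqrt 2 / 2)"
  define \<gamma> where "\<gamma> t = of_real \<sigma> * cis (pi / 4) + of_real t * cis (- (pi / 4))" for t
  have c\<gamma>: "continuous_on A \<gamma>" for A unfolding \<gamma>_def by (intro continuous_intros)
  have \<tau>: "0 < \<tau>" using s by (simp add: \<tau>_def)
  have ReIm: "Re (\<gamma> t) = (\<sigma> + t) * (sqrt 2 / 2)" "Im (\<gamma> t) = (\<sigma> - t) * (sqrt 2 / 2)" for t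
    by (auto simp: \<gamma>_def cos_45 sin_45 algebra_simps)
  have h2: "(sqrt 2 / 2) * (sqrt 2 / 2) = (1 / 2 :: real)" by simp
  have gt: "\<gamma> \<tau> = s"
  proof -
    have "(\<sigma> + \<tau>) * (sqrt 2 / 2) = 2 * Re s * ((sqrt 2 / 2) * (sqrt 2 / 2))"
      "(\<sigma> - \<tau>) * (sqrt 2 / 2) = 2 * Im s * ((sqrt 2 / 2) * (sqrt 2 / 2))"
    proof -
      have "((x + y) * h + (x - y) * h) * h = 2 * x * (h * h)"
        "((x + y) * h - (x - y) * h) * h = 2 * y * (h * h)" for x y h :: real
        by (simp_all add: algebra_simps)
      then show "(\<sigma> + \<tau>) * (sqrt 2 / 2) = 2 * Re s * ((sqrt 2 / 2) * (sqrt 2 / 2))"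
        "(\<sigma> - \<tau>) * (sqrt 2 / 2) = 2 * Im s * ((sqrt 2 / 2) * (sqrt 2 / 2))"
        unfolding \<sigma>_def \<tau>_def by blast+
    qed
    then have "Re (\<gamma> \<tau>) = Re s" "Im (\<gamma> \<tau>) = Im s" unfolding h2 ReIm by linarith+
    then show ?thesis by (rule complex_eqI)
  qed
  have n2: "(norm (\<gamma> t))\<^sup>2 = \<sigma>\<^sup>2 + t\<^sup>2" for t
  proof -
    have "(norm (\<gamma> t))\<^sup>2 = 2 * (\<sigma>\<^sup>2 + t\<^sup>2) * ((sqrt 2 / 2) * (sqrt 2 / 2))"
    proof -
      have "((\<sigma> + t) * h)\<^sup>2 + ((\<sigma> - t) * h)\<^sup>2 = 2 * (\<sigma>\<^sup>2 + t\<^sup>2) * (h * h)" for h :: real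
        by (simp add: power2_eq_square algebra_simps)
      then show ?thesis unfolding cmod_power2 ReIm .
    qed
    then show ?thesis unfolding h2 by simp
  qed
  have \<sigma>\<tau>: "\<tau> < \<sigma>" using s by (simp add: \<sigma>_def \<tau>_def)
  have sec: "\<gamma> t \<in> sector" if "0 \<le> t" "t \<le> \<tau>" for t
  proof -
    have "(norm (\<gamma> t))\<^sup>2 \<le> (norm (\<gamma> \<tau>))\<^sup>2" unfolding n2 using that by (intro add_left_mono power_mono)
    then have "norm (\<gamma> t) \<le> norm (\<gamma> \<tau>)" by (rule power2_le_imp_le) simp
    also have "\<dots> \<le> 1" unfolding gt using s by (simp add: sector_def)
    finally show ?thesis using that \<sigma>\<tau> by (simp add: sector_def ReIm)
  qed
  have "Re (om (\<gamma> 0)) + Im (om (\<gamma> 0)) < Re (om (\<gamma> \<tau>)) + Im (om (\<gamma> \<tau>))"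
  proof (rule strictly_increasing_except[OF \<tau>, of "\<lambda>t. Re (om (\<gamma> t)) + Im (om (\<gamma> t))" 0])
    show "continuous_on {0..\<tau>} (\<lambda>t. Re (om (\<gamma> t)) + Im (om (\<gamma> t)))"
      by (intro continuous_on_add Re_c Im_c path_cont[OF om_cont c\<gamma>]) (blast intro: sec)+
    fix z assume z: "0 < z" "z < \<tau>"
    have d: "(\<gamma> has_vector_derivative cis (- (pi / 4))) (at z)"
      unfolding \<gamma>_def using has_vector_derivative_add[OF has_vector_derivative_const ray_deriv] by simp
    have Im_pos: "0 < Im (\<gamma> z)" using z \<sigma>\<tau> by (simp add: ReIm)
    then have g: "\<gamma> z \<in> sector" "\<gamma> z \<noteq> of_real b" using sec[of z] z by auto
    show "\<exists>D. ((\<lambda>t. Re (om (\<gamma> t)) + Im (om (\<gamma> t))) has_vector_derivative D) (at z) \<and> 0 < D"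
    proof (rule w_quadrant[OF g])
      fix K \<mu> assume \<mu>: "K > 0" "w (\<gamma> z) = - of_real K * cis (- \<mu>)"
        "0 < Im (\<gamma> z) \<Longrightarrow> Im (\<gamma> z) < Re (\<gamma> z) \<Longrightarrow> 0 < \<mu> \<and> \<mu> < pi / 2"
      have "0 < \<mu> \<and> \<mu> < pi / 2" using \<mu>(3) z \<sigma>\<tau> by (simp add: ReIm)
      then have "0 < sin \<mu>" by (intro sin_gt_zero) auto
      moreover have "Re (cis (- (pi / 4)) * w (\<gamma> z)) + Im (cis (- (pi / 4)) * w (\<gamma> z)) = K * sqrt 2 * sin \<mu>"
        unfolding \<mu>(2) by (simp add: cos_45 sin_45 algebra_simps)
      ultimately show ?thesis
        using has_vector_derivative_add[OF has_real_derivative_Re[OF path_om[OF d g]] has_real_derivative_Im[OF path_om[OF d g]]] \<mu>(1)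
        by (intro exI conjI) (assumption, simp)
    qed
  qed
  moreover have "Re (om (\<gamma> 0)) + Im (om (\<gamma> 0)) = 0"
  proof -
    have "0 \<le> \<sigma>" using \<tau> \<sigma>\<tau> by simp
    moreover have "\<sigma> \<le> 1"
    proof -
      have "\<sigma>\<^sup>2 \<le> 1\<^sup>2" using n2[of \<tau>] gt s power_le_one[of "norm s" 2] by (simp add: sector_def) (smt (verit) zero_le_power2)
      then show ?thesis by (rule power2_le_imp_le) simp
    qed
    ultimately show ?thesis using on_diagonal(1)[of \<sigma>] by (simp add: \<gamma>_def zz_def)
  qed
  ultimately show ?thesis by (simp add: gt zz_def)
qed

text \<open>The Noshiro-Warschawski criterion: arg om' varies by at most a quarter turn, so after a
  rotation the derivative of om has positive real part, and the sector is convex.\<close>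

lemma zz_inj: "inj_on zz sector"
proof (rule inj_onI, rule ccontr)
  fix s s' assume s: "s \<in> sector" "s' \<in> sector" "zz s = zz s'" "s \<noteq> s'"
  define \<gamma> where "\<gamma> t = s + of_real t * (s' - s)" for t
  have c\<gamma>: "continuous_on A \<gamma>" for A unfolding \<gamma>_def by (intro continuous_intros)
  \<comment> \<open>The segment meets b at most once. If it misses b, the value 0 is a
    dummy.\<close>
  define c where "c = (if \<exists>t. \<gamma> t = of_real b then SOME t. \<gamma> t = of_real b else 0)"
  have c: "\<gamma> t \<noteq> of_real b" if "t \<noteq> c" for t
  proof
    assume t: "\<gamma> t = of_real b"
    then have "\<gamma> (SOME t. \<gamma> t = of_real b) = of_real b" by (rule someI)
    then have "\<gamma> c = of_real b" using t by (auto simp: c_def)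
    then have "of_real c * (s' - s) = of_real t * (s' - s)"
      using t unfolding \<gamma>_def by (metis add_left_imp_eq)
    then show False using that s(4) by simp
  qed
  have eq: "sector = {s. inner \<i> s \<ge> 0} \<inter> {s. inner (1 - \<i>) s \<ge> 0} \<inter> cball 0 1"
    by (auto simp: sector_def inner_complex_def)
  have "convex sector"
    unfolding eq by (intro convex_Int convex_halfspace_ge convex_cball)
  then have sec: "\<gamma> t \<in> sector" if "0 \<le> t" "t \<le> 1" for t
    using convexD_alt[of sector s s' t] s that by (simp add: \<gamma>_def scaleR_conv_of_real algebra_simps)
  let ?f = "\<lambda>t. Re (- cis (pi / 4) / (s' - s) * om (\<gamma> t))"
  have "?f 0 < ?f 1"
  proof (rule strictly_increasing_except[of 0 1 ?f c])
    show "continuous_on {0..1} ?f"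
      by (intro Re_c continuous_on_mult continuous_on_const path_cont[OF om_cont c\<gamma>]) (blast intro: sec)+
    fix z assume z: "0 < z" "z < 1" "z \<noteq> c"
    have d: "(\<gamma> has_vector_derivative s' - s) (at z)"
      unfolding \<gamma>_def using has_vector_derivative_add[OF has_vector_derivative_const ray_deriv] by simp
    have g: "\<gamma> z \<in> sector" "\<gamma> z \<noteq> of_real b" using sec[of z] z c by auto
    show "\<exists>D. (?f has_vector_derivative D) (at z) \<and> 0 < D"
    proof (rule w_quadrant[OF g])
      fix K \<mu> assume \<mu>: "K > 0" "0 \<le> \<mu>" "\<mu> \<le> pi / 2" "w (\<gamma> z) = - of_real K * cis (- \<mu>)"
      have "- cis (pi / 4) / (s' - s) * ((s' - s) * w (\<gamma> z)) = of_real K * cis (pi / 4 - \<mu>)"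
        unfolding \<mu>(4) using s(4) cis_mult[of "pi / 4" "- \<mu>"] by (simp add: field_simps)
      moreover have "0 < cos (pi / 4 - \<mu>)"
        using \<mu> pi_gt_zero by (intro cos_gt_zero_pi) linarith+
      ultimately show ?thesis using \<mu>(1)
        by (intro ex_Re[OF has_vector_derivative_mult_right[OF path_om[OF d g]], where P = "\<lambda>D. 0 < D"]) simp
    qed
  qed simp
  then show False using s(3) by (simp add: \<gamma>_def zz_def)
qed

subsection \<open>Maximisers of the Legendre family\<close>

lemma feasible:
  assumes s: "s \<in> sector" "norm s < 1" and v: "Im s = 0 \<Longrightarrow> 0 \<le> Im v" "Im s = Re s \<Longrightarrow> Im v \<le> Re v"
  shows "eventually (\<lambda>h. s + of_real h * v \<in> sector) (at_right 0)"
proof -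
  have pos: "eventually (\<lambda>h. 0 \<le> x + h * y) (at_right (0::real))" if "0 \<le> x" "x = 0 \<Longrightarrow> 0 \<le> y" for x y :: real
  proof (cases "x = 0")
    case True
    then show ?thesis using that by (auto simp: eventually_at_filter)
  next
    case False
    have "((\<lambda>h. x + h * y) \<longlongrightarrow> x + 0 * y) (at_right 0)" by (intro tendsto_intros)
    then have "eventually (\<lambda>h. 0 < x + h * y) (at_right 0)"
      by (rule order_tendstoD(1)) (use that False in auto)
    then show ?thesis by eventually_elim simp
  qed
  have "((\<lambda>h. norm (s + of_real h * v)) \<longlongrightarrow> norm (s + of_real 0 * v)) (at_right 0)" by (intro tendsto_intros)
  then have n: "eventually (\<lambda>h. norm (s + of_real h * v) < 1) (at_right 0)"
    by (rule order_tendstoD(2)) (use s in auto)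
  have 1: "eventually (\<lambda>h. 0 \<le> Im s + h * Im v) (at_right 0)"
    using s v by (intro pos) (auto simp: sector_def)
  have 2: "eventually (\<lambda>h. 0 \<le> (Re s - Im s) + h * (Re v - Im v)) (at_right 0)"
    using s v by (intro pos) (auto simp: sector_def)
  from n 1 2 show ?thesis by eventually_elim (auto simp: sector_def algebra_simps)
qed

lemma maximiser_variation:
  assumes s: "s \<in> sector" "s \<noteq> of_real b" and mx: "\<And>s'. s' \<in> sector \<Longrightarrow> Psi y s' \<le> Psi y s"
    and ev: "eventually (\<lambda>h. s + of_real h * v \<in> sector) (at_right 0)"
  shows "Re (v * w s * ((y - zz s) + s\<^sup>2 * cnj (y - zz s))) \<le> 0"
proof (rule ccontr)
  let ?D = "Re (v * w s * ((y - zz s) + s\<^sup>2 * cnj (y - zz s)))"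
  assume "\<not> ?D \<le> 0"
  have d: "((\<lambda>h. s + of_real h * v) has_vector_derivative v) (at 0)"
    using has_vector_derivative_add[OF has_vector_derivative_const ray_deriv] by simp
  have "((\<lambda>h. Psi y (s + of_real h * v)) has_real_derivative ?D) (at 0)"
    using path_Psi[OF d] s by (simp add: has_real_derivative_iff_has_vector_derivative)
  from DERIV_pos_inc_right[OF this] \<open>\<not> ?D \<le> 0\<close> obtain e where e: "e > 0"
    "\<And>h. 0 < h \<Longrightarrow> h < e \<Longrightarrow> Psi y s < Psi y (s + of_real h * v)" by auto
  from ev obtain e' where e': "e' > 0" "\<And>h. 0 < h \<Longrightarrow> h < e' \<Longrightarrow> s + of_real h * v \<in> sector"
    by (auto simp: eventually_at_right_field)
  define h where "h = min e e' / 2"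
  have "0 < h" "h < e" "h < e'" using e(1) e'(1) by (auto simp: h_def min_def)
  then show False using e(2) e'(2) mx by force
qed


text \<open>om' is infinite at b, so there is no first-order condition. Instead \<open>Psi y\<close>
  would grow strictly on leaving b: towards 1 if Re y < 1, and towards 0 if Im y > 0.\<close>

lemma maximiser_at_b:
  assumes mx: "\<And>s'. s' \<in> sector \<Longrightarrow> Psi y s' \<le> Psi y (of_real b)"
    and y: "0 \<le> Im y" "Im y \<le> Re y" "Re y \<le> 1"
  shows "y = 1"
proof -
  have cz: "continuous_on {x..y} (\<lambda>r. zz (of_real r))" if "0 \<le> x" "y \<le> 1" for x y
    using that by (rule axisc[OF zz_cont])
  have sec: "of_real z \<in> sector" if "0 \<le> z" "z \<le> 1" for z
    using that by (simp add: sector_def)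
  have ax: "(complex_of_real has_vector_derivative 1) (at z)" for z
    using ray_deriv[of 1] by simp
  have Re1: "Re y = 1"
  proof (rule ccontr)
    assume "Re y \<noteq> 1"
    then have lt: "Re y < Re (zz (of_real b))" using y by (simp add: zz_def om_b)
    have "((\<lambda>r. Re (zz (of_real r))) \<longlongrightarrow> Re (zz (of_real b))) (at b within {b..1})"
      using Re_c[OF cz[of b 1]] b by (simp add: continuous_on)
    then have "eventually (\<lambda>r. Re y < Re (zz (of_real r))) (at b within {b..1})"
      using lt by (rule order_tendstoD)
    then obtain d where d: "d > 0" "\<And>r. r \<in> {b..1} \<Longrightarrow> r \<noteq> b \<Longrightarrow> dist r b < d \<Longrightarrow> Re y < Re (zz (of_real r))"
      by (auto simp: eventually_at)
    define e where "e = min (b + d) 1"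
    have e: "b < e" "e \<le> 1" "e \<le> b + d" using d b by (auto simp: e_def)
    have "Psi y (of_real b) < Psi y (of_real e)"
    proof (rule strictly_increasing_except[OF e(1), of "\<lambda>r. Psi y (of_real r)" b])
      show "continuous_on {b..e} (\<lambda>r. Psi y (of_real r))"
        by (rule axisc[OF Psi_cont]) (use b e in auto)
      fix z assume z: "b < z" "z < e" "z \<noteq> b"
      show "\<exists>D. ((\<lambda>r. Psi y (of_real r)) has_vector_derivative D) (at z) \<and> 0 < D"
      proof (rule axis_deriv_right[of z])
        fix K assume K: "K > 0" "w (of_real z) = - of_real K"
        have "Re y < Re (zz (of_real z))" using d(2)[of z] z e by (auto simp: dist_real_def)
        then have "0 < K * ((1 + z\<^sup>2) * (Re (zz (of_real z)) - Re y))"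
          using K by (intro mult_pos_pos) (auto simp: add_pos_nonneg)
        moreover have "Re (1 * w (of_real z) * ((y - zz (of_real z)) + (of_real z)\<^sup>2 * cnj (y - zz (of_real z))))
            = K * ((1 + z\<^sup>2) * (Re (zz (of_real z)) - Re y))"
          unfolding K(2) by (simp add: algebra_simps flip: of_real_power)
        moreover have "of_real z \<in> sector" "complex_of_real z \<noteq> of_real b"
          using sec[of z] z e b by auto
        ultimately show ?thesis using path_Psi[OF ax, of z y] by metis
      qed (use z e in auto)
    qed
    then show False using mx[of "of_real e"] sec[of e] e b by simp
  qed
  have "Im y = 0"
  proof (rule ccontr)
    assume "Im y \<noteq> 0"
    then have lt: "Im (zz (of_real b)) < Im y" using y by (simp add: zz_def om_b)
    have "((\<lambda>r. Im (zz (of_real r))) \<longlongrightarrow> Im (zz (of_real b))) (at b within {0..b})"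
      using Im_c[OF cz[of 0 b]] b by (simp add: continuous_on)
    then have "eventually (\<lambda>r. Im (zz (of_real r)) < Im y) (at b within {0..b})"
      using lt by (rule order_tendstoD)
    then obtain d where d: "d > 0" "\<And>r. r \<in> {0..b} \<Longrightarrow> r \<noteq> b \<Longrightarrow> dist r b < d \<Longrightarrow> Im (zz (of_real r)) < Im y"
      by (auto simp: eventually_at)
    define e where "e = max (b - d) 0"
    have e: "e < b" "0 \<le> e" "b - d \<le> e" using d b by (auto simp: e_def)
    have "- Psi y (of_real e) < - Psi y (of_real b)"
    proof (rule strictly_increasing_except[OF e(1), of "\<lambda>r. - Psi y (of_real r)" b])
      show "continuous_on {e..b} (\<lambda>r. - Psi y (of_real r))"
        by (rule continuous_on_minus[OF axisc[OF Psi_cont]]) (use b e in auto)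
      fix z assume z: "e < z" "z < b" "z \<noteq> b"
      show "\<exists>D. ((\<lambda>r. - Psi y (of_real r)) has_vector_derivative D) (at z) \<and> 0 < D"
      proof (rule axis_deriv_left[of z])
        fix K assume K: "K > 0" "w (of_real z) = of_real K * \<i>"
        have "z\<^sup>2 < 1" using z b e by (simp add: abs_square_less_1)
        moreover have "Im (zz (of_real z)) < Im y" using d(2)[of z] z e by (auto simp: dist_real_def)
        ultimately have "0 < K * ((1 - z\<^sup>2) * (Im y - Im (zz (of_real z))))"
          using K by (intro mult_pos_pos) auto
        moreover have "Re (1 * w (of_real z) * ((y - zz (of_real z)) + (of_real z)\<^sup>2 * cnj (y - zz (of_real z))))
            = - (K * ((1 - z\<^sup>2) * (Im y - Im (zz (of_real z)))))"
          unfolding K(2) by (simp add: algebra_simps flip: of_real_power)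
        moreover have "of_real z \<in> sector" "complex_of_real z \<noteq> of_real b"
          using sec[of z] z e b by auto
        ultimately show ?thesis
          using has_vector_derivative_minus[OF path_Psi[OF ax, of z y]] by (metis add.inverse_inverse)
      qed (use z e in auto)
    qed
    then show False using mx[of "of_real e"] sec[of e] e b by simp
  qed
  with Re1 show ?thesis by (simp add: complex_eq_iff)
qed

text \<open>In the interior, stationarity says Y + s^2 cnj Y = 0 for Y = y - zz s, and taking norms
  gives Y = 0 as |s| < 1. On an edge only the tangential variation can be reversed, which kills one
  component of Y. The inward variation gives a sign for the other one, opposite to the sign that y
  inherits from lying in the chamber while \<open>zz s\<close> lies on the corresponding edge of
  it.\<close>

theorem maximiser_eq:
  assumes s: "s \<in> sector" "norm s < 1" and mx: "\<And>s'. s' \<in> sector \<Longrightarrow> Psi y s' \<le> Psi y s"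
    and y: "0 \<le> Im y" "Im y \<le> Re y" "Re y \<le> 1"
  shows "zz s = y"
proof (cases "s = of_real b")
  case True
  then show ?thesis using maximiser_at_b[of y] mx y by (simp add: zz_def om_b)
next
  case False
  define Y where "Y = y - zz s"
  define W where "W = w s * (Y + s\<^sup>2 * cnj Y)"
  have var: "Re (v * W) \<le> 0" if "Im s = 0 \<Longrightarrow> 0 \<le> Im v" "Im s = Re s \<Longrightarrow> Im v \<le> Re v" for v
    using maximiser_variation[OF s(1) False mx feasible[OF s that]] by (simp add: W_def Y_def mult.assoc)
  have ns: "norm s ^ 2 < 1" using s by (simp add: abs_square_less_1)
  have sec: "0 \<le> Im s" "Im s \<le> Re s" using s by (auto simp: sector_def)
  have "Y = 0"
  proof (cases "Im s = 0")
    case Im0: True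
    define r where "r = Re s"
    have sr: "s = of_real r" using Im0 by (simp add: r_def complex_eq_iff)
    have r: "0 \<le> r" "r < 1" "r \<noteq> b"
    proof -
      show "0 \<le> r" using sec by (simp add: r_def)
      show "r < 1" using s(2) complex_Re_le_cmod[of s] unfolding r_def by linarith
      show "r \<noteq> b" using False sr by blast
    qed
    have r2: "0 < 1 - r\<^sup>2" "0 < 1 + r\<^sup>2" using r by (auto simp: abs_square_less_1 add_pos_nonneg)
    consider "r = 0" | "0 < r" "r < b" | "b < r" using r by linarith
    then show ?thesis
    proof cases
      case 1
      then have s0: "s = 0" using sr by simp
      have z0: "zz s = 1 + \<i>" by (simp add: s0 zz_def om_0)
      show ?thesis
      proof -
        show ?thesis
        proof (rule w_polar[of 0 0])
          fix K \<mu> assume \<mu>: "K > 0" "w (of_real 0 * cis 0) = - of_real K * cis (- \<mu>)"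
            "0 = (0::real) \<Longrightarrow> 0 < b \<Longrightarrow> \<mu> = pi / 2"
          have "cis (- (pi / 2)) = - \<i>" by (simp add: complex_eq_iff)
          then have w0: "w s = of_real K * \<i>" using \<mu> b by (simp add: s0)
          \<comment> \<open>At the vertex s = 0 one variation is enough: Im y \<ge> 1 leaves only
            the corner of the square.\<close>
          have "Re (1 * W) \<le> 0" by (rule var) auto
          moreover have "W = of_real K * \<i> * Y" unfolding W_def w0 by (simp add: s0)
          ultimately have "0 \<le> K * Im Y" by simp
          then have "0 \<le> Im Y" using \<mu> by (simp add: zero_le_mult_iff)
          then show ?thesis using y by (simp add: Y_def z0 complex_eq_iff)
        qed (use b in auto)
      qed
    next
      case 2
      show ?thesis
      proof (rule axis_deriv_left[OF 2])
        fix K assume K: "K > 0" "w (of_real r) = of_real K * \<i>"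
        have W: "W = Complex (- K * ((1 - r\<^sup>2) * Im Y)) (K * ((1 + r\<^sup>2) * Re Y))"
          unfolding W_def sr K(2) by (simp add: complex_eq_iff algebra_simps flip: of_real_power)
        have "Re (1 * W) \<le> 0" "Re ((-1) * W) \<le> 0" by (rule var; use 2 in \<open>simp add: sr\<close>)+
        then have "K * ((1 - r\<^sup>2) * Im Y) = 0" by (simp add: W)
        then have "Im Y = 0" using K r2 by simp
        moreover have "Re (\<i> * W) \<le> 0" by (rule var; use 2 in \<open>simp add: sr\<close>)
        then have "0 \<le> K * ((1 + r\<^sup>2) * Re Y)" by (simp add: W)
        then have "0 \<le> Re Y" using K r2 by (simp add: zero_le_mult_iff)
        moreover have "Re Y \<le> 0" using y on_left_axis(1)[of r] 2 by (simp add: Y_def sr)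
        ultimately show ?thesis by (simp add: complex_eq_iff)
      qed
    next
      case 3
      show ?thesis
      proof (rule axis_deriv_right[OF 3 r(2)])
        fix K assume K: "K > 0" "w (of_real r) = - of_real K"
        have W: "W = Complex (- K * ((1 + r\<^sup>2) * Re Y)) (- K * ((1 - r\<^sup>2) * Im Y))"
          unfolding W_def sr K(2) by (simp add: complex_eq_iff algebra_simps flip: of_real_power)
        have p: "0 < r" using 3 b by simp
        have "Re (1 * W) \<le> 0" "Re ((-1) * W) \<le> 0" by (rule var; use p in \<open>simp add: sr\<close>)+
        then have "K * ((1 + r\<^sup>2) * Re Y) = 0" by (simp add: W)
        then have "Re Y = 0" using K r2 by simp
        moreover have "Re (\<i> * W) \<le> 0" by (rule var; use p in \<open>simp add: sr\<close>)
        then have "K * ((1 - r\<^sup>2) * Im Y) \<le> 0" by (simp add: W)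
        then have "Im Y \<le> 0" using K r2 by (simp add: mult_le_0_iff)
        moreover have "0 \<le> Im Y" using y on_right_axis(1)[of r] 3 r by (simp add: Y_def sr)
        ultimately show ?thesis by (simp add: complex_eq_iff)
      qed
    qed
  next
    case Im: False
    show ?thesis
    proof (cases "Im s = Re s")
      case True
      define r where "r = norm s"
      have "(norm s)\<^sup>2 = 2 * (Re s)\<^sup>2" using True by (simp add: cmod_power2)
      then have "norm s = sqrt 2 * Re s"
        using sec Im True by (metis norm_ge_zero real_sqrt_abs2 real_sqrt_mult real_sqrt_power abs_of_nonneg real_sqrt_unique)
      then have sr: "s = of_real r * cis (pi / 4)"
        using True by (simp add: r_def complex_eq_iff cos_45 sin_45)
      have r: "0 < r" "r < 1" using Im s by (auto simp: r_def)
      have r2: "0 < 1 - r\<^sup>2" "0 < 1 + r\<^sup>2" using r by (auto simp: abs_square_less_1 add_pos_nonneg)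
      show ?thesis
      proof (rule diagonal_deriv[OF r])
        fix K assume K: "K > 0" "w (of_real r * cis (pi / 4)) = of_real K * \<i>"
        have s2: "s\<^sup>2 = of_real (r\<^sup>2) * \<i>"
          unfolding sr power_mult_distrib cis_pi4_squared by simp
        have W: "W = Complex (- K * (Im Y + r\<^sup>2 * Re Y)) (K * (Re Y + r\<^sup>2 * Im Y))"
          unfolding W_def s2 K(2)[folded sr] by (simp add: complex_eq_iff algebra_simps flip: of_real_power)
        \<comment> \<open>1 + i is tangential to the diagonal edge and may be reversed, 1 - i points
          into the sector.\<close>
        have "Re ((1 + \<i>) * W) \<le> 0" "Re (- (1 + \<i>) * W) \<le> 0" by (rule var; use Im in simp)+
        then have "K * ((1 + r\<^sup>2) * (Re Y + Im Y)) = 0" by (simp add: W algebra_simps)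
        then have 1: "Re Y + Im Y = 0" using K r2 by simp
        have "Re ((1 - \<i>) * W) \<le> 0" by (rule var; use Im in simp)
        then have "K * ((1 - r\<^sup>2) * (Re Y - Im Y)) \<le> 0" by (simp add: W algebra_simps)
        then have "Re Y - Im Y \<le> 0" using K r2 by (simp add: mult_le_0_iff)
        moreover have "0 \<le> Re Y - Im Y" using y on_diagonal(1)[of r] r by (simp add: Y_def sr)
        ultimately show ?thesis using 1 by (simp add: complex_eq_iff)
      qed
    next
      case False
      have "Re (1 * W) \<le> 0" "Re ((-1) * W) \<le> 0" "Re (\<i> * W) \<le> 0" "Re (- \<i> * W) \<le> 0"
        by (rule var; use Im False in simp)+
      then have "W = 0" by (simp add: complex_eq_iff)
      moreover have "w s \<noteq> 0"
        by (rule w_quadrant[OF s(1) \<open>s \<noteq> of_real b\<close>]) (auto simp: cis_neq_zero)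
      ultimately have "Y = - (s\<^sup>2 * cnj Y)" by (simp add: W_def eq_neg_iff_add_eq_0)
      then have "norm Y = (norm s)\<^sup>2 * norm Y"
        by (metis complex_mod_cnj norm_minus_cancel norm_mult norm_power)
      then show ?thesis using ns by auto
    qed
  qed
  then show ?thesis by (simp add: Y_def)
qed

end

section \<open>Suprema of compact families of affine functions\<close>

definition supaff :: "('a::euclidean_space \<times> real) set \<Rightarrow> 'a \<Rightarrow> real" where
  "supaff K x = (SUP (q, t)\<in>K. q \<bullet> x - t)"

text \<open>A maximising affine function is remembered by its slope only, since the slope is the
  candidate for the gradient; different intercept data with equal slope need not be told
  apart.\<close>

definition maximal :: "('a::euclidean_space \<times> real) set \<Rightarrow> 'a \<Rightarrow> 'a \<Rightarrow> bool" where
  "maximal K x q \<longleftrightarrow> (\<exists>t. (q, t) \<in> K \<and> q \<bullet> x - t = supaff K x)"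

context
  fixes K :: "('a::euclidean_space \<times> real) set"
  assumes K: "compact K" "K \<noteq> {}"
begin

lemma supaff_bdd: "bdd_above ((\<lambda>(q, t). q \<bullet> x - t) ` K)"
proof -
  have "compact ((\<lambda>(q, t). q \<bullet> x - t) ` K)"
    by (intro compact_continuous_image K) (auto simp: split_beta intro!: continuous_intros)
  then show ?thesis by (intro bounded_imp_bdd_above compact_imp_bounded)
qed

lemma supaff_upper: "(q, t) \<in> K \<Longrightarrow> q \<bullet> x - t \<le> supaff K x"
  unfolding supaff_def using supaff_bdd[of x] by (force intro: cSUP_upper2)

lemma maximal_exists:
  obtains q t where "(q, t) \<in> K" "q \<bullet> x - t = supaff K x"
proof -
  have "continuous_on K (\<lambda>(q, t). q \<bullet> x - t)" by (auto simp: split_beta intro!: continuous_intros)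
  from continuous_attains_sup[OF K this] obtain z where z: "z \<in> K"
    "\<And>y. y \<in> K \<Longrightarrow> (case y of (q, t) \<Rightarrow> q \<bullet> x - t) \<le> (case z of (q, t) \<Rightarrow> q \<bullet> x - t)" by blast
  have "supaff K x = (case z of (q, t) \<Rightarrow> q \<bullet> x - t)"
    unfolding supaff_def using z by (intro antisym cSUP_least K cSUP_upper supaff_bdd) auto
  with z(1) show ?thesis by (cases z) (auto intro: that)
qed

lemma supaff_convex: "convex_on UNIV (supaff K)"
proof (rule convex_onI)
  fix t :: real and x y assume t: "0 < t" "t < 1"
  obtain q s where q: "(q, s) \<in> K" "q \<bullet> ((1 - t) *\<^sub>R x + t *\<^sub>R y) - s = supaff K ((1 - t) *\<^sub>R x + t *\<^sub>R y)"
    by (rule maximal_exists)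
  have "q \<bullet> ((1 - t) *\<^sub>R x + t *\<^sub>R y) - s = (1 - t) * (q \<bullet> x - s) + t * (q \<bullet> y - s)"
    by (simp add: inner_add_right algebra_simps)
  also have "\<dots> \<le> (1 - t) * supaff K x + t * supaff K y"
    using t q(1) by (intro add_mono mult_left_mono supaff_upper) auto
  finally show "supaff K ((1 - t) *\<^sub>R x + t *\<^sub>R y) \<le> (1 - t) * supaff K x + t * supaff K y"
    using q(2) by simp
qed simp

text \<open>By compactness, maximisers at points tending to x subconverge to a maximiser at x, and
  uniqueness identifies its slope as p. The same statement gives continuity of the gradient.\<close>

lemma maximal_closed:
  assumes u: "\<And>q. maximal K x q \<Longrightarrow> q = p" and e: "e > 0"
  obtains d where "d > 0" "\<And>y q. dist y x < d \<Longrightarrow> maximal K y q \<Longrightarrow> dist q p < e"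
proof (rule ccontr)
  assume "\<not> thesis"
  with that have "\<forall>d>0. \<exists>y q. dist y x < d \<and> maximal K y q \<and> e \<le> dist q p" by (meson not_le)
  then have "\<forall>n. \<exists>y q. dist y x < 1 / real (Suc n) \<and> maximal K y q \<and> e \<le> dist q p" by simp
  then obtain y q where y: "\<And>n. dist (y n) x < 1 / real (Suc n)" and q: "\<And>n. maximal K (y n) (q n)" "\<And>n. e \<le> dist (q n) p"
    by metis
  from q(1) obtain t where t: "\<And>n. (q n, t n) \<in> K" "\<And>n. q n \<bullet> y n - t n = supaff K (y n)"
    unfolding maximal_def by metis
  have "seq_compact K" using K(1) by (simp add: compact_eq_seq_compact_metric)
  then obtain l r where l: "l \<in> K" "strict_mono (r :: nat \<Rightarrow> nat)" "((\<lambda>n. (q n, t n)) \<circ> r) \<longlonglongrightarrow> l"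
    using t(1) unfolding seq_compact_def by (metis (no_types, lifting))
  have ylim: "y \<longlonglongrightarrow> x"
  proof (rule tendsto_dist_iff[THEN iffD2], rule tendsto_sandwich[OF _ _ tendsto_const])
    show "(\<lambda>n. 1 / real (Suc n)) \<longlonglongrightarrow> 0" by (rule LIMSEQ_Suc[OF lim_1_over_n])
    show "\<forall>\<^sub>F n in sequentially. dist (y n) x \<le> 1 / real (Suc n)"
      using y by (intro always_eventually allI less_imp_le)
  qed auto
  have yr: "(\<lambda>n. y (r n)) \<longlonglongrightarrow> x" using LIMSEQ_subseq_LIMSEQ[OF ylim l(2)] by (simp add: o_def)
  obtain q0 t0 where q0: "l = (q0, t0)" by (cases l)
  have qr: "(\<lambda>n. q (r n)) \<longlonglongrightarrow> q0" and tr: "(\<lambda>n. t (r n)) \<longlonglongrightarrow> t0"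
    using tendsto_fst[OF l(3)] tendsto_snd[OF l(3)] by (simp_all add: q0 o_def)
  have "q' \<bullet> x - t' \<le> q0 \<bullet> x - t0" if "(q', t') \<in> K" for q' t'
  proof (rule LIMSEQ_le)
    show "(\<lambda>n. q' \<bullet> y (r n) - t') \<longlonglongrightarrow> q' \<bullet> x - t'" by (intro tendsto_intros yr)
    show "(\<lambda>n. q (r n) \<bullet> y (r n) - t (r n)) \<longlonglongrightarrow> q0 \<bullet> x - t0" by (intro tendsto_intros qr yr tr)
    show "\<exists>N. \<forall>n\<ge>N. q' \<bullet> y (r n) - t' \<le> q (r n) \<bullet> y (r n) - t (r n)"
      using supaff_upper[OF that] t(2) by auto
  qed
  then have "supaff K x \<le> q0 \<bullet> x - t0" using maximal_exists[of x] by metis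
  then have "maximal K x q0" unfolding maximal_def using supaff_upper[of q0 t0 x] l(1) q0 by (intro exI[of _ t0]) auto
  then have "q0 = p" by (rule u)
  moreover have "e \<le> dist q0 p"
    using tendsto_dist[OF qr tendsto_const, of p] q(2) by (intro LIMSEQ_le_const) auto
  ultimately show False using e by simp
qed

text \<open>Danskin's argument: the error of the linear approximation with slope p lies between 0
  and the inner product of q - p with y - x, where q is maximal at y, and q tends to p.\<close>

lemma supaff_has_derivative:
  assumes u: "\<And>q. maximal K x q \<Longrightarrow> q = p"
  shows "(supaff K has_derivative (\<lambda>h. p \<bullet> h)) (at x)"
proof -
  obtain q0 t0 where "(q0, t0) \<in> K" "q0 \<bullet> x - t0 = supaff K x" by (rule maximal_exists)
  with u[of q0] have p: "(p, t0) \<in> K" "p \<bullet> x - t0 = supaff K x" by (auto simp: maximal_def)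
  show ?thesis
    unfolding has_derivative_at_within_iff_Ex has_derivative_within_alt
  proof (safe intro!: bounded_linear_inner_right)
    fix e :: real assume "0 < e"
    then obtain d where d: "d > 0" "\<And>y q. dist y x < d \<Longrightarrow> maximal K y q \<Longrightarrow> dist q p < e"
      using maximal_closed[OF u] by metis
    show "\<exists>d>0. \<forall>y\<in>UNIV. norm (y - x) < d \<longrightarrow> norm (supaff K y - supaff K x - p \<bullet> (y - x)) \<le> e * norm (y - x)"
    proof (intro exI[of _ d] conjI d ballI impI)
      fix y assume y: "norm (y - x) < d"
      obtain q t where q: "(q, t) \<in> K" "q \<bullet> y - t = supaff K y" by (rule maximal_exists)
      then have "dist q p < e" using d(2)[of y q] y by (auto simp: maximal_def dist_norm)
      have "0 \<le> supaff K y - supaff K x - p \<bullet> (y - x)"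
        using supaff_upper[OF p(1), of y] p(2) by (simp add: inner_diff_right)
      moreover have "supaff K y - supaff K x - p \<bullet> (y - x) \<le> (q - p) \<bullet> (y - x)"
        using supaff_upper[OF q(1), of x] q(2) by (simp add: inner_diff_right inner_diff_left)
      moreover have "(q - p) \<bullet> (y - x) \<le> e * norm (y - x)"
        using norm_cauchy_schwarz[of "q - p" "y - x"] \<open>dist q p < e\<close>
        by (smt (verit) dist_norm mult_right_mono norm_ge_zero)
      ultimately show "norm (supaff K y - supaff K x - p \<bullet> (y - x)) \<le> e * norm (y - x)" by simp
    qed
  qed
qed

end

context hodograph
begin

section \<open>The solution of the obstacle problem\<close>

definition unit4 :: "complex set" where "unit4 = {1, \<i>, -1, - \<i>}"

text \<open>The orbit of the family under the symmetries of the square, generated by multiplication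
  by i and by conjugation. For x in the chamber the added members never exceed the original ones, by
  the rearrangement inequality.\<close>

definition KK :: "(complex \<times> real) set" where
  "KK = (\<lambda>(c, s). (c * pp s, Phi s)) ` (unit4 \<times> sector) \<union> (\<lambda>(c, s). (c * cnj (pp s), Phi s)) ` (unit4 \<times> sector)"

definition uu :: "complex \<Rightarrow> real" where "uu = supaff KK"

text \<open>A selection of maximal slopes. Where the slope is unique, it is the gradient of
  \<open>uu\<close> and depends continuously on the point.\<close>

definition gu :: "complex \<Rightarrow> complex" where "gu x = (SOME q. maximal KK x q)"

definition uniq :: "complex \<Rightarrow> bool" where
  "uniq x \<longleftrightarrow> (\<forall>q q'. maximal KK x q \<longrightarrow> maximal KK x q' \<longrightarrow> q = q')"

lemma compact_sector: "compact sector"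
proof -
  have "closed sector"
    unfolding sector_def by (intro closed_Collect_conj closed_Collect_le continuous_intros)
  moreover have "bounded sector" by (rule boundedI[of _ 1]) (auto simp: sector_def)
  ultimately show ?thesis by (simp add: compact_eq_bounded_closed)
qed

lemma KK_compact: "compact KK" and KK_nonempty: "KK \<noteq> {}"
proof -
  have "compact (unit4 \<times> sector)"
    by (intro compact_Times compact_sector) (simp add: unit4_def)
  moreover have "continuous_on (unit4 \<times> sector) (\<lambda>(c, s). (c * pp s, Phi s))"
    "continuous_on (unit4 \<times> sector) (\<lambda>(c, s). (c * cnj (pp s), Phi s))"
    unfolding split_beta
    by (intro continuous_intros continuous_on_compose2[OF pp_cont] continuous_on_compose2[OF Phi_cont]; auto)+
  ultimately show "compact KK" unfolding KK_def by (intro compact_Un compact_continuous_image)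
  have "(1, 0) \<in> unit4 \<times> sector" by (simp add: unit4_def sector_def)
  then show "KK \<noteq> {}" unfolding KK_def by blast
qed

lemmas uu_upper = supaff_upper[OF KK_compact KK_nonempty, folded uu_def]
lemmas uu_attained = maximal_exists[OF KK_compact KK_nonempty, folded uu_def]
lemmas uu_convex = supaff_convex[OF KK_compact KK_nonempty, folded uu_def]

lemma maximal_KK: "maximal KK x q \<longleftrightarrow> (\<exists>t. (q, t) \<in> KK \<and> q \<bullet> x - t = uu x)"
  by (simp add: maximal_def uu_def)

lemma gu_maximal: "maximal KK x (gu x)"
  unfolding gu_def by (rule someI_ex) (metis maximal_KK uu_attained)

lemma gu_eqI: "uniq x \<Longrightarrow> maximal KK x q \<Longrightarrow> gu x = q"
  using gu_maximal unfolding uniq_def by blast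

lemma uu_has_derivative: "uniq x \<Longrightarrow> (uu has_derivative (\<lambda>h. gu x \<bullet> h)) (at x)"
  unfolding uu_def
  by (rule supaff_has_derivative[OF KK_compact KK_nonempty]) (metis gu_eqI)

lemma gu_continuous: "(\<And>x. x \<in> A \<Longrightarrow> uniq x) \<Longrightarrow> continuous_on A gu"
  unfolding continuous_on_iff
proof safe
  fix x and e :: real assume x: "\<And>x. x \<in> A \<Longrightarrow> uniq x" "x \<in> A" "0 < e"
  then obtain d where d: "d > 0" "\<And>y q. dist y x < d \<Longrightarrow> maximal KK y q \<Longrightarrow> dist q (gu x) < e"
    using maximal_closed[OF KK_compact KK_nonempty, of x "gu x" e] gu_eqI by metis
  then show "\<exists>d>0. \<forall>x'\<in>A. dist x' x < d \<longrightarrow> dist (gu x') (gu x) < e"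
    using gu_maximal by blast
qed

lemma KK_i: "(q, t) \<in> KK \<Longrightarrow> (\<i> * q, t) \<in> KK"
proof -
  have u: "c \<in> unit4 \<Longrightarrow> \<i> * c \<in> unit4" for c by (auto simp: unit4_def)
  assume "(q, t) \<in> KK"
  then consider c s where "c \<in> unit4" "s \<in> sector" "q = c * pp s" "t = Phi s"
    | c s where "c \<in> unit4" "s \<in> sector" "q = c * cnj (pp s)" "t = Phi s" unfolding KK_def by auto
  then show ?thesis
  proof cases
    case 1
    then show ?thesis unfolding KK_def
      by (intro UnI1 image_eqI[of _ _ "(\<i> * c, s)"]) (auto simp: u mult.assoc)
  next
    case 2
    then show ?thesis unfolding KK_def
      by (intro UnI2 image_eqI[of _ _ "(\<i> * c, s)"]) (auto simp: u mult.assoc)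
  qed
qed

lemma KK_cnj: "(q, t) \<in> KK \<Longrightarrow> (cnj q, t) \<in> KK"
proof -
  have u: "c \<in> unit4 \<Longrightarrow> cnj c \<in> unit4" for c by (auto simp: unit4_def)
  assume "(q, t) \<in> KK"
  then consider c s where "c \<in> unit4" "s \<in> sector" "q = c * pp s" "t = Phi s"
    | c s where "c \<in> unit4" "s \<in> sector" "q = c * cnj (pp s)" "t = Phi s" unfolding KK_def by auto
  then show ?thesis
  proof cases
    case 1
    then show ?thesis unfolding KK_def
      by (intro UnI2 image_eqI[of _ _ "(cnj c, s)"]) (auto simp: u)
  next
    case 2
    then show ?thesis unfolding KK_def
      by (intro UnI1 image_eqI[of _ _ "(cnj c, s)"]) (auto simp: u)
  qed
qed

lemma inner_i: "(\<i> * q) \<bullet> (\<i> * x) = q \<bullet> x" and inner_cnj: "cnj q \<bullet> cnj x = q \<bullet> x"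
  by (auto simp: inner_complex_def)

lemma uu_i_le: "uu x \<le> uu (\<i> * x)"
  using uu_attained[of x] KK_i uu_upper inner_i by metis

lemma uu_cnj_le: "uu x \<le> uu (cnj x)"
  using uu_attained[of x] KK_cnj uu_upper inner_cnj by metis

lemma uu_i: "uu (\<i> * x) = uu x"
proof -
  have "uu (\<i> * x) \<le> uu (\<i> * (\<i> * (\<i> * (\<i> * x))))"
    by (rule order_trans[OF uu_i_le order_trans[OF uu_i_le uu_i_le]])
  then show ?thesis using uu_i_le[of x] by simp
qed

lemma uu_cnj: "uu (cnj x) = uu x"
  using uu_cnj_le[of x] uu_cnj_le[of "cnj x"] by simp

lemma maximal_i: "maximal KK x q \<Longrightarrow> maximal KK (\<i> * x) (\<i> * q)"
  unfolding maximal_KK uu_i inner_i using KK_i by blast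

lemma maximal_cnj: "maximal KK x q \<Longrightarrow> maximal KK (cnj x) (cnj q)"
  unfolding maximal_KK uu_cnj inner_cnj using KK_cnj by blast

lemma uniq_i: "uniq x \<Longrightarrow> uniq (\<i> * x)"
proof -
  assume u: "uniq x"
  have *: "maximal KK x (- \<i> * q)" if "maximal KK (\<i> * x) q" for q
    using maximal_i[OF maximal_i[OF maximal_i[OF that]]] by simp
  show ?thesis unfolding uniq_def
  proof safe
    fix q q' assume "maximal KK (\<i> * x) q" "maximal KK (\<i> * x) q'"
    then have "- \<i> * q = - \<i> * q'" using * u unfolding uniq_def by blast
    then show "q = q'" by simp
  qed
qed

lemma uniq_cnj: "uniq x \<Longrightarrow> uniq (cnj x)"
  unfolding uniq_def by (metis maximal_cnj complex_cnj_cnj)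

lemma gu_i: "uniq x \<Longrightarrow> gu (\<i> * x) = \<i> * gu x"
  using gu_eqI uniq_i maximal_i gu_maximal by metis

lemma gu_cnj: "uniq x \<Longrightarrow> gu (cnj x) = cnj (gu x)"
  using gu_eqI uniq_cnj maximal_cnj gu_maximal by metis

section \<open>Reduction to one chamber of the symmetry group\<close>

definition chamber :: "complex set" where
  "chamber = {x. 0 \<le> Im x \<and> Im x \<le> Re x \<and> Re x \<le> 1}"

definition square :: "complex set" where
  "square = {x. \<bar>Re x\<bar> \<le> 1 \<and> \<bar>Im x\<bar> \<le> 1}"

lemma square_induct [consumes 1, case_names chamber i cnj]:
  assumes x: "x \<in> square" and base: "\<And>x. x \<in> chamber \<Longrightarrow> P x"
    and i: "\<And>x. P x \<Longrightarrow> P (\<i> * x)" and cnj: "\<And>x. P x \<Longrightarrow> P (cnj x)"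
  shows "P x"
proof -
  have ref: "P x" if "0 \<le> Re x" "\<bar>Im x\<bar> \<le> Re x" "Re x \<le> 1" for x
  proof (cases "0 \<le> Im x")
    case True
    then show ?thesis using that by (intro base) (auto simp: chamber_def)
  next
    case False
    then have "P (cnj x)" using that by (intro base) (auto simp: chamber_def)
    then show ?thesis using cnj by force
  qed
  have i3: "P x" if "P (\<i> * x)" for x
    using i[OF i[OF i[OF that]]] by simp
  consider "0 \<le> Re x" "\<bar>Im x\<bar> \<le> Re x" | "Re x \<le> 0" "\<bar>Im x\<bar> \<le> - Re x"
    | "0 \<le> Im x" "\<bar>Re x\<bar> \<le> Im x" | "Im x \<le> 0" "\<bar>Re x\<bar> \<le> - Im x" by linarith
  then show ?thesis
  proof cases
    case 1
    then show ?thesis using x by (intro ref) (auto simp: square_def)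
  next
    case 2
    then have "P (\<i> * (\<i> * x))" using x by (intro ref) (auto simp: square_def)
    then show ?thesis by (rule i3[OF i3])
  next
    case 3
    then have "P (\<i> * (\<i> * (\<i> * x)))" using x by (intro ref) (auto simp: square_def)
    then show ?thesis by (rule i3[OF i3[OF i3]])
  next
    case 4
    then have "P (\<i> * x)" using x by (intro ref) (auto simp: square_def)
    then show ?thesis by (rule i3)
  qed
qed

lemma pp_chamber:
  assumes "s \<in> sector"
  shows "0 \<le> Im (pp s)" "Im (pp s) \<le> Re (pp s)" "norm s < 1 \<Longrightarrow> 0 < Re (pp s)"
    "norm s = 1 \<Longrightarrow> pp s = 0" "norm s = 1 \<Longrightarrow> Phi s = 0" "norm s < 1 \<Longrightarrow> 0 < UU s"
  by (rule sector_polar[OF assms]; use Im_pp_nonneg Im_pp_le_Re_pp Re_pp_pos on_arc UU_pos in force)+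

lemma Psi_inner: "Psi x s = pp s \<bullet> x - Phi s"
  by (simp add: Psi_def inner_complex_def)

text \<open>The eight images of p arise by exchanging its coordinates and changing signs. Against an
  x with nonnegative, decreasing coordinates the best image is the one with nonnegative coordinates
  in the same order, which is p.\<close>

lemma rearrangement:
  assumes p: "0 \<le> Im p" "Im p \<le> Re p" and x: "0 \<le> Im x" "Im x \<le> Re x" and c: "c \<in> unit4"
  shows "(c * p) \<bullet> x \<le> p \<bullet> x" "(c * cnj p) \<bullet> x \<le> p \<bullet> x"
proof -
  have "0 \<le> (Re p - Im p) * (Re x - Im x)" "0 \<le> Re p * Re x" "0 \<le> Im p * Im x" "0 \<le> Re p * Im x" "0 \<le> Im p * Re x"
    using assms by auto
  then show "(c * p) \<bullet> x \<le> p \<bullet> x" "(c * cnj p) \<bullet> x \<le> p \<bullet> x"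
    using c by (auto simp: unit4_def inner_complex_def algebra_simps)
qed

text \<open>Ties in the rearrangement inequality need x on a mirror line of the chamber. The
  conditions \<open>st\<close> then put p on the same line, so the tied image is p itself.\<close>

lemma rearrangement_eq:
  assumes p: "0 \<le> Im p" "Im p \<le> Re p" "0 < Re p" and x: "0 \<le> Im x" "Im x \<le> Re x" "0 < Re x"
    and st: "Im x = 0 \<Longrightarrow> Im p = 0" "Re x = Im x \<Longrightarrow> Re p = Im p" and c: "c \<in> unit4"
    and q: "q = c * p \<or> q = c * cnj p" "q \<bullet> x = p \<bullet> x"
  shows "q = p"
proof -
  \<comment> \<open>The images without exchange of coordinates; the exchanged ones reduce to these,
    because a tie there forces Re p = Im p.\<close>
  have unsw: "q = p" if "Re q = Re p \<or> Re q = - Re p" "Im q = Im p \<or> Im q = - Im p"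
  proof -
    have "0 \<le> (Re p - Re q) * Re x" "0 \<le> (Im p - Im q) * Im x" using that p x by auto
    moreover have "(Re p - Re q) * Re x + (Im p - Im q) * Im x = 0"
      using q(2) by (simp add: inner_complex_def algebra_simps)
    ultimately have "(Re p - Re q) * Re x = 0" "(Im p - Im q) * Im x = 0" by linarith+
    then have "Re q = Re p" "Im q = Im p \<or> Im x = 0" using x by auto
    moreover have "Im q = Im p" if "Im x = 0" using st(1)[OF that] \<open>Im q = Im p \<or> Im q = - Im p\<close> by auto
    ultimately show ?thesis by (auto simp: complex_eq_iff)
  qed
  have "(Re q = Re p \<or> Re q = - Re p) \<and> (Im q = Im p \<or> Im q = - Im p) \<or>
      (Re q = Im p \<or> Re q = - Im p) \<and> (Im q = Re p \<or> Im q = - Re p)"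
    using q(1) c by (auto simp: unit4_def)
  then show ?thesis
  proof
    assume "(Re q = Im p \<or> Re q = - Im p) \<and> (Im q = Re p \<or> Im q = - Re p)"
    then have sw: "Re q = Im p \<or> Re q = - Im p" "Im q = Re p \<or> Im q = - Re p" by auto
    have "Re q * Re x \<le> Im p * Re x" "Im q * Im x \<le> Re p * Im x"
      using sw p x by (auto intro!: mult_right_mono)
    moreover have "Re q * Re x + Im q * Im x = Re p * Re x + Im p * Im x"
      using q(2) by (simp add: inner_complex_def)
    moreover have "0 \<le> (Re p - Im p) * (Re x - Im x)" using p x by simp
    ultimately have "(Re p - Im p) * (Re x - Im x) = 0" by (simp add: algebra_simps)
    then have "Re p = Im p" using st(2) by auto
    then show ?thesis using sw by (intro unsw) auto
  qed (use unsw in blast)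
qed

text \<open>A point on a mirror line of the square can have a unique maximal slope only if the slope
  lies on that line too. Points of the sector are sorted by the edges they lie on; on the side of
  the square, injectivity of \<open>zz\<close> shows that only s = 0 reaches the diagonal.\<close>

lemma stabiliser:
  assumes s: "s \<in> sector" "norm s < 1"
  shows "0 < Re (zz s)" "Im (zz s) = 0 \<Longrightarrow> Im (pp s) = 0" "Re (zz s) = Im (zz s) \<Longrightarrow> Re (pp s) = Im (pp s)"
    "0 < Im (zz s) \<Longrightarrow> Im (zz s) < Re (zz s) \<Longrightarrow> Re (zz s) < 1 \<Longrightarrow> 0 < Im s \<and> Im s < Re s"
proof -
  have sec: "0 \<le> Im s" "Im s \<le> Re s" using s by (auto simp: sector_def)
  have zpG: "Re (zz s) = Re (pp s) - Re (Ga s)" by (simp add: zz_def pp_def)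
  have pos: "0 < Re (pp s)" using pp_chamber(3)[OF s] .
  consider "s = 0" | "0 < Im s" "Im s < Re s" | "0 < Im s" "Im s = Re s"
    | "Im s = 0" "0 < Re s" "Re s < b" | "Im s = 0" "b \<le> Re s"
    using sec by (force simp: complex_eq_iff)
  then have "0 < Re (zz s) \<and> (Im (zz s) = 0 \<longrightarrow> Im (pp s) = 0) \<and> (Re (zz s) = Im (zz s) \<longrightarrow> Re (pp s) = Im (pp s))
    \<and> (0 < Im (zz s) \<longrightarrow> Im (zz s) < Re (zz s) \<longrightarrow> Re (zz s) < 1 \<longrightarrow> 0 < Im s \<and> Im s < Re s)"
  proof cases
    case 1
    then show ?thesis by (simp add: zz_def pp_def om_0 Ga_0)
  next
    case 2
    then show ?thesis using Im_zz_pos[OF s(1)] Im_zz_less_Re_zz[OF s(1)] by auto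
  next
    case 3
    have "s = of_real (norm s) * cis (pi / 4)"
    proof (rule sector_polar[OF s(1)])
      fix \<rho> \<alpha> assume a: "0 \<le> \<rho>" "\<rho> \<le> 1" "0 \<le> \<alpha>" "\<alpha> \<le> pi / 4" "s = of_real \<rho> * cis \<alpha>" "norm s = \<rho>"
      have "\<rho> * sin \<alpha> = \<rho> * cos \<alpha>" "0 < \<rho>" using a 3 by (auto simp: zero_less_mult_iff)
      then have e: "sin \<alpha> = cos \<alpha>" by simp
      have "\<not> \<alpha> < pi / 4"
      proof
        assume "\<alpha> < pi / 4"
        then have "sin \<alpha> < sin (pi / 4)" "cos (pi / 4) < cos \<alpha>"
          using a by (auto intro!: sin_monotone_2pi cos_monotone_0_pi)
        then show False using e by (simp add: sin_45 cos_45)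
      qed
      then have "\<alpha> = pi / 4" using a by simp
      then show ?thesis using a(5,6) by metis
    qed
    then obtain \<rho> where \<rho>: "s = of_real \<rho> * cis (pi / 4)" "0 \<le> \<rho>" "\<rho> \<le> 1" using s by (metis norm_ge_zero less_imp_le)
    note d = on_diagonal[OF \<rho>(2,3), folded \<rho>(1)]
    have "0 < Re (zz s)" using d(3) pos zpG by linarith
    with d show ?thesis by auto
  next
    case 4
    then have "s = of_real (Re s)" by (simp add: complex_eq_iff)
    then obtain \<rho> where \<rho>: "s = of_real \<rho>" "0 < \<rho>" "\<rho> < b" using 4 by metis
    have z: "Re (zz s) = 1" "0 < Im (zz s)" using on_left_axis[of \<rho>] \<rho> by auto
    have "Re (zz s) \<noteq> Im (zz s)"
    proof
      assume "Re (zz s) = Im (zz s)"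
      then have "zz s = zz 0" using z by (simp add: complex_eq_iff zz_def om_0)
      moreover have "0 \<in> sector" by (simp add: sector_def)
      ultimately have "s = 0" using zz_inj s by (auto dest: inj_onD)
      then show False using \<rho> by simp
    qed
    with z show ?thesis by auto
  next
    case 5
    then have "s = of_real (Re s)" by (simp add: complex_eq_iff)
    moreover have "Re s \<le> 1" using s complex_Re_le_cmod[of s] by linarith
    ultimately obtain \<rho> where \<rho>: "s = of_real \<rho>" "b \<le> \<rho>" "\<rho> \<le> 1" using 5 by metis
    note d = on_right_axis[OF \<rho>(2,3), folded \<rho>(1)]
    have "0 < Re (zz s)" using d(3) pos zpG by linarith
    with d show ?thesis by auto
  qed
  then show "0 < Re (zz s)" "Im (zz s) = 0 \<Longrightarrow> Im (pp s) = 0" "Re (zz s) = Im (zz s) \<Longrightarrow> Re (pp s) = Im (pp s)"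
    "0 < Im (zz s) \<Longrightarrow> Im (zz s) < Re (zz s) \<Longrightarrow> Re (zz s) < 1 \<Longrightarrow> 0 < Im s \<and> Im s < Re s" by auto
qed

text \<open>A maximal slope comes from some s. If |s| < 1, then \<open>zz s\<close> is x and the
  value is \<open>UU s\<close> > 0; if |s| = 1, slope and value are 0. The two cases cannot mix, and
  injectivity of \<open>zz\<close> makes the slope unique. That \<open>zz\<close> covers the
  positivity set is a by-product: a maximiser exists by compactness, and it parametrises its
  point.\<close>

lemma chamber_dichotomy:
  assumes x: "x \<in> chamber"
  shows "uniq x" "0 \<le> uu x" "uu x = 0 \<Longrightarrow> gu x = 0"
    "uu x > 0 \<Longrightarrow> \<exists>s\<in>sector. norm s < 1 \<and> zz s = x \<and> gu x = pp s"
proof -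
  have xc: "0 \<le> Im x" "Im x \<le> Re x" "Re x \<le> 1" using x by (auto simp: chamber_def)
  have KK_cases: "\<exists>c s. c \<in> unit4 \<and> s \<in> sector \<and> (q = c * pp s \<or> q = c * cnj (pp s)) \<and> t = Phi s" if "(q, t) \<in> KK" for q t
    using that unfolding KK_def by auto
  have inKK: "(pp s, Phi s) \<in> KK" if "s \<in> sector" for s
    using that unfolding KK_def by (intro UnI1 image_eqI[of _ _ "(1, s)"]) (auto simp: unit4_def)
  have Psi_le: "Psi x s \<le> uu x" if "s \<in> sector" for s
    using uu_upper[OF inKK[OF that], of x] by (simp add: Psi_inner)
  have one: "1 \<in> sector" by (simp add: sector_def)
  have "Psi x 1 = 0" using pp_chamber(4,5)[OF one] by (simp add: Psi_def)
  then show nn: "0 \<le> uu x" using Psi_le[OF one] by simp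
  have mx: "\<exists>c s. c \<in> unit4 \<and> s \<in> sector \<and> (q = c * pp s \<or> q = c * cnj (pp s)) \<and> Psi x s = uu x \<and> q \<bullet> x = pp s \<bullet> x"
    if m: "maximal KK x q" for q
  proof -
    obtain t where t: "(q, t) \<in> KK" "q \<bullet> x - t = uu x" using m unfolding maximal_KK by blast
    obtain c s where c: "c \<in> unit4" "s \<in> sector" "q = c * pp s \<or> q = c * cnj (pp s)" "t = Phi s"
      using KK_cases[OF t(1)] by blast
    have "q \<bullet> x \<le> pp s \<bullet> x"
      using rearrangement[OF pp_chamber(1,2)[OF c(2)] xc(1,2) c(1)] c(3) by auto
    then show ?thesis using c t Psi_le[OF c(2)] by (intro exI[of _ c] exI[of _ s]) (auto simp: Psi_inner)
  qed
  have inner_s: "zz s = x \<and> 0 < uu x" if "s \<in> sector" "norm s < 1" "Psi x s = uu x" for s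
  proof -
    have "zz s = x" using that Psi_le xc by (intro maximiser_eq) auto
    then show ?thesis using pp_chamber(6)[OF that(1,2)] that(3) by (simp add: UU_def)
  qed
  have norm1: "norm s = 1 \<or> norm s < 1" if "s \<in> sector" for s using that by (auto simp: sector_def)
  have outer_s: "pp s = 0 \<and> uu x = 0" if "s \<in> sector" "norm s = 1" "Psi x s = uu x" for s
    using pp_chamber(4,5)[OF that(1,2)] that(3) by (simp add: Psi_def)
  have zero: "q = 0" if m: "maximal KK x q" and u0: "uu x = 0" for q
    using mx[OF m] inner_s outer_s norm1 u0 by (metis complex_cnj_zero less_irrefl mult_zero_right)
  have pos: "\<exists>s\<in>sector. norm s < 1 \<and> zz s = x \<and> q = pp s" if m: "maximal KK x q" and u0: "uu x > 0" for q
  proof -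
    obtain c s where c: "c \<in> unit4" "s \<in> sector" "q = c * pp s \<or> q = c * cnj (pp s)" "Psi x s = uu x" "q \<bullet> x = pp s \<bullet> x"
      using mx[OF m] by blast
    have n: "norm s < 1" using norm1[OF c(2)] outer_s[OF c(2) _ c(4)] u0 by auto
    have z: "zz s = x" using inner_s[OF c(2) n c(4)] by simp
    note st = stabiliser[OF c(2) n, unfolded z]
    have "q = pp s"
      by (rule rearrangement_eq[OF pp_chamber(1,2)[OF c(2)] pp_chamber(3)[OF c(2) n] xc(1,2) st(1-3) c(1) c(3,5)])
    with c n z show ?thesis by blast
  qed
  show u: "uniq x"
    unfolding uniq_def
  proof safe
    fix q q' assume q: "maximal KK x q" "maximal KK x q'"
    show "q = q'"
    proof (cases "uu x = 0")
      case True
      then show ?thesis using zero q by metis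
    next
      case False
      then have "uu x > 0" using nn by simp
      then obtain s s' where "s \<in> sector" "zz s = x" "q = pp s" "s' \<in> sector" "zz s' = x" "q' = pp s'"
        using pos q by metis
      then show ?thesis using zz_inj by (metis inj_onD)
    qed
  qed
  show "uu x = 0 \<Longrightarrow> gu x = 0" using zero gu_maximal by blast
  show "uu x > 0 \<Longrightarrow> \<exists>s\<in>sector. norm s < 1 \<and> zz s = x \<and> gu x = pp s" using pos gu_maximal by blast
qed

lemma square_uniq: "x \<in> square \<Longrightarrow> uniq x"
  by (induction x rule: square_induct) (auto intro: chamber_dichotomy uniq_i uniq_cnj)

lemma square_uu_nonneg: "x \<in> square \<Longrightarrow> 0 \<le> uu x"
  by (induction x rule: square_induct) (auto simp: uu_i uu_cnj intro: chamber_dichotomy)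

lemma square_gu_zero: "x \<in> square \<Longrightarrow> uu x = 0 \<Longrightarrow> gu x = 0"
proof -
  assume x: "x \<in> square" "uu x = 0"
  have "uniq x \<and> (uu x = 0 \<longrightarrow> gu x = 0)"
    using x(1) by (induction x rule: square_induct)
      (auto simp: uu_i uu_cnj gu_i gu_cnj intro: chamber_dichotomy uniq_i uniq_cnj)
  with x show ?thesis by simp
qed


lemma Psi_le_uu: "s \<in> sector \<Longrightarrow> Psi x s \<le> uu x"
proof -
  assume "s \<in> sector"
  then have "(pp s, Phi s) \<in> KK"
    unfolding KK_def by (intro UnI1 image_eqI[of _ _ "(1, s)"]) (auto simp: unit4_def)
  from uu_upper[OF this, of x] show ?thesis by (simp add: Psi_inner)
qed

text \<open>The intermediate value theorem produces a preimage of x on the segment from 0 to b,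
  where \<open>UU\<close> is positive and Re pp is 2/3; by injectivity it is the parameter of the
  maximal slope.\<close>

lemma chamber_right_side:
  assumes x: "x \<in> chamber" "Re x = 1"
  shows "0 < uu x" "Re (gu x) = 2 / 3"
proof -
  have "\<exists>\<rho>\<ge>0. \<rho> \<le> b \<and> Im (zz (of_real \<rho>)) = Im x"
  proof (rule IVT2')
    show "Im (zz (of_real b)) \<le> Im x" "Im x \<le> Im (zz (of_real 0))"
      using x by (auto simp: zz_def om_b om_0 chamber_def)
    show "continuous_on {0..b} (\<lambda>\<rho>. Im (zz (of_real \<rho>)))"
      by (intro Im_c axisc zz_cont) (use b in auto)
  qed (use b in auto)
  then obtain \<rho> where \<rho>: "0 \<le> \<rho>" "\<rho> \<le> b" "Im (zz (of_real \<rho>)) = Im x" by blast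
  have z: "zz (of_real \<rho>) = x" using \<rho> on_left_axis(1)[OF \<rho>(1,2)] x by (simp add: complex_eq_iff)
  have sec: "of_real \<rho> \<in> sector" "norm (complex_of_real \<rho>) < 1" using \<rho> b by (auto simp: sector_def)
  have "0 < UU (of_real \<rho>)" by (rule pp_chamber(6)[OF sec])
  also have "\<dots> \<le> uu x" using Psi_le_uu[OF sec(1), of x] z by (simp add: UU_def)
  finally show pos: "0 < uu x" .
  obtain s where s: "s \<in> sector" "zz s = x" "gu x = pp s" using chamber_dichotomy(4)[OF x(1) pos] by blast
  then have "s = of_real \<rho>" using z sec zz_inj by (metis inj_onD)
  then show "Re (gu x) = 2 / 3" using s on_left_axis(2)[OF \<rho>(1,2)] by simp
qed

lemma square_sides:
  assumes "x \<in> square"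
  shows "Re x = 1 \<Longrightarrow> 0 < uu x \<and> Re (gu x) = 2 / 3" "Re x = -1 \<Longrightarrow> 0 < uu x \<and> Re (gu x) = - 2 / 3"
    "Im x = 1 \<Longrightarrow> 0 < uu x \<and> Im (gu x) = 2 / 3" "Im x = -1 \<Longrightarrow> 0 < uu x \<and> Im (gu x) = - 2 / 3"
proof -
  have "uniq x \<and> (Re x = 1 \<longrightarrow> 0 < uu x \<and> Re (gu x) = 2 / 3) \<and> (Re x = -1 \<longrightarrow> 0 < uu x \<and> Re (gu x) = - 2 / 3) \<and>
    (Im x = 1 \<longrightarrow> 0 < uu x \<and> Im (gu x) = 2 / 3) \<and> (Im x = -1 \<longrightarrow> 0 < uu x \<and> Im (gu x) = - 2 / 3)"
    using assms
  proof (induction x rule: square_induct)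
    case (chamber x)
    \<comment> \<open>The only point of the chamber with Im x = 1 is the corner, which lies on the
      diagonal, so its second condition follows from the first.\<close>
    have "Im (gu x) = Re (gu x)" if "Im x = 1"
    proof -
      have R: "Re x = 1" using chamber that by (simp add: chamber_def)
      obtain s where s: "s \<in> sector" "norm s < 1" "zz s = x" "gu x = pp s"
        using chamber_dichotomy(4)[OF chamber chamber_right_side(1)[OF chamber R]] by blast
      then show ?thesis using stabiliser(3)[OF s(1,2)] R that by simp
    qed
    then show ?case using chamber_right_side[OF chamber] chamber_dichotomy(1)[OF chamber] chamber
      by (auto simp: chamber_def)
  next
    case (i x)
    then show ?case using uniq_i gu_i by (auto simp: uu_i)
  next
    case (cnj x)
    then show ?case using uniq_cnj gu_cnj by (auto simp: uu_cnj)
  qed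
  then show "Re x = 1 \<Longrightarrow> 0 < uu x \<and> Re (gu x) = 2 / 3" "Re x = -1 \<Longrightarrow> 0 < uu x \<and> Re (gu x) = - 2 / 3"
    "Im x = 1 \<Longrightarrow> 0 < uu x \<and> Im (gu x) = 2 / 3" "Im x = -1 \<Longrightarrow> 0 < uu x \<and> Im (gu x) = - 2 / 3" by auto
qed

subsection \<open>Second derivatives\<close>

text \<open>A Hessian v + \<tau> cnj v has trace 2 whatever \<tau> is, so this form contains the
  equation \<Delta>u = 2. The bound on \<tau> bounds the second derivatives.\<close>

definition regular :: "complex \<Rightarrow> bool" where
  "regular x \<longleftrightarrow> (\<exists>\<tau>. norm \<tau> \<le> 1 \<and> (gu has_derivative (\<lambda>v. v + \<tau> * cnj v)) (at x))"

text \<open>With g the holomorphic inverse of om near cnj x, the gradient is y + Ga (g (cnj y)), and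
  Ga composed with g has derivative s^2. The set N is chosen so that the formula holds in a full
  neighbourhood of x.\<close>

lemma chamber_regular:
  assumes x: "0 < Im x" "Im x < Re x" "Re x < 1" "0 < uu x"
  shows "regular x"
proof -
  define I where "I = {s. 0 < Im s \<and> Im s < Re s \<and> norm s < 1}"
  have I: "open I" unfolding I_def by (intro open_Collect_conj open_Collect_less continuous_intros)
  have Isec: "s \<in> sector" "s \<noteq> of_real b" if "s \<in> I" for s using that by (auto simp: I_def sector_def)
  have om_hol: "om holomorphic_on I"
    unfolding holomorphic_on_open[OF I] using om_deriv Isec by blast
  have om_inj: "inj_on om I"
    using zz_inj Isec unfolding inj_on_def zz_def by (metis complex_cnj_cnj)
  obtain g where g: "g holomorphic_on (om ` I)" "\<And>s. s \<in> I \<Longrightarrow> deriv om s * deriv g (om s) = 1"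
    "\<And>s. s \<in> I \<Longrightarrow> g (om s) = s"
    using holomorphic_has_inverse[OF om_hol I om_inj] by metis
  have omI: "open (om ` I)" using open_mapping_thm3[OF om_hol I om_inj] .
  have xch: "x \<in> chamber" using x by (auto simp: chamber_def)
  obtain s where s: "s \<in> sector" "norm s < 1" "zz s = x" using chamber_dichotomy(4)[OF xch x(4)] by blast
  have sI: "s \<in> I" using stabiliser(4)[OF s(1,2)] s x by (auto simp: I_def)
  have omx: "om s = cnj x" using s(3) by (auto simp: zz_def)
  define N where "N = {y. cnj y \<in> om ` I} \<inter> {y. 0 < Im y} \<inter> {y. Im y < Re y} \<inter> {y. Re y < 1} \<inter> {y. 0 < uu y}"
  have uc: "continuous_on UNIV uu"
    by (rule convex_on_continuous[OF open_UNIV uu_convex])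
  have N: "open N"
  proof -
    have "open {y. cnj y \<in> om ` I}"
      using open_vimage[OF omI, of cnj] by (auto simp: vimage_def intro!: continuous_intros)
    then show ?thesis
      unfolding N_def by (intro open_Int open_Collect_less continuous_intros uc)
  qed
  have xN: "x \<in> N" unfolding N_def using sI omx x by (auto intro: image_eqI[of _ _ s])
  have gu_eq: "y + Ga (g (cnj y)) = gu y" if y: "y \<in> N" for y
  proof -
    have "y \<in> chamber" "0 < uu y" using y by (auto simp: N_def chamber_def)
    then obtain s' where s': "s' \<in> sector" "norm s' < 1" "zz s' = y" "gu y = pp s'"
      using chamber_dichotomy(4) by blast
    obtain s'' where s'': "s'' \<in> I" "om s'' = cnj y" using y by (auto simp: N_def)
    have "zz s'' = zz s'" using s'' s' by (simp add: zz_def)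
    then have "s'' = s'" using zz_inj s' Isec(1)[OF s''(1)] by (auto dest: inj_onD)
    then have "g (cnj y) = s'" using g(3)[OF s''(1)] s'' by simp
    then show ?thesis using s' by (simp add: pp_def zz_def)
  qed
  have Dom: "deriv om s = w s" by (rule DERIV_imp_deriv[OF om_deriv[OF Isec[OF sI]]])
  have Dg: "(g has_field_derivative deriv g (cnj x)) (at (cnj x))"
    using holomorphic_derivI[OF g(1) omI] sI omx by (metis image_eqI)
  have wg: "w s * deriv g (cnj x) = 1" using g(2)[OF sI] Dom omx by simp
  have gx: "g (cnj x) = s" using g(3)[OF sI] omx by simp
  have "((\<lambda>y. Ga (g y)) has_field_derivative s\<^sup>2 * w s * deriv g (cnj x)) (at (cnj x))"
    using DERIV_chain2[OF Ga_deriv[OF Isec[OF sI], folded gx] Dg] by (simp add: gx)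
  then have "((\<lambda>y. Ga (g y)) has_field_derivative s\<^sup>2) (at (cnj x))"
    using wg by (simp add: mult.assoc)
  then have "((\<lambda>y. Ga (g (cnj y))) has_derivative (\<lambda>v. s\<^sup>2 * cnj v)) (at x)"
    using has_derivative_compose[OF bounded_linear_imp_has_derivative[OF bounded_linear_cnj], of "\<lambda>y. Ga (g y)" "\<lambda>h. s\<^sup>2 * h" x UNIV]
    by (simp add: has_field_derivative_def)
  from has_derivative_add[OF has_derivative_ident this]
  have "(gu has_derivative (\<lambda>v. v + s\<^sup>2 * cnj v)) (at x)"
    by (rule has_derivative_transform_within_open[OF _ N xN]) (rule gu_eq)
  moreover have "norm (s\<^sup>2) \<le> 1" using s by (simp add: norm_power power_le_one)
  ultimately show ?thesis unfolding regular_def by blast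
qed

lemma open_interior_square: "open {x::complex. \<bar>Re x\<bar> < 1 \<and> \<bar>Im x\<bar> < 1}"
  by (intro open_Collect_conj open_Collect_less continuous_intros)

text \<open>Away from axes and diagonals, symmetry transports the claim from the open chamber, with
  \<tau> turning into - \<tau> or cnj \<tau>. On the excluded lines the chambers are glued together,
  and there only continuity of the gradient will be used.\<close>

lemma square_regular:
  assumes "\<bar>Re x\<bar> < 1" "\<bar>Im x\<bar> < 1" "Re x \<noteq> 0" "Im x \<noteq> 0" "\<bar>Re x\<bar> \<noteq> \<bar>Im x\<bar>" "0 < uu x"
  shows "regular x"
proof -
  let ?Q = "{x::complex. \<bar>Re x\<bar> < 1 \<and> \<bar>Im x\<bar> < 1}"
  have Qu: "uniq y" if "y \<in> ?Q" for y using that by (intro square_uniq) (auto simp: square_def)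
  have "x \<in> square" using assms by (auto simp: square_def)
  then have "x \<in> ?Q \<longrightarrow> Re x \<noteq> 0 \<longrightarrow> Im x \<noteq> 0 \<longrightarrow> \<bar>Re x\<bar> \<noteq> \<bar>Im x\<bar> \<longrightarrow> 0 < uu x \<longrightarrow> regular x"
  proof (induction x rule: square_induct)
    case (chamber x)
    then show ?case using chamber_regular[of x] by (auto simp: chamber_def)
  next
    case (i x)
    show ?case
    proof (intro impI)
      assume a: "\<i> * x \<in> ?Q" "Re (\<i> * x) \<noteq> 0" "Im (\<i> * x) \<noteq> 0" "\<bar>Re (\<i> * x)\<bar> \<noteq> \<bar>Im (\<i> * x)\<bar>" "0 < uu (\<i> * x)"
      then obtain \<tau> where \<tau>: "norm \<tau> \<le> 1" "(gu has_derivative (\<lambda>v. v + \<tau> * cnj v)) (at x)"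
        using i by (auto simp: uu_i regular_def)
      have "((\<lambda>y. - \<i> * y) has_derivative (\<lambda>v. - \<i> * v)) (at (\<i> * x))"
        by (rule bounded_linear_imp_has_derivative[OF bounded_linear_mult_right])
      from has_derivative_compose[OF this, of gu "\<lambda>v. v + \<tau> * cnj v"] \<tau>(2)
      have "((\<lambda>y. gu (- \<i> * y)) has_derivative (\<lambda>v. - \<i> * v + \<tau> * cnj (- \<i> * v))) (at (\<i> * x))" by simp
      from has_derivative_mult_right[OF this, of \<i>]
      have "((\<lambda>y. \<i> * gu (- \<i> * y)) has_derivative (\<lambda>v. v + (- \<tau>) * cnj v)) (at (\<i> * x))"
        by (simp add: algebra_simps)
      then have "(gu has_derivative (\<lambda>v. v + (- \<tau>) * cnj v)) (at (\<i> * x))"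
      proof (rule has_derivative_transform_within_open[OF _ open_interior_square a(1)])
        fix y assume "y \<in> ?Q"
        then have "uniq (- \<i> * y)" by (intro Qu) auto
        from gu_i[OF this] show "\<i> * gu (- \<i> * y) = gu y" by simp
      qed
      then show "regular (\<i> * x)" using \<tau>(1) unfolding regular_def by (intro exI[of _ "- \<tau>"]) auto
    qed
  next
    case (cnj x)
    show ?case
    proof (intro impI)
      assume a: "cnj x \<in> ?Q" "Re (cnj x) \<noteq> 0" "Im (cnj x) \<noteq> 0" "\<bar>Re (cnj x)\<bar> \<noteq> \<bar>Im (cnj x)\<bar>" "0 < uu (cnj x)"
      then obtain \<tau> where \<tau>: "norm \<tau> \<le> 1" "(gu has_derivative (\<lambda>v. v + \<tau> * cnj v)) (at x)"
        using cnj by (auto simp: uu_cnj regular_def)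
      from has_derivative_compose[OF bounded_linear_imp_has_derivative[OF bounded_linear_cnj], of gu "\<lambda>v. v + \<tau> * cnj v" "cnj x" UNIV] \<tau>(2)
      have "((\<lambda>y. gu (cnj y)) has_derivative (\<lambda>v. cnj v + \<tau> * v)) (at (cnj x))" by simp
      from has_derivative_compose[OF this bounded_linear_imp_has_derivative[OF bounded_linear_cnj]]
      have "((\<lambda>y. cnj (gu (cnj y))) has_derivative (\<lambda>v. v + cnj \<tau> * cnj v)) (at (cnj x))" by simp
      then have "(gu has_derivative (\<lambda>v. v + cnj \<tau> * cnj v)) (at (cnj x))"
      proof (rule has_derivative_transform_within_open[OF _ open_interior_square a(1)])
        fix y assume "y \<in> ?Q"
        then have "uniq (cnj y)" by (intro Qu) auto
        from gu_cnj[OF this] show "cnj (gu (cnj y)) = gu y" by simp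
      qed
      then show "regular (cnj x)" using \<tau>(1) unfolding regular_def by (intro exI[of _ "cnj \<tau>"]) auto
    qed
  qed
  with assms show ?thesis by simp
qed

end

lemma equal_derivative_imp_equal:
  fixes f g :: "real \<Rightarrow> complex"
  assumes "\<And>x. (f has_vector_derivative d x) (at x)" "\<And>x. (g has_vector_derivative d x) (at x)" "f a = g a"
  shows "f x = g x"
proof -
  have "((\<lambda>x. f x - g x) has_derivative (\<lambda>h. 0)) (at x within UNIV)" for x
    using has_vector_derivative_diff[OF assms(1)[of x] assms(2)[of x]] by (simp add: has_vector_derivative_def)
  then obtain c where c: "\<And>x. x \<in> UNIV \<Longrightarrow> f x - g x = c"
    using has_derivative_zero_constant[of UNIV "\<lambda>x. f x - g x"] by blast
  show ?thesis using c[of x] c[of a] assms(3) by simp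
qed

context hodograph
begin

section \<open>The free boundary\<close>

text \<open>The radius of curvature of the free boundary at the point with outer normal cis \<phi>:
  on the arc, \<open>zz\<close> has derivative \<open>RR\<close> times i cis \<alpha>. The formula
  makes sense for all angles and so continues the curve beyond one eighth.\<close>

definition RR :: "real \<Rightarrow> real" where "RR \<phi> = k / norm (1 - (of_real b) ^ 4 * cis (4 * \<phi>))"

lemma RR_denom_pos: "0 < norm (1 - (of_real b) ^ 4 * cis (4 * \<phi>))"
proof -
  have "norm ((of_real b) ^ 4 * cis (4 * \<phi>)) < 1" using b by (simp add: norm_mult norm_power power_less_one_iff)
  then have "(of_real b) ^ 4 * cis (4 * \<phi>) \<noteq> 1" by auto
  then show ?thesis by simp
qed

lemma RR_pos: "0 < RR \<phi>"
  unfolding RR_def using k RR_denom_pos by (intro divide_pos_pos)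

lemma RR_cont: "continuous_on A RR"
  unfolding RR_def by (intro continuous_intros) (metis RR_denom_pos less_irrefl)

lemma RR_minus: "RR (- \<phi>) = RR \<phi>"
proof -
  have "norm (1 - (of_real b) ^ 4 * cis (4 * - \<phi>)) = norm (cnj (1 - (of_real b) ^ 4 * cis (4 * \<phi>)))"
    by (simp add: cis_cnj)
  then show ?thesis by (simp only: RR_def complex_mod_cnj)
qed

lemma RR_shift: "RR (\<phi> + pi / 2) = RR \<phi>"
proof -
  have "cis (4 * (\<phi> + pi / 2)) = cis (4 * \<phi>)"
    by (simp add: complex_eq_iff distrib_left)
  then show ?thesis by (simp add: RR_def)
qed

text \<open>Writing RR = k / sqrt Q with Q a trigonometric polynomial bounded away from 0, one has
  RR' = - RR Q' / (2 Q), and bootstrapping applies.\<close>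

lemma Cinf_RR: "Cinf RR"
proof -
  define B where "B = b ^ 4"
  define Q where "Q \<phi> = 1 - 2 * B * cos (4 * \<phi>) + B * B" for \<phi> :: real
  have n2: "(norm (1 - (of_real b) ^ 4 * cis (4 * \<phi>)))\<^sup>2 = Q \<phi>" for \<phi>
  proof -
    have "(norm (1 - (of_real b) ^ 4 * cis (4 * \<phi>)))\<^sup>2 = (1 - B * cos (4 * \<phi>))\<^sup>2 + (B * sin (4 * \<phi>))\<^sup>2"
      by (simp add: cmod_power2 B_def flip: of_real_power)
    also have "\<dots> = 1 - 2 * B * cos (4 * \<phi>) + B\<^sup>2 * ((sin (4 * \<phi>))\<^sup>2 + (cos (4 * \<phi>))\<^sup>2)" by algebra
    also have "\<dots> = Q \<phi>" unfolding sin_cos_squared_add by (simp add: Q_def power2_eq_square)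
    finally show ?thesis .
  qed
  have Qpos: "Q \<phi> > 0" for \<phi> using RR_denom_pos[of \<phi>] n2[of \<phi>] by (metis zero_less_power)
  have RQ: "RR \<phi> = k / sqrt (Q \<phi>)" for \<phi>
    unfolding RR_def n2[symmetric] by simp
  define Q' where "Q' \<phi> = 8 * B * sin (4 * \<phi>)" for \<phi> :: real
  have dQ: "(Q has_real_derivative Q' \<phi>) (at \<phi>)" for \<phi>
    unfolding Q_def Q'_def by (auto intro!: derivative_eq_intros)
  have C4: "Cinf (\<lambda>\<phi>. 4 * \<phi>)" by (intro Cinf_mult Cinf_const Cinf_ident)
  have CQ: "Cinf Q" unfolding Q_def
    by (intro Cinf_add Cinf_diff Cinf_mult Cinf_const Cinf_compose[OF Cinf_cos C4])
  have CQ': "Cinf Q'" unfolding Q'_def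
    by (intro Cinf_mult Cinf_const Cinf_compose[OF Cinf_sin C4])
  have CiQ: "Cinf (\<lambda>\<phi>. inverse (Q \<phi>))" by (rule Cinf_inverse[OF CQ]) (metis Qpos less_irrefl)
  show ?thesis
  proof (rule Cinf_bootstrap)
    fix x
    have "((\<lambda>\<phi>. k / sqrt (Q \<phi>)) has_real_derivative RR x * (- (1/2) * (Q' x * inverse (Q x)))) (at x)"
    proof -
      have s: "((\<lambda>\<phi>. sqrt (Q \<phi>)) has_real_derivative inverse (sqrt (Q x)) / 2 * Q' x) (at x)"
        by (rule DERIV_chain2[OF DERIV_real_sqrt[OF Qpos] dQ])
      have sp: "sqrt (Q x) > 0" using Qpos by simp
      have "((\<lambda>\<phi>. k / sqrt (Q \<phi>)) has_real_derivative
        (0 * sqrt (Q x) - k * (inverse (sqrt (Q x)) / 2 * Q' x)) / (sqrt (Q x) * sqrt (Q x))) (at x)"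
        using sp by (intro DERIV_divide DERIV_const s) simp
      moreover have "(0 * q - k * (inverse q / 2 * Q' x)) / (q * q) = (k / q) * (- (1/2) * (Q' x * inverse (q * q)))"
        if "q > 0" for q
        using that by (simp add: field_simps)
      moreover have "sqrt (Q x) * sqrt (Q x) = Q x" using Qpos[of x] by simp
      ultimately show ?thesis using sp unfolding RQ by metis
    qed
    then show "(RR has_real_derivative RR x * (- (1/2) * (Q' x * inverse (Q x)))) (at x)"
      unfolding RQ .
  next
    fix n assume "Cn n RR"
    then show "Cn n (\<lambda>x. RR x * (- (1/2) * (Q' x * inverse (Q x))))"
      using CQ' CiQ by (intro Cn_mult Cn_const) (auto simp: Cinf_def)
  qed
qed

lemma curve_exists: "\<exists>c. (\<forall>\<phi>. (c has_vector_derivative of_real (RR \<phi>) * (\<i> * cis \<phi>)) (at \<phi>)) \<and> c 0 = zz 1"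
proof -
  let ?f = "\<lambda>\<phi>. of_real (RR \<phi>) * (\<i> * cis \<phi>)"
  have "continuous_on UNIV ?f" by (intro continuous_intros RR_cont)
  then obtain F where "\<And>x. (F has_vector_derivative ?f x) (at x)"
    using einterval_antiderivative[of "-\<infinity>" "\<infinity>" ?f] by (auto simp: continuous_on_eq_continuous_at)
  then have "\<forall>\<phi>. ((\<lambda>u. F u + (zz 1 - F 0)) has_vector_derivative ?f \<phi>) (at \<phi>)"
    by (auto intro: has_vector_derivative_add_const[THEN iffD2])
  then show ?thesis by (intro exI[of _ "\<lambda>u. F u + (zz 1 - F 0)"]) simp
qed

text \<open>The entire boundary curve, parametrised by its normal angle. Prescribing its velocity
  instead of gluing eight arcs makes it smooth at once; its symmetries follow from those of
  \<open>RR\<close> and uniqueness of primitives.\<close>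

definition cc :: "real \<Rightarrow> complex" where
  "cc = (SOME c. (\<forall>\<phi>. (c has_vector_derivative of_real (RR \<phi>) * (\<i> * cis \<phi>)) (at \<phi>)) \<and> c 0 = zz 1)"

lemma cc_deriv: "(cc has_vector_derivative of_real (RR \<phi>) * (\<i> * cis \<phi>)) (at \<phi>)"
  and cc_0: "cc 0 = zz 1"
  using someI_ex[OF curve_exists] by (auto simp: cc_def)

lemma cc_cont: "continuous_on A cc"
  by (intro continuous_at_imp_continuous_on) (auto intro: has_vector_derivative_continuous cc_deriv)

lemma cc_zz:
  assumes "0 \<le> \<alpha>" "\<alpha> \<le> pi / 4"
  shows "cc \<alpha> = zz (cis \<alpha>)"
proof -
  let ?d = "\<lambda>\<phi>. zz (of_real 1 * cis \<phi>) - cc \<phi>"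
  have d: "(?d has_vector_derivative 0) (at z)" if z: "0 < z" "z < \<alpha>" for z
  proof (rule arc_polar[of 1 z])
    fix \<kappa> \<beta> assume h: "1 = (1::real) \<Longrightarrow> \<beta> = z \<and> \<kappa> = k / norm (1 - (of_real b) ^ 4 * cis (4 * z))"
      "((\<lambda>\<alpha>. zz (of_real 1 * cis \<alpha>)) has_vector_derivative of_real (1 * \<kappa>) * (\<i> * cis \<beta>)) (at z)"
    then have "\<beta> = z" "\<kappa> = RR z" by (auto simp: RR_def)
    with has_vector_derivative_diff[OF h(2) cc_deriv[of z]] show ?thesis by simp
  qed (use z assms in auto)
  have c: "continuous_on {0..\<alpha>} ?d"
    by (intro continuous_on_diff arcc zz_cont cc_cont) (use assms in auto)
  have "Re (?d 0) = Re (?d \<alpha>)" "Im (?d 0) = Im (?d \<alpha>)"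
    by (rule constant_except[OF assms(1) Re_c[OF c]] constant_except[OF assms(1) Im_c[OF c]];
        use has_real_derivative_Re[OF d] has_real_derivative_Im[OF d] in simp)+
  then show ?thesis by (simp add: cc_0 complex_eq_iff)
qed

lemma cc_minus: "cc (- \<phi>) = cnj (cc \<phi>)"
proof -
  have "cnj (cc (- x)) = cc x" for x
  proof (rule equal_derivative_imp_equal[where a = 0])
    fix x
    have "((\<lambda>x. cc (- x)) has_vector_derivative - (of_real (RR (- x)) * (\<i> * cis (- x)))) (at x)"
      using vector_diff_chain_at[of uminus "-1" x cc, OF _ cc_deriv]
      by (auto simp: o_def intro!: derivative_eq_intros has_vector_derivative_minus[OF has_vector_derivative_id, simplified])
    from bounded_linear.has_vector_derivative[OF bounded_linear_cnj this]
    show "((\<lambda>x. cnj (cc (- x))) has_vector_derivative of_real (RR x) * (\<i> * cis x)) (at x)"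
      by (simp add: RR_minus cis_cnj)
    show "cnj (cc (- 0)) = cc 0"
      using on_right_axis(1)[of 1] b by (simp add: cc_0 complex_eq_iff)
  qed (rule cc_deriv)
  from this[of "- \<phi>"] show ?thesis by simp
qed

text \<open>Both sides have the same velocity by periodicity of \<open>RR\<close>. They agree at
  -pi/4 since cc (pi/4) lies on the diagonal, where z = i cnj z.\<close>

lemma cc_shift: "cc (\<phi> + pi / 2) = \<i> * cc \<phi>"
proof (rule equal_derivative_imp_equal[where a = "- (pi / 4)"])
  fix x
  have "((\<lambda>x. cc (x + pi / 2)) has_vector_derivative of_real (RR (x + pi / 2)) * (\<i> * cis (x + pi / 2))) (at x)"
    using vector_diff_chain_at[of "\<lambda>x. x + pi / 2" 1 x cc, OF _ cc_deriv]
    by (auto simp: o_def has_vector_derivative_add_const)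
  then show "((\<lambda>x. cc (x + pi / 2)) has_vector_derivative of_real (RR x) * (\<i> * cis (x + pi / 2))) (at x)"
    by (simp add: RR_shift)
  have "cis (x + pi / 2) = \<i> * cis x" by (simp add: complex_eq_iff cos_add sin_add)
  then show "((\<lambda>x. \<i> * cc x) has_vector_derivative of_real (RR x) * (\<i> * cis (x + pi / 2))) (at x)"
    using has_vector_derivative_mult_right[OF cc_deriv[of x], of \<i>] by (simp add: mult_ac)
  have "cc (pi / 4) = \<i> * cnj (cc (pi / 4))"
    using on_diagonal(1)[of 1] cc_zz[of "pi / 4"] by (simp add: complex_eq_iff)
  then show "cc (- (pi / 4) + pi / 2) = \<i> * cc (- (pi / 4))"
    unfolding cc_minus by (simp add: field_simps)
qed

lemma support_condition_shift: "cis (\<phi> + pi / 2) \<bullet> (\<i> * x - cc (\<phi> + pi / 2)) = cis \<phi> \<bullet> (x - cc \<phi>)"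
proof -
  have "cis (\<phi> + pi / 2) = \<i> * cis \<phi>" by (simp add: complex_eq_iff cos_add sin_add)
  then show ?thesis unfolding cc_shift by (simp only: inner_i flip: right_diff_distrib)
qed

lemma support_condition_minus: "cis (- \<phi>) \<bullet> (cnj x - cc (- \<phi>)) = cis \<phi> \<bullet> (x - cc \<phi>)"
  unfolding cc_minus cis_cnj[symmetric] by (simp only: inner_cnj flip: complex_cnj_diff)

lemma angle_induct:
  assumes base: "\<And>\<phi>. 0 \<le> \<phi> \<Longrightarrow> \<phi> \<le> pi / 4 \<Longrightarrow> P \<phi>"
    and minus: "\<And>\<phi>. P \<phi> \<Longrightarrow> P (- \<phi>)" and shift: "\<And>\<phi>. P \<phi> \<Longrightarrow> P (\<phi> + pi / 2)"
  shows "P \<phi>"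
proof -
  have small: "P \<phi>" if "- (pi / 4) \<le> \<phi>" "\<phi> \<le> pi / 4" for \<phi>
    using that base[of \<phi>] minus[OF base[of "- \<phi>"]] by (cases "0 \<le> \<phi>") auto
  have up: "P (\<phi> + real n * (pi / 2))" if "P \<phi>" for n \<phi>
  proof (induction n)
    case (Suc n)
    then show ?case using shift[OF Suc] by (simp add: algebra_simps add_divide_distrib)
  qed (use that in simp)
  have pos: "P \<phi>" if "0 \<le> \<phi>" for \<phi>
  proof -
    define n where "n = nat \<lfloor>(\<phi> + pi / 4) / (pi / 2)\<rfloor>"
    have x0: "0 \<le> (\<phi> + pi / 4) / (pi / 2)" using that by simp
    have n: "real n \<le> (\<phi> + pi / 4) / (pi / 2)" "(\<phi> + pi / 4) / (pi / 2) < real n + 1"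
      using x0 by (auto simp: n_def)
    have "real n * (pi / 2) \<le> \<phi> + pi / 4" "\<phi> + pi / 4 < (real n + 1) * (pi / 2)"
      using n by (auto simp: le_divide_eq divide_less_eq)
    then have "P (\<phi> - real n * (pi / 2))" by (intro small) (auto simp: algebra_simps)
    from up[OF this, of n] show ?thesis by simp
  qed
  show ?thesis using pos[of \<phi>] minus[OF pos[of "- \<phi>"]] by (cases "0 \<le> \<phi>") auto
qed

text \<open>If uu x = 0, every s on the arc maximises \<open>Psi x\<close>, with value 0. Moving s
  inwards along its ray cannot increase \<open>Psi x\<close>, and the derivative in that direction
  is a positive multiple of the inner product in question.\<close>

lemma arc_support:
  assumes x: "uu x = 0" and \<alpha>: "0 \<le> \<alpha>" "\<alpha> \<le> pi / 4"
  shows "cis \<alpha> \<bullet> (x - cc \<alpha>) \<le> 0"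
proof -
  have s: "cis \<alpha> \<in> sector" using polar_in_sector[of 1 \<alpha>] \<alpha> by simp
  have nb: "cis \<alpha> \<noteq> of_real b" using b by (metis norm_cis norm_of_real abs_of_pos less_irrefl)
  have mx: "Psi x s' \<le> Psi x (cis \<alpha>)" if "s' \<in> sector" for s'
    using Psi_le_uu[OF that, of x] x on_arc[OF \<alpha>] by (simp add: Psi_def)
  have ev: "eventually (\<lambda>h. cis \<alpha> + of_real h * (- cis \<alpha>) \<in> sector) (at_right 0)"
  proof -
    have "eventually (\<lambda>h. 0 < h \<and> h < (1::real)) (at_right 0)"
      by (auto simp: eventually_at_right_field intro: exI[of _ 1])
    then show ?thesis
    proof eventually_elim
      fix h :: real assume "0 < h \<and> h < 1"
      then have "of_real (1 - h) * cis \<alpha> \<in> sector" using \<alpha> by (intro polar_in_sector) auto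
      then show "cis \<alpha> + of_real h * (- cis \<alpha>) \<in> sector" by (simp add: algebra_simps)
    qed
  qed
  have v: "Re ((- cis \<alpha>) * w (cis \<alpha>) * ((x - zz (cis \<alpha>)) + (cis \<alpha>)\<^sup>2 * cnj (x - zz (cis \<alpha>)))) \<le> 0"
    by (rule maximiser_variation[OF s nb mx ev])
  show ?thesis
  proof (rule ray_polar[of 1 \<alpha>])
    fix \<kappa> \<beta> assume \<kappa>: "\<kappa> > 0" and \<beta>: "1 = (1::real) \<Longrightarrow> \<beta> = \<alpha> \<and> \<kappa> = k / norm (1 - (of_real b) ^ 4 * cis (4 * \<alpha>))"
      and e: "cis \<alpha> * w (of_real 1 * cis \<alpha>) = - of_real \<kappa> * cis (- \<beta>)"
    define Y where "Y = x - zz (cis \<alpha>)"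
    have e': "(- cis \<alpha>) * w (cis \<alpha>) = of_real \<kappa> * cis (- \<alpha>)" using e \<beta> by simp
    have "cis (- \<alpha>) * (cis \<alpha>)\<^sup>2 = cis \<alpha>" by (simp add: Complex.DeMoivre cis_mult)
    then have "(- cis \<alpha>) * w (cis \<alpha>) * (Y + (cis \<alpha>)\<^sup>2 * cnj Y) = of_real \<kappa> * (cis (- \<alpha>) * Y + cis \<alpha> * cnj Y)"
      unfolding e' by (simp add: distrib_left mult.assoc[symmetric])
    then have "Re (of_real \<kappa> * (cis (- \<alpha>) * Y + cis \<alpha> * cnj Y)) \<le> 0" using v by (simp only: Y_def)
    then have "\<kappa> * (2 * (cis \<alpha> \<bullet> Y)) \<le> 0" by (simp add: inner_complex_def algebra_simps)
    then have "cis \<alpha> \<bullet> Y \<le> 0" using \<kappa> by (simp add: mult_le_0_iff)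
    then show ?thesis using cc_zz[OF \<alpha>] by (simp add: Y_def)
  qed (use \<alpha> b in auto)
qed

text \<open>One direction transports \<open>arc_support\<close> by symmetry to all angles.
  Conversely, a chamber point with uu x > 0 is zz (\<rho> cis \<alpha>), and the half plane
  belonging to this very \<alpha> excludes it by \<open>ray_normal\<close>.\<close>

theorem zero_iff_support:
  assumes "x \<in> square"
  shows "uu x = 0 \<longleftrightarrow> (\<forall>\<phi>. cis \<phi> \<bullet> (x - cc \<phi>) \<le> 0)"
proof
  assume "uu x = 0"
  moreover have "\<forall>x. uu x = 0 \<longrightarrow> cis \<phi> \<bullet> (x - cc \<phi>) \<le> 0" for \<phi>
  proof (induction \<phi> rule: angle_induct)
    case (1 \<phi>)
    then show ?case using arc_support by blast
  next
    case (2 \<phi>)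
    show ?case
    proof safe
      fix x assume "uu x = 0"
      then have "uu (cnj x) = 0" by (simp add: uu_cnj)
      with 2 show "cis (- \<phi>) \<bullet> (x - cc (- \<phi>)) \<le> 0"
        using support_condition_minus[of \<phi> "cnj x"] by simp
    qed
  next
    case (3 \<phi>)
    show ?case
    proof safe
      fix x assume "uu x = 0"
      then have "uu (- \<i> * x) = 0" using uu_i[of "- \<i> * x"] by simp
      with 3 have "cis \<phi> \<bullet> (- \<i> * x - cc \<phi>) \<le> 0" by blast
      then show "cis (\<phi> + pi / 2) \<bullet> (x - cc (\<phi> + pi / 2)) \<le> 0"
        using support_condition_shift[of \<phi> "- \<i> * x"] by simp
    qed
  qed
  ultimately show "\<forall>\<phi>. cis \<phi> \<bullet> (x - cc \<phi>) \<le> 0" by blast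
next
  have "(\<forall>\<phi>. cis \<phi> \<bullet> (x - cc \<phi>) \<le> 0) \<longrightarrow> uu x = 0"
    using assms
  proof (induction x rule: square_induct)
    case (chamber x)
    show ?case
    proof (intro impI, rule ccontr)
      assume a: "\<forall>\<phi>. cis \<phi> \<bullet> (x - cc \<phi>) \<le> 0" "uu x \<noteq> 0"
      then have "0 < uu x" using chamber_dichotomy(2)[OF chamber] by simp
      then obtain s where s: "s \<in> sector" "norm s < 1" "zz s = x" using chamber_dichotomy(4)[OF chamber] by blast
      show False
      proof (rule sector_polar[OF s(1)])
        fix \<rho> \<alpha> assume p: "0 \<le> \<rho>" "0 \<le> \<alpha>" "\<alpha> \<le> pi / 4" "s = of_real \<rho> * cis \<alpha>" "norm s = \<rho>"
        then have "0 < Re (cnj (cis \<alpha>) * (x - cc \<alpha>))"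
          using ray_normal[of \<rho> \<alpha>] s cc_zz[of \<alpha>] by simp
        then have "0 < cis \<alpha> \<bullet> (x - cc \<alpha>)" by (simp add: inner_complex_def)
        with a(1) show False using not_le by blast
      qed
    qed
  next
    case (i x)
    then show ?case using support_condition_shift[of _ x] by (metis uu_i)
  next
    case (cnj x)
    then show ?case using support_condition_minus[of _ x] by (metis uu_cnj)
  qed
  then show "\<forall>\<phi>. cis \<phi> \<bullet> (x - cc \<phi>) \<le> 0 \<Longrightarrow> uu x = 0" by blast
qed


section \<open>The convex set enclosed by the curve, and its boundary points\<close>

definition Zset :: "complex set" where "Zset = {x. \<forall>\<phi>. cis \<phi> \<bullet> (x - cc \<phi>) \<le> 0}"

lemma cc_2pi: "cc (\<phi> + 2 * pi) = cc \<phi>"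
proof -
  have "cc (\<phi> + pi / 2 + pi / 2 + pi / 2 + pi / 2) = cc \<phi>" unfolding cc_shift by simp
  then show ?thesis by (simp add: algebra_simps)
qed

lemma cc_2pi_nat: "cc (\<phi> + 2 * pi * real n) = cc \<phi>"
proof (induction n)
  case (Suc n)
  have "cc (\<phi> + 2 * pi * real (Suc n)) = cc (\<phi> + 2 * pi * real n + 2 * pi)" by (simp add: algebra_simps)
  then show ?case using Suc cc_2pi by simp
qed simp

lemma reduce_angle:
  obtains t' where "\<bar>t'\<bar> \<le> pi" "cis t = cis (\<phi> + t')" "cc t = cc (\<phi> + t')"
proof -
  define n where "n = \<lfloor>(t - \<phi> + pi) / (2 * pi)\<rfloor>"
  define t' where "t' = t - \<phi> - 2 * pi * of_int n"
  have "of_int n \<le> (t - \<phi> + pi) / (2 * pi)" "(t - \<phi> + pi) / (2 * pi) < of_int n + 1"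
    by (auto simp: n_def)
  then have "of_int n * (2 * pi) \<le> t - \<phi> + pi" "t - \<phi> + pi < (of_int n + 1) * (2 * pi)"
    by (auto simp: le_divide_eq divide_less_eq)
  then have b: "\<bar>t'\<bar> \<le> pi" by (auto simp: t'_def algebra_simps abs_le_iff)
  have t: "t = \<phi> + t' + 2 * pi * of_int n" by (simp add: t'_def)
  have c: "cis t = cis (\<phi> + t')"
    unfolding t by (simp add: cis_mult[symmetric] cis_multiple_2pi)
  have "cc t = cc (\<phi> + t')"
  proof (cases "0 \<le> n")
    case True
    then show ?thesis using cc_2pi_nat[of "\<phi> + t'" "nat n"] by (simp add: t)
  next
    case False
    then show ?thesis using cc_2pi_nat[of t "nat (- n)"] by (simp add: t)
  qed
  with b c show ?thesis by (rule that)
qed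

lemma support_deriv: "((\<lambda>\<phi>. d \<bullet> cc \<phi>) has_vector_derivative RR \<phi> * (d \<bullet> (\<i> * cis \<phi>))) (at \<phi>)"
proof -
  have "((\<lambda>\<phi>. d \<bullet> cc \<phi>) has_vector_derivative d \<bullet> (of_real (RR \<phi>) * (\<i> * cis \<phi>))) (at \<phi>)"
    by (rule bounded_linear.has_vector_derivative[OF bounded_linear_inner_right cc_deriv])
  then show ?thesis by (simp add: inner_complex_def algebra_simps)
qed

lemma inner_cis: "cis t \<bullet> (\<i> * cis \<phi>) = sin (t - \<phi>)" "cis t \<bullet> cis \<phi> = cos (t - \<phi>)"
  by (simp_all add: inner_complex_def sin_diff cos_diff)

text \<open>In direction cis (\<phi> + t) the curve has velocity RR z sin (\<phi> + t - z), and the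
  sine keeps its sign while z runs over less than half a turn. So a normal direction is maximised
  only at its own point.\<close>

lemma support_strict:
  assumes "\<bar>t\<bar> \<le> pi" "t \<noteq> 0"
  shows "cis (\<phi> + t) \<bullet> cc \<phi> < cis (\<phi> + t) \<bullet> cc (\<phi> + t)"
proof (cases "0 < t")
  case True
  show ?thesis
  proof (rule strictly_increasing_except[of \<phi> "\<phi> + t" "\<lambda>x. cis (\<phi> + t) \<bullet> cc x" \<phi>])
    fix z assume z: "\<phi> < z" "z < \<phi> + t"
    have "0 < sin (\<phi> + t - z)" using z assms by (intro sin_gt_zero) auto
    then show "\<exists>D. ((\<lambda>x. cis (\<phi> + t) \<bullet> cc x) has_vector_derivative D) (at z) \<and> 0 < D"
      using support_deriv[of "cis (\<phi> + t)" z] RR_pos[of z] by (auto simp: inner_cis intro!: exI)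
  qed (use True in \<open>auto intro!: continuous_intros cc_cont\<close>)
next
  case False
  have "- (cis (\<phi> + t) \<bullet> cc (\<phi> + t)) < - (cis (\<phi> + t) \<bullet> cc \<phi>)"
  proof (rule strictly_increasing_except[of "\<phi> + t" \<phi> "\<lambda>x. - (cis (\<phi> + t) \<bullet> cc x)" \<phi>])
    fix z assume z: "\<phi> + t < z" "z < \<phi>"
    have "0 < sin (- (\<phi> + t - z))" using z assms by (intro sin_gt_zero) auto
    then have "sin (\<phi> + t - z) < 0" unfolding sin_minus by simp
    then have "0 < - (RR z * sin (\<phi> + t - z))" using RR_pos[of z] by (simp add: mult_pos_neg)
    moreover have "((\<lambda>x. - (cis (\<phi> + t) \<bullet> cc x)) has_vector_derivative - (RR z * sin (\<phi> + t - z))) (at z)"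
      using has_vector_derivative_minus[OF support_deriv[of "cis (\<phi> + t)" z]] by (simp add: inner_cis)
    ultimately show "\<exists>D. ((\<lambda>x. - (cis (\<phi> + t) \<bullet> cc x)) has_vector_derivative D) (at z) \<and> 0 < D" by blast
  qed (use False assms in \<open>auto intro!: continuous_intros cc_cont\<close>)
  then show ?thesis by simp
qed

lemma cc_in_Zset: "cc \<phi> \<in> Zset"
  unfolding Zset_def
proof safe
  fix t
  show "cis t \<bullet> (cc \<phi> - cc t) \<le> 0"
  proof (rule reduce_angle[of t \<phi>])
    fix t' assume p: "\<bar>t'\<bar> \<le> pi" "cis t = cis (\<phi> + t')" "cc t = cc (\<phi> + t')"
    show ?thesis unfolding p(2,3) using support_strict[OF p(1), of \<phi>] by (cases "t' = 0") (auto simp: inner_diff_right)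
  qed
qed

text \<open>The signed distances g to the supporting lines attain a maximum by periodicity. If it
  were negative, a ball around p would satisfy all constraints. So g is 0 at some \<phi>, and since
  its derivative vanishes there as well, p - cc \<phi> has neither normal nor tangential
  component.\<close>

lemma Zset_boundary_point:
  assumes p: "p \<in> Zset" "p \<notin> interior Zset"
  obtains \<phi> where "p = cc \<phi>"
proof -
  define g where "g \<phi> = cis \<phi> \<bullet> (p - cc \<phi>)" for \<phi>
  have gle: "g \<phi> \<le> 0" for \<phi> using p(1) by (simp add: g_def Zset_def)
  have gc: "continuous_on {-pi..pi} g" unfolding g_def by (intro continuous_intros cc_cont)
  have "{-pi..pi} \<noteq> {}" by simp
  from continuous_attains_sup[OF compact_Icc this gc] obtain \<phi> where \<phi>: "\<And>x. x \<in> {-pi..pi} \<Longrightarrow> g x \<le> g \<phi>" by blast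
  have sup: "g t \<le> g \<phi>" for t
  proof (rule reduce_angle[of t 0])
    fix t' assume p: "\<bar>t'\<bar> \<le> pi" "cis t = cis (0 + t')" "cc t = cc (0 + t')"
    then have "g t = g t'" by (simp add: g_def)
    moreover have "t' \<in> {-pi..pi}" using p(1) by (simp add: abs_le_iff)
    ultimately show ?thesis using \<phi> by metis
  qed
  have "g \<phi> = 0"
  proof (rule ccontr)
    assume "g \<phi> \<noteq> 0"
    then have neg: "g \<phi> < 0" using gle[of \<phi>] by simp
    have "ball p (- g \<phi>) \<subseteq> Zset"
    proof
      fix x assume x: "x \<in> ball p (- g \<phi>)"
      have "cis t \<bullet> (x - cc t) \<le> 0" for t
      proof -
        have "cis t \<bullet> (x - cc t) = g t + cis t \<bullet> (x - p)" by (simp add: g_def inner_diff_right)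
        moreover have "cis t \<bullet> (x - p) \<le> norm (x - p)" using norm_cauchy_schwarz[of "cis t" "x - p"] by simp
        moreover have "norm (x - p) < - g \<phi>" using x by (simp add: dist_norm norm_minus_commute)
        ultimately show ?thesis using sup[of t] by linarith
      qed
      then show "x \<in> Zset" by (simp add: Zset_def)
    qed
    then have "p \<in> interior Zset" using neg by (auto intro!: interiorI[of "ball p (- g \<phi>)"])
    then show False using p(2) by blast
  qed
  have "(g has_vector_derivative (\<i> * cis \<phi>) \<bullet> (p - cc \<phi>)) (at \<phi>)"
  proof -
    have "((\<lambda>\<phi>. p - cc \<phi>) has_vector_derivative - (of_real (RR \<phi>) * (\<i> * cis \<phi>))) (at \<phi>)"
      using has_vector_derivative_diff[OF has_vector_derivative_const cc_deriv] by simp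
    moreover have "(cis has_vector_derivative \<i> * cis \<phi>) (at \<phi>)" using arc_deriv[of 1 \<phi>] by simp
    ultimately have "(g has_vector_derivative
        cis \<phi> \<bullet> (- (of_real (RR \<phi>) * (\<i> * cis \<phi>))) + (\<i> * cis \<phi>) \<bullet> (p - cc \<phi>)) (at \<phi>)"
      unfolding g_def by (intro bounded_bilinear.has_vector_derivative[OF bounded_bilinear_inner])
    moreover have "cis \<phi> \<bullet> (- (of_real (RR \<phi>) * (\<i> * cis \<phi>))) = 0" by (simp add: inner_complex_def)
    ultimately show ?thesis by simp
  qed
  then have "(\<i> * cis \<phi>) \<bullet> (p - cc \<phi>) = 0"
    by (intro DERIV_local_max[of g _ \<phi> 1]) (auto simp: has_real_derivative_iff_has_vector_derivative intro: sup)
  moreover have "cis \<phi> \<bullet> (p - cc \<phi>) = 0" using \<open>g \<phi> = 0\<close> by (simp add: g_def)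
  ultimately have "p - cc \<phi> = 0"
  proof -
    let ?y = "p - cc \<phi>"
    assume 1: "(\<i> * cis \<phi>) \<bullet> ?y = 0" and 2: "cis \<phi> \<bullet> ?y = 0"
    have "cnj (cis \<phi>) * ?y = 0" using 1 2 by (simp add: complex_eq_iff inner_complex_def algebra_simps)
    then show ?thesis using cis_neq_zero by simp
  qed
  then show ?thesis by (intro that[of \<phi>]) simp
qed

end

text \<open>A positive derivative gives injectivity, but surjectivity needs growth: outside a
  bounded interval f grows at least as fast as the identity.\<close>

lemma strict_mono_deriv_inverse:
  fixes f :: "real \<Rightarrow> real"
  assumes f: "\<And>x. (f has_real_derivative f' x) (at x)" and pos: "\<And>x. 0 < f' x" and far: "\<And>x. M \<le> \<bar>x\<bar> \<Longrightarrow> 1 \<le> f' x"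
  obtains g where "\<And>y. f (g y) = y" "\<And>x. g (f x) = x" "continuous_on UNIV g"
proof -
  define N where "N = max M 0"
  have mono: "f x < f y" if "x < y" for x y
    using DERIV_pos_imp_increasing[OF that] f pos by blast
  have inj: "inj f" by (rule linorder_injI) (use mono in force)
  have grow: "y - x \<le> f y - f x" if "x \<le> y" "N \<le> x \<or> y \<le> - N" for x y
  proof -
    have "f x - x \<le> f y - y"
    proof (rule DERIV_nonneg_imp_nondecreasing[OF that(1)])
      fix z assume "x \<le> z" "z \<le> y"
      then have "M \<le> \<bar>z\<bar>" using that by (auto simp: N_def)
      then show "\<exists>w. ((\<lambda>x. f x - x) has_real_derivative w) (at z) \<and> 0 \<le> w"
        using DERIV_diff[OF f[of z] DERIV_ident] far[of z] by (intro exI[of _ "f' z - 1"]) auto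
    qed
    then show ?thesis by simp
  qed
  have cont: "isCont f x" for x using f by (rule DERIV_isCont)
  have surj: "\<exists>x. f x = y" for y
  proof -
    have N0: "0 \<le> N" by (simp add: N_def)
    define u where "u = - N - \<bar>y - f (- N)\<bar>"
    define v where "v = N + \<bar>y - f N\<bar>"
    have "f u \<le> y" using grow[of u "- N"] by (auto simp: u_def)
    moreover have "y \<le> f v" using grow[of N v] by (auto simp: v_def)
    ultimately show ?thesis using IVT[of f u y v] cont N0 by (force simp: u_def v_def)
  qed
  then have bij: "bij f" using inj by (auto simp: bij_def surj_def) (metis)
  have 1: "f (inv f y) = y" for y using bij by (simp add: bij_is_surj surj_f_inv_f)
  have 2: "inv f (f x) = x" for x using inj by simp
  have "isCont (inv f) (f x)" for x
    by (rule isCont_inverse_function[of 1]) (use 2 cont in auto)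
  then have "continuous_on UNIV (inv f)" using 1 by (metis continuous_at_imp_continuous_on)
  with 1 2 show ?thesis by (intro that)
qed

context hodograph
begin

lemma RR_bound: "RR \<phi> \<le> k / (1 - b ^ 4)"
proof -
  have "b ^ 4 < 1" using b by (simp add: power_less_one_iff)
  moreover have "1 - b ^ 4 \<le> norm (1 - (of_real b) ^ 4 * cis (4 * \<phi>))"
    using norm_triangle_ineq2[of 1 "(of_real b) ^ 4 * cis (4 * \<phi>)"] b by (simp add: norm_mult norm_power)
  ultimately show ?thesis unfolding RR_def using k RR_denom_pos[of \<phi>]
    by (intro divide_left_mono mult_pos_pos) auto
qed

text \<open>The boundary curve is a graph over its tangent at \<open>\<phi>\<close> as long as the normal turns by less
  than a right angle; the bump term makes the tangential coordinate a diffeomorphism of the line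
  without changing it near \<open>\<phi>\<close>, so that the graph function is globally defined.\<close>
lemma boundary_graph:
  assumes p: "p \<in> Zset" "p \<notin> interior Zset"
  obtains r e \<tau> \<Gamma> where "r > 0" "norm e = 1" "norm \<tau> = 1" "e \<bullet> \<tau> = 0" "Cinf \<Gamma>"
    "\<And>x. x \<in> ball p r \<Longrightarrow> x \<in> Zset \<longleftrightarrow> \<Gamma> (x \<bullet> \<tau>) \<le> x \<bullet> e"
proof -
  obtain \<phi> where p\<phi>: "p = cc \<phi>" using Zset_boundary_point[OF p] .
  define e where "e = - cis \<phi>"
  define \<tau> where "\<tau> = \<i> * cis \<phi>"
  define \<xi> where "\<xi> t = \<tau> \<bullet> cc (\<phi> + t)" for t
  define \<eta> where "\<eta> t = e \<bullet> cc (\<phi> + t)" for t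
  define R1 where "R1 t = RR (\<phi> + t)" for t
  have CR1: "Cinf R1" unfolding R1_def by (intro Cinf_compose[OF Cinf_RR] Cinf_add Cinf_const Cinf_ident)
  have shift: "((\<lambda>t. d \<bullet> cc (\<phi> + t)) has_real_derivative R1 t * (d \<bullet> (\<i> * cis (\<phi> + t)))) (at t)" for d t
  proof -
    have "((\<lambda>t. \<phi> + t) has_real_derivative 1) (at t)" by (auto intro!: derivative_eq_intros)
    from DERIV_chain2[OF support_deriv[of d "\<phi> + t", folded has_real_derivative_iff_has_vector_derivative] this]
    show ?thesis by (simp add: R1_def)
  qed
  have \<xi>': "(\<xi> has_real_derivative R1 t * cos t) (at t)" for t
  proof -
    have "\<tau> \<bullet> (\<i> * cis (\<phi> + t)) = cos t" unfolding \<tau>_def inner_i inner_cis by simp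
    with shift[of \<tau> t] show ?thesis by (simp add: \<xi>_def[abs_def])
  qed
  have \<eta>': "(\<eta> has_real_derivative R1 t * sin t) (at t)" for t
  proof -
    have "e \<bullet> (\<i> * cis (\<phi> + t)) = sin t" unfolding e_def inner_minus_left inner_cis by simp
    with shift[of e t] show ?thesis by (simp add: \<eta>_def[abs_def])
  qed
  \<comment> \<open>For |t| \<ge> pi/2 > 3/2 the argument t^2 - 1 exceeds 5/4, where the step is at
    least exp (-4/5) \<ge> 1/5. Five times the bound of RR plus 1 thus outweighs a negative RR cos t
    and leaves a derivative of at least 1.\<close>
  define C where "C = 5 * (k / (1 - b ^ 4) + 1)"
  define f' where "f' t = R1 t * cos t + C * smooth_step (t * t - 1)" for t
  have b4: "b ^ 4 < 1" using b by (simp add: power_less_one_iff)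
  have kb: "0 < k / (1 - b ^ 4)" using b4 k by simp
  have Cf': "Cinf f'" unfolding f'_def
    by (intro Cinf_add Cinf_mult CR1 Cinf_cos Cinf_const Cinf_compose[OF Cinf_smooth_step] Cinf_diff Cinf_ident)
  have far: "1 \<le> f' t" if "pi / 2 \<le> \<bar>t\<bar>" for t
  proof -
    have "3 / 2 \<le> \<bar>t\<bar>" using that pi_gt3 by linarith
    then have "(3 / 2)\<^sup>2 \<le> \<bar>t\<bar>\<^sup>2" by (intro power_mono) auto
    then have "5 / 4 \<le> t * t - 1" by (simp add: power2_eq_square)
    then have "smooth_step (5 / 4) \<le> smooth_step (t * t - 1)" by (rule smooth_step_mono)
    moreover have "1 / 5 \<le> smooth_step (5 / 4)"
      using exp_ge_add_one_self[of "- (4 / 5)"] by (simp add: smooth_step_def)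
    ultimately have "C * (1 / 5) \<le> C * smooth_step (t * t - 1)"
      using kb by (intro mult_left_mono) (auto simp: C_def)
    moreover have "\<bar>R1 t * cos t\<bar> \<le> k / (1 - b ^ 4) * 1"
      unfolding abs_mult using RR_bound RR_pos kb
      by (intro mult_mono) (auto simp: R1_def less_imp_le simp del: zero_less_divide_iff)
    ultimately show ?thesis by (simp add: f'_def C_def)
  qed
  have pos: "0 < f' t" for t
  proof (cases "pi / 2 \<le> \<bar>t\<bar>")
    case True
    then show ?thesis using far by force
  next
    case False
    then have "0 < cos t" by (intro cos_gt_zero_pi) auto
    then show ?thesis using RR_pos kb smooth_step_nonneg
      unfolding f'_def R1_def C_def by (intro add_pos_nonneg mult_pos_pos mult_nonneg_nonneg) auto
  qed
  obtain F where F: "\<And>x. (F has_real_derivative f' x) (at x)"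
    using einterval_antiderivative[of "-\<infinity>" "\<infinity>" f'] Cinf_continuous[OF Cf', of UNIV]
    by (auto simp: continuous_on_eq_continuous_at has_real_derivative_iff_has_vector_derivative)
  define f where "f t = F t + (\<xi> 0 - F 0)" for t
  have f: "(f has_real_derivative f' x) (at x)" for x
    unfolding f_def using DERIV_add[OF F DERIV_const] by simp
  obtain g where g: "\<And>y. f (g y) = y" "\<And>x. g (f x) = x" "continuous_on UNIV g"
    using strict_mono_deriv_inverse[OF f pos far] by metis
  have Cg: "Cinf g"
    by (rule Cinf_inverse_function[OF f Cf' _ g(3) g(1)]) (use pos in \<open>metis less_irrefl\<close>)
  have C\<eta>: "Cinf \<eta>" by (rule Cinf_antideriv[OF \<eta>']) (intro Cinf_mult CR1 Cinf_sin)
  define \<Gamma> where "\<Gamma> y = \<eta> (g y)" for y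
  have C\<Gamma>: "Cinf \<Gamma>" unfolding \<Gamma>_def by (rule Cinf_compose[OF C\<eta> Cg])
  have f\<xi>: "f t = \<xi> t" if "\<bar>t\<bar> \<le> 1" for t
  proof -
    have d: "((\<lambda>t. f t - \<xi> t) has_vector_derivative 0) (at z)" if "\<bar>z\<bar> < 1" for z
    proof -
      have "z * z < 1" using that abs_mult_less[of z 1 z 1] by (simp add: abs_mult_self_eq)
      then have "smooth_step (z * z - 1) = 0" by (simp add: smooth_step_def)
      then show ?thesis using DERIV_diff[OF f[of z] \<xi>'[of z]]
        by (simp add: f'_def has_real_derivative_iff_has_vector_derivative)
    qed
    have c: "continuous_on A (\<lambda>t. f t - \<xi> t)" for A
      by (intro continuous_at_imp_continuous_on ballI) (rule DERIV_isCont[OF DERIV_diff[OF f \<xi>']])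
    have "f 0 - \<xi> 0 = f t - \<xi> t"
    proof (cases "0 \<le> t")
      case True
      show ?thesis by (rule constant_except[OF True c, of 0]) (use d that in auto)
    next
      case False
      then have "t \<le> 0" by simp
      from constant_except[OF this c, of 0] d that show ?thesis by auto
    qed
    then show ?thesis by (simp add: f_def)
  qed
  have e\<tau>: "norm e = 1" "norm \<tau> = 1" "e \<bullet> \<tau> = 0"
    by (auto simp: e_def \<tau>_def norm_mult inner_complex_def)
  have decomp: "d \<bullet> y = (d \<bullet> e) * (e \<bullet> y) + (d \<bullet> \<tau>) * (\<tau> \<bullet> y)" for d y
  proof -
    define C where "C = cos \<phi>"
    define S where "S = sin \<phi>"
    have "C\<^sup>2 + S\<^sup>2 = 1" by (simp add: C_def S_def)
    then have "a * c + b' * d' = (a * - C + b' * - S) * (- C * c + - S * d') + (a * - S + b' * C) * (- S * c + C * d')"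
      for a b' c d' by algebra
    from this[of "Re d" "Re y" "Im d" "Im y"] show ?thesis
      by (simp add: e_def \<tau>_def inner_complex_def C_def S_def)
  qed
  have n_e: "cis (\<phi> + t) \<bullet> e = - cos t" for t unfolding e_def inner_minus_right inner_cis by simp
  define h where "h t = cis (\<phi> + t) \<bullet> (cc \<phi> - cc (\<phi> + t))" for t
  \<comment> \<open>Angles at which the normal has turned by at least a right angle. Their
    constraints hold at p with a uniform slack m > 0, hence on a ball around p; only the other
    angles have to be compared with the graph.\<close>
  define A where "A = {-pi..-(pi / 2)} \<union> {pi / 2..pi}"
  have A: "compact A" "A \<noteq> {}" by (auto simp: A_def)
  have "continuous_on A h" unfolding h_def
    by (intro continuous_intros continuous_on_compose2[OF cc_cont[of UNIV]]) auto
  from continuous_attains_sup[OF A this] obtain t0 where t0: "t0 \<in> A" "\<And>t. t \<in> A \<Longrightarrow> h t \<le> h t0" by blast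
  define m where "m = - h t0"
  have m: "0 < m"
  proof -
    have "\<bar>t0\<bar> \<le> pi" "t0 \<noteq> 0" using t0(1) pi_gt3 by (auto simp: A_def)
    then show ?thesis using support_strict[of t0 \<phi>] by (simp add: m_def h_def inner_diff_right)
  qed
  have fmono: "f x < f y" if "x < y" for x y
    using DERIV_pos_imp_increasing[OF that] f pos by blast
  define r where "r = min m (min (f 1 - f 0) (f 0 - f (-1)))"
  have r: "0 < r" using m fmono[of 0 1] fmono[of "-1" 0] by (auto simp: r_def)
  have main: "x \<in> Zset \<longleftrightarrow> \<Gamma> (x \<bullet> \<tau>) \<le> x \<bullet> e" if x: "x \<in> ball p r" for x
  proof -
    have xp: "norm (x - p) < r" using x by (simp add: dist_norm norm_minus_commute)
    have "\<tau> \<bullet> p = f 0" using f\<xi>[of 0] by (simp add: \<xi>_def p\<phi>)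
    then have "\<bar>\<tau> \<bullet> x - f 0\<bar> < r"
      using Cauchy_Schwarz_ineq2[of \<tau> "x - p"] e\<tau> xp by (simp add: inner_diff_right)
    then have lim: "f (-1) < \<tau> \<bullet> x" "\<tau> \<bullet> x < f 1" by (auto simp: r_def)
    define t where "t = g (\<tau> \<bullet> x)"
    have ft: "f t = \<tau> \<bullet> x" by (simp add: t_def g)
    have t1: "-1 < t" "t < 1" using lim fmono[of t "-1"] fmono[of 1 t] ft
      by (metis less_asym linorder_neqE_linordered_idom)+
    have \<xi>t: "\<tau> \<bullet> (x - cc (\<phi> + t)) = 0" using f\<xi>[of t] ft t1 by (simp add: \<xi>_def inner_diff_right)
    have \<Gamma>t: "\<Gamma> (x \<bullet> \<tau>) = e \<bullet> cc (\<phi> + t)" by (simp add: \<Gamma>_def t_def \<eta>_def inner_commute)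
    \<comment> \<open>The height of x, in the inner normal direction e at p, above the boundary
      point with the same tangential coordinate.\<close>
    define lam where "lam = e \<bullet> (x - cc (\<phi> + t))"
    have dlam: "cis (\<phi> + t') \<bullet> (x - cc (\<phi> + t)) = - cos t' * lam" for t'
      using decomp[of "cis (\<phi> + t')" "x - cc (\<phi> + t)"] \<xi>t by (simp add: n_e lam_def)
    have iff: "\<Gamma> (x \<bullet> \<tau>) \<le> x \<bullet> e \<longleftrightarrow> 0 \<le> lam"
      unfolding \<Gamma>t lam_def inner_diff_right by (simp add: inner_commute)
    show ?thesis unfolding iff
    proof
      assume "x \<in> Zset"
      then have "cis (\<phi> + t) \<bullet> (x - cc (\<phi> + t)) \<le> 0" by (simp add: Zset_def)
      then have "0 \<le> cos t * lam" unfolding dlam by simp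
      moreover have "0 < cos t" using t1 pi_gt3 by (intro cos_gt_zero_pi) auto
      ultimately show "0 \<le> lam" by (simp add: zero_le_mult_iff)
    next
      assume lam: "0 \<le> lam"
      show "x \<in> Zset"
        unfolding Zset_def
      proof safe
        fix t1
        show "cis t1 \<bullet> (x - cc t1) \<le> 0"
        proof (rule reduce_angle[of t1 \<phi>])
          fix t' assume t': "\<bar>t'\<bar> \<le> pi" "cis t1 = cis (\<phi> + t')" "cc t1 = cc (\<phi> + t')"
          show ?thesis
          proof (cases "\<bar>t'\<bar> < pi / 2")
            case True
            have "cis (\<phi> + t') \<bullet> (x - cc (\<phi> + t')) =
                cis (\<phi> + t') \<bullet> (x - cc (\<phi> + t)) + cis (\<phi> + t') \<bullet> (cc (\<phi> + t) - cc (\<phi> + t'))"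
              by (simp add: inner_diff_right)
            moreover have "cis (\<phi> + t') \<bullet> (cc (\<phi> + t) - cc (\<phi> + t')) \<le> 0"
              using cc_in_Zset[of "\<phi> + t"] by (simp add: Zset_def)
            moreover have "0 < cos t'" using True by (intro cos_gt_zero_pi) auto
            then have "- cos t' * lam \<le> 0" using lam by simp
            ultimately show ?thesis unfolding t'(2,3) dlam by linarith
          next
            case False
            then have "t' \<in> A" using t'(1) by (auto simp: A_def)
            then have "h t' \<le> - m" using t0(2) by (simp add: m_def)
            moreover have "cis (\<phi> + t') \<bullet> (x - cc (\<phi> + t')) = h t' + cis (\<phi> + t') \<bullet> (x - p)"
              by (simp add: h_def p\<phi> inner_diff_right)
            moreover have "cis (\<phi> + t') \<bullet> (x - p) \<le> norm (x - p)"
              using norm_cauchy_schwarz[of "cis (\<phi> + t')" "x - p"] by simp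
            moreover have "norm (x - p) < m" using xp by (simp add: r_def)
            ultimately show ?thesis unfolding t'(2,3) by linarith
          qed
        qed
      qed
    qed
  qed
  show ?thesis by (rule that[OF r e\<tau> C\<Gamma> main])
qed

end

section \<open>Weak derivatives on the square\<close>

abbreviation lb2 :: "(real \<times> real) measure" where "lb2 \<equiv> lborel \<Otimes>\<^sub>M lborel"

definition Sq :: "(real \<times> real) set" where "Sq = {-1<..<1} \<times> {-1<..<1}"

lemma Sq_sets [measurable]: "Sq \<in> sets lb2"
  unfolding Sq_def by measurable

lemma emeasure_Sq: "emeasure lb2 Sq < \<infinity>"
  unfolding Sq_def by (simp add: lborel.emeasure_pair_measure_Times ennreal_mult_less_top)

lemma box_Pair: "box (a, c) (b, d) = box a b \<times> box c (d::real)" for a b :: real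
  by (auto simp: box_def Basis_prod_def)

lemma integrable_bounded_Sq:
  assumes [measurable]: "f \<in> borel_measurable lb2" and b: "\<And>p. \<bar>f p\<bar> \<le> (C::real)" and z: "\<And>p. p \<notin> Sq \<Longrightarrow> f p = 0"
  shows "integrable lb2 f"
  by (rule integrableI_bounded_set[where A = Sq and B = C]) (use b z emeasure_Sq Sq_sets in \<open>auto simp del: sets_pair_measure_cong\<close>)

text \<open>Boxes form an intersection-stable generator of the Borel sets, so the vanishing of the
  integral passes to all Borel sets by a Dynkin argument, and a density with zero integrals is 0
  almost everywhere.\<close>

lemma box_integrals_zero:
  assumes k: "integrable lb2 k"
    and z: "\<And>a b c d. (\<integral>p. indicator ({a<..<b} \<times> {c<..<d}) p * k p \<partial>lb2) = (0::real)"
  shows "AE p in lb2. k p = 0"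
proof -
  have km[measurable]: "k \<in> borel_measurable lb2" using k by auto
  have sb: "sets lb2 = sigma_sets UNIV (range (\<lambda>(a, b). box a b :: (real \<times> real) set))"
    unfolding lborel_prod sets_lborel borel_eq_box by (rule sets_measure_of) simp
  have ik: "integrable lb2 (\<lambda>p. indicator A p * k p)" if "A \<in> sets lb2" for A
    using integrable_mult_indicator[OF that k] by simp
  have bz: "(\<integral>p. indicator (box a b) p * k p \<partial>lb2) = 0" for a b
    using z[of "fst a" "fst b" "snd a" "snd b"] by (cases a; cases b) (simp add: box_Pair box_real)
  have tot: "integral\<^sup>L lb2 k = 0"
  proof -
    have "(\<lambda>n. \<integral>p. indicator (box (- real n, - real n) (real n, real n)) p * k p \<partial>lb2) \<longlonglongrightarrow> integral\<^sup>L lb2 k"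
    proof (rule integral_dominated_convergence[where w = "\<lambda>p. \<bar>k p\<bar>"])
      show "AE p in lb2. (\<lambda>n. indicator (box (- real n, - real n) (real n, real n)) p * k p) \<longlonglongrightarrow> k p"
      proof (rule AE_I2)
        fix p :: "real \<times> real"
        obtain N where N: "max \<bar>fst p\<bar> \<bar>snd p\<bar> < real N" using reals_Archimedean2 by blast
        have "eventually (\<lambda>n. indicator (box (- real n, - real n) (real n, real n)) p * k p = k p) sequentially"
          using eventually_ge_at_top[of N]
        proof eventually_elim
          fix n assume "N \<le> n"
          then have "p \<in> box (- real n, - real n) (real n, real n)"
            using N by (cases p) (auto simp: box_Pair box_real abs_less_iff)
          then show "indicator (box (- real n, - real n) (real n, real n)) p * k p = k p" by simp
        qed
        then show "(\<lambda>n. indicator (box (- real n, - real n) (real n, real n)) p * k p) \<longlonglongrightarrow> k p"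
          by (rule tendsto_eventually)
      qed
    qed (use k in \<open>auto simp: lborel_prod indicator_def\<close>)
    then show ?thesis unfolding bz by (simp add: LIMSEQ_const_iff)
  qed
  have stable: "Int_stable (range (\<lambda>(a, b). box a b :: (real \<times> real) set))"
    by (auto simp: Int_stable_def box_Int_box)
  define Z where "Z A \<longleftrightarrow> A \<in> sets lb2 \<and> (\<integral>p. indicator A p * k p \<partial>lb2) = 0" for A
  have Z: "Z A" if A: "A \<in> sets lb2" for A
  proof (rule sigma_sets_induct_disjoint[OF stable, of UNIV])
    show "A \<in> sigma_sets UNIV (range (\<lambda>(a, b). box a b))" using A unfolding sb .
    show "Z {}" by (simp add: Z_def)
    show "Z B" if rg: "B \<in> range (\<lambda>(a, b). box a b)" for B
    proof -
      obtain a b where B: "B = box a b" using rg by auto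
      have "box a b \<in> sets lb2" unfolding lborel_prod by simp
      then show ?thesis using bz[of a b] unfolding Z_def B by blast
    qed
  next
    fix B assume "Z B"
    then have B: "B \<in> sets lb2" "(\<integral>p. indicator B p * k p \<partial>lb2) = 0" by (auto simp: Z_def)
    have "(\<integral>p. indicator (UNIV - B) p * k p \<partial>lb2) = (\<integral>p. k p - indicator B p * k p \<partial>lb2)"
      by (intro Bochner_Integration.integral_cong) (auto split: split_indicator)
    also have "\<dots> = 0" using B ik[OF B(1)] k tot by (subst Bochner_Integration.integral_diff) auto
    finally have "(\<integral>p. indicator (UNIV - B) p * k p \<partial>lb2) = 0" .
    moreover have "UNIV - B \<in> sets lb2" using sets.compl_sets[OF B(1)] by (simp add: space_pair_measure)
    ultimately show "Z (UNIV - B)" unfolding Z_def by blast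
  next
    fix B :: "nat \<Rightarrow> (real \<times> real) set" assume d: "disjoint_family B" and "\<And>i. Z (B i)"
    then have B: "B i \<in> sets lb2" "(\<integral>p. indicator (B i) p * k p \<partial>lb2) = 0" for i by (auto simp: Z_def)
    have UB: "(\<Union>i. B i) \<in> sets lb2" using B(1) by blast
    have "set_lebesgue_integral lb2 (\<Union>i. B i) k = (\<Sum>i. set_lebesgue_integral lb2 (B i) k)"
    proof (rule lebesgue_integral_countable_add[OF B(1)])
      show "B i \<inter> B j = {}" if "i \<noteq> j" for i j using d that by (simp add: disjoint_family_on_def)
      show "set_integrable lb2 (\<Union>i. B i) k"
        unfolding set_integrable_def by (rule integrable_mult_indicator[OF UB k])
    qed
    then have "set_lebesgue_integral lb2 (\<Union>i. B i) k = 0"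
      using B(2) by (simp add: set_lebesgue_integral_def)
    then show "Z (\<Union>i. B i)" using UB by (simp add: Z_def set_lebesgue_integral_def)
  qed auto
  then have "set_lebesgue_integral lb2 A k = set_lebesgue_integral lb2 A (\<lambda>p. 0)" if "A \<in> sets lb2" for A
    using Z[OF that] by (simp add: Z_def set_lebesgue_integral_def)
  from density_unique_real[OF k _ this] show ?thesis by simp
qed

text \<open>k is integrable only on smaller squares, so box integrals are recovered from bumps
  strictly inside, and the open square is then exhausted by countably many squares.\<close>

lemma bumps_zero:
  assumes [measurable]: "k \<in> borel_measurable lb2"
    and loc: "\<And>c. 0 < c \<Longrightarrow> c < 1 \<Longrightarrow> integrable lb2 (\<lambda>p. indicator ({-c..c} \<times> {-c..c}) p * k p)"
    and z: "\<And>a b c d n. -1 < a \<Longrightarrow> b < 1 \<Longrightarrow> -1 < c \<Longrightarrow> d < 1 \<Longrightarrow>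
      (\<integral>p. k p * (bump a b n (fst p) * bump c d n (snd p)) \<partial>lb2) = (0::real)"
  shows "AE p in lb2. p \<in> Sq \<longrightarrow> k p = 0"
proof -
  have mb[measurable]: "bump a b n \<in> borel_measurable borel" for a b n
    by (intro borel_measurable_continuous_onI Cinf_continuous Cinf_bump)
  have box: "(\<integral>p. indicator ({a<..<b} \<times> {c<..<d}) p * k p \<partial>lb2) = 0"
    if "-1 < a" "b < 1" "-1 < c" "d < 1" for a b c d
  proof -
    define m where "m = max (max \<bar>a\<bar> \<bar>b\<bar>) (max \<bar>c\<bar> \<bar>d\<bar>)"
    show ?thesis
    proof (cases "a < b \<and> c < d")
      case False
      then have "{a<..<b} \<times> {c<..<d} = {}" by auto
      then have "indicator ({a<..<b} \<times> {c<..<d}) p * k p = 0" for p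
        by (simp only: indicator_def empty_iff if_False mult_zero_left of_bool_eq)
      then show ?thesis by (simp only: Bochner_Integration.integral_zero)
    next
      case True
      then have m: "0 < m" "m < 1" using that by (auto simp: m_def)
      have sub: "{a<..<b} \<times> {c<..<d} \<subseteq> {-m..m} \<times> {-m..m}" by (auto simp: m_def)
      have "(\<lambda>n. \<integral>p. k p * (bump a b n (fst p) * bump c d n (snd p)) \<partial>lb2)
          \<longlonglongrightarrow> (\<integral>p. indicator ({a<..<b} \<times> {c<..<d}) p * k p \<partial>lb2)"
      proof (rule integral_dominated_convergence[where w = "\<lambda>p. \<bar>indicator ({-m..m} \<times> {-m..m}) p * k p\<bar>"])
        show "AE p in lb2. (\<lambda>n. k p * (bump a b n (fst p) * bump c d n (snd p)))
            \<longlonglongrightarrow> indicator ({a<..<b} \<times> {c<..<d}) p * k p"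
        proof (rule AE_I2)
          fix p
          have "(\<lambda>n. k p * (bump a b n (fst p) * bump c d n (snd p))) \<longlonglongrightarrow>
              k p * (indicator {a<..<b} (fst p) * indicator {c<..<d} (snd p))"
            by (intro tendsto_intros bump_tendsto)
          then show "(\<lambda>n. k p * (bump a b n (fst p) * bump c d n (snd p))) \<longlonglongrightarrow> indicator ({a<..<b} \<times> {c<..<d}) p * k p"
            by (cases p) (simp add: indicator_times mult_ac)
        qed
        show "AE p in lb2. norm (k p * (bump a b n (fst p) * bump c d n (snd p))) \<le> \<bar>indicator ({-m..m} \<times> {-m..m}) p * k p\<bar>" for n
        proof (rule AE_I2)
          fix p
          have 1: "bump a b n (fst p) * bump c d n (snd p) \<le> 1" "0 \<le> bump a b n (fst p) * bump c d n (snd p)"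
            by (auto intro: mult_le_one mult_nonneg_nonneg bump_le1 bump_nonneg)
          show "norm (k p * (bump a b n (fst p) * bump c d n (snd p))) \<le> \<bar>indicator ({-m..m} \<times> {-m..m}) p * k p\<bar>"
          proof (cases "p \<in> {a<..<b} \<times> {c<..<d}")
            case True
            then have "p \<in> {-m..m} \<times> {-m..m}" using sub by blast
            then show ?thesis using mult_left_mono[OF 1(1), of "\<bar>k p\<bar>"]
              by (simp add: abs_mult abs_of_nonneg[OF bump_nonneg])
          next
            case False
            then have "bump a b n (fst p) = 0 \<or> bump c d n (snd p) = 0"
              by (cases p) (auto intro: bump_outside)
            then show ?thesis by auto
          qed
        qed
        show "integrable lb2 (\<lambda>p. \<bar>indicator ({-m..m} \<times> {-m..m}) p * k p\<bar>)"
          by (intro integrable_abs loc m)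
      qed measurable
      then show ?thesis unfolding z[OF that] by (simp add: LIMSEQ_const_iff)
    qed
  qed
  define C where "C n = 1 - 1 / real (n + 2)" for n :: nat
  have C: "0 < C n" "C n < 1" for n by (auto simp: C_def field_simps)
  have "AE p in lb2. indicator ({- C n<..<C n} \<times> {- C n<..<C n}) p * k p = 0" for n
  proof (rule box_integrals_zero)
    have "integrable lb2 (\<lambda>p. indicator ({- C n<..<C n} \<times> {- C n<..<C n}) p *\<^sub>R (indicator ({-C n..C n} \<times> {-C n..C n}) p * k p))"
      by (intro integrable_mult_indicator loc C) measurable
    then show "integrable lb2 (\<lambda>p. indicator ({- C n<..<C n} \<times> {- C n<..<C n}) p * k p)"
      by (rule Bochner_Integration.integrable_cong[THEN iffD1, rotated 2]) (auto split: split_indicator)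
    fix a b c d
    have "(\<integral>p. indicator ({a<..<b} \<times> {c<..<d}) p * (indicator ({- C n<..<C n} \<times> {- C n<..<C n}) p * k p) \<partial>lb2) =
       (\<integral>p. indicator ({max a (- C n)<..<min b (C n)} \<times> {max c (- C n)<..<min d (C n)}) p * k p \<partial>lb2)"
      by (intro Bochner_Integration.integral_cong) (auto split: split_indicator)
    also have "\<dots> = 0" using C[of n] by (intro box) auto
    finally show "(\<integral>p. indicator ({a<..<b} \<times> {c<..<d}) p * (indicator ({- C n<..<C n} \<times> {- C n<..<C n}) p * k p) \<partial>lb2) = 0" .
  qed
  then have "AE p in lb2. \<forall>n. indicator ({- C n<..<C n} \<times> {- C n<..<C n}) p * k p = 0"
    unfolding AE_all_countable ..
  then show ?thesis
  proof eventually_elim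
    fix p assume *: "\<forall>n. indicator ({- C n<..<C n} \<times> {- C n<..<C n}) p * k p = 0"
    show "p \<in> Sq \<longrightarrow> k p = 0"
    proof
      assume p: "p \<in> Sq"
      define e where "e = 1 - max \<bar>fst p\<bar> \<bar>snd p\<bar>"
      have "0 < e" using p by (auto simp: e_def Sq_def)
      then obtain n where n: "inverse (real (Suc n)) < e" using reals_Archimedean by blast
      have "1 / real (n + 2) \<le> inverse (real (Suc n))" by (simp add: field_simps)
      then have "max \<bar>fst p\<bar> \<bar>snd p\<bar> < C n" using n unfolding C_def e_def by linarith
      then have "\<bar>fst p\<bar> < C n" "\<bar>snd p\<bar> < C n" by linarith+
      then have "p \<in> {- C n<..<C n} \<times> {- C n<..<C n}" by (cases p) (auto simp: abs_less_iff)
      then show "k p = 0" using *[rule_format, of n] by simp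
    qed
  qed
qed

text \<open>The weak derivative in the first variable, tested on tensor products only, with the
  derivative falling on the first factor. Applied to functions composed with
  \<open>prod.swap\<close>, it also serves for the second variable.\<close>

definition weak_x :: "(real \<times> real \<Rightarrow> real) \<Rightarrow> (real \<times> real \<Rightarrow> real) \<Rightarrow> bool" where
  "weak_x w h \<longleftrightarrow> (\<forall>A a B c. Cinf A \<longrightarrow> Cinf B \<longrightarrow> (\<forall>x. (A has_real_derivative a x) (at x)) \<longrightarrow> c < 1 \<longrightarrow>
     (\<forall>x. c < \<bar>x\<bar> \<longrightarrow> A x = 0 \<and> B x = 0) \<longrightarrow>
     (\<integral>p. w p * (a (fst p) * B (snd p)) \<partial>lb2) = - (\<integral>p. h p * (A (fst p) * B (snd p)) \<partial>lb2))"

lemma slice_integrable: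
  fixes g :: "real \<times> real \<Rightarrow> real"
  assumes g: "integrable lb2 g"
  shows "AE y in lborel. integrable lborel (\<lambda>x. g (x, y))" "integrable lborel (\<lambda>y. \<integral>x. g (x, y) \<partial>lborel)"
    "(\<integral>y. (\<integral>x. g (x, y) \<partial>lborel) \<partial>lborel) = integral\<^sup>L lb2 g"
  using lborel_pair.AE_integrable_snd[of "\<lambda>x y. g (x, y)"] lborel_pair.integrable_snd[of "\<lambda>x y. g (x, y)"]
    lborel_pair.integral_snd[of "\<lambda>x y. g (x, y)"] g by simp_all

lemma AE_lb2_snd: "AE y in lborel. P y \<Longrightarrow> AE p in lb2. P (snd p)"
proof -
  assume "AE y in lborel. P y"
  then obtain N where N: "{y \<in> space lborel. \<not> P y} \<subseteq> N" "emeasure lborel N = 0" "N \<in> sets lborel"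
    by (rule AE_E)
  then have "UNIV \<times> N \<in> null_sets lb2"
    by (auto simp: null_sets_def lborel.emeasure_pair_measure_Times)
  then show ?thesis by (rule AE_I'[of "UNIV \<times> N"]) (use N in auto)
qed

lemma product_integrable:
  fixes f g :: "real \<Rightarrow> real"
  assumes "integrable lborel f" "integrable lborel g"
  shows "integrable lb2 (\<lambda>p. f (fst p) * g (snd p))"
proof -
  have [measurable]: "f \<in> borel_measurable borel" "g \<in> borel_measurable borel" using assms by auto
  have "integrable lb2 (case_prod (\<lambda>x y. f x * g y))"
    by (rule lborel_pair.Fubini_integrable) (use assms in \<open>auto simp: abs_mult\<close>)
  then show ?thesis by (simp add: split_beta')
qed

text \<open>For fixed \<open>y\<close>, Fubini in the two horizontal variables.\<close>
lemma kernel_exchange: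
  fixes f g q :: "real \<times> real \<Rightarrow> real"
  assumes [measurable]: "f \<in> borel_measurable lb2" "q \<in> borel_measurable lb2" and g: "integrable lb2 g"
    and f: "\<And>p. \<bar>f p\<bar> \<le> C" "\<And>p. p \<notin> Sq \<Longrightarrow> f p = 0" and q: "\<And>p. \<bar>q p\<bar> \<le> D"
  shows "integrable lb2 (\<lambda>p. f p * (\<integral>x. g (x, snd p) * q (fst p, x) \<partial>lborel))"
    and "integrable lb2 (\<lambda>p. g p * (\<integral>s. f (s, snd p) * q (s, fst p) \<partial>lborel))"
    and "(\<integral>p. f p * (\<integral>x. g (x, snd p) * q (fst p, x) \<partial>lborel) \<partial>lb2) =
         (\<integral>p. g p * (\<integral>s. f (s, snd p) * q (s, fst p) \<partial>lborel) \<partial>lb2)"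
proof -
  have gm[measurable]: "g \<in> borel_measurable lb2" using g by auto
  have C0: "0 \<le> C" using f(1)[of "(0,0)"] by linarith
  have D0: "0 \<le> D" using q[of "(0,0)"] by linarith
  let ?I = "indicator {-1<..<1} :: real \<Rightarrow> real"
  have I: "integrable lborel ?I" by simp
  have fI: "\<bar>f (s, y)\<bar> \<le> C * ?I s" for s y
    using f(1)[of "(s, y)"] f(2)[of "(s, y)"] by (auto simp: Sq_def split: split_indicator)
  have ga: "integrable lb2 (\<lambda>p. \<bar>g p\<bar>)" using g by auto
  note gs = slice_integrable[OF g]
  have I1: "integrable lb2 (\<lambda>p. ?I (fst p) * (\<integral>x. \<bar>g (x, snd p)\<bar> \<partial>lborel))"
    by (rule product_integrable[OF I slice_integrable(2)[OF ga]])
  have A: "AE p in lb2. integrable lborel (\<lambda>x. g (x, snd p))" by (rule AE_lb2_snd[OF gs(1)])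
  show i1: "integrable lb2 (\<lambda>p. f p * (\<integral>x. g (x, snd p) * q (fst p, x) \<partial>lborel))"
  proof (rule Bochner_Integration.integrable_bound[OF integrable_mult_right[OF I1, of "C * D"]])
    show "AE p in lb2. norm (f p * (\<integral>x. g (x, snd p) * q (fst p, x) \<partial>lborel))
        \<le> norm (C * D * (?I (fst p) * (\<integral>x. \<bar>g (x, snd p)\<bar> \<partial>lborel)))"
      using A
    proof eventually_elim
      fix p :: "real \<times> real" assume gi: "integrable lborel (\<lambda>x. g (x, snd p))"
      have gk: "integrable lborel (\<lambda>x. g (x, snd p) * q (fst p, x))"
        by (rule Bochner_Integration.integrable_bound[OF integrable_mult_right[OF gi, of D]])
          (use D0 in \<open>auto simp: abs_mult mult.commute[of D] intro!: mult_left_mono q\<close>)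
      have "\<bar>\<integral>x. g (x, snd p) * q (fst p, x) \<partial>lborel\<bar> \<le> (\<integral>x. \<bar>g (x, snd p) * q (fst p, x)\<bar> \<partial>lborel)"
        by (rule integral_abs_bound)
      also have "\<dots> \<le> (\<integral>x. D * \<bar>g (x, snd p)\<bar> \<partial>lborel)"
        using gk gi by (intro integral_mono integrable_abs integrable_mult_right)
          (auto simp: abs_mult mult.commute[of D] intro!: mult_left_mono q)
      finally have "\<bar>\<integral>x. g (x, snd p) * q (fst p, x) \<partial>lborel\<bar> \<le> D * (\<integral>x. \<bar>g (x, snd p)\<bar> \<partial>lborel)" by simp
      then have "\<bar>f p\<bar> * \<bar>\<integral>x. g (x, snd p) * q (fst p, x) \<partial>lborel\<bar> \<le> (C * ?I (fst p)) * (D * (\<integral>x. \<bar>g (x, snd p)\<bar> \<partial>lborel))"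
        using fI[of "fst p" "snd p"] C0 by (intro mult_mono) auto
      then show "norm (f p * (\<integral>x. g (x, snd p) * q (fst p, x) \<partial>lborel))
        \<le> norm (C * D * (?I (fst p) * (\<integral>x. \<bar>g (x, snd p)\<bar> \<partial>lborel)))"
        using C0 D0 by (simp add: abs_mult mult_ac)
    qed
  qed measurable
  show i2: "integrable lb2 (\<lambda>p. g p * (\<integral>s. f (s, snd p) * q (s, fst p) \<partial>lborel))"
  proof (rule Bochner_Integration.integrable_bound[OF integrable_mult_right[OF g, of "C * D * 2"]])
    show "AE p in lb2. norm (g p * (\<integral>s. f (s, snd p) * q (s, fst p) \<partial>lborel)) \<le> norm (C * D * 2 * g p)"
    proof (rule AE_I2)
      fix p :: "real \<times> real"
      have b: "\<bar>f (s, snd p) * q (s, fst p)\<bar> \<le> C * D * ?I s" for s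
        using mult_mono[OF fI[of s "snd p"] q[of "(s, fst p)"]] C0 by (simp add: abs_mult mult_ac)
      have "\<bar>\<integral>s. f (s, snd p) * q (s, fst p) \<partial>lborel\<bar> \<le> (\<integral>s. C * D * ?I s \<partial>lborel)"
      proof -
        have "integrable lborel (\<lambda>s. f (s, snd p) * q (s, fst p))"
        proof (rule Bochner_Integration.integrable_bound[OF integrable_mult_right[OF I, of "C * D"]])
          show "AE s in lborel. norm (f (s, snd p) * q (s, fst p)) \<le> norm (C * D * ?I s)"
            using b C0 D0 by (intro AE_I2) (simp add: abs_mult)
        qed measurable
        from Bochner_Integration.integral_norm_bound_integral[OF this integrable_mult_right[OF I, of "C * D"]] b
        show ?thesis by simp
      qed
      then have "\<bar>\<integral>s. f (s, snd p) * q (s, fst p) \<partial>lborel\<bar> \<le> C * D * 2" by simp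
      then show "norm (g p * (\<integral>s. f (s, snd p) * q (s, fst p) \<partial>lborel)) \<le> norm (C * D * 2 * g p)"
        using mult_right_mono[of "\<bar>\<integral>s. f (s, snd p) * q (s, fst p) \<partial>lborel\<bar>" "C * D * 2" "\<bar>g p\<bar>"] C0 D0
        by (simp add: abs_mult mult_ac)
    qed
  qed measurable
  have swap: "(\<integral>s. f (s, y) * (\<integral>x. g (x, y) * q (s, x) \<partial>lborel) \<partial>lborel) =
      (\<integral>x. g (x, y) * (\<integral>s. f (s, y) * q (s, x) \<partial>lborel) \<partial>lborel)"
    if gi: "integrable lborel (\<lambda>x. g (x, y))" for y
  proof -
    have "integrable lb2 (\<lambda>p. C * D * (?I (fst p) * \<bar>g (snd p, y)\<bar>))"
      by (intro integrable_mult_right product_integrable I integrable_abs gi)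
    then have "integrable lb2 (\<lambda>p. f (fst p, y) * (g (snd p, y) * q p))"
    proof (rule Bochner_Integration.integrable_bound)
      show "AE p in lb2. norm (f (fst p, y) * (g (snd p, y) * q p)) \<le> norm (C * D * (?I (fst p) * \<bar>g (snd p, y)\<bar>))"
      proof (rule AE_I2)
        fix p
        have "\<bar>f (fst p, y)\<bar> * (\<bar>g (snd p, y)\<bar> * \<bar>q p\<bar>) \<le> (C * ?I (fst p)) * (\<bar>g (snd p, y)\<bar> * D)"
          using fI[of "fst p" y] q[of p] C0 by (intro mult_mono) auto
        then show "norm (f (fst p, y) * (g (snd p, y) * q p)) \<le> norm (C * D * (?I (fst p) * \<bar>g (snd p, y)\<bar>))"
          using C0 D0 by (simp add: abs_mult mult_ac)
      qed
    qed measurable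
    then have "integrable lb2 (case_prod (\<lambda>s x. f (s, y) * (g (x, y) * q (s, x))))"
      by (simp add: split_beta')
    note F = lborel_pair.Fubini_integral[OF this]
    have 1: "(\<integral>x. f (s, y) * (g (x, y) * q (s, x)) \<partial>lborel) = f (s, y) * (\<integral>x. g (x, y) * q (s, x) \<partial>lborel)" for s
      by (rule integral_mult_right_zero)
    have 2: "(\<integral>s. f (s, y) * (g (x, y) * q (s, x)) \<partial>lborel) = g (x, y) * (\<integral>s. f (s, y) * q (s, x) \<partial>lborel)" for x
      by (subst integral_mult_right_zero[symmetric]) (simp only: mult.left_commute)
    show ?thesis using F unfolding 1 2 by simp
  qed
  have "(\<integral>p. f p * (\<integral>x. g (x, snd p) * q (fst p, x) \<partial>lborel) \<partial>lb2) =
      (\<integral>y. (\<integral>s. f (s, y) * (\<integral>x. g (x, y) * q (s, x) \<partial>lborel) \<partial>lborel) \<partial>lborel)"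
    using slice_integrable(3)[OF i1] by simp
  also have "\<dots> = (\<integral>y. (\<integral>x. g (x, y) * (\<integral>s. f (s, y) * q (s, x) \<partial>lborel) \<partial>lborel) \<partial>lborel)"
    using gs(1) by (intro integral_cong_AE) (auto elim!: eventually_mono intro: swap)
  also have "\<dots> = (\<integral>p. g p * (\<integral>s. f (s, snd p) * q (s, fst p) \<partial>lborel) \<partial>lb2)"
    using slice_integrable(3)[OF i2] by simp
  finally show "(\<integral>p. f p * (\<integral>x. g (x, snd p) * q (fst p, x) \<partial>lborel) \<partial>lb2) =
         (\<integral>p. g p * (\<integral>s. f (s, snd p) * q (s, fst p) \<partial>lborel) \<partial>lb2)" .
qed


definition indefinite :: "(real \<Rightarrow> real) \<Rightarrow> real \<Rightarrow> real" where
  "indefinite a x = (\<integral>s. a s * indicator {..x} s \<partial>lborel)"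

lemma indefinite_Cinf:
  assumes a: "Cinf a" and c: "\<And>x. c < \<bar>x\<bar> \<Longrightarrow> a x = 0"
  shows "(indefinite a has_real_derivative a x) (at x)" "Cinf (indefinite a)"
    "x < - c \<Longrightarrow> indefinite a x = 0" "c < x \<Longrightarrow> indefinite a x = (\<integral>s. a s \<partial>lborel)"
proof -
  let ?F = "indefinite a"
  obtain G where G: "\<And>x. (G has_real_derivative a x) (at x)"
    using einterval_antiderivative[of "-\<infinity>" "\<infinity>" a] Cinf_continuous[OF a, of UNIV]
    by (auto simp: continuous_on_eq_continuous_at has_real_derivative_iff_has_vector_derivative)
  define m where "m = - c - 1"
  have F0: "?F x = 0" if "x < - c" for x
  proof -
    have "a s * indicator {..x} s = 0" for s using c[of s] that by (auto split: split_indicator)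
    then show ?thesis by (simp only: indefinite_def Bochner_Integration.integral_zero)
  qed
  have "?F x = G x - G m" for x
  proof (cases "m \<le> x")
    case True
    have "?F x = (\<integral>s. a s * indicator {m..x} s \<partial>lborel)"
      unfolding indefinite_def using c by (intro Bochner_Integration.integral_cong) (auto simp: m_def split: split_indicator)
    also have "\<dots> = G x - G m"
      by (rule integral_FTC_Icc_real[OF True]) (use G Cinf_continuous[OF a, of UNIV] in \<open>auto simp: continuous_on_eq_continuous_at\<close>)
    finally show ?thesis .
  next
    case False
    have "G m = G x"
    proof (rule DERIV_isconst2[of x "m + 1/2" G])
      show "(G has_real_derivative 0) (at z)" if "x < z" "z < m + 1/2" for z
        using that G[of z] c[of z] by (simp add: m_def)
      show "continuous_on {x..m + 1/2} G"
        using G by (intro continuous_at_imp_continuous_on) (auto intro: DERIV_isCont)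
    qed (use False in auto)
    then show ?thesis using F0[of x] False by (simp add: m_def)
  qed
  then have FG: "?F = (\<lambda>x. G x - G m)" by auto
  have d: "(?F has_real_derivative a x) (at x)" for x
    unfolding FG using DERIV_diff[OF G DERIV_const] by simp
  then show "(?F has_real_derivative a x) (at x)" .
  show "Cinf ?F" by (rule Cinf_antideriv[OF d a])
  show "\<And>x. x < - c \<Longrightarrow> ?F x = 0" by (rule F0)
  show "?F x = (\<integral>s. a s \<partial>lborel)" if "c < x"
  proof -
    have "a s * indicator {..x} s = a s" for s using c[of s] that by (auto split: split_indicator)
    then show ?thesis by (simp only: indefinite_def)
  qed
qed

lemma Cinf_integrable:
  assumes a: "Cinf a" and c: "\<And>x. c < \<bar>x\<bar> \<Longrightarrow> a x = 0"
  shows "integrable lborel a"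
proof -
  have "set_integrable lborel {- \<bar>c\<bar>..\<bar>c\<bar>} a"
    by (rule borel_integrable_atLeastAtMost') (rule Cinf_continuous[OF a])
  moreover have "indicator {- \<bar>c\<bar>..\<bar>c\<bar>} x *\<^sub>R a x = a x" for x using c[of x] by (auto split: split_indicator)
  ultimately show ?thesis by (simp only: set_integrable_def)
qed

lemma exists_unit_bump:
  obtains a0 where "Cinf a0" "\<And>x. 1 / 2 < \<bar>x\<bar> \<Longrightarrow> a0 x = 0" "(\<integral>x. a0 x \<partial>lborel) = 1" "\<And>x. 0 \<le> a0 x" "\<exists>C. \<forall>x. a0 x \<le> C"
proof -
  let ?b = "bump (-1/2) (1/2) 1"
  have z: "1 / 2 < \<bar>x\<bar> \<Longrightarrow> ?b x = 0" for x by (rule bump_outside) auto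
  have i: "integrable lborel ?b" by (rule Cinf_integrable[OF Cinf_bump z])
  define c0 where "c0 = (\<integral>x. ?b x \<partial>lborel)"
  have "c0 \<noteq> 0"
  proof
    assume "c0 = 0"
    then have "AE x in lborel. ?b x = 0"
      using integral_nonneg_eq_0_iff_AE[OF i] bump_nonneg by (auto simp: c0_def)
    moreover have "?b x \<noteq> 0" if "x \<in> {-1/2<..<1/2}" for x
      using that smooth_step_pos_iff[of "x + 1/2"] smooth_step_pos_iff[of "1/2 - x"] by (auto simp: bump_def)
    ultimately have "AE x in lborel. x \<notin> {-1/2<..<1/2::real}" by (auto elim!: eventually_mono)
    then have "emeasure lborel {-1/2<..<1/2::real} = 0"
      by (subst (asm) AE_iff_measurable[where N = "{-1/2<..<1/2}"]) auto
    then show False by simp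
  qed
  moreover have "0 \<le> c0" unfolding c0_def by (intro Bochner_Integration.integral_nonneg bump_nonneg)
  ultimately have c0: "0 < c0" by simp
  show ?thesis
  proof (rule that[of "\<lambda>x. inverse c0 * ?b x"])
    show "Cinf (\<lambda>x. inverse c0 * ?b x)" by (intro Cinf_mult Cinf_const Cinf_bump)
    show "(\<integral>x. inverse c0 * ?b x \<partial>lborel) = 1" using c0 by (simp add: c0_def)
    show "\<exists>C. \<forall>x. inverse c0 * ?b x \<le> C"
      using c0 bump_le1 by (intro exI[of _ "inverse c0"]) (auto simp: mult_left_le)
    show "0 \<le> inverse c0 * ?b x" for x using c0 bump_nonneg by (intro mult_nonneg_nonneg) auto
  qed (use z in auto)
qed

definition primitive :: "(real \<times> real \<Rightarrow> real) \<Rightarrow> real \<times> real \<Rightarrow> real" where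
  "primitive f p = (\<integral>s. f (s, snd p) * indicator {..fst p} s \<partial>lborel)"

text \<open>f need not be smooth nor vanish near the boundary, so it is no test function. Instead w
  is first represented through its derivative: w (s, y) is the integral of w a0 over the line minus
  the integral of h against the kernel q (s, x) = [s \<le> x] - A0 x. This is what K = 0 says. On
  integrating against f, the weighted mean of w drops out by the mean condition, and q turns f into
  its primitive.\<close>

lemma weak_x_integration_by_parts:
  assumes wk: "weak_x w h" and w: "integrable lb2 w" and h: "integrable lb2 h"
    and fm[measurable]: "f \<in> borel_measurable lb2"
    and f: "\<And>p. \<bar>f p\<bar> \<le> (C::real)" "\<And>p. p \<notin> Sq \<Longrightarrow> f p = 0" and mean: "\<And>y. (\<integral>s. f (s, y) \<partial>lborel) = 0"
  shows "(\<integral>p. h p * primitive f p \<partial>lb2) = - (\<integral>p. f p * w p \<partial>lb2)"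
proof -
  have [measurable]: "w \<in> borel_measurable lb2" "h \<in> borel_measurable lb2" using w h by auto
  obtain a0 where a0: "Cinf a0" "\<And>x. 1 / 2 < \<bar>x\<bar> \<Longrightarrow> a0 x = 0" "(\<integral>x. a0 x \<partial>lborel) = 1" "\<And>x. 0 \<le> a0 x" "\<exists>C. \<forall>x. a0 x \<le> C"
    using exists_unit_bump by blast
  then obtain C0 where C0: "\<And>x. a0 x \<le> C0" by blast
  \<comment> \<open>A0 climbs from 0 to 1 within [-1/2, 1/2]. Subtracting a multiple of it gives the
    primitive of a bump compact support.\<close>
  define A0 where "A0 = indefinite a0"
  note dA0 = indefinite_Cinf[of a0 "1/2", OF a0(1,2), folded A0_def]
  have A0_def: "A0 x = (\<integral>s. a0 s * indicator {..x} s \<partial>lborel)" for x by (simp add: A0_def indefinite_def)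
  have a0i: "integrable lborel a0" by (rule Cinf_integrable[OF a0(1,2)])
  have A01: "0 \<le> A0 x" "A0 x \<le> 1" for x
  proof -
    show "0 \<le> A0 x" unfolding A0_def using a0(4) by (intro Bochner_Integration.integral_nonneg) auto
    have "A0 x \<le> (\<integral>s. a0 s \<partial>lborel)"
      unfolding A0_def using a0i a0(4) by (intro integral_mono integrable_real_mult_indicator) (auto split: split_indicator)
    then show "A0 x \<le> 1" using a0(3) by simp
  qed
  have [measurable]: "a0 \<in> borel_measurable borel" "A0 \<in> borel_measurable borel"
    by (intro borel_measurable_continuous_onI Cinf_continuous a0 dA0)+
  define q where "q p = indicator {fst p..} (snd p) - A0 (snd p)" for p :: "real \<times> real"
  define q' where "q' p = - a0 (snd p)" for p :: "real \<times> real"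
  have q_eq: "q p = (if fst p \<le> snd p then 1 else 0) - A0 (snd p)" for p
    by (auto simp: q_def split: split_indicator)
  have [measurable]: "q \<in> borel_measurable lb2" "q' \<in> borel_measurable lb2"
    unfolding q_eq[abs_def] q'_def by measurable
  have qb: "\<bar>q p\<bar> \<le> 1" for p using A01[of "snd p"] by (auto simp: q_eq)
  have qb': "\<bar>q' p\<bar> \<le> C0" for p using C0 a0(4) by (auto simp: q'_def)
  define K where "K p = w p + (\<integral>x. h (x, snd p) * q (fst p, x) \<partial>lborel) + (\<integral>x. w (x, snd p) * q' (fst p, x) \<partial>lborel)" for p
  have Km[measurable]: "K \<in> borel_measurable lb2" unfolding K_def by measurable
  have fKi: "integrable lb2 (\<lambda>p. f p * K p)"
    and fK: "(\<integral>p. f p * K p \<partial>lb2) = (\<integral>p. f p * w p \<partial>lb2) + (\<integral>p. h p * (\<integral>s. f (s, snd p) * q (s, fst p) \<partial>lborel) \<partial>lb2)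
      + (\<integral>p. w p * (\<integral>s. f (s, snd p) * q' (s, fst p) \<partial>lborel) \<partial>lb2)"
    if [measurable]: "f \<in> borel_measurable lb2" and f: "\<And>p. \<bar>f p\<bar> \<le> (C::real)" "\<And>p. p \<notin> Sq \<Longrightarrow> f p = 0" for f C
  proof -
    note k1 = kernel_exchange[OF that(1) \<open>q \<in> borel_measurable lb2\<close> h f qb]
    note k2 = kernel_exchange[OF that(1) \<open>q' \<in> borel_measurable lb2\<close> w f qb']
    have fw: "integrable lb2 (\<lambda>p. f p * w p)"
    proof (rule Bochner_Integration.integrable_bound[OF integrable_mult_right[OF w, of C]])
      show "AE p in lb2. norm (f p * w p) \<le> norm (C * w p)"
        by (intro AE_I2) (simp add: abs_mult mult_right_mono order_trans[OF f(1) abs_ge_self])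
    qed measurable
    have e: "f p * K p = f p * w p + f p * (\<integral>x. h (x, snd p) * q (fst p, x) \<partial>lborel) + f p * (\<integral>x. w (x, snd p) * q' (fst p, x) \<partial>lborel)" for p
      by (simp add: K_def algebra_simps)
    show "integrable lb2 (\<lambda>p. f p * K p)" unfolding e by (intro Bochner_Integration.integrable_add fw k1 k2)
    show "(\<integral>p. f p * K p \<partial>lb2) = (\<integral>p. f p * w p \<partial>lb2) + (\<integral>p. h p * (\<integral>s. f (s, snd p) * q (s, fst p) \<partial>lborel) \<partial>lb2)
      + (\<integral>p. w p * (\<integral>s. f (s, snd p) * q' (s, fst p) \<partial>lborel) \<partial>lb2)"
      unfolding e using fw k1(1) k2(1) by (simp add: Bochner_Integration.integral_add k1(3) k2(3))
  qed
  have "AE p in lb2. p \<in> Sq \<longrightarrow> K p = 0"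
  proof (rule bumps_zero[OF Km])
    fix c :: real assume c: "0 < c" "c < 1"
    show "integrable lb2 (\<lambda>p. indicator ({-c..c} \<times> {-c..c}) p * K p)"
      by (rule fKi[of _ 1]) (use c in \<open>auto simp: Sq_def split: split_indicator\<close>)
  next
    fix a b c d :: real and n assume ab: "-1 < a" "b < 1" "-1 < c" "d < 1"
    let ?f = "\<lambda>p. bump a b n (fst p) * bump c d n (snd p)"
    have mb[measurable]: "bump a b n \<in> borel_measurable borel" for a b n
      by (intro borel_measurable_continuous_onI Cinf_continuous Cinf_bump)
    define m where "m = max (1/2) (max (max (- a) b) (max (- c) d))"
    have m: "m < 1" "1 / 2 \<le> m" using ab by (auto simp: m_def)
    have za: "bump a b n x = 0" if "m < \<bar>x\<bar>" for x using that by (intro bump_outside) (auto simp: m_def abs_if split: if_splits)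
    have zc: "bump c d n x = 0" if "m < \<bar>x\<bar>" for x using that by (intro bump_outside) (auto simp: m_def abs_if split: if_splits)
    have z0: "a0 x = 0" if "m < \<bar>x\<bar>" for x using that m by (intro a0(2)) auto
    have fb: "\<bar>?f p\<bar> \<le> 1" for p by (auto simp: abs_mult intro!: mult_le_one bump_le1 bump_nonneg simp: abs_of_nonneg[OF bump_nonneg])
    have fz: "?f p = 0" if "p \<notin> Sq" for p
    proof (rule ccontr)
      assume "?f p \<noteq> 0"
      then have "\<not> m < \<bar>fst p\<bar>" "\<not> m < \<bar>snd p\<bar>" using za zc by auto
      then show False using that m by (cases p) (auto simp: Sq_def)
    qed
    define ca where "ca = (\<integral>s. bump a b n s \<partial>lborel)"
    define A1 where "A1 = indefinite (bump a b n)"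
    note dA1 = indefinite_Cinf[of "bump a b n" m, OF Cinf_bump za, folded A1_def]
    have A1_def: "A1 x = (\<integral>s. bump a b n s * indicator {..x} s \<partial>lborel)" for x by (simp add: A1_def indefinite_def)
    have A0m: "x < - m \<Longrightarrow> A0 x = 0" "m < x \<Longrightarrow> A0 x = 1" for x
      using dA0(3,4)[of x] m a0(3) by auto
    have ai: "integrable lborel (bump a b n)" by (rule Cinf_integrable[OF Cinf_bump za])
    have aii: "integrable lborel (\<lambda>s. bump a b n s * indicator {..x} s)" for x
      using ai by (intro integrable_real_mult_indicator) auto
    have k1: "(\<integral>s. ?f (s, snd p) * q (s, fst p) \<partial>lborel) = (A1 (fst p) - ca * A0 (fst p)) * bump c d n (snd p)" for p
    proof -
      have "(\<integral>s. ?f (s, snd p) * q (s, fst p) \<partial>lborel) =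
          (\<integral>s. (bump a b n s * indicator {..fst p} s - A0 (fst p) * bump a b n s) * bump c d n (snd p) \<partial>lborel)"
        by (intro Bochner_Integration.integral_cong) (auto simp: q_eq algebra_simps split: split_indicator)
      also have "\<dots> = (A1 (fst p) - ca * A0 (fst p)) * bump c d n (snd p)"
        using ai aii[of "fst p"] by (simp add: A1_def ca_def mult.commute)
      finally show ?thesis .
    qed
    have k2: "(\<integral>s. ?f (s, snd p) * q' (s, fst p) \<partial>lborel) = - ca * a0 (fst p) * bump c d n (snd p)" for p
      by (simp add: q'_def ca_def mult_ac)
    \<comment> \<open>Since ca is the total mass of the bump, A vanishes on both sides and is an
      admissible test factor; its derivative is the bump minus ca a0.\<close>
    define A where "A x = A1 x - ca * A0 x" for x
    have "(\<integral>p. w p * ((bump a b n (fst p) - ca * a0 (fst p)) * bump c d n (snd p)) \<partial>lb2)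
        = - (\<integral>p. h p * (A (fst p) * bump c d n (snd p)) \<partial>lb2)"
    proof (rule wk[unfolded weak_x_def, rule_format])
      show "Cinf A" unfolding A_def by (intro Cinf_diff Cinf_mult Cinf_const dA1 dA0)
      show "Cinf (bump c d n)" by (rule Cinf_bump)
      show "(A has_real_derivative bump a b n x - ca * a0 x) (at x)" for x
        unfolding A_def by (intro DERIV_diff DERIV_cmult dA1 dA0)
      show "m < 1" by (rule m)
      show "A x = 0 \<and> bump c d n x = 0" if "m < \<bar>x\<bar>" for x
        using that zc[OF that] dA1(3,4)[of x] A0m[of x] by (auto simp: A_def ca_def abs_if split: if_splits)
    qed
    moreover have "(\<integral>p. w p * ((bump a b n (fst p) - ca * a0 (fst p)) * bump c d n (snd p)) \<partial>lb2) =
        (\<integral>p. ?f p * w p \<partial>lb2) + (\<integral>p. w p * (- ca * a0 (fst p) * bump c d n (snd p)) \<partial>lb2)"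
    proof -
      have bnd: "integrable lb2 (\<lambda>p. u p * w p)" if [measurable]: "u \<in> borel_measurable lb2" and "\<And>p. \<bar>u p\<bar> \<le> D" for u D
      proof (rule Bochner_Integration.integrable_bound[OF integrable_mult_right[OF w, of D]])
        show "AE p in lb2. norm (u p * w p) \<le> norm (D * w p)"
          by (intro AE_I2) (simp add: abs_mult mult_right_mono order_trans[OF that(2) abs_ge_self])
      qed measurable
      have "integrable lb2 (\<lambda>p. (- ca * a0 (fst p) * bump c d n (snd p)) * w p)"
      proof (rule bnd[of _ "\<bar>ca\<bar> * C0"])
        fix p
        have "\<bar>a0 (fst p)\<bar> * \<bar>bump c d n (snd p)\<bar> \<le> C0 * 1"
          using C0[of "fst p"] a0(4)[of "fst p"] bump_le1 bump_nonneg by (intro mult_mono) auto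
        from mult_left_mono[OF this, of "\<bar>ca\<bar>"]
        show "\<bar>- ca * a0 (fst p) * bump c d n (snd p)\<bar> \<le> \<bar>ca\<bar> * C0" by (simp add: abs_mult mult.assoc)
      qed measurable
      moreover have "integrable lb2 (\<lambda>p. ?f p * w p)" using fb by (intro bnd[of _ 1]) auto
      ultimately show ?thesis
        by (subst Bochner_Integration.integral_add[symmetric]) (auto simp: algebra_simps)
    qed
    moreover have "(\<integral>p. ?f p * K p \<partial>lb2) = (\<integral>p. ?f p * w p \<partial>lb2) + (\<integral>p. h p * (A (fst p) * bump c d n (snd p)) \<partial>lb2)
      + (\<integral>p. w p * (- ca * a0 (fst p) * bump c d n (snd p)) \<partial>lb2)"
      using fK[of ?f 1] fb fz unfolding k1 k2 by (simp add: A_def)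
    ultimately have "(\<integral>p. ?f p * K p \<partial>lb2) = 0" by simp
    then show "(\<integral>p. K p * ?f p \<partial>lb2) = 0" by (simp add: mult.commute)
  qed
  then have "AE p in lb2. f p * K p = 0" using f(2) by (auto elim!: eventually_mono)
  then have "(\<integral>p. f p * K p \<partial>lb2) = (\<integral>p. 0 \<partial>lb2)" by (intro integral_cong_AE) auto
  moreover have "(\<integral>s. f (s, snd p) * q (s, fst p) \<partial>lborel) = primitive f p" for p
  proof -
    let ?I = "indicator {-1<..<1} :: real \<Rightarrow> real"
    have fi: "integrable lborel (\<lambda>s. f (s, snd p))"
    proof (rule Bochner_Integration.integrable_bound)
      show "integrable lborel (\<lambda>s. C * ?I s)" by simp
      show "AE s in lborel. norm (f (s, snd p)) \<le> norm (C * ?I s)"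
        using f by (intro AE_I2) (auto simp: Sq_def split: split_indicator intro: order_trans[OF _ abs_ge_self])
    qed measurable
    have "(\<integral>s. f (s, snd p) * q (s, fst p) \<partial>lborel) =
        (\<integral>s. f (s, snd p) * indicator {..fst p} s - A0 (fst p) * f (s, snd p) \<partial>lborel)"
      by (intro Bochner_Integration.integral_cong) (auto simp: q_eq algebra_simps split: split_indicator)
    also have "\<dots> = primitive f p"
      using fi mean[of "snd p"] integrable_real_mult_indicator[OF _ fi, of "{..fst p}"] by (simp add: primitive_def)
    finally show ?thesis .
  qed
  moreover have "(\<integral>s. f (s, snd p) * q' (s, fst p) \<partial>lborel) = 0" for p
    using mean[of "snd p"] by (simp add: q'_def)
  ultimately show ?thesis using fK[OF fm f] by simp
qed

section \<open>Sobolev functions on the square\<close>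

definition vec_of :: "real \<times> real \<Rightarrow> real^2" where "vec_of p = vector [fst p, snd p]"
definition pair_of :: "real^2 \<Rightarrow> real \<times> real" where "pair_of x = (x $ 1, x $ 2)"

lemma vec_of_nth [simp]: "vec_of p $ 1 = fst p" "vec_of p $ 2 = snd p"
  by (simp_all add: vec_of_def)

lemma pair_of_sel [simp]: "fst (pair_of x) = x $ 1" "snd (pair_of x) = x $ 2"
  by (simp_all add: pair_of_def)

lemma pair_of_vec_of [simp]: "pair_of (vec_of p) = p"
  by (simp add: pair_of_def)

lemma vec_of_pair_of [simp]: "vec_of (pair_of x) = x"
  by (simp add: vec_eq_iff forall_2)

lemma pair_of_Sq [simp]: "pair_of x \<in> Sq \<longleftrightarrow> x \<in> open_square"
  by (auto simp: pair_of_def Sq_def open_square_def forall_2)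

lemma vec_of_square [simp]: "vec_of p \<in> open_square \<longleftrightarrow> p \<in> Sq"
  using pair_of_Sq[of "vec_of p"] by simp

lemma continuous_on_pair_of [continuous_intros]: "continuous_on A f \<Longrightarrow> continuous_on A (\<lambda>x. pair_of (f x))"
  unfolding pair_of_def by (intro continuous_intros)

lemma vec_of_eq: "vec_of p = (\<chi> i. if i = 1 then fst p else snd p)"
  by (simp add: vec_eq_iff forall_2)

lemma continuous_on_vec_of [continuous_intros]: "continuous_on A f \<Longrightarrow> continuous_on A (\<lambda>x. vec_of (f x))"
proof -
  assume f: "continuous_on A f"
  have "continuous_on A (\<lambda>x. if i = 1 then fst (f x) else snd (f x))" for i :: 2
    by (cases "i = 1") (auto intro!: continuous_on_fst continuous_on_snd f)
  then show ?thesis unfolding vec_of_eq by (rule continuous_on_vec_lambda)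
qed

lemma pair_of_measurable [measurable]: "pair_of \<in> borel_measurable borel"
  by (intro borel_measurable_continuous_onI continuous_on_pair_of continuous_on_id)

lemma vec_of_measurable [measurable]: "vec_of \<in> borel_measurable borel"
  by (intro borel_measurable_continuous_onI continuous_on_vec_of continuous_on_id)

lemma Basis_2: "(Basis :: (real^2) set) = {axis 1 1, axis 2 1}"
  by (auto simp: Basis_vec_def UNIV_2)

text \<open>Lebesgue measure is determined by its values on boxes. With this, line integrals can be
  handled on pairs, where Fubini applies directly.\<close>

lemma lborel_vec_of: "lborel = distr lb2 borel vec_of"
  unfolding lborel_prod
proof (rule lborel_eqI)
  fix l u :: "real^2" assume *: "\<And>b. b \<in> Basis \<Longrightarrow> l \<bullet> b \<le> u \<bullet> b"
  have lu: "l $ 1 \<le> u $ 1" "l $ 2 \<le> u $ 2"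
    using *[of "axis 1 1"] *[of "axis 2 1"] by (auto simp: Basis_2 inner_axis)
  have ne: "axis 1 1 \<noteq> (axis 2 1 :: real^2)" by (simp add: axis_eq_axis)
  have "vec_of -` box l u \<inter> space (lborel :: (real \<times> real) measure) = box (pair_of l) (pair_of u)"
    by (auto simp: mem_box_cart box_Pair forall_2 pair_of_def)
  then have "emeasure (distr lborel borel vec_of) (box l u) = emeasure lborel (box (pair_of l) (pair_of u))"
    by (subst emeasure_distr) auto
  also have "\<dots> = emeasure lborel (box (l $ 1) (u $ 1)) * emeasure lborel (box (l $ 2) (u $ 2))"
    unfolding lborel_prod[symmetric] pair_of_def box_Pair by (rule lborel.emeasure_pair_measure_Times) auto
  also have "\<dots> = ennreal (\<Prod>b\<in>Basis. (u - l) \<bullet> b)"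
    using lu ne by (simp add: Basis_2 inner_axis ennreal_mult')
  finally show "emeasure (distr lborel borel vec_of) (box l u) = ennreal (\<Prod>b\<in>Basis. (u - l) \<bullet> b)" .
qed simp

lemma lb2_pair_of: "lb2 = distr lborel borel pair_of"
proof -
  have "distr (distr lborel borel vec_of) borel pair_of = distr lborel borel (pair_of \<circ> vec_of)"
    by (rule distr_distr) measurable
  also have "\<dots> = lborel" by (simp add: o_def distr_id2)
  finally show ?thesis unfolding lborel_vec_of lborel_prod by simp
qed

lemma AE_pair_of: "AE p in lb2. P p \<Longrightarrow> AE x in lebesgue. P (pair_of x)"
  by (intro AE_completion) (subst (asm) lb2_pair_of, drule AE_distrD[rotated], auto)

lemma AE_vec_of: "AE x in lebesgue. P x \<Longrightarrow> AE p in lb2. P (vec_of p)"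
  unfolding AE_completion_iff by (subst (asm) lborel_vec_of, drule AE_distrD[rotated]) (auto simp: lborel_prod)

lemma lebesgue_measurable_AE:
  fixes f g :: "'a::euclidean_space \<Rightarrow> real"
  assumes "g \<in> borel_measurable lebesgue" "AE x in lebesgue. f x = g x"
  shows "f \<in> borel_measurable lebesgue"
proof (rule borel_measurable_iff_le[THEN iffD2], intro allI)
  fix a
  have "AE x in lebesgue. x \<in> {x. g x \<le> a} \<longleftrightarrow> x \<in> {x. f x \<le> a}" using assms(2) by eventually_elim auto
  moreover have "{x. g x \<le> a} \<in> sets lebesgue" using assms(1) unfolding borel_measurable_iff_le by simp
  ultimately show "{x \<in> space lebesgue. f x \<le> a} \<in> sets lebesgue"
    using completion.in_sets_AE[of "{x. g x \<le> a}" "{x. f x \<le> a}"] by simp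
qed

text \<open>\<open>F'\<close> is a Borel version on pairs of the restriction of \<open>F\<close> to the square.\<close>
definition rep :: "(real^2 \<Rightarrow> real) \<Rightarrow> (real \<times> real \<Rightarrow> real) \<Rightarrow> bool" where
  "rep F F' \<longleftrightarrow> F' \<in> borel_measurable lb2 \<and> (\<forall>p. p \<notin> Sq \<longrightarrow> F' p = 0) \<and>
     (AE x in lebesgue. x \<in> open_square \<longrightarrow> F x = F' (pair_of x))"

lemma repD [dest]:
  assumes "rep F F'"
  shows "F' \<in> borel_measurable lb2" "\<And>p. p \<notin> Sq \<Longrightarrow> F' p = 0" "AE x in lebesgue. x \<in> open_square \<longrightarrow> F x = F' (pair_of x)"
  using assms by (auto simp: rep_def)

lemma open_square_open: "open open_square"
proof -
  have "open_square = {x. -1 < x $ 1} \<inter> {x. x $ 1 < 1} \<inter> {x. -1 < x $ 2} \<inter> {x. x $ 2 < 1}"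
    by (auto simp: open_square_def forall_2)
  then show ?thesis
    by (rule ssubst) (intro open_Int open_halfspace_component_lt_cart open_halfspace_component_gt_cart)
qed

lemma rep_AE:
  assumes "rep F F'" shows "AE x in lebesgue. indicator open_square x *\<^sub>R F x = F' (pair_of x)"
  using repD(3)[OF assms]
  by eventually_elim (auto split: split_indicator simp: repD(2)[OF assms])

lemma rep_meas:
  assumes "rep F F'" shows "(\<lambda>x. F' (pair_of x)) \<in> borel_measurable borel"
  using repD(1)[OF assms] unfolding lborel_prod by simp

lemma rep_integrable:
  assumes r: "rep F F'"
  shows "set_integrable lebesgue open_square F \<longleftrightarrow> integrable lb2 F'"
proof -
  note m = rep_meas[OF r]
  then have m': "(\<lambda>x. F' (pair_of x)) \<in> borel_measurable lebesgue" by (intro measurable_completion) simp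
  have "set_integrable lebesgue open_square F \<longleftrightarrow> integrable lebesgue (\<lambda>x. F' (pair_of x))"
    unfolding set_integrable_def
    by (rule integrable_cong_AE[OF lebesgue_measurable_AE[OF m' rep_AE[OF r]] m' rep_AE[OF r]])
  also have "\<dots> \<longleftrightarrow> integrable lborel (\<lambda>x. F' (pair_of x))" using m by (intro integrable_completion) simp
  also have "\<dots> \<longleftrightarrow> integrable (distr lborel borel pair_of) F'"
    using repD(1)[OF r] unfolding lborel_prod by (subst integrable_distr_eq) auto
  finally show ?thesis unfolding lb2_pair_of[symmetric] .
qed

lemma rep_integral:
  assumes r: "rep F F'"
  shows "(LINT x:open_square|lebesgue. F x) = integral\<^sup>L lb2 F'"
proof -
  note m = rep_meas[OF r]
  then have m': "(\<lambda>x. F' (pair_of x)) \<in> borel_measurable lebesgue" by (intro measurable_completion) simp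
  have "(LINT x:open_square|lebesgue. F x) = (\<integral>x. F' (pair_of x) \<partial>lebesgue)"
    unfolding set_lebesgue_integral_def
    by (rule integral_cong_AE[OF lebesgue_measurable_AE[OF m' rep_AE[OF r]] m' rep_AE[OF r]])
  also have "\<dots> = (\<integral>x. F' (pair_of x) \<partial>lborel)" using m by (intro integral_completion) simp
  also have "\<dots> = (\<integral>p. F' p \<partial>distr lborel borel pair_of)"
    using repD(1)[OF r] unfolding lborel_prod by (subst integral_distr) auto
  finally show ?thesis unfolding lb2_pair_of[symmetric] .
qed

lemma rep_exists:
  assumes "(\<lambda>x. indicator open_square x *\<^sub>R F x) \<in> borel_measurable lebesgue"
  shows "\<exists>F'. rep F F'"
proof -
  obtain g where g: "g \<in> borel_measurable lborel" "AE x in lborel. indicator open_square x *\<^sub>R F x = g x"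
    using completion_ex_borel_measurable_real[OF assms] by blast
  have [measurable]: "g \<in> borel_measurable borel" using g by simp
  have s: "Sq \<in> sets borel" using Sq_sets unfolding lborel_prod by simp
  have "rep F (\<lambda>p. indicator Sq p * g (vec_of p))"
    unfolding rep_def
  proof (intro conjI)
    show "(\<lambda>p. indicator Sq p * g (vec_of p)) \<in> borel_measurable lb2"
      unfolding lborel_prod using s by simp
    show "AE x in lebesgue. x \<in> open_square \<longrightarrow> F x = indicator Sq (pair_of x) * g (vec_of (pair_of x))"
      using AE_completion[OF g(2)] by eventually_elim (auto split: split_indicator_asm)
  qed auto
  then show ?thesis by blast
qed

lemma rep_ops:
  assumes F: "rep F F'" and G: "rep G G'"
  shows "rep (\<lambda>x. F x + G x) (\<lambda>p. F' p + G' p)" "rep (\<lambda>x. F x - G x) (\<lambda>p. F' p - G' p)"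
    "rep (\<lambda>x. F x * G x) (\<lambda>p. F' p * G' p)"
proof -
  note [measurable] = repD(1)[OF F] repD(1)[OF G]
  show "rep (\<lambda>x. F x + G x) (\<lambda>p. F' p + G' p)" "rep (\<lambda>x. F x - G x) (\<lambda>p. F' p - G' p)"
    "rep (\<lambda>x. F x * G x) (\<lambda>p. F' p * G' p)"
    unfolding rep_def using repD(3)[OF F] repD(3)[OF G] repD(2)[OF F] repD(2)[OF G] by auto
qed

lemma rep_cmult:
  assumes F: "rep F F'" shows "rep (\<lambda>x. c * F x) (\<lambda>p. c * F' p)"
proof -
  note [measurable] = repD(1)[OF F]
  show ?thesis unfolding rep_def using repD(2,3)[OF F] by auto
qed

lemma rep_Borel:
  assumes [measurable]: "f \<in> borel_measurable lb2"
  shows "rep (\<lambda>x. f (pair_of x)) (\<lambda>p. indicator Sq p * f p)"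
proof -
  note Sq_sets[measurable]
  show ?thesis unfolding rep_def
  proof (intro conjI)
    show "(\<lambda>p. indicator Sq p * f p) \<in> borel_measurable lb2" by measurable
  qed (auto split: split_indicator)
qed

definition test_tensor :: "(real \<Rightarrow> real) \<Rightarrow> (real \<Rightarrow> real) \<Rightarrow> real^2 \<Rightarrow> real" where
  "test_tensor A B = (\<lambda>x. A (x \<bullet> axis 1 1) * B (x \<bullet> axis 2 1))"

lemma test_tensor_in:
  assumes A: "Cinf A" and B: "Cinf B" and c: "c < 1" "\<And>x y. c < \<bar>x\<bar> \<Longrightarrow> A x * B y = 0" "\<And>x y. c < \<bar>x\<bar> \<Longrightarrow> A y * B x = 0"
  shows "test_tensor A B \<in> test_functions open_square"
proof -
  let ?K = "cbox (vec_of (-c, -c)) (vec_of (c, c))"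
  have "{x. test_tensor A B x \<noteq> 0} \<subseteq> ?K"
  proof
    fix x assume "x \<in> {x. test_tensor A B x \<noteq> 0}"
    then have n: "A (x $ 1) * B (x $ 2) \<noteq> 0" by (simp add: test_tensor_def inner_axis)
    have "\<not> c < \<bar>x $ 1\<bar>" "\<not> c < \<bar>x $ 2\<bar>" using n c(2)[of "x $ 1" "x $ 2"] c(3)[of "x $ 2" "x $ 1"] by auto
    then show "x \<in> ?K" by (auto simp: mem_box_cart forall_2)
  qed
  then have sub: "closure {x. test_tensor A B x \<noteq> 0} \<subseteq> ?K" by (intro closure_minimal) auto
  moreover have "?K \<subseteq> open_square" using c(1) by (auto simp: mem_box_cart forall_2 open_square_def)
  moreover have "compact (closure {x. test_tensor A B x \<noteq> 0})"
    using sub by (meson bounded_cbox bounded_subset closed_closure compact_eq_bounded_closed)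
  ultimately have "compactly_contained {x. test_tensor A B x \<noteq> 0} open_square"
    unfolding compactly_contained_def by blast
  then show ?thesis
    unfolding test_functions_def using smooth_on_tensor[OF A B] by (simp add: test_tensor_def)
qed


lemma test_tensor_derivative:
  assumes "\<And>x. (A has_real_derivative a x) (at x)" "\<And>x. (B has_real_derivative b x) (at x)"
  shows "frechet_derivative (test_tensor A B) (at x) (axis 1 1) = a (x $ 1) * B (x $ 2)"
    "frechet_derivative (test_tensor A B) (at x) (axis 2 1) = A (x $ 1) * b (x $ 2)"
  unfolding test_tensor_def frechet_derivative_tensor[OF assms]
  by (simp_all add: inner_axis_axis) (simp_all add: inner_axis)

lemma test_tensor_apply: "test_tensor A B x = A (x $ 1) * B (x $ 2)"
  by (simp add: test_tensor_def inner_axis)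

lemma Cinf_measurable: "Cinf f \<Longrightarrow> f \<in> borel_measurable borel"
  by (intro borel_measurable_continuous_onI Cinf_continuous)

lemma has_weak_gradient_tensor:
  fixes g :: "real^2 \<Rightarrow> real^2"
  assumes g: "has_weak_gradient v g open_square" and v: "rep v w"
    and A: "Cinf A" "\<And>x. (A has_real_derivative a x) (at x)" and B: "Cinf B" "\<And>x. (B has_real_derivative b x) (at x)"
    and c: "c < 1" and z: "\<And>x. c < \<bar>x\<bar> \<Longrightarrow> A x = 0 \<and> B x = 0"
  shows "rep (\<lambda>x. g x $ 1) h \<Longrightarrow>
      (\<integral>p. w p * (a (fst p) * B (snd p)) \<partial>lb2) = - (\<integral>p. h p * (A (fst p) * B (snd p)) \<partial>lb2)"
    and "rep (\<lambda>x. g x $ 2) h \<Longrightarrow>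
      (\<integral>p. w p * (A (fst p) * b (snd p)) \<partial>lb2) = - (\<integral>p. h p * (A (fst p) * B (snd p)) \<partial>lb2)"
proof -
  have d: "f' \<in> borel_measurable borel" if f: "Cinf f" "\<And>x. (f has_real_derivative f' x) (at x)" for f f'
  proof (rule Cinf_DERIV[OF f(1)])
    fix f1 assume f1: "\<And>x. (f has_real_derivative f1 x) (at x)" "Cinf f1"
    have "f' = f1" using f(2) f1(1) by (intro ext DERIV_unique)
    then show ?thesis using f1(2) Cinf_measurable by simp
  qed
  note [measurable] = d[OF A] d[OF B] Cinf_measurable[OF A(1)] Cinf_measurable[OF B(1)]
  have "test_tensor A B \<in> test_functions open_square"
    by (rule test_tensor_in[OF A(1) B(1) c]) (use z in auto)
  then have *: "(LINT x:open_square|lebesgue. v x * (a (x $ 1) * B (x $ 2))) =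
      - (LINT x:open_square|lebesgue. (g x $ 1) * (A (x $ 1) * B (x $ 2)))"
    "(LINT x:open_square|lebesgue. v x * (A (x $ 1) * b (x $ 2))) =
      - (LINT x:open_square|lebesgue. (g x $ 2) * (A (x $ 1) * B (x $ 2)))"
    using g unfolding has_weak_gradient_def
    by (auto simp: Basis_2 test_tensor_derivative[OF A(2) B(2)] inner_axis test_tensor_apply dest!: bspec[of _ _ "test_tensor A B"])
  have i: "(LINT x:open_square|lebesgue. F x * (f (x $ 1) * k (x $ 2))) = (\<integral>p. F' p * (f (fst p) * k (snd p)) \<partial>lb2)"
    if F: "rep F F'" and [measurable]: "f \<in> borel_measurable borel" "k \<in> borel_measurable borel" for F F' f k
  proof -
    have r: "rep (\<lambda>x. F x * (f (x $ 1) * k (x $ 2))) (\<lambda>p. F' p * (indicator Sq p * (f (fst p) * k (snd p))))"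
      using rep_ops(3)[OF F rep_Borel[of "\<lambda>p. f (fst p) * k (snd p)"]] by simp
    have "F' p * (indicator Sq p * q) = F' p * q" for p q
      using repD(2)[OF F] by (auto split: split_indicator)
    then show ?thesis unfolding rep_integral[OF r] by (simp only:)
  qed
  show "(\<integral>p. w p * (a (fst p) * B (snd p)) \<partial>lb2) = - (\<integral>p. h p * (A (fst p) * B (snd p)) \<partial>lb2)"
    if "rep (\<lambda>x. g x $ 1) h"
    using *(1) i[OF v, of a B] i[OF that, of A B] by simp
  show "(\<integral>p. w p * (A (fst p) * b (snd p)) \<partial>lb2) = - (\<integral>p. h p * (A (fst p) * B (snd p)) \<partial>lb2)"
    if "rep (\<lambda>x. g x $ 2) h"
    using *(2) i[OF v, of A b] i[OF that, of A B] by simp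
qed

lemma has_weak_gradient_weak_x:
  fixes g :: "real^2 \<Rightarrow> real^2"
  assumes "has_weak_gradient v g open_square" "rep v w" "rep (\<lambda>x. g x $ 1) h"
  shows "weak_x w h"
  unfolding weak_x_def
proof (intro allI impI)
  fix A a B :: "real \<Rightarrow> real" and c :: real
  assume A: "Cinf A" and B: "Cinf B" and d: "\<forall>x. (A has_real_derivative a x) (at x)" and c: "c < 1"
    and z: "\<forall>x. c < \<bar>x\<bar> \<longrightarrow> A x = 0 \<and> B x = 0"
  show "(\<integral>p. w p * (a (fst p) * B (snd p)) \<partial>lb2) = - (\<integral>p. h p * (A (fst p) * B (snd p)) \<partial>lb2)"
  proof (rule Cinf_DERIV[OF B])
    fix b assume "\<And>x. (B has_real_derivative b x) (at x)"
    from has_weak_gradient_tensor(1)[OF assms(1,2) A spec[OF d] B this c _ assms(3)] z show ?thesis by blast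
  qed
qed

lemma lb2_swap:
  fixes f :: "real \<times> real \<Rightarrow> real"
  assumes "f \<in> borel_measurable lb2"
  shows "(\<integral>p. f (prod.swap p) \<partial>lb2) = integral\<^sup>L lb2 f"
  using lborel_pair.integral_product_swap[OF assms] by (simp add: split_beta' prod.swap_def)

lemma AE_swap: "AE p in lb2. R p \<Longrightarrow> AE p in lb2. R (prod.swap p)"
  by (subst (asm) lborel_pair.distr_pair_swap, drule AE_distrD[rotated]) (auto simp: split_beta' prod.swap_def)

lemma has_weak_gradient_weak_y:
  fixes g :: "real^2 \<Rightarrow> real^2"
  assumes "has_weak_gradient v g open_square" and w: "rep v w" and h: "rep (\<lambda>x. g x $ 2) h"
  shows "weak_x (w \<circ> prod.swap) (h \<circ> prod.swap)"
  unfolding weak_x_def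
proof (intro allI impI)
  fix A a B :: "real \<Rightarrow> real" and c :: real
  assume A: "Cinf A" and B: "Cinf B" and d: "\<forall>x. (A has_real_derivative a x) (at x)" and c: "c < 1"
    and z: "\<forall>x. c < \<bar>x\<bar> \<longrightarrow> A x = 0 \<and> B x = 0"
  obtain a' where a': "\<And>x. (A has_real_derivative a' x) (at x)" "Cinf a'" using Cinf_DERIV[OF A] by blast
  have "a = a'" using d a'(1) by (intro ext DERIV_unique) auto
  with a'(2) have [measurable]: "a \<in> borel_measurable borel" "A \<in> borel_measurable borel" "B \<in> borel_measurable borel"
    using A B by (auto intro: Cinf_measurable)
  note [measurable] = repD(1)[OF w] repD(1)[OF h]
  have "(\<integral>p. w p * (B (fst p) * a (snd p)) \<partial>lb2) = - (\<integral>p. h p * (B (fst p) * A (snd p)) \<partial>lb2)"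
  proof (rule Cinf_DERIV[OF B])
    fix b assume "\<And>x. (B has_real_derivative b x) (at x)"
    from has_weak_gradient_tensor(2)[OF assms(1,2) B this A spec[OF d] c _ h] z show ?thesis by blast
  qed
  then show "(\<integral>p. (w \<circ> prod.swap) p * (a (fst p) * B (snd p)) \<partial>lb2) = - (\<integral>p. (h \<circ> prod.swap) p * (A (fst p) * B (snd p)) \<partial>lb2)"
    using lb2_swap[of "\<lambda>p. w p * (B (fst p) * a (snd p))"] lb2_swap[of "\<lambda>p. h p * (B (fst p) * A (snd p))"]
    by (simp add: mult.commute)
qed

text \<open>Integrability on smaller squares is all that a weak gradient offers by itself; it is
  enough for uniqueness.\<close>

definition loc_box :: "(real \<times> real \<Rightarrow> real) \<Rightarrow> bool" where
  "loc_box k \<longleftrightarrow> (\<forall>c. 0 < c \<longrightarrow> c < 1 \<longrightarrow> integrable lb2 (\<lambda>p. indicator ({-c..c} \<times> {-c..c}) p * k p))"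

text \<open>Measurability on the open square is not assumed but follows by exhausting it with
  compact squares, on each of which the function is integrable.\<close>

lemma locally_integrable_rep:
  assumes f: "locally_integrable_on f open_square"
  shows "\<exists>F'. rep (\<lambda>x. f x \<bullet> i) F' \<and> loc_box F'"
proof -
  define K where "K c = cbox (vec_of (-c, -c)) (vec_of (c, c))" for c :: real
  have K_iff: "x \<in> K c \<longleftrightarrow> \<bar>x $ 1\<bar> \<le> c \<and> \<bar>x $ 2\<bar> \<le> c" for x c
    by (auto simp: K_def mem_box_cart forall_2)
  have Ksub: "K c \<subseteq> open_square" if "c < 1" for c
    using that by (auto simp: K_iff open_square_def forall_2 abs_le_iff)
  have Kint: "set_integrable lebesgue (K c) (\<lambda>x. f x \<bullet> i)" if "c < 1" for c
  proof -
    have "set_integrable lebesgue (K c) f"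
      using f Ksub[OF that] unfolding locally_integrable_on_def K_def by (meson compact_cbox)
    then have "integrable lebesgue (\<lambda>x. (indicator (K c) x *\<^sub>R f x) \<bullet> i)"
      unfolding set_integrable_def by (rule integrable_inner_left)
    then show ?thesis by (simp add: set_integrable_def)
  qed
  define C where "C n = 1 - 1 / real (n + 2)" for n :: nat
  have C: "0 < C n" "C n < 1" for n by (auto simp: C_def field_simps)
  have "(\<lambda>x. indicator open_square x *\<^sub>R (f x \<bullet> i)) \<in> borel_measurable lebesgue"
  proof (rule borel_measurable_LIMSEQ_metric)
    show "(\<lambda>x. indicator (K (C n)) x *\<^sub>R (f x \<bullet> i)) \<in> borel_measurable lebesgue" for n
      using Kint[OF C(2)] by (auto simp: set_integrable_def)
    fix x :: "real^2"
    show "(\<lambda>n. indicator (K (C n)) x *\<^sub>R (f x \<bullet> i)) \<longlonglongrightarrow> indicator open_square x *\<^sub>R (f x \<bullet> i)"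
    proof (cases "x \<in> open_square")
      case False
      then have "x \<notin> K (C n)" for n using Ksub[OF C(2)] by blast
      then show ?thesis using False by simp
    next
      case True
      then have lt: "max \<bar>x $ 1\<bar> \<bar>x $ 2\<bar> < 1" by (auto simp: open_square_def forall_2 abs_less_iff)
      have "C \<longlonglongrightarrow> 1" unfolding C_def by real_asymp
      then have "eventually (\<lambda>n. max \<bar>x $ 1\<bar> \<bar>x $ 2\<bar> < C n) sequentially" by (rule order_tendstoD(1)[OF _ lt])
      then have "eventually (\<lambda>n. indicator (K (C n)) x *\<^sub>R (f x \<bullet> i) = indicator open_square x *\<^sub>R (f x \<bullet> i)) sequentially"
        by eventually_elim (use True in \<open>simp add: K_iff\<close>)
      then show ?thesis by (rule tendsto_eventually)
    qed
  qed
  then obtain F where F: "rep (\<lambda>x. f x \<bullet> i) F" using rep_exists[of "\<lambda>x. f x \<bullet> i"] by blast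
  have "loc_box F"
    unfolding loc_box_def
  proof (intro allI impI)
    fix c :: real assume c: "0 < c" "c < 1"
    let ?B = "{-c..c} \<times> {-c..c}"
    have sub: "?B \<subseteq> Sq" using c by (auto simp: Sq_def)
    have BK: "indicator ?B (pair_of x) = (indicator (K c) x :: real)" for x
      by (auto simp: pair_of_def K_iff split: split_indicator)
    have "rep (\<lambda>x. indicator ?B (pair_of x) * (f x \<bullet> i)) (\<lambda>p. (indicator Sq p * indicator ?B p) * F p)"
      by (rule rep_ops(3)[OF rep_Borel F]) measurable
    also have "(\<lambda>p. (indicator Sq p * indicator ?B p) * F p) = (\<lambda>p. indicator ?B p * F p)"
      using repD(2)[OF F] by (auto simp: fun_eq_iff split: split_indicator)
    finally have r: "rep (\<lambda>x. indicator (K c) x * (f x \<bullet> i)) (\<lambda>p. indicator ?B p * F p)" unfolding BK .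
    have "indicator open_square x *\<^sub>R (indicator (K c) x * (f x \<bullet> i)) = indicator (K c) x *\<^sub>R (f x \<bullet> i)" for x
      using Ksub[OF c(2)] by (auto split: split_indicator)
    then have "set_integrable lebesgue open_square (\<lambda>x. indicator (K c) x * (f x \<bullet> i))"
      using Kint[OF c(2)] by (simp only: set_integrable_def)
    then show "integrable lb2 (\<lambda>p. indicator ?B p * F p)" using rep_integrable[OF r] by simp
  qed
  then show ?thesis using F by blast
qed

text \<open>The fundamental lemma of the calculus of variations, with bump tensors as test
  functions: the left-hand side of the defining identity does not involve the weak
  derivative.\<close>

lemma weak_x_unique:
  assumes wh: "weak_x w h" "weak_x w h'" and l: "loc_box h" "loc_box h'"
    and [measurable]: "h \<in> borel_measurable lb2" "h' \<in> borel_measurable lb2"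
  shows "AE p in lb2. p \<in> Sq \<longrightarrow> h p = h' p"
proof -
  have "AE p in lb2. p \<in> Sq \<longrightarrow> h p - h' p = 0"
  proof (rule bumps_zero)
    fix c :: real assume "0 < c" "c < 1"
    then show "integrable lb2 (\<lambda>p. indicator ({-c..c} \<times> {-c..c}) p * (h p - h' p))"
      using l unfolding loc_box_def right_diff_distrib by (intro Bochner_Integration.integrable_diff) auto
  next
    fix a b c d :: real and n assume ab: "-1 < a" "b < 1" "-1 < c" "d < 1"
    have mb[measurable]: "bump a b n \<in> borel_measurable borel" for a b n
      by (intro Cinf_measurable Cinf_bump)
    obtain a' where a': "\<And>x. (bump a b n has_real_derivative a' x) (at x)" using Cinf_DERIV[OF Cinf_bump] by blast
    define m where "m = max (1/2) (max (max (- a) b) (max (- c) d))"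
    have m: "0 < m" "m < 1" using ab by (auto simp: m_def)
    have za: "bump a b n x = 0" if "m < \<bar>x\<bar>" for x using that by (intro bump_outside) (auto simp: m_def abs_if split: if_splits)
    have zc: "bump c d n x = 0" if "m < \<bar>x\<bar>" for x using that by (intro bump_outside) (auto simp: m_def abs_if split: if_splits)
    have e: "(\<integral>p. w p * (a' (fst p) * bump c d n (snd p)) \<partial>lb2) = - (\<integral>p. k p * (bump a b n (fst p) * bump c d n (snd p)) \<partial>lb2)"
      if "weak_x w k" for k
      using that[unfolded weak_x_def, rule_format, OF Cinf_bump Cinf_bump a' m(2)] za zc by blast
    have i: "integrable lb2 (\<lambda>p. k p * (bump a b n (fst p) * bump c d n (snd p)))"
      if "loc_box k" and [measurable]: "k \<in> borel_measurable lb2" for k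
    proof (rule Bochner_Integration.integrable_bound)
      show "integrable lb2 (\<lambda>p. indicator ({-m..m} \<times> {-m..m}) p * k p)" using that(1) m by (simp add: loc_box_def)
      show "AE p in lb2. norm (k p * (bump a b n (fst p) * bump c d n (snd p))) \<le> norm (indicator ({-m..m} \<times> {-m..m}) p * k p)"
      proof (rule AE_I2)
        fix p
        have 1: "bump a b n (fst p) * bump c d n (snd p) \<le> 1" "0 \<le> bump a b n (fst p) * bump c d n (snd p)"
          by (auto intro: mult_le_one mult_nonneg_nonneg bump_le1 bump_nonneg)
        show "norm (k p * (bump a b n (fst p) * bump c d n (snd p))) \<le> norm (indicator ({-m..m} \<times> {-m..m}) p * k p)"
        proof (cases "p \<in> {-m..m} \<times> {-m..m}")
          case True
          then show ?thesis using mult_left_mono[OF 1(1), of "\<bar>k p\<bar>"]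
            by (simp add: abs_mult abs_of_nonneg[OF bump_nonneg])
        next
          case False
          then have "m < \<bar>fst p\<bar> \<or> m < \<bar>snd p\<bar>" by (cases p) auto
          then show ?thesis using za zc by auto
        qed
      qed
    qed measurable
    show "(\<integral>p. (h p - h' p) * (bump a b n (fst p) * bump c d n (snd p)) \<partial>lb2) = 0"
      unfolding left_diff_distrib using i[OF l(1)] i[OF l(2)] e[OF wh(1)] e[OF wh(2)] by simp
  qed measurable
  then show ?thesis by eventually_elim auto
qed


section \<open>Classical gradients as weak gradients, and uniqueness of weak gradients\<close>

lemma compactly_contained_square:
  fixes S :: "(real^2) set"
  assumes "compactly_contained S open_square"
  shows "\<exists>c. 0 < c \<and> c < 1 \<and> (\<forall>x\<in>S. \<bar>x $ 1\<bar> \<le> c \<and> \<bar>x $ 2\<bar> \<le> c)"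
proof (cases "S = {}")
  case True
  then show ?thesis by (intro exI[of _ "1/2"]) auto
next
  case False
  let ?m = "\<lambda>x::real^2. max \<bar>x $ 1\<bar> \<bar>x $ 2\<bar>"
  have "\<exists>x\<in>closure S. \<forall>y\<in>closure S. ?m y \<le> ?m x"
    using assms False by (intro continuous_attains_sup continuous_intros) (auto simp: compactly_contained_def)
  then obtain x where x: "x \<in> closure S" "\<And>y. y \<in> closure S \<Longrightarrow> ?m y \<le> ?m x" by blast
  have "x \<in> open_square" using x assms by (auto simp: compactly_contained_def)
  then have "?m x < 1" by (auto simp: open_square_def forall_2 abs_less_iff)
  then show ?thesis
    using x(2) closure_subset[of S] by (intro exI[of _ "max (1/2) (?m x)"]) (fastforce simp: le_max_iff_disj)
qed

lemma slice_integration_by_parts: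
  assumes U: "continuous_on Sq U" and P: "continuous_on Sq P"
    and dU: "\<And>x y. (x, y) \<in> Sq \<Longrightarrow> ((\<lambda>s. U (s, y)) has_real_derivative P (x, y)) (at x)"
    and q: "continuous_on UNIV \<psi>" "continuous_on UNIV \<psi>'"
    and dq: "\<And>x y. ((\<lambda>s. \<psi> (s, y)) has_real_derivative \<psi>' (x, y)) (at x)"
    and c: "0 < c" "c < 1" "\<And>x y. c < \<bar>x\<bar> \<or> c < \<bar>y\<bar> \<Longrightarrow> \<psi> (x, y) = 0"
  shows "(\<integral>p. indicator Sq p * (U p * \<psi>' p) \<partial>lb2) = - (\<integral>p. indicator Sq p * (P p * \<psi> p) \<partial>lb2)"
proof -
  have z': "\<psi>' (x, y) = 0" if "c < \<bar>x\<bar> \<or> c < \<bar>y\<bar>" for x y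
  proof -
    have "eventually (\<lambda>s. \<psi> (s, y) = 0) (at x)"
    proof (cases "c < \<bar>y\<bar>")
      case True
      then show ?thesis using c(3) by simp
    next
      case False
      have "open {s. c < \<bar>s\<bar>}" by (intro open_Collect_less continuous_intros)
      then have "eventually (\<lambda>s. s \<in> {s. c < \<bar>s\<bar>}) (nhds x)" using that False by (intro eventually_nhds_in_open) auto
      then have "eventually (\<lambda>s. \<psi> (s, y) = 0) (nhds x)" by eventually_elim (use c(3) in auto)
      then show ?thesis by (simp add: eventually_nhds_conv_at)
    qed
    then have "((\<lambda>s. 0) has_real_derivative \<psi>' (x, y)) (at x)"
      using has_field_derivative_cong_eventually[of "\<lambda>s. \<psi> (s, y)" "\<lambda>s. 0" x UNIV] dq[where ?x=x and ?y=y] c(3) that by auto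
    then show ?thesis using DERIV_unique[OF _ DERIV_const] by blast
  qed
  \<comment> \<open>Strictly between c and 1: \<psi> is 0 at the ends of the segment from -d to d,
    which still lies in the open square, where U is differentiable along lines.\<close>
  define d where "d = (1 + c) / 2"
  have d: "c < d" "d < 1" "0 < d" using c by (auto simp: d_def)
  let ?K = "{-d..d} \<times> {-d..d}"
  have K: "?K \<subseteq> Sq" "compact ?K" using d by (auto simp: Sq_def intro: compact_Times)
  have ci: "integrable lb2 (\<lambda>p. indicator Sq p * f p)"
    and ce: "indicator Sq p * f p = indicator ?K p * f p"
    if "continuous_on Sq f" "\<And>x y. c < \<bar>x\<bar> \<or> c < \<bar>y\<bar> \<Longrightarrow> f (x, y) = 0" for f :: "real \<times> real \<Rightarrow> real" and p
  proof -
    have e: "indicator Sq p * f p = indicator ?K p *\<^sub>R f p" for p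
    proof (cases "p \<in> ?K")
      case True
      then have "p \<in> Sq" using K by blast
      then show ?thesis using True by simp
    next
      case False
      then have "c < \<bar>fst p\<bar> \<or> c < \<bar>snd p\<bar>" using d by (cases p) auto
      then have "f p = 0" using that(2)[of "fst p" "snd p"] by simp
      then show ?thesis by simp
    qed
    show "integrable lb2 (\<lambda>p. indicator Sq p * f p)"
      unfolding e lborel_prod by (rule borel_integrable_compact[OF K(2) continuous_on_subset[OF that(1) K(1)]])
    show "indicator Sq p * f p = indicator ?K p * f p" using e by simp
  qed
  have q': "continuous_on Sq \<psi>" "continuous_on Sq \<psi>'" using q continuous_on_subset by blast+
  have i1: "integrable lb2 (\<lambda>p. indicator Sq p * (U p * \<psi>' p))" and i2: "integrable lb2 (\<lambda>p. indicator Sq p * (P p * \<psi> p))"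
    using c(3) z' by (intro ci continuous_on_mult U P q'; force)+
  define H where "H p = U p * \<psi>' p + P p * \<psi> p" for p
  have Hi: "integrable lb2 (\<lambda>p. indicator Sq p * H p)"
    using i1 i2 by (simp add: H_def distrib_left)
  have He: "indicator Sq p * H p = indicator ?K p * H p" for p
    unfolding H_def using c(3) z' by (intro ce continuous_intros U P q') auto
  have s: "(\<integral>x. indicator Sq (x, y) * H (x, y) \<partial>lborel) = 0" for y
  proof (cases "\<bar>y\<bar> \<le> c")
    case False
    then have "H (x, y) = 0" for x using c(3) z' by (simp add: H_def)
    then show ?thesis by simp
  next
    case True
    then have y: "\<bar>y\<bar> \<le> d" "\<bar>y\<bar> < 1" using d by auto
    have iS: "continuous (at x) (\<lambda>s. f (s, y))" if "continuous_on Sq f" "\<bar>x\<bar> < 1" for f :: "real \<times> real \<Rightarrow> real" and x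
    proof -
      have o: "open Sq" unfolding Sq_def by (intro open_Times) auto
      have "(x, y) \<in> Sq" using that y by (auto simp: Sq_def abs_less_iff)
      then have "isCont f (x, y)" using that(1) o by (simp add: continuous_on_eq_continuous_at)
      moreover have "isCont (\<lambda>s. (s, y)) x" by (intro continuous_Pair continuous_const continuous_ident)
      ultimately show ?thesis using isCont_o2[of x "\<lambda>s. (s, y)" f] by blast
    qed
    have "(\<integral>x. indicator Sq (x, y) * H (x, y) \<partial>lborel) = (\<integral>x. H (x, y) * indicator {-d..d} x \<partial>lborel)"
      unfolding He using y by (intro Bochner_Integration.integral_cong) (auto split: split_indicator)
    also have "\<dots> = U (d, y) * \<psi> (d, y) - U (-d, y) * \<psi> (-d, y)"
    proof (rule integral_FTC_Icc_real)
      fix x assume x: "- d \<le> x" "x \<le> d"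
      then have x1: "\<bar>x\<bar> < 1" using d by auto
      have "(x, y) \<in> Sq" using x1 y by (auto simp: Sq_def abs_less_iff)
      from DERIV_mult[OF dU[OF this] dq[of y x]]
      show "((\<lambda>x. U (x, y) * \<psi> (x, y)) has_real_derivative H (x, y)) (at x)"
        by (simp add: H_def mult.commute add.commute)
      show "isCont (\<lambda>x. H (x, y)) x"
        unfolding H_def by (intro continuous_intros iS U P q' x1)
    qed (use d in simp)
    also have "\<dots> = 0" using c(3)[of d y] c(3)[of "-d" y] d by simp
    finally show ?thesis .
  qed
  have "(\<integral>p. indicator Sq p * H p \<partial>lb2) = 0"
    using slice_integrable(3)[OF Hi] unfolding s by simp
  then show ?thesis unfolding H_def distrib_left using i1 i2 by simp
qed

lemma integrable_on_compact:
  fixes f :: "'a::euclidean_space \<Rightarrow> 'b::euclidean_space"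
  assumes "compact K" "continuous_on K f"
  shows "set_integrable lebesgue K f"
proof -
  have "integrable lborel (\<lambda>x. indicator K x *\<^sub>R f x)" by (rule borel_integrable_compact[OF assms])
  then show ?thesis unfolding set_integrable_def by (subst integrable_completion) auto
qed

lemma open_Sq: "open Sq" unfolding Sq_def by (intro open_Times) auto

lemma pair_of_compose_continuous:
  assumes "continuous_on Sq f" shows "continuous_on open_square (\<lambda>x. f (pair_of x))"
  by (rule continuous_on_compose2[OF assms continuous_on_pair_of[OF continuous_on_id]]) auto

lemma test_function_slices:
  assumes t: "\<phi> \<in> test_functions open_square"
  shows "continuous_on UNIV \<phi>" "continuous_on UNIV (\<lambda>x. frechet_derivative \<phi> (at x) v)"
    "((\<lambda>s. \<phi> (vec_of (s, y))) has_real_derivative frechet_derivative \<phi> (at (vec_of (x, y))) (axis 1 1)) (at x)"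
    "((\<lambda>s. \<phi> (vec_of (y, s))) has_real_derivative frechet_derivative \<phi> (at (vec_of (y, x))) (axis 2 1)) (at x)"
proof -
  have "higher_differentiable_on n \<phi> UNIV" for n using t by (simp add: test_functions_def smooth_on_def)
  from this[of 0] this[of "Suc 0"]
  have d: "\<phi> differentiable (at x)" and c: "continuous_on UNIV \<phi>" "continuous_on UNIV (\<lambda>x. frechet_derivative \<phi> (at x) v)" for x v
    by auto
  show "continuous_on UNIV \<phi>" "continuous_on UNIV (\<lambda>x. frechet_derivative \<phi> (at x) v)" by (rule c)+
  have D: "(\<phi> has_derivative frechet_derivative \<phi> (at x)) (at x)" for x
    using d frechet_derivative_works by blast
  have lin: "frechet_derivative \<phi> (at z) (h *\<^sub>R w) = h * frechet_derivative \<phi> (at z) w" for z h w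
    using linear_cmul[OF linear_frechet_derivative[OF d]] by simp
  have "vec_of (s, y) = vec_of (0, y) + s *\<^sub>R axis 1 1" "vec_of (y, s) = vec_of (y, 0) + s *\<^sub>R axis 2 1" for s y
    by (simp_all add: vec_eq_iff forall_2 axis_def)
  note e = this
  have *: "((\<lambda>s. z + s *\<^sub>R w) has_derivative (\<lambda>h. h *\<^sub>R w)) (at x)" for z w :: "real^2"
    by (auto intro!: derivative_eq_intros)
  have v: "((\<lambda>s. vec_of (s, y)) has_derivative (\<lambda>h. h *\<^sub>R axis 1 1)) (at x)"
    "((\<lambda>s. vec_of (y, s)) has_derivative (\<lambda>h. h *\<^sub>R axis 2 1)) (at x)"
    by (subst e, rule *)+
  show "((\<lambda>s. \<phi> (vec_of (s, y))) has_real_derivative frechet_derivative \<phi> (at (vec_of (x, y))) (axis 1 1)) (at x)"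
    "((\<lambda>s. \<phi> (vec_of (y, s))) has_real_derivative frechet_derivative \<phi> (at (vec_of (y, x))) (axis 2 1)) (at x)"
    using has_derivative_compose[OF v(1) D] has_derivative_compose[OF v(2) D]
    unfolding has_field_derivative_def lin mult_commute_abs by blast+
qed

lemma has_weak_gradient_classical:
  assumes U: "continuous_on Sq U" and P: "continuous_on Sq P" and Q: "continuous_on Sq Q"
    and dU: "\<And>x y. (x, y) \<in> Sq \<Longrightarrow> ((\<lambda>s. U (s, y)) has_real_derivative P (x, y)) (at x)"
      "\<And>x y. (x, y) \<in> Sq \<Longrightarrow> ((\<lambda>s. U (x, s)) has_real_derivative Q (x, y)) (at y)"
  shows "has_weak_gradient (\<lambda>x. U (pair_of x)) (\<lambda>x. vec_of (P (pair_of x), Q (pair_of x))) open_square"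
  unfolding has_weak_gradient_def
proof (intro conjI ballI)
  show "locally_integrable_on (\<lambda>x. U (pair_of x)) open_square"
    unfolding locally_integrable_on_def
    using pair_of_compose_continuous[OF U] by (auto intro!: integrable_on_compact intro: continuous_on_subset)
  have "continuous_on open_square (\<lambda>x. vec_of (P (pair_of x), Q (pair_of x)))"
    by (intro continuous_intros pair_of_compose_continuous P Q)
  then show "locally_integrable_on (\<lambda>x. vec_of (P (pair_of x), Q (pair_of x))) open_square"
    unfolding locally_integrable_on_def by (auto intro!: integrable_on_compact intro: continuous_on_subset)
next
  fix \<phi> :: "real^2 \<Rightarrow> real" and i :: "real^2" assume t: "\<phi> \<in> test_functions open_square" and i: "i \<in> Basis"
  note ts = test_function_slices[OF t]
  obtain c where c: "0 < c" "c < 1" "\<And>x. \<phi> x \<noteq> 0 \<Longrightarrow> \<bar>x $ 1\<bar> \<le> c \<and> \<bar>x $ 2\<bar> \<le> c"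
    using compactly_contained_square[of "{x. \<phi> x \<noteq> 0}"] t by (auto simp: test_functions_def)
  define D where "D i p = frechet_derivative \<phi> (at (vec_of p)) i" for i p
  have cD: "continuous_on UNIV (D i)" for i
    unfolding D_def by (rule continuous_on_compose2[OF ts(2) continuous_on_vec_of[OF continuous_on_id]]) auto
  have c\<phi>: "continuous_on UNIV (\<lambda>p. \<phi> (vec_of p))"
    by (rule continuous_on_compose2[OF ts(1) continuous_on_vec_of[OF continuous_on_id]]) auto
  have zp: "\<phi> (vec_of (x, y)) = 0" if "c < \<bar>x\<bar> \<or> c < \<bar>y\<bar>" for x y
    using c(3)[of "vec_of (x, y)"] that by (cases "\<phi> (vec_of (x, y)) = 0") auto
  have r: "rep (\<lambda>x. f (pair_of x) * g (pair_of x)) (\<lambda>p. indicator Sq p * (f p * g p))"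
    if "continuous_on Sq f" "continuous_on UNIV g" for f g :: "real \<times> real \<Rightarrow> real"
  proof -
    have "continuous_on Sq (\<lambda>p. f p * g p)" by (intro continuous_on_mult that continuous_on_subset[OF that(2)]) auto
    then have "(\<lambda>p. indicator Sq p *\<^sub>R (f p * g p)) \<in> borel_measurable borel"
      using Sq_sets unfolding lborel_prod by (intro borel_measurable_continuous_on_indicator) auto
    then show ?thesis unfolding rep_def lborel_prod by (auto split: split_indicator)
  qed
  have sw: "continuous_on UNIV (\<lambda>p. prod.swap p :: real \<times> real)"
    unfolding prod.swap_def by (intro continuous_intros)
  have Ssw: "(y, x) \<in> Sq \<longleftrightarrow> (x, y) \<in> Sq" "prod.swap p \<in> Sq \<longleftrightarrow> p \<in> Sq" for x y p by (cases p, auto simp: Sq_def)+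
  have csw: "continuous_on Sq (\<lambda>p. f (prod.swap p))" if "continuous_on Sq f" for f :: "real \<times> real \<Rightarrow> real"
    by (rule continuous_on_compose2[OF that continuous_on_subset[OF sw]]) (auto simp: Ssw)
  have csw': "continuous_on UNIV (\<lambda>p. f (prod.swap p))" if "continuous_on UNIV f" for f :: "real \<times> real \<Rightarrow> real"
    by (rule continuous_on_compose2[OF that sw]) auto
  show "(LINT x:open_square|lebesgue. U (pair_of x) * frechet_derivative \<phi> (at x) i) =
      - (LINT x:open_square|lebesgue. (vec_of (P (pair_of x), Q (pair_of x)) \<bullet> i) * \<phi> x)"
  proof (cases "i = axis 1 1")
    case True
    have "(LINT x:open_square|lebesgue. U (pair_of x) * D i (pair_of x)) =
        - (LINT x:open_square|lebesgue. P (pair_of x) * \<phi> (vec_of (pair_of x)))"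
      unfolding rep_integral[OF r[OF U cD]] rep_integral[OF r[OF P c\<phi>]]
      by (rule slice_integration_by_parts[OF U P dU(1) c\<phi> cD _ c(1,2)]) (use ts(3) zp in \<open>auto simp: D_def True\<close>)
    then show ?thesis by (simp add: D_def True inner_axis)
  next
    case False
    then have i2: "i = axis 2 1" using i by (simp add: Basis_2)
    let ?D = "\<lambda>p. D i (prod.swap p)"
    have "(\<integral>p. indicator Sq p * (U (prod.swap p) * ?D p) \<partial>lb2) = - (\<integral>p. indicator Sq p * (Q (prod.swap p) * \<phi> (vec_of (prod.swap p))) \<partial>lb2)"
      by (rule slice_integration_by_parts[OF csw[OF U] csw[OF Q] _ csw'[OF c\<phi>] csw'[OF cD] _ c(1,2)])
        (use dU(2) ts(4) zp in \<open>auto simp: D_def i2 Ssw\<close>)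
    then have "(LINT x:open_square|lebesgue. U (pair_of x) * D i (pair_of x)) =
        - (LINT x:open_square|lebesgue. Q (pair_of x) * \<phi> (vec_of (pair_of x)))"
      using lb2_swap[OF repD(1)[OF r[OF U cD[of i]]]] lb2_swap[OF repD(1)[OF r[OF Q c\<phi>]]]
      unfolding rep_integral[OF r[OF U cD]] rep_integral[OF r[OF Q c\<phi>]] by (simp add: Ssw indicator_def)
    then show ?thesis by (simp add: D_def i2 inner_axis)
  qed
qed

lemma L2_square_rep:
  fixes g :: "real^2 \<Rightarrow> 'b::euclidean_space"
  assumes g: "g \<in> L2_on open_square" and r: "rep (\<lambda>x. g x \<bullet> i) h" and i: "norm i \<le> 1"
  shows "integrable lb2 (\<lambda>p. (h p)\<^sup>2)" "integrable lb2 h"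
proof -
  note Sq_sets[measurable] and repD(1)[OF r, measurable]
  have o: "open_square \<in> sets lebesgue" using open_square_open by simp
  have ig: "set_integrable lebesgue open_square (\<lambda>x. (norm (g x))\<^sup>2)"
    using g o by (simp add: L2_on_def integrable_restrict_space set_integrable_def)
  have r2: "rep (\<lambda>x. (g x \<bullet> i)\<^sup>2) (\<lambda>p. (h p)\<^sup>2)" using rep_ops(3)[OF r r] by (simp add: power2_eq_square)
  have m: "(\<lambda>x. indicator open_square x *\<^sub>R (g x \<bullet> i)\<^sup>2) \<in> borel_measurable lebesgue"
    by (rule lebesgue_measurable_AE[OF _ rep_AE[OF r2]]) (use rep_meas[OF r2] in \<open>intro measurable_completion, simp\<close>)
  have "set_integrable lebesgue open_square (\<lambda>x. (g x \<bullet> i)\<^sup>2)"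
    unfolding set_integrable_def
  proof (rule Bochner_Integration.integrable_bound[OF ig[unfolded set_integrable_def] m AE_I2])
    fix x
    have "\<bar>g x \<bullet> i\<bar> \<le> norm (g x) * norm i" by (rule Cauchy_Schwarz_ineq2)
    also have "\<dots> \<le> norm (g x)" using i by (simp add: mult_left_le)
    finally have "(g x \<bullet> i)\<^sup>2 \<le> (norm (g x))\<^sup>2" by (metis abs_le_square_iff abs_norm_cancel)
    then show "norm (indicator open_square x *\<^sub>R (g x \<bullet> i)\<^sup>2) \<le> norm (indicator open_square x *\<^sub>R (norm (g x))\<^sup>2)"
      by (simp add: indicator_def)
  qed
  then show i2: "integrable lb2 (\<lambda>p. (h p)\<^sup>2)" using rep_integrable[OF r2] by simp
  have i1: "integrable lb2 (indicator Sq :: _ \<Rightarrow> real)"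
    using integrable_real_indicator[OF Sq_sets emeasure_Sq] .
  show "integrable lb2 h"
  proof (rule Bochner_Integration.integrable_bound[OF Bochner_Integration.integrable_add[OF i1 i2] _ AE_I2])
    fix p
    have "\<bar>h p\<bar> \<le> 1 + (h p)\<^sup>2" using zero_le_power2[of "\<bar>h p\<bar> - 1"] by (simp add: power2_eq_square algebra_simps)
    then show "norm (h p) \<le> norm (indicator Sq p + (h p)\<^sup>2)"
      using repD(2)[OF r, of p] by (cases "p \<in> Sq") auto
  qed measurable
qed

text \<open>\<open>weak_gradient\<close> is a choice among all weak gradients and carries no square
  integrability of its own. Uniqueness allows replacing it by any gradient at hand: the one from
  membership in \<open>W12\<close>, or the classical gradient of the solution.\<close>

lemma weak_gradient_unique:
  fixes g g' :: "real^2 \<Rightarrow> real^2"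
  assumes g: "has_weak_gradient v g open_square" and g': "has_weak_gradient v g' open_square"
  shows "AE x in lebesgue. x \<in> open_square \<longrightarrow> g x = g' x"
proof -
  have l: "locally_integrable_on v open_square" "locally_integrable_on g open_square" "locally_integrable_on g' open_square"
    using g g' by (auto simp: has_weak_gradient_def)
  have i: "x \<bullet> axis k 1 = x $ k" for x :: "real^2" and k by (simp add: inner_axis)
  obtain w where w: "rep v w" using locally_integrable_rep[OF l(1), of 1] by auto
  have 1: "AE x in lebesgue. x \<in> open_square \<longrightarrow> g x $ 1 = g' x $ 1"
  proof -
    obtain h where h: "rep (\<lambda>x. g x $ 1) h" "loc_box h" using locally_integrable_rep[OF l(2), of "axis 1 1"] by (auto simp: i)
    obtain h' where h': "rep (\<lambda>x. g' x $ 1) h'" "loc_box h'" using locally_integrable_rep[OF l(3), of "axis 1 1"] by (auto simp: i)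
    have "AE p in lb2. p \<in> Sq \<longrightarrow> h p = h' p"
      by (rule weak_x_unique[OF has_weak_gradient_weak_x[OF g w h(1)] has_weak_gradient_weak_x[OF g' w h'(1)] h(2) h'(2) repD(1)[OF h(1)] repD(1)[OF h'(1)]])
    from AE_pair_of[OF this] repD(3)[OF h(1)] repD(3)[OF h'(1)] show ?thesis by eventually_elim auto
  qed
  have 2: "AE x in lebesgue. x \<in> open_square \<longrightarrow> g x $ 2 = g' x $ 2"
  proof -
    obtain h where h: "rep (\<lambda>x. g x $ 2) h" "loc_box h" using locally_integrable_rep[OF l(2), of "axis 2 1"] by (auto simp: i)
    obtain h' where h': "rep (\<lambda>x. g' x $ 2) h'" "loc_box h'" using locally_integrable_rep[OF l(3), of "axis 2 1"] by (auto simp: i)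
    have sw: "loc_box (k \<circ> prod.swap)" if "loc_box k" "rep f k" for k f
      unfolding loc_box_def
    proof (intro allI impI)
      fix c :: real assume "0 < c" "c < 1"
      then have "integrable lb2 (\<lambda>p. indicator ({-c..c} \<times> {-c..c}) p * k p)" using that by (simp add: loc_box_def)
      from lborel_pair.integrable_product_swap[OF this]
      show "integrable lb2 (\<lambda>p. indicator ({-c..c} \<times> {-c..c}) p * (k \<circ> prod.swap) p)"
        by (simp add: split_beta' prod.swap_def indicator_times mult.commute)
    qed
    have [measurable]: "prod.swap \<in> measurable lb2 lb2" by (rule measurable_pair_swap'[unfolded prod.swap_def[symmetric, abs_def] split_beta'])
    have hm: "h \<circ> prod.swap \<in> borel_measurable lb2" "h' \<circ> prod.swap \<in> borel_measurable lb2"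
      using repD(1)[OF h(1)] repD(1)[OF h'(1)] by (auto intro!: measurable_comp)
    have "AE p in lb2. p \<in> Sq \<longrightarrow> (h \<circ> prod.swap) p = (h' \<circ> prod.swap) p"
      by (rule weak_x_unique[OF has_weak_gradient_weak_y[OF g w h(1)] has_weak_gradient_weak_y[OF g' w h'(1)] sw[OF h(2,1)] sw[OF h'(2,1)] hm])
    from AE_swap[OF this] have "AE p in lb2. p \<in> Sq \<longrightarrow> h p = h' p" by (simp add: Sq_def mem_Times_iff conj_commute)
    from AE_pair_of[OF this] repD(3)[OF h(1)] repD(3)[OF h'(1)] show ?thesis by eventually_elim auto
  qed
  from 1 2 show ?thesis by eventually_elim (auto simp: vec_eq_iff forall_2)
qed


lemma rep_cong_AE:
  assumes "rep F F'" "AE x in lebesgue. x \<in> open_square \<longrightarrow> G x = F x" shows "rep G F'"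
proof -
  have "AE x in lebesgue. x \<in> open_square \<longrightarrow> G x = F' (pair_of x)"
    using repD(3)[OF assms(1)] assms(2) by eventually_elim auto
  then show ?thesis using assms(1) by (simp add: rep_def)
qed

text \<open>The interface between Sobolev functions on \<open>real^2\<close> and the computations on
  pairs: everything that the energy identity consumes about a competitor, phrased for the gradient
  that occurs in \<open>L_functional\<close>.\<close>

lemma W12_rep:
  assumes v: "v \<in> W12 open_square"
  obtains w h1 h2 where "rep v w" "rep (\<lambda>x. weak_gradient open_square v x $ 1) h1" "rep (\<lambda>x. weak_gradient open_square v x $ 2) h2"
    "weak_x w h1" "weak_x (w \<circ> prod.swap) (h2 \<circ> prod.swap)"
    "integrable lb2 w" "integrable lb2 h1" "integrable lb2 h2" "integrable lb2 (\<lambda>p. (h1 p)\<^sup>2)" "integrable lb2 (\<lambda>p. (h2 p)\<^sup>2)"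
proof -
  obtain g where v2: "v \<in> L2_on open_square" and g: "has_weak_gradient v g open_square" and g2: "g \<in> L2_on open_square"
    using v by (auto simp: W12_def)
  have G: "has_weak_gradient v (weak_gradient open_square v) open_square"
    unfolding weak_gradient_def by (rule someI[of "\<lambda>g. has_weak_gradient v g open_square", OF g])
  note ae = weak_gradient_unique[OF G g]
  have i: "x \<bullet> axis k 1 = x $ k" for x :: "real^2" and k by (simp add: inner_axis)
  have l: "locally_integrable_on v open_square" "locally_integrable_on g open_square"
    using g by (auto simp: has_weak_gradient_def)
  obtain w where w: "rep v w" using locally_integrable_rep[OF l(1), of 1] by auto
  obtain h1 where h1: "rep (\<lambda>x. g x \<bullet> axis 1 1) h1" using locally_integrable_rep[OF l(2)] by blast
  obtain h2 where h2: "rep (\<lambda>x. g x \<bullet> axis 2 1) h2" using locally_integrable_rep[OF l(2)] by blast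
  have r1: "rep (\<lambda>x. weak_gradient open_square v x $ 1) h1"
    by (rule rep_cong_AE[OF h1]) (use ae in \<open>eventually_elim, simp add: i\<close>)
  have r2: "rep (\<lambda>x. weak_gradient open_square v x $ 2) h2"
    by (rule rep_cong_AE[OF h2]) (use ae in \<open>eventually_elim, simp add: i\<close>)
  have w': "rep (\<lambda>x. v x \<bullet> 1) w" using w by simp
  show ?thesis
    by (rule that[OF w r1 r2 has_weak_gradient_weak_x[OF G w r1] has_weak_gradient_weak_y[OF G w r2]
      L2_square_rep(2)[OF v2 w'] L2_square_rep(2)[OF g2 h1] L2_square_rep(2)[OF g2 h2] L2_square_rep(1)[OF g2 h1] L2_square_rep(1)[OF g2 h2]]) auto
qed

lemma L_functional_rep:
  assumes "rep v w" "rep (\<lambda>x. weak_gradient open_square v x $ 1) h1" "rep (\<lambda>x. weak_gradient open_square v x $ 2) h2"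
  shows "L_functional v = (\<integral>p. ((h1 p - indicator Sq p * fst p)\<^sup>2 + (h2 p - indicator Sq p * snd p)\<^sup>2) / 2 + w p \<partial>lb2)"
proof -
  have m: "(fst :: real \<times> real \<Rightarrow> real) \<in> borel_measurable lb2" "(snd :: real \<times> real \<Rightarrow> real) \<in> borel_measurable lb2"
    by (auto simp: measurable_split_conv)
  note d1 = rep_ops(2)[OF assms(2) rep_Borel[OF m(1)]] and d2 = rep_ops(2)[OF assms(3) rep_Borel[OF m(2)]]
  have r: "rep (\<lambda>x. (1/2) * ((weak_gradient open_square v x $ 1 - fst (pair_of x)) * (weak_gradient open_square v x $ 1 - fst (pair_of x)) +
      (weak_gradient open_square v x $ 2 - snd (pair_of x)) * (weak_gradient open_square v x $ 2 - snd (pair_of x))) + v x)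
    (\<lambda>p. (1/2) * ((h1 p - indicator Sq p * fst p) * (h1 p - indicator Sq p * fst p) + (h2 p - indicator Sq p * snd p) * (h2 p - indicator Sq p * snd p)) + w p)"
    by (rule rep_ops(1)[OF rep_cmult[OF rep_ops(1)[OF rep_ops(3)[OF d1 d1] rep_ops(3)[OF d2 d2]]] assms(1)])
  have n: "(norm z)\<^sup>2 = z $ 1 * z $ 1 + z $ 2 * z $ 2" for z :: "real^2"
    by (simp add: power2_norm_eq_inner inner_vec_def sum_2)
  show ?thesis
    unfolding L_functional_def n using rep_integral[OF r] by (simp add: power2_eq_square)
qed

section \<open>Minimality and uniqueness\<close>

lemma bounded_mult_integrable:
  fixes f g :: "'a \<Rightarrow> real"
  assumes g: "integrable M g" and [measurable]: "f \<in> borel_measurable M" and f: "\<And>p. \<bar>f p\<bar> \<le> C"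
  shows "integrable M (\<lambda>p. f p * g p)"
proof (rule Bochner_Integration.integrable_bound[OF integrable_mult_right[OF g, of C]])
  show "AE p in M. norm (f p * g p) \<le> norm (C * g p)"
    by (intro AE_I2) (simp add: abs_mult mult_right_mono order_trans[OF f abs_ge_self])
qed (use g in measurable)

lemma primitive_measurable:
  fixes f :: "real \<times> real \<Rightarrow> real"
  assumes [measurable]: "f \<in> borel_measurable lb2"
  shows "primitive f \<in> borel_measurable lb2"
proof -
  have e: "indicator {..x} s = (if s \<le> x then 1 else (0::real))" for x s :: real by simp
  show ?thesis unfolding primitive_def[abs_def] e by measurable
qed

lemma swap_measurable [measurable]: "prod.swap \<in> measurable lb2 lb2"
  unfolding prod.swap_def by (rule measurable_Pair[OF measurable_snd measurable_fst])

lemma swap_Sq [simp]: "prod.swap p \<in> Sq \<longleftrightarrow> p \<in> Sq"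
  by (cases p) (auto simp: Sq_def)

lemma measure_Sq: "measure lb2 Sq = 4"
proof -
  have "emeasure lb2 Sq = ennreal 2 * ennreal 2"
    unfolding Sq_def by (subst lborel.emeasure_pair_measure_Times) auto
  then show ?thesis by (simp add: measure_def ennreal_mult''[symmetric] del: ennreal_numeral)
qed

lemma integral_Sq: "(\<integral>p. indicator Sq p \<partial>lb2) = (4::real)"
  using measure_Sq by (simp add: space_pair_measure)

lemma integrable_Sq: "integrable lb2 (indicator Sq :: _ \<Rightarrow> real)"
  by (rule integrable_real_indicator[OF Sq_sets emeasure_Sq])

text \<open>A test function of mean zero splits into one of mean zero on each horizontal line and one that
  depends on \<open>y\<close> only and has mean zero on each vertical line.\<close>
lemma constant_of_line_means:
  assumes d: "integrable lb2 d" and d0: "\<And>p. p \<notin> Sq \<Longrightarrow> d p = 0"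
    and x: "\<And>f. f \<in> borel_measurable lb2 \<Longrightarrow> (\<And>p. \<bar>f p\<bar> \<le> 4) \<Longrightarrow> (\<And>p. p \<notin> Sq \<Longrightarrow> f p = 0) \<Longrightarrow>
      (\<And>y. (\<integral>s. f (s, y) \<partial>lborel) = 0) \<Longrightarrow> (\<integral>p. f p * d p \<partial>lb2) = (0::real)"
    and y: "\<And>f. f \<in> borel_measurable lb2 \<Longrightarrow> (\<And>p. \<bar>f p\<bar> \<le> 4) \<Longrightarrow> (\<And>p. p \<notin> Sq \<Longrightarrow> f p = 0) \<Longrightarrow>
      (\<And>y. (\<integral>s. f (s, y) \<partial>lborel) = 0) \<Longrightarrow> (\<integral>p. f p * d (prod.swap p) \<partial>lb2) = (0::real)"
  shows "\<exists>m. AE p in lb2. p \<in> Sq \<longrightarrow> d p = m"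
proof -
  note Sq_sets[measurable]
  have dm[measurable]: "d \<in> borel_measurable lb2" using d by auto
  define m where "m = (\<integral>p. d p \<partial>lb2) / 4"
  \<comment> \<open>The sign of d - m as a test function produces the L1 norm of d - m. Subtracting
    its mean \<mu> makes it admissible, which changes nothing because d - m has mean zero.\<close>
  define g0 where "g0 p = indicator Sq p * sgn (d p - m)" for p
  have g0m[measurable]: "g0 \<in> borel_measurable lb2" unfolding g0_def by measurable
  have g0b: "\<bar>g0 p\<bar> \<le> indicator Sq p" for p by (auto simp: g0_def abs_sgn_eq split: split_indicator)
  have g0i: "integrable lb2 g0"
    by (rule Bochner_Integration.integrable_bound[OF integrable_Sq g0m AE_I2]) (use g0b in \<open>simp\<close>)
  define \<mu> where "\<mu> = (\<integral>p. g0 p \<partial>lb2) / 4"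
  have \<mu>: "\<bar>\<mu>\<bar> \<le> 1"
  proof -
    have "\<bar>\<integral>p. g0 p \<partial>lb2\<bar> \<le> (\<integral>p. indicator Sq p \<partial>lb2)"
      using Bochner_Integration.integral_norm_bound_integral[OF g0i integrable_Sq] g0b by simp
    then show ?thesis unfolding integral_Sq \<mu>_def by simp
  qed
  define g where "g p = g0 p - \<mu> * indicator Sq p" for p
  have gm[measurable]: "g \<in> borel_measurable lb2" unfolding g_def by measurable
  have gz: "g p = 0" if "p \<notin> Sq" for p using that by (simp add: g_def g0_def)
  have gb: "\<bar>g p\<bar> \<le> 2" for p
  proof (cases "p \<in> Sq")
    case True
    then show ?thesis using g0b[of p] \<mu> by (simp add: g_def)
  qed (simp add: gz)
  have gi: "integrable lb2 g" unfolding g_def using g0i integrable_Sq by simp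
  have g0: "(\<integral>p. g p \<partial>lb2) = 0"
    unfolding g_def using g0i integrable_Sq by (simp only: Bochner_Integration.integral_diff integrable_mult_right integral_mult_right_zero integral_Sq) (simp add: \<mu>_def)
  \<comment> \<open>The mean over a horizontal line, which has length 2.\<close>
  define gx where "gx t = (\<integral>s. g (s, t) \<partial>lborel) / 2" for t
  have gxm[measurable]: "gx \<in> borel_measurable borel" unfolding gx_def by measurable
  have I: "integrable lborel (indicator {-1<..<1} :: real \<Rightarrow> real)" by simp
  have gI: "\<bar>g (s, t)\<bar> \<le> 2 * indicator {-1<..<1} s" for s t
    using gb[of "(s, t)"] gz[of "(s, t)"] by (cases "s \<in> {-1<..<1}") (auto simp: Sq_def)
  have sl: "integrable lborel (\<lambda>s. g (s, t))" for t
  proof (rule Bochner_Integration.integrable_bound[OF integrable_mult_right[OF I, of 2] _ AE_I2])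
    show "norm (g (s, t)) \<le> norm (2 * indicator {-1<..<1} s :: real)" for s
      using gI[of s t] by simp
  qed measurable
  have gxb: "\<bar>gx t\<bar> \<le> 2" for t
  proof -
    have "\<bar>\<integral>s. g (s, t) \<partial>lborel\<bar> \<le> 4"
      using Bochner_Integration.integral_norm_bound_integral[OF sl integrable_mult_right[OF I, of 2]] gI by simp
    then show ?thesis by (simp add: gx_def)
  qed
  have gx0: "gx t = 0" if "t \<notin> {-1<..<1}" for t
  proof -
    have "g (s, t) = 0" for s using that by (intro gz) (auto simp: Sq_def)
    then show ?thesis by (simp add: gx_def)
  qed
  have gxi: "(\<integral>t. gx t \<partial>lborel) = 0"
    unfolding gx_def using slice_integrable(3)[OF gi] g0 by simp
  define f1 where "f1 p = g p - indicator Sq p * gx (snd p)" for p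
  define f2 where "f2 p = indicator Sq p * gx (fst p)" for p
  have [measurable]: "f1 \<in> borel_measurable lb2" "f2 \<in> borel_measurable lb2" unfolding f1_def f2_def by measurable
  have f1b: "\<bar>f1 p\<bar> \<le> 4" for p using gb[of p] gxb[of "snd p"] by (auto simp: f1_def split: split_indicator)
  have f2b: "\<bar>f2 p\<bar> \<le> 4" for p using gxb[of "fst p"] by (auto simp: f2_def split: split_indicator)
  have 1: "(\<integral>p. f1 p * d p \<partial>lb2) = 0"
  proof (rule x)
    fix t
    have e: "f1 (s, t) = g (s, t) - gx t * indicator {-1<..<1} s" for s
      using gx0[of t] by (auto simp: f1_def Sq_def split: split_indicator)
    show "(\<integral>s. f1 (s, t) \<partial>lborel) = 0"
      unfolding e using sl[of t] I by (simp add: Bochner_Integration.integral_diff) (simp add: gx_def)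
  qed (use f1b gz in \<open>auto simp: f1_def\<close>)
  have 2: "(\<integral>p. f2 p * d (prod.swap p) \<partial>lb2) = 0"
  proof (rule y)
    fix t
    have e: "f2 (s, t) = indicator {-1<..<1} t * gx s" for s
      using gx0[of s] by (auto simp: f2_def Sq_def split: split_indicator)
    show "(\<integral>s. f2 (s, t) \<partial>lborel) = 0" unfolding e using gxi by simp
  qed (use f2b in \<open>auto simp: f2_def\<close>)
  have f2d: "(\<lambda>p. f2 p * d (prod.swap p)) \<in> borel_measurable lb2" by measurable
  have 3: "(\<integral>p. f2 (prod.swap p) * d p \<partial>lb2) = 0" using lb2_swap[OF f2d] 2 by simp
  have i1: "integrable lb2 (\<lambda>p. f1 p * d p)" by (rule bounded_mult_integrable[OF d _ f1b]) measurable
  have i3: "integrable lb2 (\<lambda>p. f2 (prod.swap p) * d p)" by (rule bounded_mult_integrable[OF d _ f2b]) measurable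
  have g12: "g p * d p = f1 p * d p + f2 (prod.swap p) * d p" for p
    by (simp add: f1_def f2_def algebra_simps indicator_def)
  have gd: "(\<integral>p. g p * d p \<partial>lb2) = 0" unfolding g12 using i1 i3 1 3 by simp
  have gdi: "integrable lb2 (\<lambda>p. g p * d p)" by (rule bounded_mult_integrable[OF d gm gb])
  have e: "indicator Sq p * \<bar>d p - m\<bar> = g p * d p - m * g p + \<mu> * (d p - m * indicator Sq p)" for p
  proof (cases "p \<in> Sq")
    case True
    have "\<bar>d p - m\<bar> = sgn (d p - m) * (d p - m)" by (simp add: abs_sgn mult.commute)
    then show ?thesis using True by (simp add: g_def g0_def algebra_simps)
  next
    case False
    then show ?thesis using d0[OF False] gz[OF False] by simp
  qed
  have i: "integrable lb2 (\<lambda>p. indicator Sq p * \<bar>d p - m\<bar>)"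
    unfolding e using gdi gi d integrable_Sq by simp
  have "(\<integral>p. indicator Sq p * \<bar>d p - m\<bar> \<partial>lb2) = 
      (\<integral>p. g p * d p \<partial>lb2) - m * (\<integral>p. g p \<partial>lb2) + \<mu> * ((\<integral>p. d p \<partial>lb2) - m * (\<integral>p. indicator Sq p \<partial>lb2))"
    unfolding e using gdi gi d integrable_Sq by (simp add: Bochner_Integration.integral_add Bochner_Integration.integral_diff)
  also have "\<dots> = 0" unfolding gd g0 integral_Sq by (simp add: m_def)
  finally have "AE p in lb2. indicator Sq p * \<bar>d p - m\<bar> = 0"
    using integral_nonneg_eq_0_iff_AE[OF i] by (auto simp: indicator_def)
  then have "AE p in lb2. p \<in> Sq \<longrightarrow> d p = m" by eventually_elim auto
  then show ?thesis by blast
qed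

abbreviation cSq :: "(real \<times> real) set" where "cSq \<equiv> {-1..1} \<times> {-1..1}"

text \<open>With \<open>V = Du - x\<close>, the functions \<open>F\<^sub>1\<close> and \<open>F\<^sub>2\<close> (in swapped coordinates) are
  \<open>\<partial>\<^sub>xV\<^sub>1\<close> and \<open>\<partial>\<^sub>yV\<^sub>2\<close>; their vanishing line means express that \<open>V\<close> has no normal
  component on the boundary, and \<open>div_eq\<close> is the Euler--Lagrange equation.\<close>
locale obstacle_solution =
  fixes U P Q F1 F2 :: "real \<times> real \<Rightarrow> real" and C :: real
  assumes cont: "continuous_on cSq U" "continuous_on cSq P" "continuous_on cSq Q"
    and dU: "\<And>x y. (x, y) \<in> Sq \<Longrightarrow> ((\<lambda>s. U (s, y)) has_real_derivative P (x, y)) (at x)"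
      "\<And>x y. (x, y) \<in> Sq \<Longrightarrow> ((\<lambda>s. U (x, s)) has_real_derivative Q (x, y)) (at y)"
    and U_nonneg: "\<And>p. p \<in> Sq \<Longrightarrow> 0 \<le> U p"
    and F1: "F1 \<in> borel_measurable lb2" "\<And>p. \<bar>F1 p\<bar> \<le> C" "\<And>p. p \<notin> Sq \<Longrightarrow> F1 p = 0" "\<And>y. (\<integral>s. F1 (s, y) \<partial>lborel) = 0"
      "AE p in lb2. p \<in> Sq \<longrightarrow> primitive F1 p = P p - fst p"
    and F2: "F2 \<in> borel_measurable lb2" "\<And>p. \<bar>F2 p\<bar> \<le> C" "\<And>p. p \<notin> Sq \<Longrightarrow> F2 p = 0" "\<And>y. (\<integral>s. F2 (s, y) \<partial>lborel) = 0"
      "AE p in lb2. p \<in> Sq \<longrightarrow> primitive F2 p = Q (prod.swap p) - fst p"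
    and div_eq: "AE p in lb2. p \<in> Sq \<longrightarrow> F1 p + F2 (prod.swap p) = (if U p = 0 then - 2 else 1)"
begin

definition u :: "real^2 \<Rightarrow> real" where "u x = U (pair_of x)"
definition U1 where "U1 p = indicator Sq p * U p"
definition P1 where "P1 p = indicator Sq p * P p"
definition Q1 where "Q1 p = indicator Sq p * Q p"
definition V1 where "V1 p = indicator Sq p * (P p - fst p)"
definition V2 where "V2 p = indicator Sq p * (Q p - snd p)"
definition Zp where "Zp = {p \<in> Sq. U p = 0}"

lemma Sq_cSq: "Sq \<subseteq> cSq" by (auto simp: Sq_def)

lemma cont_Sq: "continuous_on Sq U" "continuous_on Sq P" "continuous_on Sq Q"
  using cont continuous_on_subset[OF _ Sq_cSq] by blast+

lemma Sq_continuous: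
  assumes "continuous_on cSq f"
  shows "(\<lambda>p. indicator Sq p * f p) \<in> borel_measurable lb2" "\<exists>B. \<forall>p. \<bar>indicator Sq p * f p\<bar> \<le> (B::real)"
proof -
  have "(\<lambda>p. indicator Sq p *\<^sub>R f p) \<in> borel_measurable borel"
    by (rule borel_measurable_continuous_on_indicator[OF borel_open[OF open_Sq] continuous_on_subset[OF assms Sq_cSq]])
  then show "(\<lambda>p. indicator Sq p * f p) \<in> borel_measurable lb2" unfolding lborel_prod by simp
  have "compact (f ` cSq)" by (intro compact_continuous_image assms compact_Times compact_Icc)
  then obtain B where B: "\<And>p. p \<in> cSq \<Longrightarrow> \<bar>f p\<bar> \<le> B" using compact_imp_bounded bounded_iff by (metis image_eqI real_norm_def)
  have "\<bar>indicator Sq p * f p\<bar> \<le> \<bar>B\<bar>" for p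
    using B[of p] Sq_cSq by (cases "p \<in> Sq") auto
  then show "\<exists>B. \<forall>p. \<bar>indicator Sq p * f p\<bar> \<le> B" by blast
qed

lemma V_cont: "continuous_on cSq (\<lambda>p. P p - fst p)" "continuous_on cSq (\<lambda>p. Q p - snd p)"
  by (intro continuous_intros cont)+

lemma meas [measurable]: "U1 \<in> borel_measurable lb2" "P1 \<in> borel_measurable lb2" "Q1 \<in> borel_measurable lb2"
    "V1 \<in> borel_measurable lb2" "V2 \<in> borel_measurable lb2" "F1 \<in> borel_measurable lb2" "F2 \<in> borel_measurable lb2"
  using Sq_continuous(1)[OF cont(1)] Sq_continuous(1)[OF cont(2)] Sq_continuous(1)[OF cont(3)]
    Sq_continuous(1)[OF V_cont(1)] Sq_continuous(1)[OF V_cont(2)] F1(1) F2(1)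
  unfolding U1_def P1_def Q1_def V1_def V2_def by auto

lemma bounded:
  obtains B where "\<And>p. \<bar>U1 p\<bar> \<le> B" "\<And>p. \<bar>P1 p\<bar> \<le> B" "\<And>p. \<bar>Q1 p\<bar> \<le> B" "\<And>p. \<bar>V1 p\<bar> \<le> B" "\<And>p. \<bar>V2 p\<bar> \<le> B"
proof -
  obtain B1 B2 B3 B4 B5 where "\<And>p. \<bar>U1 p\<bar> \<le> B1" "\<And>p. \<bar>P1 p\<bar> \<le> B2" "\<And>p. \<bar>Q1 p\<bar> \<le> B3" "\<And>p. \<bar>V1 p\<bar> \<le> B4" "\<And>p. \<bar>V2 p\<bar> \<le> B5"
    using Sq_continuous(2)[OF cont(1)] Sq_continuous(2)[OF cont(2)] Sq_continuous(2)[OF cont(3)]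
      Sq_continuous(2)[OF V_cont(1)] Sq_continuous(2)[OF V_cont(2)] unfolding U1_def P1_def Q1_def V1_def V2_def by metis
  then show thesis
    by (intro that[of "max B1 (max B2 (max B3 (max B4 B5)))"]) (auto simp: le_max_iff_disj)
qed

lemma Zp_sets [measurable]: "Zp \<in> sets lb2"
proof -
  note Sq_sets[measurable]
  have "Zp = Sq \<inter> {p \<in> space lb2. U1 p = 0}" by (auto simp: Zp_def U1_def space_pair_measure)
  moreover have "{p \<in> space lb2. U1 p = 0} \<in> sets lb2" by measurable
  ultimately show ?thesis using sets.Int[OF Sq_sets] by metis
qed

text \<open>Integration by parts moves the derivatives onto V = Du - x, whose divergence is 1 off
  the zero set and -2 on it. Hence w minus w div V is 0 or 3 w. As V has no normal component on the
  boundary, no boundary values of w occur.\<close>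

lemma flux_identity:
  assumes wx: "weak_x w h1" and wy: "weak_x (w \<circ> prod.swap) (h2 \<circ> prod.swap)"
    and i: "integrable lb2 w" "integrable lb2 h1" "integrable lb2 h2" and w0: "\<And>p. p \<notin> Sq \<Longrightarrow> w p = 0"
    and h0: "\<And>p. p \<notin> Sq \<Longrightarrow> h1 p = 0" "\<And>p. p \<notin> Sq \<Longrightarrow> h2 p = 0"
  shows "integrable lb2 (\<lambda>p. h1 p * V1 p + h2 p * V2 p + w p)" "integrable lb2 (\<lambda>p. indicator Zp p * w p)"
    "(\<integral>p. h1 p * V1 p + h2 p * V2 p + w p \<partial>lb2) = 3 * (\<integral>p. indicator Zp p * w p \<partial>lb2)"
proof -
  have [measurable]: "w \<in> borel_measurable lb2" "h1 \<in> borel_measurable lb2" "h2 \<in> borel_measurable lb2" using i by auto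
  obtain B where B: "\<And>p. \<bar>V1 p\<bar> \<le> B" "\<And>p. \<bar>V2 p\<bar> \<le> B" using bounded by metis
  have sw: "integrable lb2 (k \<circ> prod.swap)" if "integrable lb2 k" for k :: "real \<times> real \<Rightarrow> real"
    using lborel_pair.integrable_product_swap[OF that] by (simp add: split_beta' prod.swap_def o_def)
  have hv: "integrable lb2 (\<lambda>p. h1 p * V1 p)" "integrable lb2 (\<lambda>p. h2 p * V2 p)"
    using bounded_mult_integrable[OF i(2) meas(4) B(1)] bounded_mult_integrable[OF i(3) meas(5) B(2)]
    by (simp_all add: mult.commute)
  then show "integrable lb2 (\<lambda>p. h1 p * V1 p + h2 p * V2 p + w p)" using i by simp
  show "integrable lb2 (\<lambda>p. indicator Zp p * w p)" by (rule bounded_mult_integrable[OF i(1), of _ 1]) auto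
  note m1 = primitive_measurable[OF F1(1)] and m2 = primitive_measurable[OF F2(1)]
  have "(\<integral>p. h1 p * V1 p \<partial>lb2) = (\<integral>p. h1 p * primitive F1 p \<partial>lb2)"
  proof (rule integral_cong_AE)
    show "AE p in lb2. h1 p * V1 p = h1 p * primitive F1 p"
      using F1(5) by eventually_elim (auto simp: V1_def h0 indicator_def)
  qed (use m1 in measurable)
  also have "\<dots> = - (\<integral>p. F1 p * w p \<partial>lb2)"
    by (rule weak_x_integration_by_parts[OF wx i(1,2) F1(1-4)])
  finally have e1: "(\<integral>p. h1 p * V1 p \<partial>lb2) = - (\<integral>p. F1 p * w p \<partial>lb2)" .
  have "(\<integral>p. (h2 p * V2 p) \<partial>lb2) = (\<integral>p. (h2 \<circ> prod.swap) p * V2 (prod.swap p) \<partial>lb2)"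
    using lb2_swap[of "\<lambda>p. h2 p * V2 p"] by simp
  also have "\<dots> = (\<integral>p. (h2 \<circ> prod.swap) p * primitive F2 p \<partial>lb2)"
  proof (rule integral_cong_AE)
    show "AE p in lb2. (h2 \<circ> prod.swap) p * V2 (prod.swap p) = (h2 \<circ> prod.swap) p * primitive F2 p"
      using F2(5) by eventually_elim (auto simp: V2_def h0 indicator_def)
  qed (use m2 in \<open>unfold o_def, measurable\<close>)
  also have "\<dots> = - (\<integral>p. F2 p * (w \<circ> prod.swap) p \<partial>lb2)"
    by (rule weak_x_integration_by_parts[OF wy sw[OF i(1)] sw[OF i(3)] F2(1-4)])
  also have "\<dots> = - (\<integral>p. F2 (prod.swap p) * w p \<partial>lb2)"
    using lb2_swap[of "\<lambda>p. F2 (prod.swap p) * w p"] by simp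
  finally have e2: "(\<integral>p. h2 p * V2 p \<partial>lb2) = - (\<integral>p. F2 (prod.swap p) * w p \<partial>lb2)" .
  have Fi: "integrable lb2 (\<lambda>p. F1 p * w p)" "integrable lb2 (\<lambda>p. F2 (prod.swap p) * w p)"
    using F1(2) F2(2) by (auto intro!: bounded_mult_integrable[OF i(1), of _ C])
  have "(\<integral>p. h1 p * V1 p + h2 p * V2 p + w p \<partial>lb2) = (\<integral>p. w p - F1 p * w p - F2 (prod.swap p) * w p \<partial>lb2)"
    using hv i Fi by (simp add: e1 e2)
  also have "\<dots> = (\<integral>p. 3 * (indicator Zp p * w p) \<partial>lb2)"
  proof (rule integral_cong_AE)
    show "AE p in lb2. w p - F1 p * w p - F2 (prod.swap p) * w p = 3 * (indicator Zp p * w p)"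
      using div_eq
    proof eventually_elim
      fix p assume *: "p \<in> Sq \<longrightarrow> F1 p + F2 (prod.swap p) = (if U p = 0 then - 2 else 1)"
      show "w p - F1 p * w p - F2 (prod.swap p) * w p = 3 * (indicator Zp p * w p)"
      proof (cases "p \<in> Sq")
        case True
        have "w p - F1 p * w p - F2 (prod.swap p) * w p = (1 - (F1 p + F2 (prod.swap p))) * w p" by (simp add: algebra_simps)
        then show ?thesis using * True by (auto simp: Zp_def)
      qed (simp add: w0)
    qed
  qed measurable
  finally show "(\<integral>p. h1 p * V1 p + h2 p * V2 p + w p \<partial>lb2) = 3 * (\<integral>p. indicator Zp p * w p \<partial>lb2)" by simp
qed

text \<open>The terms of the expanded energy that depend on the solution alone; it turns out to be
  the minimal value.\<close>

definition c0 :: real where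
  "c0 = (\<integral>p. ((V1 p)\<^sup>2 + (V2 p)\<^sup>2) / 2 - (P1 p * V1 p + Q1 p * V2 p) \<partial>lb2)"

lemma products_integrable:
  assumes [measurable]: "f \<in> borel_measurable lb2" "g \<in> borel_measurable lb2"
    and b: "\<And>p. \<bar>f p\<bar> \<le> (B::real)" "\<And>p. \<bar>g p\<bar> \<le> (B::real)" and "\<And>p. p \<notin> Sq \<Longrightarrow> f p = 0"
  shows "integrable lb2 (\<lambda>p. f p * g p)"
proof (rule integrable_bounded_Sq[of _ "B * B"])
  show "\<bar>f p * g p\<bar> \<le> B * B" for p
    unfolding abs_mult using b order_trans[OF abs_ge_zero b(1)] by (intro mult_mono) auto
qed (use assms in auto)

text \<open>Expand |Dv - x|^2 with Dv - x = (Dv - Du) + V. The product of Dv and V, together with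
  the linear term v of the functional, is the flux identity; the rest is a square and the constant
  \<open>c0\<close>.\<close>

lemma energy_identity:
  assumes r: "rep v w" "rep (\<lambda>x. weak_gradient open_square v x $ 1) h1" "rep (\<lambda>x. weak_gradient open_square v x $ 2) h2"
    and wx: "weak_x w h1" and wy: "weak_x (w \<circ> prod.swap) (h2 \<circ> prod.swap)"
    and i: "integrable lb2 w" "integrable lb2 h1" "integrable lb2 h2" and i2: "integrable lb2 (\<lambda>p. (h1 p)\<^sup>2)" "integrable lb2 (\<lambda>p. (h2 p)\<^sup>2)"
  shows "integrable lb2 (\<lambda>p. ((h1 p - P1 p)\<^sup>2 + (h2 p - Q1 p)\<^sup>2) / 2)"
    "L_functional v = (\<integral>p. ((h1 p - P1 p)\<^sup>2 + (h2 p - Q1 p)\<^sup>2) / 2 \<partial>lb2) + 3 * (\<integral>p. indicator Zp p * w p \<partial>lb2) + c0"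
proof -
  note z = repD(2)[OF r(1)] repD(2)[OF r(2)] repD(2)[OF r(3)]
  have fl: "integrable lb2 (\<lambda>p. h1 p * V1 p + h2 p * V2 p + w p)"
    "(\<integral>p. h1 p * V1 p + h2 p * V2 p + w p \<partial>lb2) = 3 * (\<integral>p. indicator Zp p * w p \<partial>lb2)"
    by (rule flux_identity[OF wx wy i]; erule z)+
  obtain B where B: "\<And>p. \<bar>P1 p\<bar> \<le> B" "\<And>p. \<bar>Q1 p\<bar> \<le> B" "\<And>p. \<bar>V1 p\<bar> \<le> B" "\<And>p. \<bar>V2 p\<bar> \<le> B" using bounded by metis
  have pz: "P1 p = 0" "Q1 p = 0" "V1 p = 0" "V2 p = 0" if "p \<notin> Sq" for p
    using that by (auto simp: P1_def Q1_def V1_def V2_def)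
  have ip: "integrable lb2 (\<lambda>p. V1 p * V1 p)" "integrable lb2 (\<lambda>p. V2 p * V2 p)" "integrable lb2 (\<lambda>p. P1 p * V1 p)" "integrable lb2 (\<lambda>p. Q1 p * V2 p)"
    "integrable lb2 (\<lambda>p. P1 p * P1 p)" "integrable lb2 (\<lambda>p. Q1 p * Q1 p)"
    using B pz by (auto intro!: products_integrable)
  have ih: "integrable lb2 (\<lambda>p. P1 p * h1 p)" "integrable lb2 (\<lambda>p. Q1 p * h2 p)"
    using B i by (auto intro!: bounded_mult_integrable)
  have sq: "((h1 p - P1 p)\<^sup>2 + (h2 p - Q1 p)\<^sup>2) / 2 =
      ((h1 p)\<^sup>2 + (h2 p)\<^sup>2) / 2 - P1 p * h1 p - Q1 p * h2 p + (P1 p * P1 p + Q1 p * Q1 p) / 2" for p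
    by (simp add: power2_eq_square algebra_simps add_divide_distrib diff_divide_distrib)
  show E: "integrable lb2 (\<lambda>p. ((h1 p - P1 p)\<^sup>2 + (h2 p - Q1 p)\<^sup>2) / 2)"
    unfolding sq using i2 ih ip by simp
  have ic: "integrable lb2 (\<lambda>p. ((V1 p)\<^sup>2 + (V2 p)\<^sup>2) / 2 - (P1 p * V1 p + Q1 p * V2 p))"
    unfolding power2_eq_square using ip by simp
  have "((h1 p - indicator Sq p * fst p)\<^sup>2 + (h2 p - indicator Sq p * snd p)\<^sup>2) / 2 + w p =
     ((h1 p - P1 p)\<^sup>2 + (h2 p - Q1 p)\<^sup>2) / 2 + (h1 p * V1 p + h2 p * V2 p + w p) +
     (((V1 p)\<^sup>2 + (V2 p)\<^sup>2) / 2 - (P1 p * V1 p + Q1 p * V2 p))" for p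
  proof -
    have "indicator Sq p * fst p = P1 p - V1 p" "indicator Sq p * snd p = Q1 p - V2 p"
      by (simp_all add: P1_def Q1_def V1_def V2_def algebra_simps)
    then show ?thesis by (simp only:) (simp add: power2_eq_square field_simps)
  qed
  then have "L_functional v = (\<integral>p. ((h1 p - P1 p)\<^sup>2 + (h2 p - Q1 p)\<^sup>2) / 2 + (h1 p * V1 p + h2 p * V2 p + w p) +
     (((V1 p)\<^sup>2 + (V2 p)\<^sup>2) / 2 - (P1 p * V1 p + Q1 p * V2 p)) \<partial>lb2)"
    unfolding L_functional_rep[OF r] by (simp only:)
  also have "\<dots> = (\<integral>p. ((h1 p - P1 p)\<^sup>2 + (h2 p - Q1 p)\<^sup>2) / 2 \<partial>lb2) + 3 * (\<integral>p. indicator Zp p * w p \<partial>lb2) + c0"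
    using E fl(1) ic fl(2) unfolding c0_def
    by (simp only: Bochner_Integration.integral_add Bochner_Integration.integrable_add)
  finally show "L_functional v = (\<integral>p. ((h1 p - P1 p)\<^sup>2 + (h2 p - Q1 p)\<^sup>2) / 2 \<partial>lb2) + 3 * (\<integral>p. indicator Zp p * w p \<partial>lb2) + c0" .
qed

lemma bounded_L2:
  fixes f :: "real^2 \<Rightarrow> 'b::euclidean_space"
  assumes f: "continuous_on open_square f" and b: "\<And>x. x \<in> open_square \<Longrightarrow> norm (f x) \<le> B"
  shows "f \<in> L2_on open_square"
proof -
  have "open_square \<subseteq> cbox (vec_of (-1, -1)) (vec_of (1, 1))"
    by (auto simp: open_square_def mem_box_cart forall_2 less_imp_le)
  then have lm: "open_square \<in> lmeasurable"
    using open_square_open by (intro lmeasurable_open) (auto intro: bounded_subset[OF bounded_cbox])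
  interpret finite_measure "lebesgue_on open_square" by (rule finite_measure_lebesgue_on[OF lm])
  have m: "f \<in> borel_measurable (lebesgue_on open_square)"
    by (rule continuous_imp_measurable_on_sets_lebesgue[OF f fmeasurableD[OF lm]])
  have "integrable (lebesgue_on open_square) (\<lambda>x. (norm (f x))\<^sup>2)"
  proof (rule integrable_const_bound[of _ "B\<^sup>2"])
    show "AE x in lebesgue_on open_square. norm ((norm (f x))\<^sup>2) \<le> B\<^sup>2"
      using b by (intro AE_I2) (auto simp: space_restrict_space intro: power_mono)
  qed (use m in measurable)
  then show ?thesis using m by (simp add: L2_on_def)
qed

lemma Du: "has_weak_gradient u (\<lambda>x. vec_of (P (pair_of x), Q (pair_of x))) open_square"
  unfolding u_def by (rule has_weak_gradient_classical[OF cont_Sq dU])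

lemma u_nonneg_W12: "u \<in> nonneg_W12"
proof -
  obtain B where B: "\<And>p. \<bar>U1 p\<bar> \<le> B" "\<And>p. \<bar>P1 p\<bar> \<le> B" "\<And>p. \<bar>Q1 p\<bar> \<le> B" using bounded by metis
  have "u \<in> L2_on open_square"
  proof (rule bounded_L2)
    show "continuous_on open_square u" unfolding u_def by (rule pair_of_compose_continuous[OF cont_Sq(1)])
    show "norm (u x) \<le> B" if "x \<in> open_square" for x
      using B(1)[of "pair_of x"] that by (simp add: u_def U1_def)
  qed
  moreover have "(\<lambda>x. vec_of (P (pair_of x), Q (pair_of x))) \<in> L2_on open_square"
  proof (rule bounded_L2)
    show "continuous_on open_square (\<lambda>x. vec_of (P (pair_of x), Q (pair_of x)))"
      by (intro continuous_intros pair_of_compose_continuous cont_Sq)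
    show "norm (vec_of (P (pair_of x), Q (pair_of x))) \<le> B + B" if "x \<in> open_square" for x
      using norm_le_l1_cart[of "vec_of (P (pair_of x), Q (pair_of x))"] B(2)[of "pair_of x"] B(3)[of "pair_of x"] that
      by (simp add: sum_2 P1_def Q1_def)
  qed
  moreover have "AE x in lebesgue_on open_square. 0 \<le> u x"
    using U_nonneg by (intro AE_I2) (auto simp: space_restrict_space u_def)
  ultimately show ?thesis using Du by (auto simp: nonneg_W12_def W12_def)
qed

lemma u_reps: "rep u U1" "rep (\<lambda>x. vec_of (P (pair_of x), Q (pair_of x)) $ 1) P1" "rep (\<lambda>x. vec_of (P (pair_of x), Q (pair_of x)) $ 2) Q1"
  using meas unfolding rep_def u_def by (auto simp: U1_def P1_def Q1_def)

lemma u_weak_x: "weak_x U1 P1" "weak_x (U1 \<circ> prod.swap) (Q1 \<circ> prod.swap)"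
  by (rule has_weak_gradient_weak_x[OF Du u_reps(1,2)]) (rule has_weak_gradient_weak_y[OF Du u_reps(1,3)])

lemma u_integrable: "integrable lb2 U1" "integrable lb2 P1" "integrable lb2 Q1" "integrable lb2 (\<lambda>p. (P1 p)\<^sup>2)" "integrable lb2 (\<lambda>p. (Q1 p)\<^sup>2)"
proof -
  obtain B where B: "\<And>p. \<bar>U1 p\<bar> \<le> B" "\<And>p. \<bar>P1 p\<bar> \<le> B" "\<And>p. \<bar>Q1 p\<bar> \<le> B" using bounded by metis
  have z: "U1 p = 0" "P1 p = 0" "Q1 p = 0" if "p \<notin> Sq" for p using that by (auto simp: U1_def P1_def Q1_def)
  show "integrable lb2 U1" "integrable lb2 P1" "integrable lb2 Q1"
    using B z meas by (auto intro!: integrable_bounded_Sq[of _ B])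
  show "integrable lb2 (\<lambda>p. (P1 p)\<^sup>2)" "integrable lb2 (\<lambda>p. (Q1 p)\<^sup>2)"
    unfolding power2_eq_square using B z by (auto intro!: products_integrable)
qed

text \<open>In the energy identity for u itself the square vanishes, and so does the integral over
  the zero set.\<close>

lemma L_u: "L_functional u = c0"
proof -
  have G: "has_weak_gradient u (weak_gradient open_square u) open_square"
    unfolding weak_gradient_def by (rule someI[of "\<lambda>g. has_weak_gradient u g open_square", OF Du])
  note ae = weak_gradient_unique[OF G Du]
  have r1: "rep (\<lambda>x. weak_gradient open_square u x $ 1) P1"
    by (rule rep_cong_AE[OF u_reps(2)]) (use ae in \<open>eventually_elim, simp\<close>)
  have r2: "rep (\<lambda>x. weak_gradient open_square u x $ 2) Q1"
    by (rule rep_cong_AE[OF u_reps(3)]) (use ae in \<open>eventually_elim, simp\<close>)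
  have "(\<lambda>p. indicator Zp p * U1 p) = (\<lambda>p. 0)" by (auto simp: Zp_def U1_def indicator_def)
  then show ?thesis
    using energy_identity(2)[OF u_reps(1) r1 r2 u_weak_x u_integrable] by (simp del: mult_eq_0_iff)
qed

lemma measure_Zp: "measure lb2 Zp = 4 / 3"
proof -
  note Sq_sets[measurable]
  have Fi: "integrable lb2 F1" "integrable lb2 F2"
    by (rule integrable_bounded_Sq[of F1 C], fact F1(1), fact F1(2), erule F1(3))
      (rule integrable_bounded_Sq[of F2 C], fact F2(1), fact F2(2), erule F2(3))
  have F0: "(\<integral>p. F1 p \<partial>lb2) = 0" "(\<integral>p. F2 (prod.swap p) \<partial>lb2) = 0"
    using slice_integrable(3)[OF Fi(1)] slice_integrable(3)[OF Fi(2)] F1(4) F2(4) lb2_swap[OF F2(1)] by simp_all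
  have Fs: "integrable lb2 (\<lambda>p. F2 (prod.swap p))"
    using lborel_pair.integrable_product_swap[OF Fi(2)] by (simp add: split_beta' prod.swap_def)
  have Zi: "integrable lb2 (indicator Zp :: _ \<Rightarrow> real)"
    by (rule integrable_bounded_Sq[of _ 1], measurable) (auto simp: Zp_def)
  have "0 = (\<integral>p. F1 p + F2 (prod.swap p) \<partial>lb2)" using Fi(1) Fs F0 by simp
  also have "\<dots> = (\<integral>p. indicator Sq p - 3 * indicator Zp p \<partial>lb2)"
  proof (rule integral_cong_AE)
    show "AE p in lb2. F1 p + F2 (prod.swap p) = indicator Sq p - 3 * indicator Zp p"
      using div_eq by eventually_elim (use F1(3) F2(3) in \<open>auto simp: Zp_def indicator_def\<close>)
  qed measurable
  also have "\<dots> = 4 - 3 * (\<integral>p. indicator Zp p \<partial>lb2)"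
    using Zi integrable_Sq integral_Sq by (simp only: Bochner_Integration.integral_diff integrable_mult_right integral_mult_right_zero)
  finally show ?thesis by (simp add: space_pair_measure)
qed

lemma measure_zero_set: "0 < measure lebesgue (zero_set u)"
proof -
  have "rep (indicator (zero_set u)) (indicator Zp)"
    unfolding rep_def using Zp_sets by (auto simp: Zp_def zero_set_def u_def indicator_def)
  from rep_integral[OF this] have "(LINT x:open_square|lebesgue. indicator (zero_set u) x) = (4 / 3 :: real)"
    using measure_Zp by (simp add: space_pair_measure)
  moreover have "indicator open_square x *\<^sub>R indicator (zero_set u) x = (indicator (zero_set u) x :: real)" for x
    by (auto simp: zero_set_def indicator_def)
  ultimately have "(\<integral>x. indicator (zero_set u) x \<partial>lebesgue) = (4 / 3 :: real)"
    by (simp only: set_lebesgue_integral_def)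
  then show ?thesis by simp
qed

lemma rep_nonneg:
  assumes v: "v \<in> nonneg_W12" and r: "rep v w" shows "AE p in lb2. 0 \<le> w p"
proof -
  have "AE x in lebesgue. x \<in> open_square \<longrightarrow> 0 \<le> v x"
    using v open_square_open by (simp add: nonneg_W12_def AE_restrict_space_iff)
  with repD(3)[OF r] have "AE x in lebesgue. 0 \<le> w (pair_of x)"
    by eventually_elim (use repD(2)[OF r] in \<open>metis order_refl pair_of_Sq\<close>)
  from AE_vec_of[OF this] show ?thesis by simp
qed

theorem u_minimizer: "is_minimizer u"
  unfolding is_minimizer_def is_arg_min_def
proof (intro conjI notI)
  show "u \<in> nonneg_W12" by (rule u_nonneg_W12)
  assume "\<exists>v. v \<in> nonneg_W12 \<and> L_functional v < L_functional u"
  then obtain v where v: "v \<in> nonneg_W12" "L_functional v < c0" by (auto simp: L_u)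
  have vW: "v \<in> W12 open_square" using v by (simp add: nonneg_W12_def)
  show False
  proof (rule W12_rep[OF vW])
    fix w h1 h2
    assume r: "rep v w" "rep (\<lambda>x. weak_gradient open_square v x $ 1) h1" "rep (\<lambda>x. weak_gradient open_square v x $ 2) h2"
      "weak_x w h1" "weak_x (w \<circ> prod.swap) (h2 \<circ> prod.swap)"
      "integrable lb2 w" "integrable lb2 h1" "integrable lb2 h2" "integrable lb2 (\<lambda>p. (h1 p)\<^sup>2)" "integrable lb2 (\<lambda>p. (h2 p)\<^sup>2)"
    have "0 \<le> (\<integral>p. ((h1 p - P1 p)\<^sup>2 + (h2 p - Q1 p)\<^sup>2) / 2 \<partial>lb2)" by (intro Bochner_Integration.integral_nonneg) simp
    moreover have "0 \<le> (\<integral>p. indicator Zp p * w p \<partial>lb2)"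
      using rep_nonneg[OF v(1) r(1)] by (intro integral_nonneg_AE) (auto elim!: eventually_mono)
    ultimately show False using energy_identity(2)[OF r] v(2) by linarith
  qed
qed

text \<open>Equality of energies makes Dv = Du and makes v vanish almost everywhere on the zero set
  of u. The first leaves v - u constant; the second, as the zero set has positive area, leaves only
  the constant 0.\<close>

theorem u_unique:
  assumes "is_minimizer v" shows "AE x in lebesgue_on open_square. v x = u x"
proof -
  have v: "v \<in> nonneg_W12" and Lv: "L_functional v \<le> c0"
    using assms u_nonneg_W12 L_u by (auto simp: is_minimizer_def is_arg_min_def not_less)
  have vW: "v \<in> W12 open_square" using v by (simp add: nonneg_W12_def)
  show ?thesis
  proof (rule W12_rep[OF vW])
    fix w h1 h2
    assume r: "rep v w" "rep (\<lambda>x. weak_gradient open_square v x $ 1) h1" "rep (\<lambda>x. weak_gradient open_square v x $ 2) h2"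
      "weak_x w h1" "weak_x (w \<circ> prod.swap) (h2 \<circ> prod.swap)"
      "integrable lb2 w" "integrable lb2 h1" "integrable lb2 h2" "integrable lb2 (\<lambda>p. (h1 p)\<^sup>2)" "integrable lb2 (\<lambda>p. (h2 p)\<^sup>2)"
    have [measurable]: "w \<in> borel_measurable lb2" "h1 \<in> borel_measurable lb2" "h2 \<in> borel_measurable lb2" using r by auto
    note e = energy_identity[OF r]
    have wn: "AE p in lb2. 0 \<le> indicator Zp p * w p" using rep_nonneg[OF v r(1)] by eventually_elim simp
    have wi: "integrable lb2 (\<lambda>p. indicator Zp p * w p)"
      by (rule flux_identity(2)[OF r(4-8) repD(2)[OF r(1)] repD(2)[OF r(2)] repD(2)[OF r(3)]])
    have n: "0 \<le> (\<integral>p. ((h1 p - P1 p)\<^sup>2 + (h2 p - Q1 p)\<^sup>2) / 2 \<partial>lb2)" "0 \<le> (\<integral>p. indicator Zp p * w p \<partial>lb2)"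
      using wn by (auto intro: Bochner_Integration.integral_nonneg integral_nonneg_AE)
    then have 0: "(\<integral>p. ((h1 p - P1 p)\<^sup>2 + (h2 p - Q1 p)\<^sup>2) / 2 \<partial>lb2) = 0" "(\<integral>p. indicator Zp p * w p \<partial>lb2) = 0"
      using e(2) Lv by linarith+
    have wZ: "AE p in lb2. indicator Zp p * w p = 0" using integral_nonneg_eq_0_iff_AE[OF wi wn] 0 by simp
    have "AE p in lb2. ((h1 p - P1 p)\<^sup>2 + (h2 p - Q1 p)\<^sup>2) / 2 = 0"
      using integral_nonneg_eq_0_iff_AE[OF e(1)] 0 by simp
    then have hP: "AE p in lb2. h1 p = P1 p \<and> h2 p = Q1 p" by eventually_elim (simp add: sum_power2_eq_zero_iff)
    have sw: "integrable lb2 (k \<circ> prod.swap)" if "integrable lb2 k" for k :: "real \<times> real \<Rightarrow> real"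
      using lborel_pair.integrable_product_swap[OF that] by (simp add: split_beta' prod.swap_def o_def)
    define d where "d p = w p - U1 p" for p
    have di: "integrable lb2 d" unfolding d_def using r(6) u_integrable(1) by simp
    have dm[measurable]: "d \<in> borel_measurable lb2" using di by auto
    have "\<exists>m. AE p in lb2. p \<in> Sq \<longrightarrow> d p = m"
    proof (rule constant_of_line_means[OF di])
      show "d p = 0" if "p \<notin> Sq" for p using that repD(2)[OF r(1)] by (simp add: d_def U1_def)
    next
      fix f :: "real \<times> real \<Rightarrow> real" assume f: "f \<in> borel_measurable lb2" "\<And>p. \<bar>f p\<bar> \<le> 4" "\<And>p. p \<notin> Sq \<Longrightarrow> f p = 0"
        "\<And>y. (\<integral>s. f (s, y) \<partial>lborel) = 0"
      note m = primitive_measurable[OF f(1)]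
      have "(\<integral>p. h1 p * primitive f p \<partial>lb2) = (\<integral>p. P1 p * primitive f p \<partial>lb2)"
      proof (rule integral_cong_AE)
        show "AE p in lb2. h1 p * primitive f p = P1 p * primitive f p"
          using hP by eventually_elim simp
      qed (intro borel_measurable_times m; measurable)+
      then have "(\<integral>p. f p * w p \<partial>lb2) = (\<integral>p. f p * U1 p \<partial>lb2)"
        using weak_x_integration_by_parts[OF r(4,6,7) f] weak_x_integration_by_parts[OF u_weak_x(1) u_integrable(1,2) f] by simp
      then show "(\<integral>p. f p * d p \<partial>lb2) = 0"
        unfolding d_def right_diff_distrib
        using bounded_mult_integrable[OF r(6) f(1,2)] bounded_mult_integrable[OF u_integrable(1) f(1,2)] by simp
    next
      fix f :: "real \<times> real \<Rightarrow> real" assume f: "f \<in> borel_measurable lb2" "\<And>p. \<bar>f p\<bar> \<le> 4" "\<And>p. p \<notin> Sq \<Longrightarrow> f p = 0"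
        "\<And>y. (\<integral>s. f (s, y) \<partial>lborel) = 0"
      note m = primitive_measurable[OF f(1)]
      have "(\<integral>p. (h2 \<circ> prod.swap) p * primitive f p \<partial>lb2) = (\<integral>p. (Q1 \<circ> prod.swap) p * primitive f p \<partial>lb2)"
        unfolding o_def
      proof (rule integral_cong_AE)
        show "AE p in lb2. h2 (prod.swap p) * primitive f p = Q1 (prod.swap p) * primitive f p"
          using AE_swap[OF hP] by eventually_elim simp
      qed (intro borel_measurable_times m; measurable)+
      then have "(\<integral>p. f p * (w \<circ> prod.swap) p \<partial>lb2) = (\<integral>p. f p * (U1 \<circ> prod.swap) p \<partial>lb2)"
        using weak_x_integration_by_parts[OF r(5) sw[OF r(6)] sw[OF r(8)] f]
          weak_x_integration_by_parts[OF u_weak_x(2) sw[OF u_integrable(1)] sw[OF u_integrable(3)] f] by simp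
      then show "(\<integral>p. f p * d (prod.swap p) \<partial>lb2) = 0"
        unfolding d_def right_diff_distrib
        using bounded_mult_integrable[OF sw[OF r(6)] f(1,2)] bounded_mult_integrable[OF sw[OF u_integrable(1)] f(1,2)] by simp
    qed
    then obtain m where m: "AE p in lb2. p \<in> Sq \<longrightarrow> d p = m" by blast
    have "m = 0"
    proof (rule ccontr)
      assume "m \<noteq> 0"
      have "AE p in lb2. p \<notin> Zp"
        using m wZ
      proof eventually_elim
        fix p assume *: "p \<in> Sq \<longrightarrow> d p = m" "indicator Zp p * w p = 0"
        show "p \<notin> Zp"
        proof
          assume "p \<in> Zp"
          then have "p \<in> Sq" "w p = 0" "U1 p = 0" using * by (auto simp: Zp_def U1_def)
          then show False using * \<open>m \<noteq> 0\<close> by (simp add: d_def)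
        qed
      qed
      then have "emeasure lb2 Zp = 0" using AE_iff_null_sets[OF Zp_sets] null_setsD1 by blast
      then show False using measure_Zp by (simp add: measure_def)
    qed
    from AE_pair_of[OF m] repD(3)[OF r(1)]
    have "AE x in lebesgue. x \<in> open_square \<longrightarrow> v x = u x"
      by eventually_elim (simp add: d_def \<open>m = 0\<close> u_def U1_def)
    then show ?thesis using open_square_open by (simp add: AE_restrict_space_iff)
  qed
qed

end

section \<open>The minimizer on the square\<close>

lemma inverse_Suc_at_0: "filterlim (\<lambda>n. inverse (real (Suc n))) (at 0) sequentially"
  unfolding filterlim_at using LIMSEQ_inverse_real_of_nat by simp

text \<open>G is differentiable only off finitely many points of almost every line, so F is taken as
  a limit of difference quotients, which keeps it measurable in both variables. Continuity of G is
  what lets the fundamental theorem of calculus ignore finitely many exceptions; the vanishing of G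
  at the ends gives mean zero.\<close>

lemma line_derivative:
  fixes G :: "real \<times> real \<Rightarrow> real"
  assumes G: "continuous_on cSq G" and C: "0 \<le> C"
    and ends: "\<And>y. \<bar>y\<bar> < 1 \<Longrightarrow> G (1, y) = 0" "\<And>y. \<bar>y\<bar> < 1 \<Longrightarrow> G (-1, y) = 0"
    and der: "\<And>y. \<bar>y\<bar> < 1 \<Longrightarrow> y \<noteq> 0 \<Longrightarrow> \<exists>S. finite S \<and> (\<forall>x. \<bar>x\<bar> < 1 \<longrightarrow> x \<notin> S \<longrightarrow>
      (\<exists>d. \<bar>d\<bar> \<le> C \<and> ((\<lambda>s. G (s, y)) has_real_derivative d) (at x)))"
  obtains F where "F \<in> borel_measurable lb2" "\<And>p. \<bar>F p\<bar> \<le> C" "\<And>p. p \<notin> Sq \<Longrightarrow> F p = 0"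
    "\<And>y. (\<integral>s. F (s, y) \<partial>lborel) = 0"
    "AE p in lb2. p \<in> Sq \<longrightarrow> primitive F p = G p"
    "\<And>x y d. (x, y) \<in> Sq \<Longrightarrow> y \<noteq> 0 \<Longrightarrow> \<bar>d\<bar> \<le> C \<Longrightarrow> ((\<lambda>s. G (s, y)) has_real_derivative d) (at x) \<Longrightarrow> F (x, y) = d"
proof -
  \<comment> \<open>Clamping the coordinates extends G continuously to the plane, so that the
    forward quotients are defined everywhere.\<close>
  define cl where "cl t = max (-1) (min 1 t)" for t :: real
  define Gc where "Gc p = G (cl (fst p), cl (snd p))" for p
  have "continuous_on UNIV Gc"
    unfolding Gc_def cl_def by (rule continuous_on_compose2[OF G]) (auto intro!: continuous_intros)
  then have Gcm: "Gc \<in> borel_measurable lb2" unfolding lborel_prod using borel_measurable_continuous_onI by simp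
  note Gcm[measurable]
  have Gc: "Gc p = G p" if "p \<in> cSq" for p
    using that by (cases p) (auto simp: Gc_def cl_def)
  define q where "q n p = (Gc (fst p + inverse (real (Suc n)), snd p) - Gc p) / inverse (real (Suc n))" for n p
  have qm[measurable]: "q n \<in> borel_measurable lb2" for n unfolding q_def by measurable
  note Sq_sets[measurable]
  \<comment> \<open>Where the quotients do not converge, \<open>lim\<close> has an arbitrary value,
    which the truncation keeps bounded. The line y = 0, on which no derivatives are assumed, is set
    to 0.\<close>
  define F where "F p = indicator Sq p * (indicator {t. t \<noteq> 0} (snd p) * max (- C) (min C (lim (\<lambda>n. q n p))))" for p
  have Fm[measurable]: "F \<in> borel_measurable lb2" unfolding F_def by measurable
  have Fb: "\<bar>F p\<bar> \<le> C" for p using C by (auto simp: F_def split: split_indicator)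
  have Fz: "F p = 0" if "p \<notin> Sq" for p using that by (simp add: F_def)
  have Fd: "F (x, y) = d" if xy: "(x, y) \<in> Sq" and y: "y \<noteq> 0" and d: "\<bar>d\<bar> \<le> C"
    and D: "((\<lambda>s. G (s, y)) has_real_derivative d) (at x)" for x y d
  proof -
    have x1: "x < 1" "(x, y) \<in> cSq" using xy by (auto simp: Sq_def)
    have "(\<lambda>n. (G (x + inverse (real (Suc n)), y) - G (x, y)) / inverse (real (Suc n))) \<longlonglongrightarrow> d"
      using filterlim_compose[OF DERIV_D[OF D] inverse_Suc_at_0] .
    moreover have "eventually (\<lambda>n. (G (x + inverse (real (Suc n)), y) - G (x, y)) / inverse (real (Suc n)) = q n (x, y)) sequentially"
    proof -
      have "eventually (\<lambda>n. inverse (real (Suc n)) < 1 - x) sequentially"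
        using order_tendstoD(2)[OF LIMSEQ_inverse_real_of_nat, of "1 - x"] x1 by simp
      then show ?thesis
      proof eventually_elim
        fix n assume n: "inverse (real (Suc n)) < 1 - x"
        have "(x + i, y) \<in> cSq" if "0 < i" "i < 1 - x" for i using that x1 by auto
        from this[OF _ n] have "(x + inverse (real (Suc n)), y) \<in> cSq" by simp
        then show "(G (x + inverse (real (Suc n)), y) - G (x, y)) / inverse (real (Suc n)) = q n (x, y)"
          using x1 by (simp add: q_def Gc del: of_nat_Suc)
      qed
    qed
    ultimately have "(\<lambda>n. q n (x, y)) \<longlonglongrightarrow> d" by (rule Lim_transform_eventually)
    then show ?thesis using xy y d by (auto simp: F_def limI)
  qed
  have prim: "(\<integral>s. F (s, y) * indicator {-1..x} s \<partial>lborel) = G (x, y)" if y: "\<bar>y\<bar> < 1" "y \<noteq> 0" and x: "-1 < x" "x \<le> 1" for x y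
  proof -
    obtain S where S: "finite S" "\<And>x. \<bar>x\<bar> < 1 \<Longrightarrow> x \<notin> S \<Longrightarrow> \<exists>d. \<bar>d\<bar> \<le> C \<and> ((\<lambda>s. G (s, y)) has_real_derivative d) (at x)"
      using der[OF y] by blast
    have "((\<lambda>s. F (s, y)) has_integral (G (x, y) - G (-1, y))) {-1..x}"
    proof (rule fundamental_theorem_of_calculus_interior_strong[OF S(1)])
      fix t assume t: "t \<in> {-1<..<x} - S"
      then have t1: "\<bar>t\<bar> < 1" "t \<notin> S" using x by auto
      obtain d where d: "\<bar>d\<bar> \<le> C" "((\<lambda>s. G (s, y)) has_real_derivative d) (at t)" using S(2)[OF t1] by blast
      have "(t, y) \<in> Sq" using t1 y by (auto simp: Sq_def)
      from Fd[OF this y(2) d] d(2)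
      show "((\<lambda>s. G (s, y)) has_vector_derivative F (t, y)) (at t)"
        by (simp add: has_real_derivative_iff_has_vector_derivative)
    next
      show "continuous_on {-1..x} (\<lambda>s. G (s, y))"
        by (rule continuous_on_compose2[OF G]) (use x y in \<open>auto intro!: continuous_intros\<close>)
    qed (use x in simp)
    moreover have "set_integrable lborel {-1..x} (\<lambda>s. F (s, y))"
      unfolding set_integrable_def
    proof (rule Bochner_Integration.integrable_bound[of _ "\<lambda>s. C * indicator {-1..x} s"])
      show "AE s in lborel. norm (indicator {-1..x} s *\<^sub>R F (s, y)) \<le> norm (C * indicator {-1..x} s)"
        using Fb C by (intro AE_I2) (auto split: split_indicator)
      show "integrable lborel (\<lambda>s. C * indicator {-1..x} s)"
        by (intro integrable_mult_right integrable_real_indicator) (use x in auto)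
    qed (auto intro: measurable_compose[OF _ Fm])
    ultimately have "(LINT s:{-1..x}|lborel. F (s, y)) = G (x, y)"
      using set_borel_integral_eq_integral(2) ends(2)[OF y(1)] by (metis diff_zero integral_unique)
    then show ?thesis by (simp add: set_lebesgue_integral_def mult.commute)
  qed
  show thesis
  proof (rule that[OF Fm Fb Fz _ _ Fd])
    show "(\<integral>s. F (s, y) \<partial>lborel) = 0" for y
    proof (cases "\<bar>y\<bar> < 1 \<and> y \<noteq> 0")
      case True
      have e: "F (s, y) * indicator {-1..1} s = F (s, y)" for s
        using Fz[of "(s, y)"] by (auto simp: Sq_def split: split_indicator)
      show ?thesis using prim[of y 1] ends(1)[of y] True unfolding e by simp
    next
      case False
      then have "F (s, y) = 0" for s by (auto simp: F_def Sq_def abs_less_iff indicator_def)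
      then show ?thesis by simp
    qed
    have "AE y in lborel. y \<noteq> (0::real)" by (rule AE_lborel_singleton)
    from AE_lb2_snd[OF this]
    show "AE p in lb2. p \<in> Sq \<longrightarrow> primitive F p = G p"
    proof eventually_elim
      fix p :: "real \<times> real" assume p0: "snd p \<noteq> 0"
      show "p \<in> Sq \<longrightarrow> primitive F p = G p"
      proof
        assume p: "p \<in> Sq"
        have e: "F (s, snd p) * indicator {..fst p} s = F (s, snd p) * indicator {-1..fst p} s" for s
          using Fz[of "(s, snd p)"] by (auto simp: Sq_def split: split_indicator)
        have "\<bar>snd p\<bar> < 1" "-1 < fst p" "fst p \<le> 1" using p by (auto simp: Sq_def)
        then show "primitive F p = G p"
          unfolding primitive_def e using prim[of "snd p" "fst p"] p0 by simp
      qed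
    qed
  qed
qed

lemma negligible_AE_lb2:
  assumes "negligible N" shows "AE p in lb2. p \<notin> N"
proof -
  have "AE p in lebesgue. p \<notin> N"
    using assms by (intro AE_not_in) (simp add: negligible_iff_null_sets)
  then show ?thesis unfolding AE_completion_iff lborel_prod .
qed

section \<open>The plane as complex numbers\<close>

definition to_complex :: "real^2 \<Rightarrow> complex" where "to_complex x = Complex (x $ 1) (x $ 2)"
definition of_complex :: "complex \<Rightarrow> real^2" where "of_complex z = vec_of (Re z, Im z)"

lemma to_complex_sel [simp]: "Re (to_complex x) = x $ 1" "Im (to_complex x) = x $ 2"
  by (simp_all add: to_complex_def)

lemma to_of_complex [simp]: "to_complex (of_complex z) = z" "of_complex (to_complex x) = x"
  by (simp_all add: complex_eq_iff vec_eq_iff forall_2 of_complex_def)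

lemma inner_to_complex: "to_complex x \<bullet> z = x \<bullet> of_complex z"
  by (simp add: inner_complex_def inner_vec_def sum_2 of_complex_def)

lemma inner_of_complex: "of_complex z \<bullet> of_complex w = z \<bullet> w"
  using inner_to_complex[of "of_complex z" w] by simp

lemma norm_of_complex [simp]: "norm (of_complex z) = norm z"
  by (simp add: norm_eq_sqrt_inner inner_of_complex)

lemma dist_to_complex: "dist (to_complex x) (to_complex y) = dist x y"
proof -
  have "to_complex x - to_complex y = to_complex (x - y)" by (simp add: complex_eq_iff)
  then show ?thesis using norm_of_complex[of "to_complex (x - y)"] by (simp add: dist_norm)
qed

lemma linear_to_complex: "linear to_complex"
  by (rule linearI) (simp_all add: complex_eq_iff)

lemma continuous_on_to_complex [continuous_intros]: "continuous_on A f \<Longrightarrow> continuous_on A (\<lambda>x. to_complex (f x))"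
  unfolding to_complex_def complex_eq_iff by (intro continuous_intros)

section \<open>Verification of the Euler-Lagrange conditions\<close>

context hodograph
begin

abbreviation cx :: "real \<times> real \<Rightarrow> complex" where "cx p \<equiv> Complex (fst p) (snd p)"

text \<open>The unconstrained Euler-Lagrange conditions are \<Delta>u = 3 and outer normal
  derivative 1 on the sides; the factor 3/2 turns the values 2 and 2/3 of \<open>uu\<close> into
  these.\<close>

definition vU where "vU p = 3 / 2 * uu (cx p)" for p
definition vP where "vP p = 3 / 2 * Re (gu (cx p))" for p
definition vQ where "vQ p = 3 / 2 * Im (gu (cx p))" for p

lemma uu_continuous: "continuous_on A uu"
  using convex_on_continuous[OF open_UNIV uu_convex] continuous_on_subset by blast

lemma cx_square: "cx p \<in> square \<longleftrightarrow> p \<in> cSq"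
  by (cases p) (auto simp: square_def)

lemma cx_continuous: "continuous_on A cx"
  by (simp add: Complex_eq) (intro continuous_intros)

lemma gu_cx_continuous: "continuous_on cSq (\<lambda>p. gu (cx p))"
  by (rule continuous_on_compose2[OF gu_continuous[of square, OF square_uniq] cx_continuous]) (auto simp: square_def)

lemma v_continuous: "continuous_on cSq vU" "continuous_on cSq vP" "continuous_on cSq vQ"
  unfolding vU_def vP_def vQ_def
  by (intro continuous_intros continuous_on_compose2[OF uu_continuous[of UNIV] cx_continuous] gu_cx_continuous; simp)+

lemma Complex_lines:
  "((\<lambda>s. Complex s y) has_derivative (\<lambda>h. of_real h)) (at x)" "((\<lambda>s. Complex y s) has_derivative (\<lambda>h. \<i> * of_real h)) (at x)"
  unfolding Complex_eq by (auto intro!: derivative_eq_intros)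

lemma v_derivative:
  assumes "(x, y) \<in> Sq"
  shows "((\<lambda>s. vU (s, y)) has_real_derivative vP (x, y)) (at x)" "((\<lambda>s. vU (x, s)) has_real_derivative vQ (x, y)) (at y)"
proof -
  have "Complex x y \<in> square" using assms by (auto simp: square_def Sq_def)
  note d = uu_has_derivative[OF square_uniq[OF this]]
  have "((\<lambda>s. uu (Complex s y)) has_derivative (\<lambda>h. gu (Complex x y) \<bullet> of_real h)) (at x)"
    using has_derivative_compose[OF Complex_lines(1) d] .
  then have "((\<lambda>s. uu (Complex s y)) has_real_derivative Re (gu (Complex x y))) (at x)"
    unfolding has_field_derivative_def by (simp add: inner_complex_def)
  from DERIV_cmult[OF this, of "3/2"] show "((\<lambda>s. vU (s, y)) has_real_derivative vP (x, y)) (at x)"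
    by (simp add: vU_def vP_def)
  have "((\<lambda>s. uu (Complex x s)) has_derivative (\<lambda>h. gu (Complex x y) \<bullet> (\<i> * of_real h))) (at y)"
    using has_derivative_compose[OF Complex_lines(2) d] .
  then have "((\<lambda>s. uu (Complex x s)) has_real_derivative Im (gu (Complex x y))) (at y)"
    unfolding has_field_derivative_def by (simp add: inner_complex_def)
  from DERIV_cmult[OF this, of "3/2"] show "((\<lambda>s. vU (x, s)) has_real_derivative vQ (x, y)) (at y)"
    by (simp add: vU_def vQ_def)
qed

lemma regular_slices:
  assumes "regular z"
  obtains t where "\<bar>t\<bar> \<le> 1" "((\<lambda>s. vP (s, Im z)) has_real_derivative 3 / 2 * (1 + t)) (at (Re z))"
    "((\<lambda>s. vQ (Re z, s)) has_real_derivative 3 / 2 * (1 - t)) (at (Im z))"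
proof -
  obtain \<tau> where \<tau>: "norm \<tau> \<le> 1" "(gu has_derivative (\<lambda>v. v + \<tau> * cnj v)) (at z)"
    using assms by (auto simp: regular_def)
  then have g: "(gu has_derivative (\<lambda>v. v + \<tau> * cnj v)) (at (Complex (Re z) (Im z)))" by simp
  have "((\<lambda>s. Re (gu (Complex s (Im z)))) has_derivative (\<lambda>h. Re (of_real h + \<tau> * cnj (of_real h)))) (at (Re z))"
    by (rule has_derivative_Re, rule has_derivative_compose[OF Complex_lines(1) g])
  moreover have "(\<lambda>h. Re (of_real h + \<tau> * cnj (of_real h))) = (\<lambda>h. (1 + Re \<tau>) * h)" by (auto simp: algebra_simps)
  ultimately have "((\<lambda>s. Re (gu (Complex s (Im z)))) has_real_derivative (1 + Re \<tau>)) (at (Re z))"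
    unfolding has_field_derivative_def by (simp only:)
  from DERIV_cmult[OF this, of "3/2"] have 1: "((\<lambda>s. vP (s, Im z)) has_real_derivative 3 / 2 * (1 + Re \<tau>)) (at (Re z))"
    by (simp add: vP_def)
  have "((\<lambda>s. Im (gu (Complex (Re z) s))) has_derivative (\<lambda>h. Im (\<i> * of_real h + \<tau> * cnj (\<i> * of_real h)))) (at (Im z))"
    by (rule has_derivative_Im, rule has_derivative_compose[OF Complex_lines(2) g])
  moreover have "(\<lambda>h. Im (\<i> * of_real h + \<tau> * cnj (\<i> * of_real h))) = (\<lambda>h. (1 - Re \<tau>) * h)" by (auto simp: algebra_simps)
  ultimately have "((\<lambda>s. Im (gu (Complex (Re z) s))) has_real_derivative (1 - Re \<tau>)) (at (Im z))"
    unfolding has_field_derivative_def by (simp only:)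
  from DERIV_cmult[OF this, of "3/2"] have 2: "((\<lambda>s. vQ (Re z, s)) has_real_derivative 3 / 2 * (1 - Re \<tau>)) (at (Im z))"
    by (simp add: vQ_def)
  show thesis by (rule that[OF _ 1 2]) (use \<tau>(1) abs_Re_le_cmod[of \<tau>] in linarith)
qed

text \<open>As \<open>uu\<close> is nonnegative on the square, its zeros are a sublevel set, so on a
  line they form a compact convex set.\<close>

lemma zero_segment:
  fixes E :: "real \<Rightarrow> complex"
  assumes E: "E = (\<lambda>s. z + s *\<^sub>R v)" and sq: "\<And>s. s \<in> {-1..1} \<Longrightarrow> E s \<in> square"
  shows "\<exists>a b. {s \<in> {-1..1}. uu (E s) = 0} = {a..b}"
proof -
  let ?S = "{s \<in> {-1..1}. uu (E s) = 0}"
  have S: "?S = {s \<in> {-1..1}. uu (E s) \<le> 0}" using square_uu_nonneg[OF sq] by force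
  have cE: "continuous_on A E" for A unfolding E by (intro continuous_intros)
  have "compact ?S"
  proof -
    have "continuous_on {-1..1} (\<lambda>s. uu (E s))" by (rule continuous_on_compose2[OF uu_continuous[of UNIV] cE]) auto
    then have "closed ?S" by (intro continuous_closed_preimage_constant) auto
    moreover have "bounded ?S" by (rule bounded_subset[of "{-1..1}"]) auto
    ultimately show ?thesis by (simp add: compact_eq_bounded_closed)
  qed
  moreover have "convex ?S"
    unfolding S
  proof (rule convexI)
    fix s t a b :: real assume st: "s \<in> {s \<in> {-1..1}. uu (E s) \<le> 0}" "t \<in> {s \<in> {-1..1}. uu (E s) \<le> 0}" and ab: "0 \<le> a" "0 \<le> b" "a + b = 1"
    have "a *\<^sub>R s + b *\<^sub>R t \<in> {-1..1}" using convexD[OF convex_real_interval(5), of s "-1" 1 t a b] st ab by simp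
    moreover have "E (a *\<^sub>R s + b *\<^sub>R t) = a *\<^sub>R E s + b *\<^sub>R E t"
    proof -
      have "z = a *\<^sub>R z + b *\<^sub>R z" using ab by (simp flip: scaleR_add_left)
      then show ?thesis by (simp add: E algebra_simps)
    qed
    moreover have "uu (a *\<^sub>R E s + b *\<^sub>R E t) \<le> a * uu (E s) + b * uu (E t)"
      using uu_convex ab by (simp add: convex_on_def)
    moreover have "a * uu (E s) + b * uu (E t) \<le> 0" using st ab by (intro add_nonpos_nonpos mult_nonneg_nonpos) auto
    ultimately show "a *\<^sub>R s + b *\<^sub>R t \<in> {s \<in> {-1..1}. uu (E s) \<le> 0}" by simp
  qed
  ultimately show ?thesis using connected_compact_interval_1 convex_connected by metis
qed

text \<open>A line crosses the free boundary in at most two points, the ends a and c of its segment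
  of zeros. Elsewhere the point is in the positivity set, or the gradient vanishes along the line
  near it. If there are no zeros, a and c have no meaning.\<close>

lemma segment_cases:
  fixes E :: "real \<Rightarrow> complex"
  assumes E: "E = (\<lambda>s. z + s *\<^sub>R v)" and sq: "\<And>s. s \<in> {-1..1} \<Longrightarrow> E s \<in> square"
  obtains a c where "\<And>s. \<bar>s\<bar> < 1 \<Longrightarrow> s \<notin> {a, c} \<Longrightarrow> 0 < uu (E s) \<or> eventually (\<lambda>t. gu (E t) = 0) (nhds s)"
proof -
  obtain a b where ab: "{s \<in> {-1..1}. uu (E s) = 0} = {a..b}" using zero_segment[OF E sq] by blast
  show thesis
  proof (rule that[of a b])
    fix s :: real assume s: "\<bar>s\<bar> < 1" "s \<notin> {a, b}"
    show "0 < uu (E s) \<or> eventually (\<lambda>t. gu (E t) = 0) (nhds s)"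
    proof (cases "uu (E s) = 0")
      case False
      have "s \<in> {-1..1}" using s by auto
      then show ?thesis using False square_uu_nonneg[OF sq[of s]] by simp
    next
      case True
      then have "s \<in> {a..b}" using s unfolding ab[symmetric] by auto
      then have "s \<in> {a<..<b}" using s by auto
      then have "eventually (\<lambda>t. t \<in> {a<..<b}) (nhds s)" by (intro eventually_nhds_in_open) auto
      then have "eventually (\<lambda>t. gu (E t) = 0) (nhds s)"
      proof eventually_elim
        fix t assume "t \<in> {a<..<b}"
        then have "t \<in> {s \<in> {-1..1}. uu (E s) = 0}" unfolding ab by auto
        then show "gu (E t) = 0" using square_gu_zero[OF sq[of t]] by simp
      qed
      then show ?thesis by simp
    qed
  qed
qed

lemma zero_derivative:
  assumes "eventually (\<lambda>t. f t = 0) (nhds x)" shows "((\<lambda>s. f s - s) has_real_derivative -1) (at (x::real))"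
proof -
  have "eventually (\<lambda>s. f s - s = - s) (nhds x)" using assms by eventually_elim simp
  from DERIV_cong_ev[OF refl this refl, of "-1"] show ?thesis
    using DERIV_minus[OF DERIV_ident, of x UNIV] by simp
qed

text \<open>Besides the ends of the zero segment, the exceptions are the intersections with axis and
  diagonals, at 0, y and -y. The bound 2 holds since 3/2 (1 + t) - 1 lies between -1 and 2 for |t|
  \<le> 1, and on the zero set the derivative is -1.\<close>

lemma line_exceptions:
  fixes E :: "real \<Rightarrow> complex"
  assumes E: "E = (\<lambda>s. z + s *\<^sub>R v)" and sq: "\<And>s. s \<in> {-1..1} \<Longrightarrow> E s \<in> square"
    and reg: "\<And>s. \<bar>s\<bar> < 1 \<Longrightarrow> s \<notin> {0, y, -y} \<Longrightarrow> 0 < uu (E s) \<Longrightarrow> regular (E s)"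
    and zero: "\<And>s. gu (E s) = 0 \<Longrightarrow> f s = 0"
    and d: "\<And>s. regular (E s) \<Longrightarrow> \<exists>t. \<bar>t\<bar> \<le> 1 \<and> (f has_real_derivative 3 / 2 * (1 + t)) (at s)"
  shows "\<exists>S. finite S \<and> (\<forall>x. \<bar>x\<bar> < 1 \<longrightarrow> x \<notin> S \<longrightarrow> (\<exists>d. \<bar>d\<bar> \<le> 2 \<and> ((\<lambda>s. f s - s) has_real_derivative d) (at x)))"
proof -
  obtain a c where ac: "\<And>s. \<bar>s\<bar> < 1 \<Longrightarrow> s \<notin> {a, c} \<Longrightarrow> 0 < uu (E s) \<or> eventually (\<lambda>t. gu (E t) = 0) (nhds s)"
    using segment_cases[OF E sq] by blast
  have "\<exists>d. \<bar>d\<bar> \<le> 2 \<and> ((\<lambda>s. f s - s) has_real_derivative d) (at x)"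
    if x: "\<bar>x\<bar> < 1" "x \<notin> {a, c, 0, y, -y}" for x
  proof -
    consider "0 < uu (E x)" | "eventually (\<lambda>t. gu (E t) = 0) (nhds x)" using ac[of x] x by blast
    then show ?thesis
    proof cases
      case 1
      obtain t where t: "\<bar>t\<bar> \<le> 1" "(f has_real_derivative 3 / 2 * (1 + t)) (at x)"
        using d[OF reg[OF x(1) _ 1]] x by auto
      have "((\<lambda>s. f s - s) has_real_derivative 3 / 2 * (1 + t) - 1) (at x)" by (intro DERIV_diff t DERIV_ident)
      moreover have "\<bar>3 / 2 * (1 + t) - 1\<bar> \<le> 2" using t(1) by (simp add: abs_le_iff)
      ultimately show ?thesis by blast
    next
      case 2
      then have "eventually (\<lambda>t. f t = 0) (nhds x)" by eventually_elim (rule zero)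
      from zero_derivative[OF this] show ?thesis by (intro exI[of _ "-1"]) simp
    qed
  qed
  then show ?thesis by (intro exI[of _ "{a, c, 0, y, -y}"]) auto
qed

lemma x_slices:
  assumes y: "\<bar>y\<bar> < 1" "y \<noteq> 0"
  shows "\<exists>S. finite S \<and> (\<forall>x. \<bar>x\<bar> < 1 \<longrightarrow> x \<notin> S \<longrightarrow> (\<exists>d. \<bar>d\<bar> \<le> 2 \<and> ((\<lambda>s. vP (s, y) - s) has_real_derivative d) (at x)))"
proof (rule line_exceptions)
  show "(\<lambda>s. Complex s y) = (\<lambda>s. \<i> * of_real y + s *\<^sub>R 1)" by (auto simp: complex_eq_iff)
  show "regular (Complex s y)" if "\<bar>s\<bar> < 1" "s \<notin> {0, y, -y}" "0 < uu (Complex s y)" for s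
    using y that by (intro square_regular) (auto simp: abs_if split: if_splits)
  show "\<exists>t. \<bar>t\<bar> \<le> 1 \<and> ((\<lambda>s. vP (s, y)) has_real_derivative 3 / 2 * (1 + t)) (at s)" if "regular (Complex s y)" for s
    by (rule regular_slices[OF that]) auto
qed (use y in \<open>auto simp: square_def vP_def\<close>)

lemma y_slices:
  assumes y: "\<bar>y\<bar> < 1" "y \<noteq> 0"
  shows "\<exists>S. finite S \<and> (\<forall>x. \<bar>x\<bar> < 1 \<longrightarrow> x \<notin> S \<longrightarrow> (\<exists>d. \<bar>d\<bar> \<le> 2 \<and> ((\<lambda>s. vQ (y, s) - s) has_real_derivative d) (at x)))"
proof (rule line_exceptions)
  show "(\<lambda>s. Complex y s) = (\<lambda>s. of_real y + s *\<^sub>R \<i>)" by (auto simp: complex_eq_iff)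
  show "regular (Complex y s)" if "\<bar>s\<bar> < 1" "s \<notin> {0, y, -y}" "0 < uu (Complex y s)" for s
    using y that by (intro square_regular) (auto simp: abs_if split: if_splits)
  show "\<exists>t. \<bar>t\<bar> \<le> 1 \<and> ((\<lambda>s. vQ (y, s)) has_real_derivative 3 / 2 * (1 + t)) (at s)" if "regular (Complex y s)" for s
  proof (rule regular_slices[OF that])
    fix t assume "\<bar>t\<bar> \<le> 1" "((\<lambda>x. vQ (Re (Complex y s), x)) has_real_derivative 3 / 2 * (1 - t)) (at (Im (Complex y s)))"
    then show ?thesis by (intro exI[of _ "- t"]) simp
  qed
qed (use y in \<open>auto simp: square_def vQ_def\<close>)

definition Z0 :: "(real \<times> real) set" where "Z0 = {p \<in> cSq. uu (cx p) \<le> 0}"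

lemma convex_Z0: "convex Z0"
proof (rule convexI)
  fix p q :: "real \<times> real" and a b :: real assume pq: "p \<in> Z0" "q \<in> Z0" and ab: "0 \<le> a" "0 \<le> b" "a + b = 1"
  have "convex cSq" by (intro convex_Times convex_real_interval)
  then have "a *\<^sub>R p + b *\<^sub>R q \<in> cSq" using convexD[of cSq p q a b] pq ab by (simp add: Z0_def del: mem_Times_iff)
  moreover have "cx (a *\<^sub>R p + b *\<^sub>R q) = a *\<^sub>R cx p + b *\<^sub>R cx q" by (simp add: complex_eq_iff)
  moreover have "uu (a *\<^sub>R cx p + b *\<^sub>R cx q) \<le> a * uu (cx p) + b * uu (cx q)"
    using uu_convex ab by (simp add: convex_on_def)
  moreover have "a * uu (cx p) + b * uu (cx q) \<le> 0" using pq ab by (intro add_nonpos_nonpos mult_nonneg_nonpos) (auto simp: Z0_def)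
  ultimately show "a *\<^sub>R p + b *\<^sub>R q \<in> Z0" unfolding Z0_def by (metis (no_types, lifting) mem_Collect_eq order_trans)
qed

text \<open>The zero set is convex, so its frontier is a null set, and so are the axes and
  diagonals. The interior is needed because derivatives require the gradient to vanish in a
  neighbourhood.\<close>

lemma AE_regular_or_interior:
  "AE p in lb2. p \<in> Sq \<longrightarrow> fst p \<noteq> 0 \<and> snd p \<noteq> 0 \<and> (regular (cx p) \<and> 0 < uu (cx p) \<or> p \<in> interior Z0)"
proof -
  have n: "negligible {p :: real \<times> real. a \<bullet> p = 0}" if "a \<noteq> 0" for a using negligible_hyperplane[of a 0] that by simp
  have "negligible {p :: real \<times> real. (1, 0) \<bullet> p = 0}" "negligible {p :: real \<times> real. (0, 1) \<bullet> p = 0}"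
    "negligible {p :: real \<times> real. (1, 1) \<bullet> p = 0}" "negligible {p :: real \<times> real. (1, -1) \<bullet> p = 0}"
    by (rule n, simp add: zero_prod_def)+
  note N = this[THEN negligible_AE_lb2] and F = negligible_AE_lb2[OF negligible_convex_frontier[OF convex_Z0]]
  from N F show ?thesis
  proof eventually_elim
    fix p :: "real \<times> real"
    assume *: "p \<notin> {p. (1, 0) \<bullet> p = 0}" "p \<notin> {p. (0, 1) \<bullet> p = 0}" "p \<notin> {p. (1, 1) \<bullet> p = 0}" "p \<notin> {p. (1, -1) \<bullet> p = 0}"
      and fr: "p \<notin> frontier Z0"
    then have ne: "fst p \<noteq> 0" "snd p \<noteq> 0" "\<bar>fst p\<bar> \<noteq> \<bar>snd p\<bar>" by (auto simp: inner_prod_def)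
    show "p \<in> Sq \<longrightarrow> fst p \<noteq> 0 \<and> snd p \<noteq> 0 \<and> (regular (cx p) \<and> 0 < uu (cx p) \<or> p \<in> interior Z0)"
    proof (cases "p \<in> Sq \<and> p \<notin> Z0")
      case True
      then have pos: "0 < uu (cx p)" by (cases p) (auto simp: Z0_def Sq_def)
      have "regular (cx p)" using True ne pos by (intro square_regular) (auto simp: Sq_def)
      then show ?thesis using ne pos by simp
    next
      case False
      then show ?thesis using ne fr closure_subset[of Z0] by (auto simp: frontier_def)
    qed
  qed
qed

lemma exists_obstacle_solution: "\<exists>F1 F2. obstacle_solution vU vP vQ F1 F2 2"
proof -
  have in_sq: "Complex x y \<in> square" if "\<bar>x\<bar> \<le> 1" "\<bar>y\<bar> \<le> 1" for x y using that by (simp add: square_def)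
  have sides: "vP (1, y) = 1" "vP (-1, y) = -1" "vQ (y, 1) = 1" "vQ (y, -1) = -1" if "\<bar>y\<bar> < 1" for y
    using square_sides[OF in_sq[of 1 y]] square_sides[OF in_sq[of "-1" y]] square_sides[OF in_sq[of y 1]] square_sides[OF in_sq[of y "-1"]] that
    by (simp_all add: vP_def vQ_def)
  have G1: "continuous_on cSq (\<lambda>p. vP p - fst p)" by (intro continuous_intros v_continuous)
  have sw: "continuous_on cSq (\<lambda>p. vQ (prod.swap p))"
    unfolding prod.swap_def by (rule continuous_on_compose2[OF v_continuous(3)]) (auto intro!: continuous_intros)
  have G2: "continuous_on cSq (\<lambda>p. vQ (prod.swap p) - fst p)" by (intro continuous_intros sw)
  show ?thesis
  proof (rule line_derivative[OF G1, of 2], goal_cases)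
    case (5 F1)
    note F1 = 5
    show ?case
    proof (rule line_derivative[OF G2, of 2], goal_cases)
      case (5 F2)
      note F2 = 5
      have ar: "AE p in lb2. p \<in> Sq \<longrightarrow> F1 p + F2 (prod.swap p) = (if vU p = 0 then - 2 else 1)"
        using AE_regular_or_interior
      proof eventually_elim
        fix p :: "real \<times> real"
        assume *: "p \<in> Sq \<longrightarrow> fst p \<noteq> 0 \<and> snd p \<noteq> 0 \<and> (regular (cx p) \<and> 0 < uu (cx p) \<or> p \<in> interior Z0)"
        show "p \<in> Sq \<longrightarrow> F1 p + F2 (prod.swap p) = (if vU p = 0 then - 2 else 1)"
        proof
          assume p: "p \<in> Sq"
          obtain x y where xy: "p = (x, y)" by (cases p)
          have S: "(x, y) \<in> Sq" "(y, x) \<in> Sq" using p by (auto simp: xy Sq_def)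
          have n0: "x \<noteq> 0" "y \<noteq> 0" using * p by (auto simp: xy)
          consider "regular (Complex x y)" "0 < uu (Complex x y)" | "(x, y) \<in> interior Z0" using * p by (auto simp: xy)
          then show "F1 p + F2 (prod.swap p) = (if vU p = 0 then - 2 else 1)"
          proof cases
            case 1
            obtain t where t: "\<bar>t\<bar> \<le> 1" "((\<lambda>s. vP (s, y)) has_real_derivative 3 / 2 * (1 + t)) (at x)"
                "((\<lambda>s. vQ (x, s)) has_real_derivative 3 / 2 * (1 - t)) (at y)"
              using 1(1) by (rule regular_slices) simp
            \<comment> \<open>The parameter t cancels between the two pure second derivatives: they
              sum to 3, so the divergence of Du - x is 1. On the interior of the zero set both
              slices contribute -1.\<close>
            have "F1 (x, y) = 3 / 2 * (1 + t) - 1"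
            proof (rule F1(6)[OF S(1) n0(2)])
              show "((\<lambda>s. vP (s, y) - fst (s, y)) has_real_derivative 3 / 2 * (1 + t) - 1) (at x)"
                unfolding fst_conv by (intro DERIV_diff t DERIV_ident)
            qed (use t(1) in \<open>simp add: abs_le_iff\<close>)
            moreover have "F2 (y, x) = 3 / 2 * (1 - t) - 1"
            proof (rule F2(6)[OF S(2) n0(1)])
              show "((\<lambda>s. vQ (prod.swap (s, x)) - fst (s, x)) has_real_derivative 3 / 2 * (1 - t) - 1) (at y)"
                unfolding fst_conv swap_simp by (intro DERIV_diff t DERIV_ident)
            qed (use t(1) in \<open>simp add: abs_le_iff\<close>)
            ultimately show ?thesis using 1(2) by (simp add: xy vU_def algebra_simps)
          next
            case 2
            have z: "gu (Complex s t) = 0 \<and> uu (Complex s t) = 0" if "(s, t) \<in> interior Z0" for s t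
            proof -
              have st: "(s, t) \<in> Z0" using that interior_subset by blast
              then have sq: "Complex s t \<in> square" by (auto simp: Z0_def square_def)
              have "uu (Complex s t) = 0" using st square_uu_nonneg[OF sq] by (simp add: Z0_def)
              then show ?thesis using square_gu_zero[OF sq] by simp
            qed
            have "isCont (\<lambda>s. (s, y)) x" "isCont (\<lambda>s. (x, s)) y" by (intro continuous_intros)+
            then have "eventually (\<lambda>s. (s, y) \<in> interior Z0) (nhds x)" "eventually (\<lambda>s. (x, s) \<in> interior Z0) (nhds y)"
              using 2 by (auto simp: continuous_at_open eventually_nhds)
            then have e: "eventually (\<lambda>s. vP (s, y) = 0) (nhds x)" "eventually (\<lambda>s. vQ (x, s) = 0) (nhds y)"
              by (auto elim!: eventually_mono simp: vP_def vQ_def z)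
            have "F1 (x, y) = -1"
              by (rule F1(6)[OF S(1) n0(2)]) (use zero_derivative[OF e(1)] in auto)
            moreover have "F2 (y, x) = -1"
              by (rule F2(6)[OF S(2) n0(1)]) (use zero_derivative[OF e(2)] in auto)
            ultimately show ?thesis using z[OF 2] by (simp add: xy vU_def)
          qed
        qed
      qed
      have "obstacle_solution vU vP vQ F1 F2 2"
      proof
        show "0 \<le> vU p" if "p \<in> Sq" for p
          using square_uu_nonneg[of "cx p"] that by (auto simp: vU_def cx_square Sq_def)
      qed (use v_continuous v_derivative F1 F2 ar in auto)
      then show ?case by blast
    qed (use sides y_slices in auto)
  qed (use sides x_slices in auto)
qed

section \<open>Transfer of the zero set to \<open>real^2\<close>\<close>

lemma vU_pair_of: "vU (pair_of x) = 3 / 2 * uu (to_complex x)"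
  by (simp add: vU_def to_complex_def)

text \<open>\<open>uu\<close> is positive on the sides, so the closed square gives the same zeros as
  the open one. In this form the zero set is visibly closed, which yields compact
  containment.\<close>

lemma zero_set_iff: "x \<in> zero_set (\<lambda>x. vU (pair_of x)) \<longleftrightarrow> to_complex x \<in> square \<and> uu (to_complex x) \<le> 0"
proof -
  have "to_complex x \<in> square \<and> uu (to_complex x) \<le> 0 \<Longrightarrow> x \<in> open_square"
  proof -
    assume *: "to_complex x \<in> square \<and> uu (to_complex x) \<le> 0"
    then have "\<not> 0 < uu (to_complex x)" by simp
    then have "x $ 1 \<noteq> 1" "x $ 1 \<noteq> -1" "x $ 2 \<noteq> 1" "x $ 2 \<noteq> -1"
      using square_sides[of "to_complex x"] * by auto
    then show "x \<in> open_square" using * by (auto simp: square_def open_square_def forall_2 abs_le_iff)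
  qed
  moreover have "x \<in> open_square \<Longrightarrow> to_complex x \<in> square"
    by (auto simp: square_def open_square_def forall_2 abs_le_iff)
  ultimately show ?thesis
    using square_uu_nonneg[of "to_complex x"] by (auto simp: zero_set_def vU_pair_of)
qed

lemma vU_convex: "convex_on open_square (\<lambda>x. vU (pair_of x))"
proof (rule convex_onI)
  fix t :: real and x y :: "real^2" assume t: "0 < t" "t < 1"
  have "uu ((1 - t) *\<^sub>R to_complex x + t *\<^sub>R to_complex y) \<le> (1 - t) * uu (to_complex x) + t * uu (to_complex y)"
    using uu_convex t by (simp add: convex_on_def)
  then show "vU (pair_of ((1 - t) *\<^sub>R x + t *\<^sub>R y)) \<le> (1 - t) * vU (pair_of x) + t * vU (pair_of y)"
    by (simp add: vU_pair_of linear_add[OF linear_to_complex] linear_cmul[OF linear_to_complex])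
next
  have "open_square = box (vec_of (-1, -1)) (vec_of (1, 1))" by (auto simp: open_square_def mem_box_cart forall_2)
  then show "convex open_square" using convex_box(2) by metis
qed

abbreviation ZS :: "(real^2) set" where "ZS \<equiv> zero_set (\<lambda>x. vU (pair_of x))"

lemma ZS_convex: "convex ZS"
proof (rule convexI)
  fix x y :: "real^2" and a b :: real assume xy: "x \<in> ZS" "y \<in> ZS" and ab: "0 \<le> a" "0 \<le> b" "a + b = 1"
  have "convex open_square" using vU_convex by (rule convex_on_imp_convex)
  then have S: "a *\<^sub>R x + b *\<^sub>R y \<in> open_square" using xy ab by (auto simp: zero_set_def convex_def)
  have "vU (pair_of (a *\<^sub>R x + b *\<^sub>R y)) \<le> a * vU (pair_of x) + b * vU (pair_of y)"
    using vU_convex xy ab unfolding convex_on_def zero_set_def by blast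
  also have "\<dots> = 0" using xy by (simp add: zero_set_def)
  finally have "uu (to_complex (a *\<^sub>R x + b *\<^sub>R y)) \<le> 0" by (simp add: vU_pair_of)
  moreover have "to_complex (a *\<^sub>R x + b *\<^sub>R y) \<in> square"
    using S by (auto simp: square_def open_square_def forall_2 abs_le_iff)
  ultimately show "a *\<^sub>R x + b *\<^sub>R y \<in> ZS" unfolding zero_set_iff by blast
qed

lemma ZS_compact: "compact ZS"
proof -
  have "closed ({x. uu (to_complex x) \<le> 0} \<inter> {x. to_complex x \<in> square})"
  proof (rule closed_Int)
    have "continuous_on UNIV (\<lambda>x. uu (to_complex x))"
      by (rule continuous_on_compose2[OF uu_continuous[of UNIV] continuous_on_to_complex[OF continuous_on_id]]) auto
    then show "closed {x. uu (to_complex x) \<le> 0}" by (intro closed_Collect_le continuous_on_const)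
    have "closed square" unfolding square_def by (intro closed_Collect_conj closed_Collect_le continuous_intros)
    then have "closed (to_complex -` square)"
      by (intro closed_vimage continuous_on_to_complex[OF continuous_on_id])
    then show "closed {x. to_complex x \<in> square}" by (simp add: vimage_def)
  qed
  moreover have "{x. uu (to_complex x) \<le> 0} \<inter> {x. to_complex x \<in> square} = ZS" using zero_set_iff by blast
  moreover have "bounded ZS"
    by (rule bounded_subset[OF bounded_cbox[of "vec_of (-1, -1)" "vec_of (1, 1)"]])
      (auto simp: zero_set_def open_square_def mem_box_cart forall_2 less_imp_le)
  ultimately show ?thesis by (simp add: compact_eq_bounded_closed)
qed

lemma ZS_compactly_contained: "compactly_contained ZS open_square"
  using ZS_compact compact_imp_closed[OF ZS_compact]
  by (auto simp: compactly_contained_def closure_closed zero_set_def)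

lemma ZS_Zset:
  assumes "x \<in> open_square" shows "x \<in> ZS \<longleftrightarrow> to_complex x \<in> Zset"
proof -
  have sq: "to_complex x \<in> square" using assms by (auto simp: square_def open_square_def forall_2 abs_le_iff)
  show ?thesis unfolding Zset_def mem_Collect_eq zero_iff_support[OF sq, symmetric]
    using assms by (simp add: zero_set_def vU_pair_of)
qed

lemma ZS_smooth_boundary: "smooth_boundary ZS"
  unfolding smooth_boundary_def
proof
  fix p assume p: "p \<in> frontier ZS"
  then have pZ: "p \<in> ZS" "p \<notin> interior ZS"
    using compact_imp_closed[OF ZS_compact] by (auto simp: frontier_def closure_closed)
  have po: "p \<in> open_square" using pZ(1) by (simp add: zero_set_def)
  obtain r0 where r0: "r0 > 0" "ball p r0 \<subseteq> open_square" using open_square_open po openE by blast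
  have q: "to_complex p \<in> Zset" using ZS_Zset[OF po] pZ by simp
  have q': "to_complex p \<notin> interior Zset"
  proof
    assume "to_complex p \<in> interior Zset"
    then obtain r where r: "r > 0" "ball (to_complex p) r \<subseteq> Zset" by (auto simp: mem_interior)
    have "ball p (min r r0) \<subseteq> ZS"
    proof
      fix x assume x: "x \<in> ball p (min r r0)"
      then have "x \<in> open_square" "to_complex x \<in> ball (to_complex p) r" using r0 by (auto simp: dist_to_complex)
      then show "x \<in> ZS" using ZS_Zset r by blast
    qed
    moreover have "0 < min r r0" using r r0 by simp
    ultimately have "p \<in> interior ZS" unfolding mem_interior by blast
    then show False using pZ by simp
  qed
  show "\<exists>r>0. \<exists>e. \<exists>\<gamma> :: real^2 \<Rightarrow> real. norm e = 1 \<and> smooth_on \<gamma> UNIV \<and> (\<forall>x\<in>ball p r. (x \<in> ZS) = (\<gamma> (x - (x \<bullet> e) *\<^sub>R e) \<le> x \<bullet> e))"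
  proof (rule boundary_graph[OF q q'])
    fix r e \<tau> \<Gamma>
    assume r: "r > 0" and e: "norm e = 1" "norm \<tau> = 1" "e \<bullet> \<tau> = 0" and \<Gamma>: "Cinf \<Gamma>"
      and g: "\<And>x. x \<in> ball (to_complex p) r \<Longrightarrow> (x \<in> Zset) = (\<Gamma> (x \<bullet> \<tau>) \<le> x \<bullet> e)"
    let ?e = "of_complex e" and ?t = "of_complex \<tau>"
    let ?g = "\<lambda>x::real^2. \<Gamma> (x \<bullet> ?t)"
    have "norm ?e = 1" using e by simp
    moreover have "smooth_on ?g UNIV" using smooth_on_tensor[OF \<Gamma> Cinf_const[of 1], of ?t] by simp
    moreover have "\<forall>x\<in>ball p (min r r0). (x \<in> ZS) = (?g (x - (x \<bullet> ?e) *\<^sub>R ?e) \<le> x \<bullet> ?e)"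
    proof
      fix x assume "x \<in> ball p (min r r0)"
      then have x: "x \<in> open_square" "to_complex x \<in> ball (to_complex p) r" using r0 by (auto simp: dist_to_complex)
      \<comment> \<open>The graph function depends only on the component along \<tau>, which
        projection to the hyperplane orthogonal to e preserves.\<close>
      have "(x - (x \<bullet> ?e) *\<^sub>R ?e) \<bullet> ?t = x \<bullet> ?t" using e by (simp add: inner_diff_left inner_of_complex)
      then show "(x \<in> ZS) = (?g (x - (x \<bullet> ?e) *\<^sub>R ?e) \<le> x \<bullet> ?e)"
        using g[OF x(2)] ZS_Zset[OF x(1)] by (simp add: inner_to_complex)
    qed
    moreover have "0 < min r r0" using r r0 by simp
    ultimately show ?thesis by blast
  qed
qed

end

theorem corollary1p6:
  shows "\<exists>u :: real^2 \<Rightarrow> real.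
    is_minimizer u \<and>
    (\<forall>v. is_minimizer v \<longrightarrow> (AE x in lebesgue_on open_square. v x = u x)) \<and>
    convex_on open_square u \<and>
    smooth_boundary (zero_set u) \<and>
    convex (zero_set u) \<and>
    0 < measure lebesgue (zero_set u) \<and>
    compactly_contained (zero_set u) open_square"
proof (rule exists_hodograph_map)
  fix b k :: real and om Ga G :: "complex \<Rightarrow> complex"
  assume h: "0 < b" "b < 1" "0 < k"
    "continuous_on sector om" "continuous_on sector Ga" "continuous_on sector G"
    "\<And>s. s \<in> sector \<Longrightarrow> s \<noteq> of_real b \<Longrightarrow> (om has_field_derivative - of_real k * At b s / rt b s) (at s)"
    "\<And>s. s \<in> sector \<Longrightarrow> s \<noteq> of_real b \<Longrightarrow> (Ga has_field_derivative s\<^sup>2 * (- of_real k * At b s / rt b s)) (at s)"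
    "\<And>s. s \<in> sector \<Longrightarrow> s \<noteq> of_real b \<Longrightarrow> (G has_field_derivative om s * (s\<^sup>2 * (- of_real k * At b s / rt b s))) (at s)"
    "om (of_real b) = 1" "Ga (of_real b) = - 1 / 3" "om 0 = 1 - \<i>" "Ga 0 = - 1 / 3 - \<i> / 3"
  interpret hodograph b k om Ga G by unfold_locales (use h in \<open>simp_all add: wder_def\<close>)
  obtain F1 F2 where "obstacle_solution vU vP vQ F1 F2 2" using exists_obstacle_solution by blast
  then interpret obstacle_solution vU vP vQ F1 F2 2 .
  show ?thesis
    using u_minimizer u_unique measure_zero_set vU_convex ZS_smooth_boundary ZS_convex ZS_compactly_contained
    unfolding u_def[abs_def] by blast
qed


end
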